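(* Let $F$ and $G$ be holomorphic germs at $0\in\mathbb{C}$ whose singularities $(\alpha)$, resp. $(\beta)$, in $\mathbb{C}$ are all isolated and integrable. For every $\gamma$ in the product set $(\alpha\beta)$ and every $k\in\mathbb{Z}$, $$\Delta_\gamma\Sigma_\gamma^k(F\odot G)=\sum_{\alpha\beta=\gamma}\Delta_\alpha\Sigma_\alpha^kF\ \bar\star\ \Delta_\beta\Sigma_\beta^kG,$$ where the sum runs over pairs of a singularity $\alpha$ of $F$ and a singularity $\beta$ of $G$ with $\alpha\beta=\gamma$. In this sense the operators $(\Delta_\gamma\Sigma_\gamma^k)_{k\in\mathbb{Z}}$ define morphisms from the Hadamard algebra to the integral convolution algebra (with product $\bar\star$) on the associated monodromy spaces.
   Context: Hadamard product: for $F(z)=\sum_{n\ge0}A_nz^n$ and $G(z)=\sum_{n\ge0}B_nz^n$, $F\odot G(z)=\sum_{n\ge0}A_nB_nz^n$, continued analytically from $0$ (principal branch). A singularity $\alpha$ is isolated if the function extends analytically along all paths in a punctured disc around $\alpha$ (it may be multivalued there). For an isolated singularity $\alpha$ of $F$, $\Sigma_\alpha F$ is the branch obtained by local analytic continuation of $F$ along a loop of winding number $1$ around $\alpha$; $\Delta_\alpha=\Sigma_\alpha-\mathrm{Id}$ is the monodromy operator, and $\Sigma_\alpha^k$ ($k\in\mathbb{Z}$) are the iterates of the invertible operator $\Sigma_\alpha$. The singularity $\alpha$ is integrable if $(z-\alpha)F(z)\to0$ as $z\to\alpha$ in the Stolz sense, i.e. with $\arg(z-\alpha)$ bounded. Integral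 convolution: for $f$ defined near (with possible isolated singularity at) $\alpha$ and $g$ near $\beta$, and $z$ near $\gamma=\alpha\beta$, $$(f\,\bar\star\,g)(z)=-\frac{1}{2\pi i}\int_\alpha^{z/\beta}f(u)\,g(z/u)\,\frac{du}{u},$$ integrated along a local path (e.g. the segment) from $\alpha$ to $z/\beta$. *)

theory Defs
  imports "HOL-Complex_Analysis.Complex_Analysis"
begin

text \<open>
  A holomorphic germ at \<open>0\<close> is a power series of positive radius of convergence.
\<close>

definition hadamard :: "complex fps \<Rightarrow> complex fps \<Rightarrow> complex fps" where
  "hadamard F G = Abs_fps (\<lambda>n. fps_nth F n * fps_nth G n)"

text \<open>
  \<open>\<Phi>\<close> continues the germ of \<open>f\<close> at the initial point of \<open>p\<close> along \<open>p\<close>: only the germ of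
  \<open>\<Phi> t\<close> at \<open>p t\<close> is meaningful.
\<close>

definition continuation_along ::
  "(real \<Rightarrow> complex) \<Rightarrow> (complex \<Rightarrow> complex) \<Rightarrow> (real \<Rightarrow> complex \<Rightarrow> complex) \<Rightarrow> bool" where
  "continuation_along p f \<Phi> \<longleftrightarrow>
     (\<forall>\<^sub>F z in nhds (pathstart p). \<Phi> 0 z = f z) \<and>
     (\<forall>t\<in>{0..1}. \<Phi> t analytic_on {p t}) \<and>
     (\<forall>t\<in>{0..1}. \<forall>\<^sub>F s in at t within {0..1}. \<forall>\<^sub>F z in nhds (p s). \<Phi> s z = \<Phi> t z)"

definition continuable_along :: "(real \<Rightarrow> complex) \<Rightarrow> (complex \<Rightarrow> complex) \<Rightarrow> bool" where
  "continuable_along p f \<longleftrightarrow> (\<exists>\<Phi>. continuation_along p f \<Phi>)"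

definition continued_value :: "(real \<Rightarrow> complex) \<Rightarrow> (complex \<Rightarrow> complex) \<Rightarrow> complex" where
  "continued_value p f = (THE w. \<exists>\<Phi>. continuation_along p f \<Phi> \<and> w = \<Phi> 1 (pathfinish p))"

text \<open>
  The principal branch lives on the Mittag-Leffler star: the points to which the germ can be
  continued along the straight segment from \<open>0\<close>.
\<close>

definition principal_star :: "complex fps \<Rightarrow> complex set" where
  "principal_star F = {z. continuable_along (linepath 0 z) (eval_fps F)}"

definition principal_branch :: "complex fps \<Rightarrow> complex \<Rightarrow> complex" where
  "principal_branch F z = continued_value (linepath 0 z) (eval_fps F)"

text \<open>
  Singularities of the principal branch. A point on the cut of the star behind a singularity is
  regular if the branches on both sides of the cut extend across it; singularities lying behind
  another one on the same ray (seen from one side of the cut or from both) are included.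
\<close>

definition singularities :: "complex fps \<Rightarrow> complex set" where
  "singularities F = {\<alpha>. \<forall>r>0. \<exists>b \<in> principal_star F \<inter> ball \<alpha> r.
     \<not> (\<exists>f. f holomorphic_on ball \<alpha> r \<and> (\<forall>\<^sub>F z in nhds b. f z = principal_branch F z))}"

definition isolated_at :: "complex fps \<Rightarrow> complex \<Rightarrow> bool" where
  "isolated_at F \<alpha> \<longleftrightarrow> (\<exists>r>0. \<forall>b \<in> principal_star F \<inter> (ball \<alpha> r - {\<alpha>}). \<forall>p.
     path p \<and> pathstart p = b \<and> path_image p \<subseteq> ball \<alpha> r - {\<alpha>} \<longrightarrow>
     continuable_along p (principal_branch F))"

text \<open>The arc from \<open>b\<close> around \<open>\<alpha>\<close>, turning through the (signed, unrestricted) angle \<open>\<theta>\<close>.\<close>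

definition arc_about :: "complex \<Rightarrow> complex \<Rightarrow> real \<Rightarrow> real \<Rightarrow> complex" where
  "arc_about \<alpha> b \<theta> t = \<alpha> + (b - \<alpha>) * exp (\<i> * of_real (\<theta> * t))"

text \<open>
  Stolz limit of the multivalued function \<open>(z - \<alpha>) F(z)\<close>: a point with bounded \<open>arg (z - \<alpha>)\<close>
  on the sheets over the punctured disc is reached from a point of the star by turning around
  \<open>\<alpha>\<close> through a bounded angle.
\<close>

definition integrable_at :: "complex fps \<Rightarrow> complex \<Rightarrow> bool" where
  "integrable_at F \<alpha> \<longleftrightarrow> (\<forall>B. uniform_limit {-B..B}
     (\<lambda>b \<theta>. (pathfinish (arc_about \<alpha> b \<theta>) - \<alpha>) *
             continued_value (arc_about \<alpha> b \<theta>) (principal_branch F))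
     (\<lambda>_. 0) (at \<alpha> within principal_star F))"

text \<open>
  The monodromy operators act on functions holomorphic near the point of evaluation \<open>u\<close>, the
  loop being the circle about \<open>\<alpha>\<close> through \<open>u\<close>. The inverse of \<open>\<Sigma>\<close> is continuation along the
  reversed loop.
\<close>

definition Sigma_op :: "complex \<Rightarrow> (complex \<Rightarrow> complex) \<Rightarrow> complex \<Rightarrow> complex" where
  "Sigma_op \<alpha> f u = continued_value (arc_about \<alpha> u (2 * pi)) f"

definition Sigma_inv :: "complex \<Rightarrow> (complex \<Rightarrow> complex) \<Rightarrow> complex \<Rightarrow> complex" where
  "Sigma_inv \<alpha> f u = continued_value (arc_about \<alpha> u (- 2 * pi)) f"

definition Sigma_pow :: "complex \<Rightarrow> int \<Rightarrow> (complex \<Rightarrow> complex) \<Rightarrow> complex \<Rightarrow> complex" where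
  "Sigma_pow \<alpha> k = (if 0 \<le> k then Sigma_op \<alpha> ^^ nat k else Sigma_inv \<alpha> ^^ nat (- k))"

definition Delta_op :: "complex \<Rightarrow> (complex \<Rightarrow> complex) \<Rightarrow> complex \<Rightarrow> complex" where
  "Delta_op \<alpha> f u = Sigma_op \<alpha> f u - f u"

text \<open>
  The integral is a gauge integral over the segment, so it covers integrals that converge only
  as improper integrals at the end points, as happens for integrable singularities.
\<close>

definition conv_integrand ::
  "(complex \<Rightarrow> complex) \<Rightarrow> (complex \<Rightarrow> complex) \<Rightarrow> complex \<Rightarrow> complex \<Rightarrow> complex" where
  "conv_integrand f g z u = f u * g (z / u) / u"

definition int_conv ::
  "complex \<Rightarrow> complex \<Rightarrow> (complex \<Rightarrow> complex) \<Rightarrow> (complex \<Rightarrow> complex) \<Rightarrow> complex \<Rightarrow> complex" where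
  "int_conv \<alpha> \<beta> f g z =
     - (1 / (2 * of_real pi * \<i>)) * contour_integral (linepath \<alpha> (z / \<beta>)) (conv_integrand f g z)"

definition sing_pairs :: "complex fps \<Rightarrow> complex fps \<Rightarrow> complex \<Rightarrow> (complex \<times> complex) set" where
  "sing_pairs F G \<gamma> = {(\<alpha>, \<beta>). \<alpha> \<in> singularities F \<and> \<beta> \<in> singularities G \<and> \<alpha> * \<beta> = \<gamma>}"

text \<open>
  The points \<open>z\<close> at which the principal branches in the monodromy formula at \<open>\<gamma>\<close> are defined.
  For \<open>z\<close> near \<open>\<gamma>\<close> the convolution evaluates \<open>F\<close> on the segment from \<open>z / \<beta>\<close> to \<open>\<alpha>\<close> and
  \<open>G\<close> on an arc from \<open>z / \<alpha>\<close> to \<open>\<beta>\<close>. The arguments \<open>u / \<alpha>\<close> and \<open>z / (u * \<beta>)\<close> stay on the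
  same side of the real axis as \<open>z / \<gamma>\<close>, so all branches are taken from the same side of the
  cuts.
\<close>

definition common_star :: "complex fps \<Rightarrow> complex fps \<Rightarrow> complex \<Rightarrow> complex set" where
  "common_star F G \<gamma> = {z \<in> principal_star (hadamard F G).
     \<forall>(\<alpha>, \<beta>) \<in> sing_pairs F G \<gamma>. z / \<beta> \<in> principal_star F \<and> z / \<alpha> \<in> principal_star G}"

end

theory Submission
  imports Defs
begin

text \<open>
  In the coordinate \<open>x = ln u\<close> the Hadamard product at \<open>z\<close> is the integral of
  \<open>F(e\<^sup>x) G(z/e\<^sup>x) / 2\<pi>i\<close> over a contour from \<open>x\<^sub>0\<close> to \<open>x\<^sub>0 + 2\<pi>i\<close> along which both principal branches
  are defined. Near \<open>\<gamma>\<close> put \<open>z = \<gamma>(1 + e\<^sup>W)\<close>: the punctured disc becomes a half plane, a turn about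
  \<open>\<gamma>\<close> becomes \<open>W \<mapsto> W + 2\<pi>i\<close>, and it suffices to extend the integral from one side of the cut
  (\<open>0 < \<plusminus>Im W < \<pi>\<close>) to this half plane and to compute the difference of its values at \<open>W + 2\<pi>i\<close>
  and \<open>W\<close>. The contour follows a vertical line to the left of the singularities of \<open>F\<close>, with a
  detour around the cut of \<open>z \<mapsto> G(z/e\<^sup>x)\<close> in each of the finitely many directions where that cut
  meets the line. A detour runs through the narrow strip between a cut of \<open>F\<close> and a cut of \<open>G\<close>; the
  pieces of it near a point of this strip that is not a pinch extend without monodromy, whereas at a
  pinch \<open>\<alpha>\<beta> = \<gamma>\<close> the contour is caught between \<open>\<alpha>\<close> and \<open>z/\<beta>\<close>, and pulling it through as \<open>z\<close> turns
  leaves the integral of \<open>\<Delta>\<^sub>\<alpha>F(u) \<Delta>\<^sub>\<beta>G(z/u)\<close> over the segment between them.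
\<close>

subsection \<open>Integrals over segments depending on a parameter\<close>

text \<open>The obstacle is that nothing may be evaluated at the singular points: integrability
  controls (u - \<alpha>) F(u) only for bounded arguments, so the convolution integral need not
  converge absolutely at either end. The contour therefore stays away from both branch points; its
  integral is holomorphic in W for free, and its monodromy is computed with primitives alone.
  Integrability does its work in two limits, u -> \<alpha> and u -> z/\<beta>, which show that a
  primitive of the convolution integrand extends continuously to the closed segment. The fundamental
  theorem then yields the integral in the gauge sense. With T the shift by 2 pi i, the product of
  jumps arises from TA TB - A B = TA (TB - B) + (TA - A) B. A second obstacle is that principal
  branches live only on stars and may differ on the two sides of a ray. Each side (\<sigma> = 1 or
  -1) is therefore treated separately, with the multivalued continuation attached to the side from
  which it is read. The exponent k adds nothing new: it is the case k = 0 taken at W + 2 pi i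
  k.\<close>

lemma contour_integral_linepath_continuous_on:
  assumes "continuous_on (U \<times> closed_segment a b) (\<lambda>(w, s). k w s)"
  shows "continuous_on U (\<lambda>w. contour_integral (linepath a b) (k w))"
proof -
  have "continuous_on U (\<lambda>w. integral (cbox 0 (1::real)) (\<lambda>t. k w (linepath a b t) * (b - a)))"
  proof (rule integral_continuous_on_param)
    have "continuous_on (U \<times> {0..1}) ((\<lambda>p. k (fst p) (snd p)) \<circ> (\<lambda>p. (fst p, linepath a b (snd p))))"
    proof (rule continuous_on_compose)
      show "continuous_on (U \<times> {0..1}) (\<lambda>p. (fst p, linepath a b (snd p)))"
        unfolding linepath_def by (intro continuous_intros)
      show "continuous_on ((\<lambda>p. (fst p, linepath a b (snd p))) ` (U \<times> {0..1})) (\<lambda>p. k (fst p) (snd p))"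
        by (rule continuous_on_subset[OF assms[unfolded case_prod_unfold]]) (auto simp: linepath_in_path)
    qed
    then show "continuous_on (U \<times> cbox 0 1) (\<lambda>(w, t). k w (linepath a b t) * (b - a))"
      by (auto simp: case_prod_unfold o_def intro!: continuous_intros)
  qed
  then show ?thesis
    by (simp add: contour_integral_integral)
qed

text \<open>Morera's theorem: over a triangle the two integrations may be exchanged because the
  integrand is jointly continuous, and each inner triangle integral vanishes by Cauchy's
  theorem.\<close>

lemma contour_integral_linepath_holomorphic_on:
  assumes U: "open U"
    and cont: "continuous_on (U \<times> closed_segment a b) (\<lambda>(w, s). k w s)"
    and hol: "\<And>s. s \<in> closed_segment a b \<Longrightarrow> (\<lambda>w. k w s) holomorphic_on U"
  shows "(\<lambda>w. contour_integral (linepath a b) (k w)) holomorphic_on U"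
proof -
  let ?I = "\<lambda>w. contour_integral (linepath a b) (k w)"
  have "?I analytic_on U"
  proof (rule Morera_triangle[OF contour_integral_linepath_continuous_on[OF cont] U], intro impI)
    fix p q r assume sub: "convex hull {p, q, r} \<subseteq> U"
    have edges: "closed_segment p q \<subseteq> U" "closed_segment q r \<subseteq> U" "closed_segment r p \<subseteq> U"
      using sub by (auto simp: segment_convex_hull intro!: order_trans[OF hull_mono sub])
    have swap: "contour_integral (linepath x y) ?I =
        contour_integral (linepath a b) (\<lambda>s. contour_integral (linepath x y) (\<lambda>w. k w s))"
      if "closed_segment x y \<subseteq> U" for x y
      by (rule contour_integral_swap)
        (use that in \<open>auto intro!: continuous_on_subset[OF cont]\<close>)
    have int: "(\<lambda>s. contour_integral (linepath x y) (\<lambda>w. k w s)) contour_integrable_on linepath a b"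
      if "closed_segment x y \<subseteq> U" for x y
    proof (rule contour_integrable_continuous_linepath, rule contour_integral_linepath_continuous_on)
      have "continuous_on (closed_segment a b \<times> closed_segment x y) ((\<lambda>p. k (fst p) (snd p)) \<circ> (\<lambda>p. (snd p, fst p)))"
        by (intro continuous_on_compose continuous_intros continuous_on_subset[OF cont[unfolded case_prod_unfold]])
          (use that in auto)
      then show "continuous_on (closed_segment a b \<times> closed_segment x y) (\<lambda>(s, w). k w s)"
        by (simp add: o_def case_prod_unfold)
    qed
    have zero: "contour_integral (linepath p q) (\<lambda>w. k w s) + contour_integral (linepath q r) (\<lambda>w. k w s)
        + contour_integral (linepath r p) (\<lambda>w. k w s) = 0" if "s \<in> closed_segment a b" for s
      using Cauchy_theorem_triangle[OF holomorphic_on_subset[OF hol[OF that] sub]]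
      by (rule has_chain_integral_chain_integral3)
    have "contour_integral (linepath p q) ?I + contour_integral (linepath q r) ?I + contour_integral (linepath r p) ?I
      = contour_integral (linepath a b) (\<lambda>s. contour_integral (linepath p q) (\<lambda>w. k w s)
          + contour_integral (linepath q r) (\<lambda>w. k w s) + contour_integral (linepath r p) (\<lambda>w. k w s))"
      using edges by (simp add: swap contour_integral_add int contour_integrable_add)
    also have "\<dots> = contour_integral (linepath a b) (\<lambda>s. 0)"
      by (rule contour_integral_eq) (use zero in auto)
    finally show "contour_integral (linepath p q) ?I + contour_integral (linepath q r) ?I
      + contour_integral (linepath r p) ?I = 0" by simp
  qed
  then show ?thesis by (simp add: analytic_imp_holomorphic)
qed

text \<open>Moves the end points into the integrand, so that end points depending holomorphically on
  a parameter are covered by the case of a fixed segment.\<close>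

lemma contour_integral_linepath_unit:
  "contour_integral (linepath a b) f = contour_integral (linepath 0 1) (\<lambda>t. f (a + t * (b - a)) * (b - a))"
  by (simp add: contour_integral_integral linepath_def algebra_simps scaleR_conv_of_real)

lemma contour_integral_linepath_translate:
  "contour_integral (linepath (a + h) (b + h)) f = contour_integral (linepath a b) (\<lambda>s. f (s + h))"
  by (simp add: contour_integral_integral linepath_def algebra_simps)

lemma contour_integral_linepath_primitive:
  assumes "\<And>s. s \<in> S \<Longrightarrow> (N has_field_derivative f s) (at s within S)" "closed_segment a b \<subseteq> S"
  shows "contour_integral (linepath a b) f = N b - N a" "f contour_integrable_on linepath a b"
  using contour_integral_primitive[OF assms(1), of "linepath a b"] assms(2)
  by (auto simp: contour_integral_unique contour_integrable_on_def)

text \<open>Contour pieces are compared through differences of values, in which the free constants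
  of primitives on different domains cancel.\<close>

lemma primitives_differ_constant:
  assumes "connected S" "open S" "x \<in> S" "y \<in> S"
    and "\<And>s. s \<in> S \<Longrightarrow> (N has_field_derivative f s) (at s)"
    and "\<And>s. s \<in> S \<Longrightarrow> (M has_field_derivative f s) (at s)"
  shows "N x - N y = M x - (M y :: complex)"
proof -
  have "\<And>s. s \<in> S \<Longrightarrow> ((\<lambda>s. N s - M s) has_field_derivative 0) (at s)"
    using DERIV_diff[OF assms(5,6)] by simp
  then have "(\<lambda>s. N s - M s) constant_on S"
    using assms(1,2) has_field_derivative_0_imp_constant_on by blast
  then show ?thesis using assms(3,4) by (auto simp: constant_on_def algebra_simps)
qed

subsection \<open>The local convolution kernel in logarithmic coordinates\<close>

text \<open>With u = \<alpha>(1 + e^s) a multivalued function on a punctured disc about \<alpha>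
  becomes a function on a left half plane. There u - \<alpha> = \<alpha> e^s, and arg (u - \<alpha>)
  is Im s up to a constant, so decay on the strips |Im s| \<le> M is integrability in the Stolz
  sense.\<close>

definition integrable_branch :: "real \<Rightarrow> (complex \<Rightarrow> complex) \<Rightarrow> bool" where
  "integrable_branch c A \<longleftrightarrow> A holomorphic_on {s. Re s < c} \<and>
     (\<forall>M e. 0 < e \<longrightarrow> (\<exists>R. \<forall>s. Re s < R \<longrightarrow> Re s < c \<longrightarrow> \<bar>Im s\<bar> \<le> M \<longrightarrow> norm (exp s * A s) \<le> e))"

text \<open>In the coordinate s the monodromy operators are shifts: \<open>turn\<close> is \<Sigma>
  and \<open>jump\<close> is \<Delta>.\<close>

definition turn :: "(complex \<Rightarrow> complex) \<Rightarrow> complex \<Rightarrow> complex" where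
  "turn A s = A (s + 2 * of_real pi * \<i>)"

definition jump :: "(complex \<Rightarrow> complex) \<Rightarrow> complex \<Rightarrow> complex" where
  "jump A s = A (s + 2 * of_real pi * \<i>) - A s"

text \<open>
  For \<open>z = \<alpha>\<beta>(1 + e\<^sup>W)\<close> and \<open>u = \<alpha>(1 + e\<^sup>s)\<close> the coordinate of \<open>z/u = \<beta>(1 + e\<^sup>T)\<close> is \<open>T = partner W s\<close>;
  \<open>outer_partner\<close> is the determination of the same logarithm that is adapted to \<open>Re W < Re s\<close>.
\<close>

definition partner :: "complex \<Rightarrow> complex \<Rightarrow> complex" where
  "partner W s = W + Ln (1 - exp (s - W)) - Ln (1 + exp s)"

definition outer_partner :: "complex \<Rightarrow> complex \<Rightarrow> complex" where
  "outer_partner W s = s - \<i> * pi + Ln (1 - exp (W - s)) - Ln (1 + exp s)"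

text \<open>The last factor is du/u for u = \<alpha>(1 + e^s), so integrals of \<open>kern\<close>
  over s are integrals of f(u) g(z/u) du/u.\<close>

definition kern :: "(complex \<Rightarrow> complex) \<Rightarrow> (complex \<Rightarrow> complex) \<Rightarrow> complex \<Rightarrow> complex \<Rightarrow> complex" where
  "kern A B W s = A s * B (partner W s) * (exp s / (1 + exp s))"

definition outer_kern :: "(complex \<Rightarrow> complex) \<Rightarrow> (complex \<Rightarrow> complex) \<Rightarrow> complex \<Rightarrow> complex \<Rightarrow> complex" where
  "outer_kern A B W s = A s * B (outer_partner W s) * (exp s / (1 + exp s))"

text \<open>The logarithm in \<open>partner W\<close> branches at W + 2 pi i n. The slit to the
  right of W and the bound 2 pi on the height keep s off its cut, and the resulting set is
  star-shaped about W - 1, which supplies primitives.\<close>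

definition slit_strip :: "real \<Rightarrow> complex \<Rightarrow> complex set" where
  "slit_strip d W = {s. Re s < d \<and> \<bar>Im s - Im W\<bar> < 2 * pi \<and> (Im s = Im W \<longrightarrow> Re s < Re W)}"

definition outer_strip :: "real \<Rightarrow> complex \<Rightarrow> complex set" where
  "outer_strip d W = {s. Re W < Re s \<and> Re s < d}"

lemma integrable_branch_holo: "integrable_branch c A \<Longrightarrow> A holomorphic_on {s. Re s < c}"
  by (simp add: integrable_branch_def)

lemma integrable_branch_decay:
  assumes "integrable_branch c A" "0 < e"
  obtains R where "R \<le> c" "\<And>s. Re s < R \<Longrightarrow> \<bar>Im s\<bar> \<le> M \<Longrightarrow> norm (exp s * A s) \<le> e"
proof -
  obtain R where "\<forall>s. Re s < R \<longrightarrow> Re s < c \<longrightarrow> \<bar>Im s\<bar> \<le> M \<longrightarrow> norm (exp s * A s) \<le> e"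
    using assms unfolding integrable_branch_def by blast
  then show thesis by (intro that[of "min R c"]) auto
qed

lemma holomorphic_on_Re_lt_shift:
  assumes "A holomorphic_on {s. Re s < c}"
  shows "(\<lambda>s. A (s + 2 * of_real pi * \<i>)) holomorphic_on {s. Re s < c}"
proof -
  have "(A \<circ> (\<lambda>s. s + 2 * of_real pi * \<i>)) holomorphic_on {s. Re s < c}"
    by (rule holomorphic_on_compose_gen[OF _ assms]) (auto intro!: holomorphic_intros)
  then show ?thesis by (simp add: o_def)
qed

lemma exp_add_2pii [simp]: "exp (s + 2 * of_real pi * \<i>) = exp (s :: complex)"
  by (simp add: exp_add)

lemma integrable_branch_turn:
  assumes "integrable_branch c A"
  shows "integrable_branch c (turn A)"
  unfolding integrable_branch_def
proof (intro conjI allI impI)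
  show "turn A holomorphic_on {s. Re s < c}"
    unfolding turn_def by (rule holomorphic_on_Re_lt_shift[OF integrable_branch_holo[OF assms]])
  fix M e :: real assume "0 < e"
  then obtain R where R: "\<And>s. Re s < R \<Longrightarrow> \<bar>Im s\<bar> \<le> M + 2 * pi \<Longrightarrow> norm (exp s * A s) \<le> e"
    using integrable_branch_decay[OF assms] by metis
  show "\<exists>R. \<forall>s. Re s < R \<longrightarrow> Re s < c \<longrightarrow> \<bar>Im s\<bar> \<le> M \<longrightarrow> norm (exp s * turn A s) \<le> e"
  proof (intro exI allI impI)
    fix s :: complex assume "Re s < R" "\<bar>Im s\<bar> \<le> M"
    moreover from this have "\<bar>Im s + 2 * pi\<bar> \<le> M + 2 * pi" using pi_gt_zero by linarith
    ultimately show "norm (exp s * turn A s) \<le> e"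
      using R[of "s + 2 * of_real pi * \<i>"] by (simp add: turn_def)
  qed
qed

lemma integrable_branch_diff:
  assumes "integrable_branch c A" "integrable_branch c B"
  shows "integrable_branch c (\<lambda>s. A s - B s)"
  unfolding integrable_branch_def
proof (intro conjI allI impI)
  show "(\<lambda>s. A s - B s) holomorphic_on {s. Re s < c}"
    using assms by (auto intro!: holomorphic_intros dest: integrable_branch_holo)
  fix M e :: real assume "0 < e"
  then obtain R where R: "\<And>s. Re s < R \<Longrightarrow> \<bar>Im s\<bar> \<le> M \<Longrightarrow> norm (exp s * A s) \<le> e / 2"
    using integrable_branch_decay[OF assms(1), of "e / 2"] by (metis half_gt_zero)
  obtain R' where R': "\<And>s. Re s < R' \<Longrightarrow> \<bar>Im s\<bar> \<le> M \<Longrightarrow> norm (exp s * B s) \<le> e / 2"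
    using integrable_branch_decay[OF assms(2), of "e / 2"] \<open>0 < e\<close> by (metis half_gt_zero)
  show "\<exists>R. \<forall>s. Re s < R \<longrightarrow> Re s < c \<longrightarrow> \<bar>Im s\<bar> \<le> M \<longrightarrow> norm (exp s * (A s - B s)) \<le> e"
  proof (intro exI[of _ "min R R'"] allI impI)
    fix s :: complex assume "Re s < min R R'" "\<bar>Im s\<bar> \<le> M"
    then have "norm (exp s * A s) + norm (exp s * B s) \<le> e" using R[of s] R'[of s] by fastforce
    then show "norm (exp s * (A s - B s)) \<le> e"
      by (simp add: right_diff_distrib) (meson norm_triangle_ineq4 order_trans)
  qed
qed

lemma integrable_branch_jump: "integrable_branch c A \<Longrightarrow> integrable_branch c (jump A)"
  using integrable_branch_diff[OF integrable_branch_turn, of c A A]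
  by (simp add: jump_def[abs_def] turn_def)

section \<open>Size and domain of the partner coordinate\<close>

lemma one_minus_exp_not_nonpos:
  assumes "\<bar>Im v\<bar> < 2 * pi" "Im v = 0 \<Longrightarrow> Re v < 0"
  shows "1 - exp v \<notin> \<real>\<^sub>\<le>\<^sub>0"
proof
  assume "1 - exp v \<in> \<real>\<^sub>\<le>\<^sub>0"
  then have *: "exp (Re v) * sin (Im v) = 0" "exp (Re v) * cos (Im v) \<ge> 1"
    by (auto simp: complex_nonpos_Reals_iff Re_exp Im_exp)
  then have "sin (Im v) = 0" "cos (Im v) > 0"
    by (auto simp: zero_less_mult_iff intro: less_le_trans[of 0 1])
      (metis exp_gt_zero less_le_trans zero_less_mult_pos zero_less_one)
  then have "cos (Im v) = 1" by (metis abs_of_pos cos_squared_eq power2_eq_1_iff sin_zero_abs_cos_one)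
  then have "Im v = 0" using assms(1) cos_one_2pi_int[of "Im v"]
    by (auto simp: abs_mult) 
  then show False using * assms(2) by simp
qed

lemma one_plus_not_nonpos: "norm z < 1 \<Longrightarrow> 1 + z \<notin> \<real>\<^sub>\<le>\<^sub>0" for z :: complex
  using abs_Re_le_cmod[of z] by (auto simp: complex_nonpos_Reals_iff)

lemma one_minus_not_nonpos: "norm z < 1 \<Longrightarrow> 1 - z \<notin> \<real>\<^sub>\<le>\<^sub>0" for z :: complex
  using one_plus_not_nonpos[of "- z"] by simp

text \<open>The margins come from e^2 \<ge> 4: for Re s, Re W < c - 2 both exponentials are below
  e^c/4 \<le> 1/8, hence |e^W - e^s| / |1 + e^s| < (e^c/2) / (7/8) < e^c, and the partner stays in
  the half plane where the second branch lives. The stronger bound Re W < c - 3 used later leaves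
  room for the corners W + 1 \<plusminus> i pi.\<close>

locale scale =
  fixes c :: real
  assumes exp_c: "exp c \<le> 1 / 2"
begin

abbreviation "S \<equiv> slit_strip (c - 2)"
abbreviation "R \<equiv> outer_strip (c - 2)"

lemma norm_exp_small:
  assumes "Re s < c - 2"
  shows "norm (exp s) < exp c / 4" "norm (exp s) < 1 / 8"
proof -
  have "(1::real) + 1 \<le> exp 1" by (rule exp_ge_add_one_self)
  then have "(2::real) * 2 \<le> exp 1 * exp 1" by (intro mult_mono) auto
  then have "exp (2::real) \<ge> 4" by (simp flip: exp_add)
  then have "exp (c - 2) \<le> exp c / 4" by (simp add: exp_diff field_simps)
  then show "norm (exp s) < exp c / 4" using assms exp_less_mono[OF assms] by (simp only: norm_exp_eq_Re)
  then show "norm (exp s) < 1 / 8" using exp_c by simp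
qed

lemma one_plus_exp:
  assumes "Re s < c - 2"
  shows "norm (1 + exp s) \<ge> 7 / 8" "norm (1 + exp s) \<le> 9 / 8" "1 + exp s \<noteq> 0" "1 + exp s \<notin> \<real>\<^sub>\<le>\<^sub>0"
proof -
  have e: "norm (exp s) < 1 / 8" by (rule norm_exp_small[OF assms])
  show "norm (1 + exp s) \<ge> 7 / 8" using norm_diff_ineq[of 1 "exp s"] e by simp
  then show "1 + exp s \<noteq> 0" by auto
  show "norm (1 + exp s) \<le> 9 / 8" using norm_triangle_ineq[of 1 "exp s"] e by simp
  show "1 + exp s \<notin> \<real>\<^sub>\<le>\<^sub>0" using one_plus_not_nonpos[of "exp s"] e by linarith
qed

lemma slit_not_nonpos:
  assumes "s \<in> S W"
  shows "1 - exp (s - W) \<notin> \<real>\<^sub>\<le>\<^sub>0"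
  by (rule one_minus_exp_not_nonpos) (use assms in \<open>auto simp: slit_strip_def\<close>)

lemma inner_not_nonpos:
  assumes "Re s < Re W"
  shows "1 - exp (s - W) \<notin> \<real>\<^sub>\<le>\<^sub>0"
  by (rule one_minus_not_nonpos) (use assms in simp)

lemma exp_partner:
  assumes "1 - exp (s - W) \<notin> \<real>\<^sub>\<le>\<^sub>0" "Re s < c - 2"
  shows "exp (partner W s) = (exp W - exp s) / (1 + exp s)"
proof -
  have "1 - exp (s - W) \<noteq> 0" using assms(1) by auto
  then have "exp (partner W s) = exp W * (1 - exp (s - W)) / (1 + exp s)"
    using one_plus_exp[OF assms(2)] by (simp add: partner_def exp_diff exp_add exp_Ln)
  then show ?thesis by (simp add: exp_diff right_diff_distrib)
qed

lemma exp_outer_partner: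
  assumes "Re W < Re s" "Re s < c - 2"
  shows "exp (outer_partner W s) = (exp W - exp s) / (1 + exp s)"
proof -
  have "1 - exp (W - s) \<noteq> 0" using inner_not_nonpos[OF assms(1)] by auto
  then have "exp (outer_partner W s) = - exp s * (1 - exp (W - s)) / (1 + exp s)"
    using one_plus_exp[OF assms(2)]
    by (simp add: outer_partner_def exp_diff exp_add exp_Ln mult.commute)
  then show ?thesis by (simp add: exp_diff right_diff_distrib)
qed

lemma Re_less_c:
  assumes "exp t = (exp W - exp s) / (1 + exp s)" "Re s < c - 2" "Re W < c - 2"
  shows "Re t < c"
proof -
  have "exp (Re t) = norm (exp W - exp s) / norm (1 + exp s)"
    using assms(1) norm_exp_eq_Re[of t] by (simp add: norm_divide)
  also have "norm (exp W - exp s) < exp c / 2"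
    using norm_triangle_ineq4[of "exp W" "exp s"] norm_exp_small[OF assms(2)] norm_exp_small[OF assms(3)] by linarith
  then have "norm (exp W - exp s) / norm (1 + exp s) < exp c"
    using one_plus_exp[OF assms(2)] mult_left_mono[of "7/8" "norm (1 + exp s)" "exp c"] exp_gt_zero[of c]
    by (subst pos_divide_less_eq) (linarith, argo)
  finally show ?thesis by simp
qed

lemma Re_partner:
  assumes "1 - exp (s - W) \<notin> \<real>\<^sub>\<le>\<^sub>0" "Re s < c - 2" "Re W < c - 2"
  shows "Re (partner W s) < c"
  using Re_less_c[OF exp_partner] assms by blast

lemma Re_outer_partner:
  assumes "Re W < Re s" "Re s < c - 2"
  shows "Re (outer_partner W s) < c"
  using Re_less_c[OF exp_outer_partner] assms by force

text \<open>Ln (1 - e^v) and v - i pi + Ln (1 - e^(-v)) have the same exponential, so it is enough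
  that the imaginary part of the latter lies in (-pi, pi]. Since Im (Ln (1 - e^(-v))) has the sign
  of sin (Im v), it always pushes the value away from the nearer end of this interval.\<close>

lemma partner_upper:
  assumes "s \<in> R W" "Im W < Im s" "Im s < Im W + 2 * pi"
  shows "partner W s = outer_partner W s"
proof -
  define v where "v = s - W"
  define w where "w = 1 - exp (- v)"
  have v: "0 < Re v" "0 < Im v" "Im v < 2 * pi" using assms by (auto simp: v_def outer_strip_def)
  have nw: "norm (exp (- v)) < 1" using v by simp
  have Rw: "Re w > 0" unfolding w_def using abs_Re_le_cmod[of "exp (- v)"] nw by (simp only: minus_complex.sel one_complex.sel)
  then have "w \<noteq> 0" by auto
  have Imw: "Im w = exp (- Re v) * sin (Im v)" by (simp add: w_def Im_exp)
  have half: "\<bar>Im (Ln w)\<bar> < pi / 2" using Rw by (rule Re_Ln_pos_lt_imp)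
  have "Ln (1 - exp v) = v - \<i> * pi + Ln w"
  proof (rule Ln_unique)
    show "exp (v - \<i> * pi + Ln w) = 1 - exp v"
      using \<open>w \<noteq> 0\<close> by (simp add: exp_add exp_diff mult.commute[of \<i>] w_def exp_minus right_diff_distrib)
    have "- pi < Im v - pi + Im (Ln w) \<and> Im v - pi + Im (Ln w) \<le> pi"
    proof (cases "Im v" pi rule: linorder_cases)
      case less
      then have "0 \<le> Im w" using v by (simp add: Imw sin_ge_zero)
      then have "0 \<le> Im (Ln w)" using \<open>w \<noteq> 0\<close> Im_Ln_pos_le by auto
      then show ?thesis using less v half by (auto simp: abs_if split: if_splits)
    next
      case equal
      then show ?thesis using half by (auto simp: abs_if split: if_splits)
    next
      case greater
      then have "Im w \<le> 0" using v sin_le_zero[of "Im v"] by (simp add: Imw mult_nonneg_nonpos)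
      then have "Im (Ln w) \<le> 0" using Im_Ln_pos_lt[OF \<open>w \<noteq> 0\<close>] half pi_gt_zero by linarith
      then show ?thesis using greater v half by (auto simp: abs_if split: if_splits)
    qed
    then show "- pi < Im (v - \<i> * pi + Ln w)" "Im (v - \<i> * pi + Ln w) \<le> pi" by simp_all
  qed
  then show ?thesis by (simp add: partner_def outer_partner_def v_def w_def)
qed

lemma partner_periodic [simp]:
  "partner W (s + 2 * of_real pi * \<i>) = partner W s" "partner W (s - 2 * of_real pi * \<i>) = partner W s"
  "partner (W + 2 * of_real pi * \<i>) s = partner W s + 2 * of_real pi * \<i>"
  by (simp_all add: partner_def exp_add exp_diff)

lemma outer_partner_periodic [simp]:
  "outer_partner (W + 2 * of_real pi * \<i>) s = outer_partner W s"
  "outer_partner W (s + 2 * of_real pi * \<i>) = outer_partner W s + 2 * of_real pi * \<i>"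
  by (simp_all add: outer_partner_def exp_add exp_diff)

text \<open>Reduced to the upper case by s -> s + 2 pi i, which changes \<open>outer_partner\<close>
  but not \<open>partner\<close>. The extra 2 pi i is the reason why the last leg of
  \<open>pinch\<close> carries \<open>turn B\<close>.\<close>

lemma partner_lower:
  assumes "s \<in> R W" "Im W - 2 * pi < Im s" "Im s < Im W"
  shows "partner W s = outer_partner W s + 2 * of_real pi * \<i>"
  using partner_upper[of "s + 2 * of_real pi * \<i>" W] assms
  by (simp add: outer_strip_def exp_add)

lemma open_S: "open (S W)"
proof -
  have "S W = {s. Re s < c - 2} \<inter> {s. \<bar>Im s - Im W\<bar> < 2 * pi} \<inter> ({s. Im s < Im W} \<union> {s. Im s > Im W} \<union> {s. Re s < Re W})"
    by (auto simp: slit_strip_def)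
  then show ?thesis by (simp only:) (intro open_Int open_Un open_Collect_less continuous_intros)
qed

lemma center_in_S: "Re W < c - 2 \<Longrightarrow> W - 1 \<in> S W"
  by (simp add: slit_strip_def)

lemma segment_in_S:
  assumes "Re W < c - 2" "x \<in> S W"
  shows "closed_segment (W - 1) x \<subseteq> S W" "closed_segment x (W - 1) \<subseteq> S W"
proof -
  show *: "closed_segment (W - 1) x \<subseteq> S W"
  proof
    fix s assume "s \<in> closed_segment (W - 1) x"
    then obtain u where u: "0 \<le> u" "u \<le> 1" "s = (1 - u) *\<^sub>R (W - 1) + u *\<^sub>R x"
      by (auto simp: closed_segment_def)
    have Im: "Im s - Im W = u * (Im x - Im W)" unfolding u(3) by (simp add: algebra_simps)
    have Re: "Re s = (1 - u) * (Re W - 1) + u * Re x" unfolding u(3) by simp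
    have "\<bar>u * (Im x - Im W)\<bar> \<le> 1 * \<bar>Im x - Im W\<bar>"
      unfolding abs_mult by (rule mult_right_mono) (use u in auto)
    moreover have "Re s < c - 2" unfolding Re
      by (rule convex_bound_lt) (use u assms in \<open>auto simp: slit_strip_def\<close>)
    moreover have "Re s < Re W" if "Im s = Im W"
    proof (cases "u = 0")
      case False
      then have "Re x < Re W" using Im that assms(2) by (auto simp: slit_strip_def)
      then show ?thesis unfolding Re by (intro convex_bound_lt) (use u in auto)
    qed (use Re in auto)
    ultimately show "s \<in> S W" using Im assms(2) by (auto simp: slit_strip_def)
  qed
  then show "closed_segment x (W - 1) \<subseteq> S W" by (simp add: closed_segment_commute)
qed

lemma starlike_S: "Re W < c - 2 \<Longrightarrow> starlike (S W)"
  unfolding starlike_def by (rule bexI[OF _ center_in_S]) (use segment_in_S(1) in simp_all)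

lemma open_R: "open (R W)" and convex_R: "convex (R W)"
proof -
  have "R W = {s. Re W < Re s} \<inter> {s. Re s < c - 2}" by (auto simp: outer_strip_def)
  then show "open (R W)" "convex (R W)"
    by (simp_all only:) (intro open_Int open_Collect_less continuous_intros convex_Int
        convex_halfspace_Re_gt convex_halfspace_Re_lt)+
qed

text \<open>The halves of the slit strip above and below the line through W. They are convex, and on
  their parts to the right of W both kernels can be compared.\<close>

definition upper_gap :: "complex \<Rightarrow> complex set" where
  "upper_gap W = {s. Re s < c - 2 \<and> Im W < Im s \<and> Im s < Im W + 2 * pi}"

definition lower_gap :: "complex \<Rightarrow> complex set" where
  "lower_gap W = {s. Re s < c - 2 \<and> Im W - 2 * pi < Im s \<and> Im s < Im W}"

lemma upper_gap_props: "open (upper_gap W)" "convex (upper_gap W)" "upper_gap W \<subseteq> S W"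
proof -
  have "upper_gap W = {s. Re s < c - 2} \<inter> {s. Im W < Im s} \<inter> {s. Im s < Im W + 2 * pi}"
    by (auto simp: upper_gap_def)
  then show "open (upper_gap W)" "convex (upper_gap W)"
    by (simp_all only:) (intro open_Int open_Collect_less continuous_intros convex_Int convex_halfspace_Re_lt
        convex_halfspace_Im_gt convex_halfspace_Im_lt)+
  show "upper_gap W \<subseteq> S W" by (auto simp: upper_gap_def slit_strip_def)
qed

lemma lower_gap_props: "open (lower_gap W)" "convex (lower_gap W)" "lower_gap W \<subseteq> S W"
proof -
  have "lower_gap W = {s. Re s < c - 2} \<inter> {s. Im W - 2 * pi < Im s} \<inter> {s. Im s < Im W}"
    by (auto simp: lower_gap_def)
  then show "open (lower_gap W)" "convex (lower_gap W)"
    by (simp_all only:) (intro open_Int open_Collect_less continuous_intros convex_Int convex_halfspace_Re_lt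
        convex_halfspace_Im_gt convex_halfspace_Im_lt)+
  show "lower_gap W \<subseteq> S W" by (auto simp: lower_gap_def slit_strip_def)
qed

section \<open>Holomorphy and primitives of the kernels\<close>

lemma kern_holomorphic:
  assumes A: "A holomorphic_on {s. Re s < c}" and B: "B holomorphic_on {s. Re s < c}" and W: "Re W < c - 2"
    and T: "\<And>s. s \<in> T \<Longrightarrow> Re s < c - 2 \<and> 1 - exp (s - W) \<notin> \<real>\<^sub>\<le>\<^sub>0"
  shows "kern A B W holomorphic_on T"
proof -
  have p: "partner W holomorphic_on T"
    unfolding partner_def by (intro holomorphic_intros) (use T one_plus_exp(4) in blast)+
  have Tc: "T \<subseteq> {s. Re s < c}" "partner W ` T \<subseteq> {s. Re s < c}"
    using T Re_partner W by (auto intro: order_less_trans[of _ "c - 2"])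
  have "(B \<circ> partner W) holomorphic_on T"
    by (rule holomorphic_on_compose_gen[OF p B Tc(2)])
  moreover have "A holomorphic_on T"
    by (rule holomorphic_on_subset[OF A Tc(1)])
  moreover have "1 + exp s \<noteq> 0" if "s \<in> T" for s
    using T[OF that] one_plus_exp(3) by simp
  ultimately show ?thesis unfolding kern_def o_def
    by (intro holomorphic_intros) simp_all
qed

lemma kern_holomorphic_S:
  assumes "A holomorphic_on {s. Re s < c}" "B holomorphic_on {s. Re s < c}" "Re W < c - 2"
  shows "kern A B W holomorphic_on S W"
  by (rule kern_holomorphic[OF assms]) (use slit_not_nonpos in \<open>auto simp: slit_strip_def\<close>)

lemma outer_kern_holomorphic:
  assumes A: "A holomorphic_on {s. Re s < c}" and B: "B holomorphic_on {s. Re s < c}"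
  shows "outer_kern A B W holomorphic_on R W"
proof -
  have p: "outer_partner W holomorphic_on R W"
    unfolding outer_partner_def
    by (intro holomorphic_intros) (use one_plus_exp(4) inner_not_nonpos in \<open>auto simp: outer_strip_def\<close>)
  have "(B \<circ> outer_partner W) holomorphic_on R W"
    by (rule holomorphic_on_compose_gen[OF p B]) (use Re_outer_partner in \<open>auto simp: outer_strip_def\<close>)
  moreover have "A holomorphic_on R W"
    by (rule holomorphic_on_subset[OF A]) (auto simp: outer_strip_def)
  ultimately show ?thesis unfolding outer_kern_def o_def
    by (intro holomorphic_intros) (use one_plus_exp(3) in \<open>auto simp: outer_strip_def\<close>)
qed

lemma kern_primitive:
  assumes "A holomorphic_on {s. Re s < c}" "B holomorphic_on {s. Re s < c}" "Re W < c - 2"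
  obtains N where "\<And>s. s \<in> S W \<Longrightarrow> (N has_field_derivative kern A B W s) (at s)"
proof -
  have h: "kern A B W holomorphic_on S W" by (rule kern_holomorphic_S[OF assms])
  have "\<exists>N. \<forall>s\<in>S W. (N has_field_derivative kern A B W s) (at s)"
    by (rule holomorphic_starlike_primitive[OF holomorphic_on_imp_continuous_on[OF h] starlike_S[OF assms(3)] open_S finite.emptyI])
      (use holomorphic_on_imp_differentiable_at[OF h open_S] in auto)
  then show thesis using that by blast
qed

lemma outer_kern_primitive:
  assumes "A holomorphic_on {s. Re s < c}" "B holomorphic_on {s. Re s < c}"
  obtains N where "\<And>s. s \<in> R W \<Longrightarrow> (N has_field_derivative outer_kern A B W s) (at s)"
proof -
  obtain N where N: "\<And>s. s \<in> R W \<Longrightarrow> (N has_field_derivative outer_kern A B W s) (at s within R W)"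
    using holomorphic_convex_primitive'[OF convex_R open_R outer_kern_holomorphic[OF assms]] by blast
  show thesis by (rule that[of N]) (use N at_within_open[OF _ open_R] in simp)
qed

text \<open>
  The contour runs from \<open>s0\<close> to \<open>t0\<close> through the gap between the two branch points: the first
  and the last leg stay outside of both of them, the middle part is a clockwise loop about \<open>- \<infinity>\<close>
  to the left of \<open>W\<close>.
\<close>

definition pinch :: "(complex \<Rightarrow> complex) \<Rightarrow> (complex \<Rightarrow> complex) \<Rightarrow> complex \<Rightarrow> complex \<Rightarrow> complex \<Rightarrow> complex" where
  "pinch A B s0 t0 W =
     contour_integral (linepath s0 (W + 1 + \<i> * pi)) (outer_kern A B W)
   + contour_integral (linepath (W + 1 + \<i> * pi) (W - 1)) (kern A B W)
   + contour_integral (linepath (W - 1) (W + 1 - \<i> * pi)) (kern A B W)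
   + contour_integral (linepath (W + 1 - \<i> * pi) t0) (outer_kern A (turn B) W)"

text \<open>W moves the integrand and, through p and q, also the segment; all is pulled back to the
  fixed unit segment.\<close>

lemma holomorphic_on_integral_kern:
  assumes A: "A holomorphic_on {s. Re s < c}" and B: "B holomorphic_on {s. Re s < c}"
    and U: "open U" and p: "p holomorphic_on U" and q: "q holomorphic_on U"
    and UW: "\<And>W. W \<in> U \<Longrightarrow> Re W < c - 2"
    and T: "\<And>W t. W \<in> U \<Longrightarrow> t \<in> closed_segment 0 1 \<Longrightarrow> p W + t * q W \<in> S W"
  shows "(\<lambda>W. contour_integral (linepath 0 1) (\<lambda>t. kern A B W (p W + t * q W) * q W)) holomorphic_on U"
proof (rule contour_integral_linepath_holomorphic_on[OF U])
  define g where "g W t = p W + t * q W" for W t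
  have dom: "g W t \<in> S W" if "W \<in> U" "t \<in> closed_segment 0 1" for W t
    using T[OF that] by (simp add: g_def)
  have T1: "Re (g W t) < c - 2" "1 - exp (g W t - W) \<notin> \<real>\<^sub>\<le>\<^sub>0"
      "1 + exp (g W t) \<notin> \<real>\<^sub>\<le>\<^sub>0" "1 + exp (g W t) \<noteq> 0"
      "Re (partner W (g W t)) < c" "Re (g W t) < c"
    if "W \<in> U" "t \<in> closed_segment 0 1" for W t
  proof -
    show a: "Re (g W t) < c - 2" using dom[OF that] unfolding slit_strip_def by blast
    show b: "1 - exp (g W t - W) \<notin> \<real>\<^sub>\<le>\<^sub>0" using slit_not_nonpos[OF dom[OF that]] .
    show "Re (partner W (g W t)) < c" by (rule Re_partner[OF b a UW[OF that(1)]])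
    show "1 + exp (g W t) \<notin> \<real>\<^sub>\<le>\<^sub>0" "1 + exp (g W t) \<noteq> 0" using one_plus_exp a by blast+
    show "Re (g W t) < c" using a by linarith
  qed
  note contA = holomorphic_on_imp_continuous_on[OF A] and contB = holomorphic_on_imp_continuous_on[OF B]
  note contp = holomorphic_on_imp_continuous_on[OF p] and contq = holomorphic_on_imp_continuous_on[OF q]
  have cq: "continuous_on (U \<times> closed_segment 0 1) (\<lambda>x. q (fst x))"
    by (rule continuous_on_compose2[OF contq]) (auto intro!: continuous_intros)
  have cp: "continuous_on (U \<times> closed_segment 0 1) (\<lambda>x. p (fst x))"
    by (rule continuous_on_compose2[OF contp]) (auto intro!: continuous_intros)
  have cg: "continuous_on (U \<times> closed_segment 0 1) (\<lambda>x. g (fst x) (snd x))"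
    unfolding g_def by (intro continuous_intros cp cq)
  have cP: "continuous_on (U \<times> closed_segment 0 1) (\<lambda>x. partner (fst x) (g (fst x) (snd x)))"
    unfolding partner_def by (intro continuous_intros cg) (use T1 in \<open>simp_all add: mem_Times_iff\<close>)
  have cB: "continuous_on (U \<times> closed_segment 0 1) (\<lambda>x. B (partner (fst x) (g (fst x) (snd x))))"
    by (rule continuous_on_compose2[OF contB cP]) (use T1 in \<open>auto simp: mem_Times_iff\<close>)
  have cA: "continuous_on (U \<times> closed_segment 0 1) (\<lambda>x. A (g (fst x) (snd x)))"
    by (rule continuous_on_compose2[OF contA cg]) (use T1 in \<open>auto simp: mem_Times_iff\<close>)
  have "continuous_on (U \<times> closed_segment 0 1) (\<lambda>x. kern A B (fst x) (g (fst x) (snd x)) * q (fst x))"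
    unfolding kern_def by (intro continuous_intros cA cB cq cg) (use T1 in \<open>simp add: mem_Times_iff\<close>)
  then show "continuous_on (U \<times> closed_segment 0 1) (\<lambda>(W, t). kern A B W (p W + t * q W) * q W)"
    by (simp add: case_prod_unfold g_def)
  fix t :: complex assume t: "t \<in> closed_segment 0 1"
  have hg: "(\<lambda>W. g W t) holomorphic_on U" unfolding g_def by (intro holomorphic_intros p q)
  have hP: "(\<lambda>W. partner W (g W t)) holomorphic_on U"
    unfolding partner_def by (intro holomorphic_intros hg) (use T1 t in simp_all)
  have "(B \<circ> (\<lambda>W. partner W (g W t))) holomorphic_on U"
    by (rule holomorphic_on_compose_gen[OF hP B]) (use T1 t in auto)
  moreover have "(A \<circ> (\<lambda>W. g W t)) holomorphic_on U"
    by (rule holomorphic_on_compose_gen[OF hg A]) (use T1 t in auto)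
  ultimately have "(\<lambda>W. A (g W t) * B (partner W (g W t)) * (exp (g W t) / (1 + exp (g W t))) * q W) holomorphic_on U"
    unfolding o_def by (intro holomorphic_intros hg q) (use T1 t in simp_all)
  then show "(\<lambda>W. kern A B W (p W + t * q W) * q W) holomorphic_on U"
    by (simp add: kern_def g_def)
qed

lemma holomorphic_on_integral_outer_kern:
  assumes A: "A holomorphic_on {s. Re s < c}" and B: "B holomorphic_on {s. Re s < c}"
    and U: "open U" and p: "p holomorphic_on U" and q: "q holomorphic_on U"
    and T: "\<And>W t. W \<in> U \<Longrightarrow> t \<in> closed_segment 0 1 \<Longrightarrow> p W + t * q W \<in> R W"
  shows "(\<lambda>W. contour_integral (linepath 0 1) (\<lambda>t. outer_kern A B W (p W + t * q W) * q W)) holomorphic_on U"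
proof (rule contour_integral_linepath_holomorphic_on[OF U])
  define g where "g W t = p W + t * q W" for W t
  have dom: "g W t \<in> R W" if "W \<in> U" "t \<in> closed_segment 0 1" for W t
    using T[OF that] by (simp add: g_def)
  have T1: "Re (g W t) < c - 2" "1 - exp (W - g W t) \<notin> \<real>\<^sub>\<le>\<^sub>0"
      "1 + exp (g W t) \<notin> \<real>\<^sub>\<le>\<^sub>0" "1 + exp (g W t) \<noteq> 0"
      "Re (outer_partner W (g W t)) < c" "Re (g W t) < c"
    if "W \<in> U" "t \<in> closed_segment 0 1" for W t
  proof -
    show a: "Re (g W t) < c - 2" using dom[OF that] unfolding outer_strip_def by blast
    have b: "Re W < Re (g W t)" using dom[OF that] unfolding outer_strip_def by blast
    show "1 - exp (W - g W t) \<notin> \<real>\<^sub>\<le>\<^sub>0" using inner_not_nonpos[OF b] .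
    show "Re (outer_partner W (g W t)) < c" by (rule Re_outer_partner[OF b a])
    show "1 + exp (g W t) \<notin> \<real>\<^sub>\<le>\<^sub>0" "1 + exp (g W t) \<noteq> 0" using one_plus_exp a by blast+
    show "Re (g W t) < c" using a by linarith
  qed
  note contA = holomorphic_on_imp_continuous_on[OF A] and contB = holomorphic_on_imp_continuous_on[OF B]
  note contp = holomorphic_on_imp_continuous_on[OF p] and contq = holomorphic_on_imp_continuous_on[OF q]
  have cq: "continuous_on (U \<times> closed_segment 0 1) (\<lambda>x. q (fst x))"
    by (rule continuous_on_compose2[OF contq]) (auto intro!: continuous_intros)
  have cp: "continuous_on (U \<times> closed_segment 0 1) (\<lambda>x. p (fst x))"
    by (rule continuous_on_compose2[OF contp]) (auto intro!: continuous_intros)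
  have cg: "continuous_on (U \<times> closed_segment 0 1) (\<lambda>x. g (fst x) (snd x))"
    unfolding g_def by (intro continuous_intros cp cq)
  have cP: "continuous_on (U \<times> closed_segment 0 1) (\<lambda>x. outer_partner (fst x) (g (fst x) (snd x)))"
    unfolding outer_partner_def by (intro continuous_intros cg) (use T1 in \<open>simp_all add: mem_Times_iff\<close>)
  have cB: "continuous_on (U \<times> closed_segment 0 1) (\<lambda>x. B (outer_partner (fst x) (g (fst x) (snd x))))"
    by (rule continuous_on_compose2[OF contB cP]) (use T1 in \<open>auto simp: mem_Times_iff\<close>)
  have cA: "continuous_on (U \<times> closed_segment 0 1) (\<lambda>x. A (g (fst x) (snd x)))"
    by (rule continuous_on_compose2[OF contA cg]) (use T1 in \<open>auto simp: mem_Times_iff\<close>)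
  have "continuous_on (U \<times> closed_segment 0 1) (\<lambda>x. outer_kern A B (fst x) (g (fst x) (snd x)) * q (fst x))"
    unfolding outer_kern_def by (intro continuous_intros cA cB cq cg) (use T1 in \<open>simp add: mem_Times_iff\<close>)
  then show "continuous_on (U \<times> closed_segment 0 1) (\<lambda>(W, t). outer_kern A B W (p W + t * q W) * q W)"
    by (simp add: case_prod_unfold g_def)
  fix t :: complex assume t: "t \<in> closed_segment 0 1"
  have hg: "(\<lambda>W. g W t) holomorphic_on U" unfolding g_def by (intro holomorphic_intros p q)
  have hP: "(\<lambda>W. outer_partner W (g W t)) holomorphic_on U"
    unfolding outer_partner_def by (intro holomorphic_intros hg) (use T1 t in simp_all)
  have "(B \<circ> (\<lambda>W. outer_partner W (g W t))) holomorphic_on U"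
    by (rule holomorphic_on_compose_gen[OF hP B]) (use T1 t in auto)
  moreover have "(A \<circ> (\<lambda>W. g W t)) holomorphic_on U"
    by (rule holomorphic_on_compose_gen[OF hg A]) (use T1 t in auto)
  ultimately have "(\<lambda>W. A (g W t) * B (outer_partner W (g W t)) * (exp (g W t) / (1 + exp (g W t))) * q W) holomorphic_on U"
    unfolding o_def by (intro holomorphic_intros hg q) (use T1 t in simp_all)
  then show "(\<lambda>W. outer_kern A B W (p W + t * q W) * q W) holomorphic_on U"
    by (simp add: outer_kern_def g_def)
qed

end

lemma affine_in_segment: "t \<in> closed_segment 0 1 \<Longrightarrow> a + t * (b - a) \<in> closed_segment a (b::complex)"
  by (auto simp: closed_segment_def scaleR_conv_of_real algebra_simps)

context scale
begin

section \<open>The pinched contour and its monodromy\<close>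

lemma pinch_corners:
  assumes "Re W < c - 3"
  shows "W + 1 + \<i> * pi \<in> upper_gap W" "W + 1 - \<i> * pi \<in> lower_gap W"
    "W + 1 + \<i> * pi \<in> R W" "W + 1 - \<i> * pi \<in> R W"
  using assms pi_gt_zero by (auto simp: upper_gap_def lower_gap_def outer_strip_def)

lemma outer_kern_upper:
  "s \<in> R W \<Longrightarrow> s \<in> upper_gap W \<Longrightarrow> outer_kern A B W s = kern A B W s"
  by (simp add: outer_kern_def kern_def partner_upper upper_gap_def)

lemma outer_kern_lower:
  "s \<in> R W \<Longrightarrow> s \<in> lower_gap W \<Longrightarrow> outer_kern A (turn B) W s = kern A B W s"
  by (simp add: outer_kern_def kern_def partner_lower lower_gap_def turn_def)

text \<open>The corners move with W, so the contour keeps its position relative to both branch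
  points for every value of Im W. The legs to the fixed points s0 and t0 would leave the slit strip;
  they stay in the convex outer strip, where \<open>outer_partner\<close> is holomorphic without any
  bound on Im s.\<close>

lemma pinch_holomorphic:
  assumes A: "A holomorphic_on {s. Re s < c}" and B: "B holomorphic_on {s. Re s < c}"
    and e: "e \<le> c - 3" "e \<le> Re s0" "Re s0 < c - 2" "e \<le> Re t0" "Re t0 < c - 2"
  shows "pinch A B s0 t0 holomorphic_on {W. Re W < e}"
proof -
  define U where "U = {W. Re W < e}"
  have U: "open U" unfolding U_def by (intro open_Collect_less continuous_intros)
  have tB: "turn B holomorphic_on {s. Re s < c}"
    using holomorphic_on_Re_lt_shift[OF B] by (simp add: turn_def[abs_def])
  have UW: "Re W < c - 3" "Re W < c - 2" "s0 \<in> R W" "t0 \<in> R W" if "W \<in> U" for W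
    using that e by (auto simp: U_def outer_strip_def)
  have seg: "s + t * (s' - s) \<in> R W" if "s \<in> R W" "s' \<in> R W" "t \<in> closed_segment 0 1" for s s' t W
    using affine_in_segment[OF that(3)] closed_segment_subset[OF that(1,2) convex_R] by blast
  have "(\<lambda>W. contour_integral (linepath 0 1)
      (\<lambda>t. outer_kern A B W (s0 + t * (W + 1 + \<i> * pi - s0)) * (W + 1 + \<i> * pi - s0))) holomorphic_on U"
    by (rule holomorphic_on_integral_outer_kern[OF A B U]) (auto intro!: holomorphic_intros seg pinch_corners UW)
  moreover have "(\<lambda>W. contour_integral (linepath 0 1)
      (\<lambda>t. outer_kern A (turn B) W ((W + 1 - \<i> * pi) + t * (t0 - (W + 1 - \<i> * pi))) * (t0 - (W + 1 - \<i> * pi)))) holomorphic_on U"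
    by (rule holomorphic_on_integral_outer_kern[OF A tB U]) (auto intro!: holomorphic_intros seg pinch_corners UW)
  moreover have "(\<lambda>W. contour_integral (linepath 0 1)
      (\<lambda>t. kern A B W ((W + 1 + \<i> * pi) + t * ((W - 1) - (W + 1 + \<i> * pi))) * ((W - 1) - (W + 1 + \<i> * pi)))) holomorphic_on U"
  proof (rule holomorphic_on_integral_kern[OF A B U])
    fix W t assume "W \<in> U" "t \<in> closed_segment (0::complex) 1"
    then show "W + 1 + \<i> * pi + t * (W - 1 - (W + 1 + \<i> * pi)) \<in> S W"
      using affine_in_segment[of t "W + 1 + \<i> * pi" "W - 1"] segment_in_S(2)[OF UW(2), of W "W + 1 + \<i> * pi"]
        pinch_corners(1)[OF UW(1), of W] upper_gap_props(3)[of W] by auto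
  qed (auto intro!: holomorphic_intros UW)
  moreover have "(\<lambda>W. contour_integral (linepath 0 1)
      (\<lambda>t. kern A B W ((W - 1) + t * ((W + 1 - \<i> * pi) - (W - 1))) * ((W + 1 - \<i> * pi) - (W - 1)))) holomorphic_on U"
  proof (rule holomorphic_on_integral_kern[OF A B U])
    fix W t assume "W \<in> U" "t \<in> closed_segment (0::complex) 1"
    then show "W - 1 + t * (W + 1 - \<i> * pi - (W - 1)) \<in> S W"
      using affine_in_segment[of t "W - 1" "W + 1 - \<i> * pi"] segment_in_S(1)[OF UW(2), of W "W + 1 - \<i> * pi"]
        pinch_corners(2)[OF UW(1), of W] lower_gap_props(3)[of W] by auto
  qed (auto intro!: holomorphic_intros UW)
  ultimately have "(\<lambda>W. pinch A B s0 t0 W) holomorphic_on U"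
    unfolding pinch_def
    by (subst (1 2 3 4) contour_integral_linepath_unit) (intro holomorphic_intros)
  then show ?thesis by (simp add: U_def)
qed

text \<open>When s0 and t0 lie in the two gaps, the outer legs are inside the slit strip as well and
  the outer kernels coincide with \<open>kern\<close>, so one primitive serves the whole contour.
  This ties \<open>pinch\<close> to the original integral for W on the given side.\<close>

lemma pinch_eq_primitive:
  assumes N: "\<And>s. s \<in> S W \<Longrightarrow> (N has_field_derivative kern A B W s) (at s)" and W: "Re W < c - 3"
    and s0: "s0 \<in> upper_gap W" "Re W < Re s0" and t0: "t0 \<in> lower_gap W" "Re W < Re t0"
  shows "pinch A B s0 t0 W = N t0 - N s0"
proof -
  have W': "Re W < c - 2" using W by simp
  have R: "s0 \<in> R W" "t0 \<in> R W" using s0 t0 by (auto simp: upper_gap_def lower_gap_def outer_strip_def)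
  note c = pinch_corners[OF W]
  have N': "\<And>s. s \<in> S W \<Longrightarrow> (N has_field_derivative kern A B W s) (at s within S W)"
    using N by (rule has_field_derivative_at_within)
  have prim: "contour_integral (linepath x y) (kern A B W) = N y - N x" if "closed_segment x y \<subseteq> S W" for x y
    using contour_integral_linepath_primitive(1)[of "S W" N "kern A B W" x y] N' that by blast
  have seg1: "closed_segment s0 (W + 1 + \<i> * pi) \<subseteq> R W \<inter> upper_gap W"
    by (rule closed_segment_subset) (use R s0 c convex_R upper_gap_props in \<open>auto intro: convex_Int\<close>)
  have seg4: "closed_segment (W + 1 - \<i> * pi) t0 \<subseteq> R W \<inter> lower_gap W"
    by (rule closed_segment_subset) (use R t0 c convex_R lower_gap_props in \<open>auto intro: convex_Int\<close>)
  have "contour_integral (linepath s0 (W + 1 + \<i> * pi)) (outer_kern A B W)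
      = contour_integral (linepath s0 (W + 1 + \<i> * pi)) (kern A B W)"
    by (rule contour_integral_eq) (use seg1 in \<open>auto intro!: outer_kern_upper\<close>)
  also have "\<dots> = N (W + 1 + \<i> * pi) - N s0"
    by (rule prim, rule order_trans[OF seg1], rule order_trans[OF Int_lower2], rule upper_gap_props(3))
  finally have 1: "contour_integral (linepath s0 (W + 1 + \<i> * pi)) (outer_kern A B W) = N (W + 1 + \<i> * pi) - N s0" .
  have "contour_integral (linepath (W + 1 - \<i> * pi) t0) (outer_kern A (turn B) W)
      = contour_integral (linepath (W + 1 - \<i> * pi) t0) (kern A B W)"
    by (rule contour_integral_eq) (use seg4 in \<open>auto intro!: outer_kern_lower\<close>)
  also have "\<dots> = N t0 - N (W + 1 - \<i> * pi)"
    by (rule prim, rule order_trans[OF seg4], rule order_trans[OF Int_lower2], rule lower_gap_props(3))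
  finally have 4: "contour_integral (linepath (W + 1 - \<i> * pi) t0) (outer_kern A (turn B) W) = N t0 - N (W + 1 - \<i> * pi)" .
  have 2: "contour_integral (linepath (W + 1 + \<i> * pi) (W - 1)) (kern A B W) = N (W - 1) - N (W + 1 + \<i> * pi)"
    by (rule prim, rule segment_in_S(2)[OF W']) (use c upper_gap_props(3)[of W] in auto)
  have 3: "contour_integral (linepath (W - 1) (W + 1 - \<i> * pi)) (kern A B W) = N (W + 1 - \<i> * pi) - N (W - 1)"
    by (rule prim, rule segment_in_S(1)[OF W']) (use c lower_gap_props(3)[of W] in auto)
  show ?thesis unfolding pinch_def 1 2 3 4 by simp
qed

text \<open>A translation by 2 pi i turns the loop at W + 2 pi i into the loop at W with both
  factors turned, while the first leg grows by the piece from a to a + 2 pi i and the last one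
  starts at a instead of b. Expanding
  \<open>turn A * turn B = turn A * jump B + jump A * B + A * B\<close> leaves only terms with a
  jump, and s0, t0 drop out.\<close>

lemma pinch_monodromy:
  assumes A: "A holomorphic_on {s. Re s < c}" and B: "B holomorphic_on {s. Re s < c}"
    and W: "Re W < c - 3" and s0: "s0 \<in> R W" and t0: "t0 \<in> R W"
    and N1: "\<And>s. s \<in> S W \<Longrightarrow> (N1 has_field_derivative kern (turn A) (jump B) W s) (at s)"
    and N2: "\<And>s. s \<in> S W \<Longrightarrow> (N2 has_field_derivative kern (jump A) B W s) (at s)"
    and M: "\<And>s. s \<in> R W \<Longrightarrow> (M has_field_derivative outer_kern (jump A) (turn B) W s) (at s)"
  defines "a \<equiv> W + 1 + \<i> * pi" and "b \<equiv> W + 1 - \<i> * pi"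
  shows "pinch A B s0 t0 (W + 2 * of_real pi * \<i>) - pinch A B s0 t0 W =
    (M a - M b) - (N1 a - N1 b) - (N2 a - N2 b)"
proof -
  have W': "Re W < c - 2" using W by simp
  note c = pinch_corners[OF W, folded a_def b_def]
  have ba: "b + 2 * of_real pi * \<i> = a" by (simp add: a_def b_def)
  have tA: "turn A holomorphic_on {s. Re s < c}" and tB: "turn B holomorphic_on {s. Re s < c}"
    using holomorphic_on_Re_lt_shift A B by (simp_all add: turn_def[abs_def])
  obtain N where N: "\<And>s. s \<in> S W \<Longrightarrow> (N has_field_derivative kern A B W s) (at s)"
    using kern_primitive[OF A B W'] by blast
  obtain M0 where M0: "\<And>s. s \<in> R W \<Longrightarrow> (M0 has_field_derivative outer_kern A B W s) (at s)"
    using outer_kern_primitive[OF A B] by blast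
  obtain M1 where M1: "\<And>s. s \<in> R W \<Longrightarrow> (M1 has_field_derivative outer_kern A (turn B) W s) (at s)"
    using outer_kern_primitive[OF A tB] by blast
  have Nt: "((\<lambda>s. N1 s + N2 s + N s) has_field_derivative kern (turn A) (turn B) W s) (at s)" if "s \<in> S W" for s
    using DERIV_add[OF DERIV_add[OF N1[OF that] N2[OF that]] N[OF that]]
    by (rule DERIV_cong) (simp add: kern_def turn_def jump_def divide_inverse, algebra)
  have Mt: "((\<lambda>s. M s + M1 s) has_field_derivative outer_kern (turn A) (turn B) W s) (at s)" if "s \<in> R W" for s
    using DERIV_add[OF M[OF that] M1[OF that]]
    by (rule DERIV_cong) (simp add: outer_kern_def turn_def jump_def divide_inverse, algebra)
  note primS = contour_integral_linepath_primitive(1)[of "S W", OF has_field_derivative_at_within]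
  note primR = contour_integral_linepath_primitive(1)[of "R W", OF has_field_derivative_at_within]
  have segR: "closed_segment x y \<subseteq> R W" if "x \<in> R W" "y \<in> R W" for x y
    by (rule closed_segment_subset[OF that convex_R])
  have aS: "a \<in> S W" "b \<in> S W" using c upper_gap_props(3)[of W] lower_gap_props(3)[of W] by auto
  have aR: "a + 2 * of_real pi * \<i> \<in> R W" using c by (simp add: outer_strip_def)
  have "contour_integral (linepath s0 (a + 2 * of_real pi * \<i>)) (outer_kern A B W)
      - contour_integral (linepath s0 a) (outer_kern A B W)
      = contour_integral (linepath a (a + 2 * of_real pi * \<i>)) (outer_kern A B W)"
    using c s0 aR by (simp add: primR[OF M0] segR)
  also have "\<dots> = contour_integral (linepath (b + 2 * of_real pi * \<i>) (a + 2 * of_real pi * \<i>)) (outer_kern A B W)"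
    by (simp only: ba)
  \<comment> \<open>Here \<open>outer_partner\<close> moves along with s, so the shift turns both
    factors.\<close>
  also have "\<dots> = contour_integral (linepath b a) (outer_kern (turn A) (turn B) W)"
    unfolding contour_integral_linepath_translate
    by (rule arg_cong[of _ _ "contour_integral (linepath b a)"]) (simp add: outer_kern_def turn_def fun_eq_iff)
  also have "\<dots> = M a + M1 a - (M b + M1 b)"
    using c by (simp add: primR[OF Mt] segR)
  finally have 1: "contour_integral (linepath s0 (a + 2 * of_real pi * \<i>)) (outer_kern A B W)
      = contour_integral (linepath s0 a) (outer_kern A B W) + (M a + M1 a - (M b + M1 b))" by (simp add: algebra_simps)
  have kt: "(\<lambda>s. kern A B (W + 2 * of_real pi * \<i>) (s + 2 * of_real pi * \<i>)) = kern (turn A) (turn B) W"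
    by (simp add: kern_def turn_def fun_eq_iff)
  have ot: "outer_kern A B' (W + 2 * of_real pi * \<i>) = outer_kern A B' W" for B'
    by (simp add: outer_kern_def fun_eq_iff)
  have seg: "closed_segment a (W - 1) \<subseteq> S W" "closed_segment (W - 1) b \<subseteq> S W"
    using segment_in_S[OF W'] aS by auto
  have "pinch A B s0 t0 (W + 2 * of_real pi * \<i>) =
      contour_integral (linepath s0 (a + 2 * of_real pi * \<i>)) (outer_kern A B W)
    + contour_integral (linepath (a + 2 * of_real pi * \<i>) (W - 1 + 2 * of_real pi * \<i>)) (kern A B (W + 2 * of_real pi * \<i>))
    + contour_integral (linepath (W - 1 + 2 * of_real pi * \<i>) (b + 2 * of_real pi * \<i>)) (kern A B (W + 2 * of_real pi * \<i>))
    + contour_integral (linepath a t0) (outer_kern A (turn B) W)"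
    unfolding pinch_def ot a_def b_def by (simp add: algebra_simps)
  also have "\<dots> = contour_integral (linepath s0 a) (outer_kern A B W) + (M a + M1 a - (M b + M1 b))
    + ((N1 b + N2 b + N b) - (N1 a + N2 a + N a)) + (M1 t0 - M1 a)"
    unfolding 1 contour_integral_linepath_translate kt
    using seg c t0 by (simp add: primS[OF Nt] primR[OF M1] segR)
  finally have 2: "pinch A B s0 t0 (W + 2 * of_real pi * \<i>) =
      contour_integral (linepath s0 a) (outer_kern A B W) + (M a + M1 a - (M b + M1 b))
    + ((N1 b + N2 b + N b) - (N1 a + N2 a + N a)) + (M1 t0 - M1 a)" .
  have 3: "pinch A B s0 t0 W = contour_integral (linepath s0 a) (outer_kern A B W) + (N b - N a) + (M1 t0 - M1 b)"
    unfolding pinch_def a_def[symmetric] b_def[symmetric]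
    using seg c t0 by (simp add: primS[OF N] primR[OF M1] segR)
  show ?thesis unfolding 2 3 by (simp add: algebra_simps)
qed

end

section \<open>Behaviour of the convolution integrand at both ends\<close>

lemma primitive_bound_segment:
  assumes "\<And>s. s \<in> X \<Longrightarrow> (N has_field_derivative f s) (at s)" "closed_segment x y \<subseteq> X"
    and "\<And>s. s \<in> closed_segment x y \<Longrightarrow> norm (f s) \<le> K"
  shows "norm (N y - N x :: complex) \<le> K * norm (y - x)"
  by (rule field_differentiable_bound[of "closed_segment x y" N f K y x])
    (use assms in \<open>auto intro: has_field_derivative_at_within\<close>)

text \<open>Just the derivative of exp at 0; it makes |e^W - e^s| comparable with |s - W|.\<close>

lemma exp_minus_one_comparable:
  obtains r where "0 < r" "\<And>v::complex. norm v < r \<Longrightarrow> norm v / 2 \<le> norm (exp v - 1) \<and> norm (exp v - 1) \<le> 2 * norm v"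
proof -
  have "((\<lambda>v. (exp v - 1) / v) \<longlongrightarrow> (1::complex)) (at 0)"
    using DERIV_exp[of "0::complex"] by (simp add: has_field_derivative_iff)
  then have "\<forall>\<^sub>F v in at (0::complex). dist ((exp v - 1) / v) 1 < 1 / 2"
    by (rule tendstoD) simp
  then obtain r where r: "0 < r" "\<And>v::complex. v \<noteq> 0 \<Longrightarrow> norm v < r \<Longrightarrow> dist ((exp v - 1) / v) 1 < 1 / 2"
    by (auto simp: eventually_at)
  show thesis
  proof (rule that[OF r(1)])
    fix v :: complex assume v: "norm v < r"
    show "norm v / 2 \<le> norm (exp v - 1) \<and> norm (exp v - 1) \<le> 2 * norm v"
    proof (cases "v = 0")
      case False
      define q where "q = (exp v - 1) / v"
      have "norm (q - 1) < 1 / 2" using r(2)[OF False v] by (simp add: q_def dist_norm)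
      then have q: "1 / 2 \<le> norm q" "norm q \<le> 2"
        using norm_triangle_ineq2[of 1 "1 - q"] norm_triangle_ineq[of "q - 1" 1] by (auto simp: norm_minus_commute)
      have "norm (exp v - 1) = norm q * norm v" using False by (simp add: q_def norm_divide)
      then show ?thesis using mult_right_mono[OF q(1), of "norm v"] mult_right_mono[OF q(2), of "norm v"] by simp
    qed simp
  qed
qed

context scale
begin

text \<open>The end u -> \<alpha>: the partner stays within distance 2 of W, where B is bounded, so
  the decay of e^s A(s) decides.\<close>

lemma kern_small_at_left_end:
  assumes A: "integrable_branch c A" and B: "B holomorphic_on {s. Re s < c}" and W: "Re W < c - 3" and e: "0 < e"
  obtains r where "r \<le> Re W" "\<And>s. Re s < r \<Longrightarrow> \<bar>Im s\<bar> \<le> M \<Longrightarrow> norm (kern A B W s) \<le> e"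
proof -
  have near: "partner W s \<in> cball W 2" if s: "Re s < Re W - 1" for s
  proof -
    have "(2::real) < exp 1" using exp_ge_add_one_self[of "1::real"] e_approx_32 by (auto simp: abs_if split: if_splits)
    then have "exp (-1 :: real) < 1 / 2" by (simp add: exp_minus field_simps)
    then have x: "norm (exp (s - W)) < 1 / 2" using s exp_less_mono[of "Re s - Re W" "-1"]
      by (simp only: norm_exp_eq_Re minus_complex.sel) linarith
    have "norm (Ln (1 - exp (s - W))) \<le> 1" using norm_Ln_le[of "- exp (s - W)"] x by simp
    moreover have "norm (exp s) < 1 / 8" by (rule norm_exp_small) (use s W in simp)
    then have "norm (Ln (1 + exp s)) \<le> 1" using norm_Ln_le[of "exp s"] by simp
    ultimately have "norm (Ln (1 - exp (s - W)) - Ln (1 + exp s)) \<le> 2"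
      using norm_triangle_ineq4[of "Ln (1 - exp (s - W))" "Ln (1 + exp s)"] by linarith
    then show ?thesis by (simp add: partner_def dist_norm norm_minus_commute algebra_simps)
  qed
  have "cball W 2 \<subseteq> {s. Re s < c}"
  proof
    fix s assume "s \<in> cball W 2"
    then have "\<bar>Re (s - W)\<bar> \<le> 2" using abs_Re_le_cmod[of "s - W"] by (simp add: dist_norm norm_minus_commute)
    then show "s \<in> {s. Re s < c}" using W by simp
  qed
  then have "compact (B ` cball W 2)"
    by (intro compact_continuous_image holomorphic_on_imp_continuous_on holomorphic_on_subset[OF B]) auto
  then obtain K where K: "0 < K" "\<And>s. s \<in> cball W 2 \<Longrightarrow> norm (B s) \<le> K"
    by (metis bounded_pos compact_imp_bounded imageI)
  obtain R0 where R0: "\<And>s. Re s < R0 \<Longrightarrow> \<bar>Im s\<bar> \<le> M \<Longrightarrow> norm (exp s * A s) \<le> e / (2 * K)"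
    using integrable_branch_decay[OF A, of "e / (2 * K)"] e K by (metis divide_pos_pos mult_pos_pos zero_less_numeral)
  show thesis
  proof (rule that[of "min R0 (Re W - 1)"])
    fix s assume s: "Re s < min R0 (Re W - 1)" "\<bar>Im s\<bar> \<le> M"
    have "norm (kern A B W s) = norm (exp s * A s) * norm (B (partner W s)) / norm (1 + exp s)"
      by (simp add: kern_def norm_mult norm_divide)
    also have "\<dots> \<le> norm (exp s * A s) * norm (B (partner W s)) / (7 / 8)"
      by (rule divide_left_mono) (use one_plus_exp[of s] s W in \<open>auto intro!: mult_pos_pos\<close>)
    also have "\<dots> \<le> (e / (2 * K)) * K / (7 / 8)"
      by (intro divide_right_mono mult_mono) (use R0[of s] K(2)[OF near[of s]] s K e in auto)
    also have "\<dots> \<le> e" using K e by simp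
    finally show "norm (kern A B W s) \<le> e" .
  qed auto
qed

text \<open>The end u -> z/\<beta>: |e^t| is comparable with |s - W|, so e^t B(t) -> 0 makes B(t) =
  o(1/h), which beats the perimeter of a square of half side h about W. The range from h to 2h
  contains the boundary of that square. Allowing every logarithm t of the quotient covers
  \<open>partner\<close> and \<open>outer_partner\<close> at once.\<close>

lemma integrand_small_at_right_end:
  assumes A: "A holomorphic_on {s. Re s < c}" and B: "integrable_branch c B" and W: "Re W < c - 3" and e: "0 < e"
  shows "\<forall>\<^sub>F h in at_right 0. \<forall>s t. h \<le> norm (s - W) \<longrightarrow> norm (s - W) \<le> 2 * h \<longrightarrow>
    exp t = (exp W - exp s) / (1 + exp s) \<longrightarrow> \<bar>Im t\<bar> \<le> M \<longrightarrow> norm (A s * B t * (exp s / (1 + exp s))) \<le> e / h"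
proof -
  obtain r where r: "0 < r" "\<And>v::complex. norm v < r \<Longrightarrow> norm v / 2 \<le> norm (exp v - 1) \<and> norm (exp v - 1) \<le> 2 * norm v"
    using exp_minus_one_comparable by blast
  have "cball W 1 \<subseteq> {s. Re s < c - 2}"
  proof
    fix s assume "s \<in> cball W 1"
    then have "\<bar>Re (s - W)\<bar> \<le> 1" using abs_Re_le_cmod[of "s - W"] by (simp add: dist_norm norm_minus_commute)
    then show "s \<in> {s. Re s < c - 2}" using W by simp
  qed
  then have sub: "\<And>s. s \<in> cball W 1 \<Longrightarrow> Re s < c - 2" by blast
  have "compact (A ` cball W 1)"
    by (intro compact_continuous_image holomorphic_on_imp_continuous_on holomorphic_on_subset[OF A]) (use sub in force)+
  then obtain K where K: "0 < K" "\<And>s. s \<in> cball W 1 \<Longrightarrow> norm (A s) \<le> K"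
    by (metis bounded_pos compact_imp_bounded imageI)
  \<comment> \<open>From |exp (s - W) - 1| \<ge> h/2 and |1 + e^s| \<le> 2, which give |e^t| \<ge> k
    h.\<close>
  define k where "k = norm (exp W) / 4"
  have k: "0 < k" by (simp add: k_def)
  obtain R0 where R0: "\<And>s. Re s < R0 \<Longrightarrow> \<bar>Im s\<bar> \<le> M \<Longrightarrow> norm (exp s * B s) \<le> e * k / K"
    using integrable_branch_decay[OF B, of "e * k / K"] e K k by (metis divide_pos_pos mult_pos_pos)
  have "\<forall>\<^sub>F h in at_right 0. 2 * h < min (min 1 r) (exp R0 / (norm (exp W) * 4)) \<and> 0 < h"
  proof (rule eventually_conj)
    have "((\<lambda>h::real. 2 * h) \<longlongrightarrow> 2 * 0) (at_right 0)" by (intro tendsto_intros)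
    then show "\<forall>\<^sub>F h in at_right 0. 2 * h < min (min 1 r) (exp R0 / (norm (exp W) * 4))"
      by (rule order_tendstoD(2)) (use r in auto)
    show "\<forall>\<^sub>F h in at_right 0. (0::real) < h" by (simp add: eventually_at_right_less)
  qed
  then show ?thesis
  proof (eventually_elim, intro allI impI)
    fix h s t assume h: "2 * h < min (min 1 r) (exp R0 / (norm (exp W) * 4)) \<and> 0 < h"
      and s: "h \<le> norm (s - W)" "norm (s - W) \<le> 2 * h"
      and t: "exp t = (exp W - exp s) / (1 + exp s)" "\<bar>Im t\<bar> \<le> M"
    have sb: "s \<in> cball W 1" using s h by (simp add: dist_norm norm_minus_commute)
    note rs = sub[OF sb]
    have "exp W - exp s = - exp W * (exp (s - W) - 1)" by (simp add: exp_diff field_simps)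
    then have nt: "norm (exp t) = norm (exp W) * norm (exp (s - W) - 1) / norm (1 + exp s)"
      by (simp add: t(1) norm_divide norm_mult)
    have v: "norm (s - W) / 2 \<le> norm (exp (s - W) - 1)" "norm (exp (s - W) - 1) \<le> 2 * norm (s - W)"
      using r(2)[of "s - W"] s h by auto
    have "norm (exp t) \<ge> norm (exp W) * (h / 2) / 2"
      unfolding nt by (intro frac_le mult_left_mono) (use v s h one_plus_exp[OF rs] in auto)
    then have low: "k * h \<le> norm (exp t)" by (simp add: k_def)
    have "norm (exp t) \<le> norm (exp W) * (4 * h) / (1 / 2)"
      unfolding nt by (intro frac_le mult_left_mono) (use v s h one_plus_exp[OF rs] in auto)
    also have "\<dots> < exp R0" using h by (simp add: field_simps)
    finally have "Re t < R0" by simp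
    then have "norm (exp t * B t) \<le> e * k / K" using R0 t(2) by blast
    then have "k * h * norm (B t) \<le> e * k / K"
      using mult_right_mono[OF low norm_ge_zero[of "B t"]] by (simp add: norm_mult)
    then have Bt: "norm (B t) \<le> e / (K * h)" using k h K by (simp add: field_simps)
    have "norm (exp s) < 1 / 8" by (rule norm_exp_small[OF rs])
    then have q: "norm (exp s / (1 + exp s)) \<le> 1"
      using one_plus_exp[OF rs] by (simp add: norm_divide divide_le_eq_1)
    have "norm (A s * B t * (exp s / (1 + exp s))) \<le> K * (e / (K * h)) * 1"
      unfolding norm_mult by (intro mult_mono Bt q K(2)[OF sb]) (use K e h in auto)
    also have "\<dots> = e / h" using K by simp
    finally show "norm (A s * B t * (exp s / (1 + exp s))) \<le> e / h" .
  qed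
qed

end

text \<open>The convolution integrand of the jumps under s = W + ln t: for t from 0 to 1 the point u
  = \<alpha>(1 + t e^W) runs through the segment from \<alpha> to z/\<beta>, and du/u = e^W dt / (1
  + t e^W).\<close>

definition conv_density :: "(complex \<Rightarrow> complex) \<Rightarrow> (complex \<Rightarrow> complex) \<Rightarrow> complex \<Rightarrow> real \<Rightarrow> complex" where
  "conv_density A B W t =
     jump A (W + of_real (ln t)) * jump B (partner W (W + of_real (ln t))) * (exp W / (1 + of_real t * exp W))"

context scale
begin

text \<open>On the upper gap Z(s) and N(s) - N(s - 2 pi i) have the same derivative, because the
  values of \<open>turn A\<close> at s and s - 2 pi i differ by \<open>jump A\<close>. Far to the
  left this difference is an integral over a vertical segment of length 2 pi and tends to 0 with the
  kernel, so the limit exists and can be read off at the corner a.\<close>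

lemma conv_primitive_left_end:
  assumes A: "integrable_branch c A" and B: "integrable_branch c B" and W: "Re W < c - 3"
    and Z: "\<And>s. s \<in> S W \<Longrightarrow> (Z has_field_derivative kern (jump A) (jump B) W s) (at s)"
    and N: "\<And>s. s \<in> S W \<Longrightarrow> (N has_field_derivative kern (turn A) (jump B) W s) (at s)"
  defines "a \<equiv> W + 1 + \<i> * pi" and "b \<equiv> W + 1 - \<i> * pi"
  shows "((\<lambda>t. Z (W + of_real (ln t))) \<longlongrightarrow> Z a - (N a - N b)) (at_right 0)"
proof (rule tendstoI)
  fix e :: real assume e: "0 < e"
  note c = pinch_corners[OF W, folded a_def b_def]
  have ab: "a - 2 * of_real pi * \<i> = b" by (simp add: a_def b_def)
  have jB: "jump B holomorphic_on {s. Re s < c}" 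
    using integrable_branch_jump[OF B] by (rule integrable_branch_holo)
  define M where "M = \<bar>Im W\<bar> + pi"
  obtain r1 where r1: "r1 \<le> Re W" "\<And>s. Re s < r1 \<Longrightarrow> \<bar>Im s\<bar> \<le> M \<Longrightarrow> norm (kern (turn A) (jump B) W s) \<le> e / 20"
    using kern_small_at_left_end[OF integrable_branch_turn[OF A] jB W, of "e / 20"] e by auto
  obtain r2 where r2: "r2 \<le> Re W" "\<And>s. Re s < r2 \<Longrightarrow> \<bar>Im s\<bar> \<le> M \<Longrightarrow> norm (kern (jump A) (jump B) W s) \<le> e / 20"
    using kern_small_at_left_end[OF integrable_branch_jump[OF A] jB W, of "e / 20"] e by auto
  have "\<forall>\<^sub>F t in at_right 0. ln t < min r1 r2 - Re W"
    using ln_at_0 by (auto simp: filterlim_at_bot_dense)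
  then show "\<forall>\<^sub>F t in at_right 0. dist (Z (W + of_real (ln t))) (Z a - (N a - N b)) < e"
  proof eventually_elim
    case (elim t)
    define s where "s = W + of_real (ln t)"
    \<comment> \<open>The point s lies on the line through W, outside of the gap; p lies in the gap,
      and p - 2 pi i is again at distance pi from s.\<close>
    define p where "p = s + \<i> * pi"
    define q where "q = s - \<i> * pi"
    have Re: "Re s < r1" "Re s < r2" "Re s < Re W" and Im: "Im s = Im W"
      using elim r1(1) by (auto simp: s_def)
    have pq: "p - 2 * of_real pi * \<i> = q" by (simp add: p_def q_def)
    have gap: "p \<in> upper_gap W" using Re W by (simp add: p_def upper_gap_def Im)
    have "Z p - Z a = (N p - N (p - 2 * of_real pi * \<i>)) - (N a - N (a - 2 * of_real pi * \<i>))"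
    proof (rule primitives_differ_constant[where M = "\<lambda>s. N s - N (s - 2 * of_real pi * \<i>)" and f = "kern (jump A) (jump B) W",
          OF convex_connected _ gap c(1)])
      fix u assume u: "u \<in> upper_gap W"
      show "(Z has_field_derivative kern (jump A) (jump B) W u) (at u)"
        using Z u upper_gap_props(3)[of W] by auto
      have "u - 2 * of_real pi * \<i> \<in> S W" using u by (simp add: upper_gap_def slit_strip_def)
      then have "((\<lambda>s. N (s - 2 * of_real pi * \<i>)) has_field_derivative
          kern (turn A) (jump B) W (u - 2 * of_real pi * \<i>) * 1) (at u)"
        by (intro DERIV_chain2[OF N]) (auto intro!: derivative_eq_intros)
      moreover have "(N has_field_derivative kern (turn A) (jump B) W u) (at u)"
        using N u upper_gap_props(3)[of W] by auto
      ultimately have D: "((\<lambda>s. N s - N (s - 2 * of_real pi * \<i>)) has_field_derivative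
          kern (turn A) (jump B) W u - kern (turn A) (jump B) W (u - 2 * of_real pi * \<i>) * 1) (at u)"
        by (intro DERIV_diff)
      have "exp (u - 2 * of_real pi * \<i>) = exp u" by (simp add: exp_diff)
      then have "kern (turn A) (jump B) W (u - 2 * of_real pi * \<i>) = A u * jump B (partner W u) * (exp u / (1 + exp u))"
        by (simp add: kern_def turn_def)
      moreover have "jump A u = turn A u - A u" by (simp add: jump_def turn_def)
      ultimately have "kern (turn A) (jump B) W u - kern (turn A) (jump B) W (u - 2 * of_real pi * \<i>) * 1 = kern (jump A) (jump B) W u"
        by (simp add: kern_def left_diff_distrib diff_divide_distrib)
      with D show "((\<lambda>s. N s - N (s - 2 * of_real pi * \<i>)) has_field_derivative kern (jump A) (jump B) W u) (at u)"
        by simp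
    qed (use upper_gap_props in auto)
    then have Zp: "Z p - Z a = (N p - N q) - (N a - N b)" by (simp only: pq ab)
    have same_Re: "Re u = Re s \<and> \<bar>Im u - Im W\<bar> \<le> pi" if "u \<in> closed_segment q p \<or> u \<in> closed_segment s p" for u
      using that pi_gt_zero by (auto simp: closed_segment_same_Re p_def q_def Im closed_segment_eq_real_ivl)
    have in_S: "u \<in> S W" and small: "norm (kern (turn A) (jump B) W u) \<le> e / 20"
        "norm (kern (jump A) (jump B) W u) \<le> e / 20"
      if "u \<in> closed_segment q p \<or> u \<in> closed_segment s p" for u
    proof -
      have u: "Re u = Re s" "\<bar>Im u - Im W\<bar> \<le> pi" using same_Re[OF that] by auto
      have "\<bar>Im u - Im W\<bar> < 2 * pi" using u(2) pi_gt_zero by linarith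
      then show "u \<in> S W" using u Re W unfolding slit_strip_def by auto
      have "\<bar>Im u\<bar> \<le> M" using u(2) unfolding M_def by linarith
      then show "norm (kern (turn A) (jump B) W u) \<le> e / 20" "norm (kern (jump A) (jump B) W u) \<le> e / 20"
        using u Re r1(2)[of u] r2(2)[of u] by auto
    qed
    have pi4: "pi \<le> 4" using pi_less_4 by simp
    have "norm (N p - N q) \<le> e / 20 * norm (p - q)"
      by (rule primitive_bound_segment[OF N]) (use in_S small in auto)
    also have "\<dots> = e / 20 * (2 * pi)" by (simp add: p_def q_def norm_mult)
    also have "\<dots> \<le> e / 20 * 8" by (rule mult_left_mono) (use pi4 e in auto)
    finally have 1: "norm (N p - N q) \<le> e / 20 * 8" .
    have "norm (Z p - Z s) \<le> e / 20 * norm (p - s)"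
      by (rule primitive_bound_segment[OF Z]) (use in_S small in auto)
    also have "\<dots> = e / 20 * pi" by (simp add: p_def norm_mult)
    also have "\<dots> \<le> e / 20 * 4" by (rule mult_left_mono) (use pi4 e in auto)
    finally have 2: "norm (Z p - Z s) \<le> e / 20 * 4" .
    have eq: "Z s - (Z a - (N a - N b)) = (N p - N q) - (Z p - Z s)" using Zp by (simp add: algebra_simps)
    have "norm (Z s - (Z a - (N a - N b))) \<le> e / 20 * 8 + e / 20 * 4"
      unfolding eq using norm_triangle_ineq4[of "N p - N q" "Z p - Z s"] 1 2 by linarith
    then show ?case using e by (simp add: dist_norm s_def)
  qed
qed

text \<open>Walk once around W on a small square. On its right side, where the slit strip is cut, M
  is the primitive: in the upper gap its kernel exceeds that of N by the kernel of Z, in the lower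
  gap it equals that of N. The perimeter is O(h) and the kernels are o(1/h) on it, so the walk
  contributes nothing in the limit and only the stated constant remains.\<close>

lemma conv_primitive_right_end:
  assumes A: "integrable_branch c A" and B: "integrable_branch c B" and W: "Re W < c - 3"
    and Z: "\<And>s. s \<in> S W \<Longrightarrow> (Z has_field_derivative kern (jump A) (jump B) W s) (at s)"
    and N: "\<And>s. s \<in> S W \<Longrightarrow> (N has_field_derivative kern (jump A) B W s) (at s)"
    and M: "\<And>s. s \<in> R W \<Longrightarrow> (M has_field_derivative outer_kern (jump A) (turn B) W s) (at s)"
  defines "a \<equiv> W + 1 + \<i> * pi" and "b \<equiv> W + 1 - \<i> * pi"
  shows "((\<lambda>t. Z (W + of_real (ln t))) \<longlongrightarrow> Z a - ((M a - M b) - (N a - N b))) (at_left 1)"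
proof -
  note c = pinch_corners[OF W, folded a_def b_def]
  have jA: "jump A holomorphic_on {s. Re s < c}"
    using integrable_branch_jump[OF A] by (rule integrable_branch_holo)
  define L where "L = Z a - ((M a - M b) - (N a - N b))"
  have "((\<lambda>h. Z (W - of_real h)) \<longlongrightarrow> L) (at_right 0)"
  proof (rule tendstoI)
    fix e :: real assume e: "0 < e"
    \<comment> \<open>Dominates |Im| of both logarithms, which is at most |Im W| + 1 + 3 pi, with
      room to spare.\<close>
    define m where "m = \<bar>Im W\<bar> + 21"
    have e': "0 < e / 20" using e by simp
    have "\<forall>\<^sub>F h in at_right (0::real). h < 1 / 2 \<and> 0 < h"
      by (intro eventually_conj eventually_at_right_less eventually_at_right_real[of 0 "1/2", THEN eventually_mono]) auto
    then show "\<forall>\<^sub>F h in at_right 0. dist (Z (W - of_real h)) L < e"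
      using integrand_small_at_right_end[OF jA B W e', of m]
        integrand_small_at_right_end[OF jA integrable_branch_jump[OF B] W e', of m]
        integrand_small_at_right_end[OF jA integrable_branch_turn[OF B] W e', of m]
    proof eventually_elim
      case (elim h)
      then have h: "0 < h" "h < 1 / 2" by auto
      define sq where "sq s \<longleftrightarrow> \<bar>Re s - Re W\<bar> \<le> h \<and> \<bar>Im s - Im W\<bar> \<le> h \<and> (\<bar>Re s - Re W\<bar> = h \<or> \<bar>Im s - Im W\<bar> = h)" for s
      have sq: "h \<le> norm (s - W)" "norm (s - W) \<le> 2 * h" "Re s < c - 2" "\<bar>Im s\<bar> \<le> \<bar>Im W\<bar> + 1" if "sq s" for s
      proof -
        have *: "\<bar>Re s - Re W\<bar> \<le> h" "\<bar>Im s - Im W\<bar> \<le> h" "\<bar>Re s - Re W\<bar> = h \<or> \<bar>Im s - Im W\<bar> = h"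
          using that by (auto simp: sq_def)
        show "h \<le> norm (s - W)" "norm (s - W) \<le> 2 * h"
          using * abs_Re_le_cmod[of "s - W"] abs_Im_le_cmod[of "s - W"] cmod_le[of "s - W"] by auto
        show "Re s < c - 2" "\<bar>Im s\<bar> \<le> \<bar>Im W\<bar> + 1" using *(1,2) h W by linarith+
      qed
      have Ln_bound: "\<bar>Im (Ln z)\<bar> \<le> pi" if "z \<noteq> 0" for z
        using mpi_less_Im_Ln[OF that] Im_Ln_le_pi[OF that] by simp
      have Kbound: "norm (kern (jump A) B W s) \<le> e / 20 / h" "norm (kern (jump A) (jump B) W s) \<le> e / 20 / h"
        if "sq s" "s \<in> S W" for s
      proof -
        have nz: "1 - exp (s - W) \<noteq> 0" "1 + exp s \<noteq> 0" using slit_not_nonpos[OF that(2)] one_plus_exp[OF sq(3)[OF that(1)]] by auto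
        have E: "exp (partner W s) = (exp W - exp s) / (1 + exp s)"
          by (rule exp_partner[OF slit_not_nonpos[OF that(2)] sq(3)[OF that(1)]])
        have "\<bar>Im (partner W s)\<bar> \<le> \<bar>Im W\<bar> + pi + pi"
          using Ln_bound[OF nz(1)] Ln_bound[OF nz(2)] by (simp add: partner_def)
        then have I: "\<bar>Im (partner W s)\<bar> \<le> m" using pi_less_4 by (simp add: m_def)
        show "norm (kern (jump A) B W s) \<le> e / 20 / h" "norm (kern (jump A) (jump B) W s) \<le> e / 20 / h"
          using elim(2,3) sq[OF that(1)] E I by (auto simp: kern_def)
      qed
      have Obound: "norm (outer_kern (jump A) (turn B) W s) \<le> e / 20 / h" if "sq s" "s \<in> R W" for s
      proof -
        have s: "Re W < Re s" "Re s < c - 2" using that(2) by (auto simp: outer_strip_def)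
        have nz: "1 - exp (W - s) \<noteq> 0" "1 + exp s \<noteq> 0" using inner_not_nonpos[OF s(1)] one_plus_exp[OF s(2)] by auto
        have E: "exp (outer_partner W s) = (exp W - exp s) / (1 + exp s)"
          by (rule exp_outer_partner[OF s])
        have "\<bar>Im (outer_partner W s)\<bar> \<le> \<bar>Im s\<bar> + pi + pi + pi"
          using Ln_bound[OF nz(1)] Ln_bound[OF nz(2)] by (simp add: outer_partner_def)
        then have I: "\<bar>Im (outer_partner W s)\<bar> \<le> m" using pi_less_4 sq(4)[OF that(1)] by (simp add: m_def)
        show ?thesis
          using elim(4) sq[OF that(1)] E I by (auto simp: outer_kern_def)
      qed
      \<comment> \<open>The corners, counterclockwise from the upper right; p0 is the middle of the
        left side and lies on the path W + ln t.\<close>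
      define p1 where "p1 = W + of_real h + \<i> * h"
      define p2 where "p2 = W - of_real h + \<i> * h"
      define p3 where "p3 = W - of_real h - \<i> * h"
      define p4 where "p4 = W + of_real h - \<i> * h"
      define p0 where "p0 = W - of_real h"
      have R: "p1 \<in> R W" "p4 \<in> R W" and gaps: "p1 \<in> upper_gap W" "p4 \<in> lower_gap W"
        using h W pi_gt3 by (auto simp: p1_def p4_def outer_strip_def upper_gap_def lower_gap_def)
      have up: "M p1 - N p1 - (M a - N a) = Z p1 - Z a"
      proof (rule primitives_differ_constant[of "R W \<inter> upper_gap W" p1 a "\<lambda>s. M s - N s" "kern (jump A) (jump B) W" Z])
        fix u assume u: "u \<in> R W \<inter> upper_gap W"
        then have uS: "u \<in> S W" using upper_gap_props(3)[of W] by auto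
        show "(Z has_field_derivative kern (jump A) (jump B) W u) (at u)" by (rule Z[OF uS])
        have "outer_kern (jump A) (turn B) W u = kern (jump A) (turn B) W u" using u by (intro outer_kern_upper) auto
        moreover have "jump B (partner W u) = turn B (partner W u) - B (partner W u)"
          by (simp add: jump_def turn_def)
        ultimately have "outer_kern (jump A) (turn B) W u - kern (jump A) B W u = kern (jump A) (jump B) W u"
          by (simp add: kern_def left_diff_distrib right_diff_distrib diff_divide_distrib)
        then show "((\<lambda>s. M s - N s) has_field_derivative kern (jump A) (jump B) W u) (at u)"
          using DERIV_diff[OF M[of u] N[OF uS]] u by simp
      qed (use R gaps c upper_gap_props[of W] open_R convex_R in \<open>auto intro!: convex_connected convex_Int\<close>)
      have low: "M p4 - N p4 - (M b - N b) = 0 - (0::complex)"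
      proof (rule primitives_differ_constant[of "R W \<inter> lower_gap W" p4 b "\<lambda>s. M s - N s" "\<lambda>_. 0" "\<lambda>_. 0"])
        fix u assume u: "u \<in> R W \<inter> lower_gap W"
        then have uS: "u \<in> S W" using lower_gap_props(3)[of W] by auto
        have "outer_kern (jump A) (turn B) W u = kern (jump A) B W u" using u by (intro outer_kern_lower) auto
        then show "((\<lambda>s. M s - N s) has_field_derivative 0) (at u)"
          using DERIV_diff[OF M[of u] N[OF uS]] u by simp
      qed (use R gaps c lower_gap_props[of W] open_R convex_R in \<open>auto intro!: convex_connected convex_Int\<close>)
      have seg: "sq u \<and> u \<in> R W" if "u \<in> closed_segment p4 p1" for u
        using that h W by (auto simp: closed_segment_same_Re p1_def p4_def closed_segment_eq_real_ivl sq_def outer_strip_def)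
      have segS: "sq u \<and> u \<in> S W"
        if "u \<in> closed_segment p4 p3 \<or> u \<in> closed_segment p3 p2 \<or> u \<in> closed_segment p2 p1 \<or> u \<in> closed_segment p2 p0" for u
        using that h W pi_gt3
        by (auto simp: closed_segment_same_Re closed_segment_same_Im p0_def p1_def p2_def p3_def p4_def
            closed_segment_eq_real_ivl sq_def slit_strip_def split: if_splits)
      have sq4: "sqrt (4 * h\<^sup>2) = 2 * h" using h by (simp add: real_sqrt_mult)
      have len: "norm (p1 - p4) = 2 * h" "norm (p3 - p4) = 2 * h" "norm (p2 - p3) = 2 * h" "norm (p1 - p2) = 2 * h"
          "norm (p0 - p2) = h"
        using h by (auto simp: p0_def p1_def p2_def p3_def p4_def cmod_def sq4)
      have simp2: "e / 20 / h * (2 * h) = e / 10" "e / 20 / h * h = e / 20" using h by auto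
      have b1: "norm (M p1 - M p4) \<le> e / 20 / h * norm (p1 - p4)"
        by (rule primitive_bound_segment[OF M]) (use seg Obound in auto)
      have b2: "norm (N p3 - N p4) \<le> e / 20 / h * norm (p3 - p4)"
        by (rule primitive_bound_segment[OF N]) (use segS Kbound in auto)
      have b3: "norm (N p2 - N p3) \<le> e / 20 / h * norm (p2 - p3)"
        by (rule primitive_bound_segment[OF N]) (use segS Kbound in auto)
      have b4: "norm (N p1 - N p2) \<le> e / 20 / h * norm (p1 - p2)"
        by (rule primitive_bound_segment[OF N]) (use segS Kbound in auto)
      have b5: "norm (Z p1 - Z p2) \<le> e / 20 / h * norm (p1 - p2)"
        by (rule primitive_bound_segment[OF Z]) (use segS Kbound in auto)
      have b6: "norm (Z p0 - Z p2) \<le> e / 20 / h * norm (p0 - p2)"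
        by (rule primitive_bound_segment[OF Z]) (use segS Kbound in auto)
      note b = b1[unfolded len simp2] b2[unfolded len simp2] b3[unfolded len simp2] b4[unfolded len simp2]
        b5[unfolded len simp2] b6[unfolded len simp2]
      have up': "Z p1 = (M p1 - N p1 - (M a - N a)) + Z a" using up[symmetric] by (simp only: diff_eq_eq)
      have low': "M p4 = N p4 + M b - N b" using low by (simp add: algebra_simps)
      have eq: "Z p0 - L = (Z p0 - Z p2) - (Z p1 - Z p2) + (M p1 - M p4) - (N p3 - N p4) - (N p2 - N p3) - (N p1 - N p2)"
        unfolding L_def up' low' by simp
      have "norm (Z p0 - L) \<le> norm (Z p0 - Z p2) + norm (Z p1 - Z p2) + norm (M p1 - M p4)
          + norm (N p3 - N p4) + norm (N p2 - N p3) + norm (N p1 - N p2)"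
        unfolding eq by (intro norm_triangle_le_diff norm_triangle_le add_mono order_refl)
      then have "norm (Z p0 - L) < e" using b e by linarith
      then show "dist (Z (W - of_real h)) L < e" by (simp only: dist_norm p0_def)
    qed
  qed
  moreover have "filterlim (\<lambda>t::real. - ln t) (at_right 0) (at_left 1)"
  proof (rule filterlim_at_withinI)
    have "((\<lambda>t::real. - ln t) \<longlongrightarrow> - ln 1) (at_left 1)" by (intro tendsto_intros) auto
    then show "((\<lambda>t::real. - ln t) \<longlongrightarrow> 0) (at_left 1)" by simp
    show "\<forall>\<^sub>F t in at_left (1::real). - ln t \<in> {0<..} - {0}"
      using eventually_at_left_real[OF zero_less_one] by eventually_elim auto
  qed
  ultimately have "((\<lambda>t. Z (W - of_real (- ln t))) \<longlongrightarrow> L) (at_left 1)"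
    by (rule filterlim_compose)
  then show ?thesis by (simp add: L_def)
qed

text \<open>By the two limits a primitive of the density extends continuously to both ends, so the
  fundamental theorem gives the gauge integral as L1 - L0. There Z a cancels, and what is left is
  the negative of the monodromy of \<open>pinch\<close>. Convergence of the convolution integral
  comes out at the same time.\<close>

theorem pinch_turn:
  assumes A: "integrable_branch c A" and B: "integrable_branch c B" and W: "Re W < c - 3"
    and s0: "Re W < Re s0" "Re s0 < c - 2" and t0: "Re W < Re t0" "Re t0 < c - 2"
  shows "(conv_density A B W has_integral
    (pinch A B s0 t0 W - pinch A B s0 t0 (W + 2 * of_real pi * \<i>))) {0..1}"
proof -
  have hA: "A holomorphic_on {s. Re s < c}" and hB: "B holomorphic_on {s. Re s < c}"
    and tA: "turn A holomorphic_on {s. Re s < c}" and tB: "turn B holomorphic_on {s. Re s < c}"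
    and jA: "jump A holomorphic_on {s. Re s < c}" and jB: "jump B holomorphic_on {s. Re s < c}"
    using A B by (auto intro!: integrable_branch_holo integrable_branch_turn integrable_branch_jump)
  have W': "Re W < c - 2" using W by simp
  have R: "s0 \<in> R W" "t0 \<in> R W" using s0 t0 by (auto simp: outer_strip_def)
  obtain Z where Z: "\<And>s. s \<in> S W \<Longrightarrow> (Z has_field_derivative kern (jump A) (jump B) W s) (at s)"
    using kern_primitive[OF jA jB W'] by blast
  obtain N1 where N1: "\<And>s. s \<in> S W \<Longrightarrow> (N1 has_field_derivative kern (turn A) (jump B) W s) (at s)"
    using kern_primitive[OF tA jB W'] by blast
  obtain N2 where N2: "\<And>s. s \<in> S W \<Longrightarrow> (N2 has_field_derivative kern (jump A) B W s) (at s)"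
    using kern_primitive[OF jA hB W'] by blast
  obtain M where M: "\<And>s. s \<in> R W \<Longrightarrow> (M has_field_derivative outer_kern (jump A) (turn B) W s) (at s)"
    using outer_kern_primitive[OF jA tB] by blast
  define a where "a = W + 1 + \<i> * pi"
  define b where "b = W + 1 - \<i> * pi"
  define L0 where "L0 = Z a - (N1 a - N1 b)"
  define L1 where "L1 = Z a - ((M a - M b) - (N2 a - N2 b))"
  have lim0: "((\<lambda>t. Z (W + of_real (ln t))) \<longlongrightarrow> L0) (at_right 0)"
    unfolding L0_def a_def b_def by (rule conv_primitive_left_end[OF A B W Z N1])
  have lim1: "((\<lambda>t. Z (W + of_real (ln t))) \<longlongrightarrow> L1) (at_left 1)"
    unfolding L1_def a_def b_def by (rule conv_primitive_right_end[OF A B W Z N2 M])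
  define \<theta> where "\<theta> t = (if t = 0 then L0 else if t = 1 then L1 else Z (W + of_real (ln t)))" for t :: real
  have der: "(\<theta> has_vector_derivative conv_density A B W t) (at t)" if t: "t \<in> {0<..<1}" for t
  proof -
    have "ln t < 0" using t by simp
    then have tS: "W + of_real (ln t) \<in> S W" using W by (auto simp: slit_strip_def)
    have "((\<lambda>t. W + of_real (ln t)) has_vector_derivative of_real (1 / t)) (at t)"
      using t by (auto intro!: derivative_eq_intros simp: has_real_derivative_iff_has_vector_derivative[symmetric]
          has_vector_derivative_of_real)
    from field_vector_diff_chain_at[OF this Z[OF tS]]
    have "((\<lambda>t. Z (W + of_real (ln t))) has_vector_derivative
        of_real (1 / t) * kern (jump A) (jump B) W (W + of_real (ln t))) (at t)"
      by (simp add: o_def)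
    moreover have "exp (W + of_real (ln t)) = of_real t * exp W"
      using t by (simp add: exp_add exp_of_real)
    ultimately have "((\<lambda>t. Z (W + of_real (ln t))) has_vector_derivative conv_density A B W t) (at t)"
      using t by (simp add: kern_def conv_density_def field_simps)
    then show ?thesis
      by (rule has_vector_derivative_transform_within_open[of _ _ _ "{0<..<1}"]) (use t in \<open>auto simp: \<theta>_def\<close>)
  qed
  have "continuous_on {0..1} \<theta>"
    unfolding continuous_on_eq_continuous_within
  proof
    fix t :: real assume "t \<in> {0..1}"
    then consider "t = 0" | "t = 1" | "t \<in> {0<..<1}" by force
    then show "continuous (at t within {0..1}) \<theta>"
    proof cases
      case 1
      have "(\<theta> \<longlongrightarrow> L0) (at_right 0)"
        by (rule Lim_transform_eventually[OF lim0])
          (use eventually_at_right_real[of 0 "1::real"] in \<open>auto elim!: eventually_mono simp: \<theta>_def\<close>)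
      then show ?thesis by (simp add: 1 continuous_within at_within_Icc_at_right \<theta>_def)
    next
      case 2
      have "(\<theta> \<longlongrightarrow> L1) (at_left 1)"
        by (rule Lim_transform_eventually[OF lim1])
          (use eventually_at_left_real[of 0 "1::real"] in \<open>auto elim!: eventually_mono simp: \<theta>_def\<close>)
      then show ?thesis by (simp add: 2 continuous_within at_within_Icc_at_left \<theta>_def)
    next
      case 3
      then show ?thesis using der has_vector_derivative_continuous continuous_at_imp_continuous_at_within by blast
    qed
  qed
  then have "(conv_density A B W has_integral (\<theta> 1 - \<theta> 0)) {0..1}"
    by (intro fundamental_theorem_of_calculus_interior der) auto
  moreover have "pinch A B s0 t0 (W + 2 * of_real pi * \<i>) - pinch A B s0 t0 W = (M a - M b) - (N1 a - N1 b) - (N2 a - N2 b)"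
    unfolding a_def b_def by (rule pinch_monodromy[OF hA hB W R N1 N2 M])
  then have "L1 - L0 = pinch A B s0 t0 W - pinch A B s0 t0 (W + 2 * of_real pi * \<i>)"
    by (simp add: L0_def L1_def algebra_simps)
  ultimately show ?thesis by (simp add: \<theta>_def)
qed

end

subsection \<open>Analytic continuation along paths\<close>

lemma holomorphic_eq_on_ball:
  assumes "f holomorphic_on ball a r" "g holomorphic_on ball a r" "b \<in> ball a r"
    and "\<forall>\<^sub>F z in nhds b. f z = g z" "z \<in> ball a r"
  shows "f z = (g z :: complex)"
proof -
  obtain V where V: "open V" "b \<in> V" "\<And>z. z \<in> V \<Longrightarrow> f z = g z"
    using assms(4) by (auto simp: eventually_nhds)
  show ?thesis
    by (rule analytic_continuation_open[of "V \<inter> ball a r" "ball a r" f g])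
      (use assms V in auto)
qed

lemma holomorphic_eq_germ_iff:
  assumes "f holomorphic_on ball a r" "g holomorphic_on ball a r" "b \<in> ball a r"
  shows "(\<forall>\<^sub>F z in nhds b. f z = g z) \<longleftrightarrow> (\<forall>z\<in>ball a r. f z = (g z :: complex))"
proof
  assume "\<forall>\<^sub>F z in nhds b. f z = g z"
  then show "\<forall>z\<in>ball a r. f z = g z" using holomorphic_eq_on_ball[OF assms] by blast
next
  assume *: "\<forall>z\<in>ball a r. f z = g z"
  have "\<forall>\<^sub>F z in nhds b. z \<in> ball a r" by (rule eventually_nhds_in_open[OF open_ball assms(3)])
  then show "\<forall>\<^sub>F z in nhds b. f z = g z" by eventually_elim (use * in blast)
qed

lemma analytic_on_singleton:
  assumes "f holomorphic_on X" "open X" "x \<in> X"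
  shows "f analytic_on {x}"
  using assms by (auto simp: analytic_on_open[symmetric] elim: analytic_on_subset)

lemma eventually_nhds_holomorphic_ball:
  assumes "\<Phi> analytic_on {a :: complex}"
  obtains r where "0 < r" "\<Phi> holomorphic_on ball a r"
  using assms by (auto simp: analytic_on_def)

text \<open>Agreement of the germs is locally constant in t: near t both families are represented by
  functions on one disc, where agreement near one point is agreement everywhere. Connectedness of
  [0,1] does the rest.\<close>

lemma continuation_along_unique:
  assumes p: "path p" and \<Phi>: "continuation_along p f \<Phi>" and \<Psi>: "continuation_along p f \<Psi>"
    and t: "t \<in> {0..1}"
  shows "\<forall>\<^sub>F z in nhds (p t). \<Phi> t z = \<Psi> t z"
proof -
  define P where "P t \<longleftrightarrow> (\<forall>\<^sub>F z in nhds (p t). \<Phi> t z = \<Psi> t z)" for t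
  have "P 0"
    using \<Phi> \<Psi> unfolding continuation_along_def P_def pathstart_def
    by (auto elim: eventually_elim2)
  have local: "\<exists>T. openin (top_of_set {0..1}) T \<and> t \<in> T \<and> (\<forall>x\<in>T. \<forall>y\<in>T. P x \<longrightarrow> P y)" if t: "t \<in> {0..1}" for t :: real
  proof -
    obtain r1 where r1: "0 < r1" "\<Phi> t holomorphic_on ball (p t) r1"
      using eventually_nhds_holomorphic_ball \<Phi> t unfolding continuation_along_def by blast
    obtain r2 where r2: "0 < r2" "\<Psi> t holomorphic_on ball (p t) r2"
      using eventually_nhds_holomorphic_ball \<Psi> t unfolding continuation_along_def by blast
    define r where "r = min r1 r2"
    have r: "0 < r" "\<Phi> t holomorphic_on ball (p t) r" "\<Psi> t holomorphic_on ball (p t) r"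
      using r1 r2 by (auto simp: r_def elim: holomorphic_on_subset)
    have "(p \<longlongrightarrow> p t) (at t within {0..1})"
      using p t unfolding path_def continuous_on_def by blast
    then have "\<forall>\<^sub>F s in at t within {0..1}. dist (p s) (p t) < r" by (rule tendstoD) (rule r)
    moreover have "\<forall>\<^sub>F s in at t within {0..1}. \<forall>\<^sub>F z in nhds (p s). \<Phi> s z = \<Phi> t z"
      "\<forall>\<^sub>F s in at t within {0..1}. \<forall>\<^sub>F z in nhds (p s). \<Psi> s z = \<Psi> t z"
      using \<Phi> \<Psi> t by (auto simp: continuation_along_def)
    ultimately have ev: "\<forall>\<^sub>F s in at t within {0..1}. P s \<longleftrightarrow> P t"
    proof eventually_elim
      case (elim s)
      have s: "p s \<in> ball (p t) r" using elim(1) by (simp add: dist_commute)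
      have "P s \<longleftrightarrow> (\<forall>\<^sub>F z in nhds (p s). \<Phi> t z = \<Psi> t z)"
        unfolding P_def by (rule eventually_cong[OF eventually_conj[OF elim(2,3)]]) auto
      also have "\<dots> \<longleftrightarrow> (\<forall>z\<in>ball (p t) r. \<Phi> t z = \<Psi> t z)"
        by (rule holomorphic_eq_germ_iff[OF r(2,3) s])
      also have "\<dots> \<longleftrightarrow> P t"
        unfolding P_def by (rule holomorphic_eq_germ_iff[OF r(2,3), symmetric]) (use r(1) in simp)
      finally show ?case .
    qed
    then obtain V where V: "open V" "t \<in> V" "\<And>s. s \<in> V \<Longrightarrow> s \<in> {0..1} \<Longrightarrow> s \<noteq> t \<Longrightarrow> P s \<longleftrightarrow> P t"
      by (auto simp: eventually_at_topological)
    show ?thesis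
    proof (rule exI[of _ "{0..1} \<inter> V"], intro conjI ballI impI)
      show "openin (top_of_set {0..1}) ({0..1} \<inter> V)" by (rule openin_open_Int[OF V(1)])
      show "t \<in> {0..1} \<inter> V" using V t by simp
      have *: "P s \<longleftrightarrow> P t" if "s \<in> {0..1} \<inter> V" for s using V(3)[of s] that by (cases "s = t") auto
      show "P y" if "x \<in> {0..1} \<inter> V" "y \<in> {0..1} \<inter> V" "P x" for x y using * that by blast
    qed
  qed
  show ?thesis
    using connected_induction_simple[of "{0..1::real}" 0 t P] t \<open>P 0\<close> local unfolding P_def
    by (simp add: connected_Icc)
qed

lemma continued_value_eq:
  assumes "path p" "continuation_along p f \<Phi>"
  shows "continued_value p f = \<Phi> 1 (pathfinish p)"
  unfolding continued_value_def
proof (rule the_equality)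
  fix w assume "\<exists>\<Psi>. continuation_along p f \<Psi> \<and> w = \<Psi> 1 (pathfinish p)"
  then obtain \<Psi> where \<Psi>: "continuation_along p f \<Psi>" "w = \<Psi> 1 (pathfinish p)" by blast
  have "\<forall>\<^sub>F z in nhds (p 1). \<Psi> 1 z = \<Phi> 1 z"
    by (rule continuation_along_unique[OF assms(1) \<Psi>(1) assms(2)]) simp
  then show "w = \<Phi> 1 (pathfinish p)"
    using eventually_nhds_x_imp_x \<Psi>(2) by (fastforce simp: pathfinish_def)
qed (use assms in blast)

text \<open>By compactness finitely many of the given germs suffice for the whole path, and after
  re-indexing they have a common radius of holomorphy. The uniform radius is what allows the path to
  be moved.\<close>

lemma continuation_uniform:
  assumes p: "path p" and \<Phi>: "continuation_along p f \<Phi>"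
  obtains \<Psi> r where "0 < r" "\<And>t. t \<in> {0..1} \<Longrightarrow> \<Psi> t holomorphic_on ball (p t) r"
    and "\<forall>\<^sub>F z in nhds (pathstart p). \<Psi> 0 z = f z" and "\<Psi> 1 (pathfinish p) = \<Phi> 1 (pathfinish p)"
    and "\<And>t. t \<in> {0..1} \<Longrightarrow> \<forall>\<^sub>F s in at t within {0..1}. \<forall>z\<in>ball (p s) r. \<Psi> s z = \<Psi> t z"
proof -
  have "\<exists>\<rho> \<delta>. 0 < \<rho> \<and> 0 < \<delta> \<and> \<Phi> t holomorphic_on ball (p t) (2 * \<rho>) \<and>
      (\<forall>s\<in>{0..1}. \<bar>s - t\<bar> < \<delta> \<longrightarrow> dist (p s) (p t) < \<rho> \<and> (\<forall>\<^sub>F z in nhds (p s). \<Phi> s z = \<Phi> t z))"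
    if t: "t \<in> {0..1}" for t
  proof -
    obtain \<rho> where \<rho>: "0 < \<rho>" "\<Phi> t holomorphic_on ball (p t) \<rho>"
      using eventually_nhds_holomorphic_ball \<Phi> t unfolding continuation_along_def by blast
    have "(p \<longlongrightarrow> p t) (at t within {0..1})"
      using p t unfolding path_def continuous_on_def by blast
    then have "\<forall>\<^sub>F s in at t within {0..1}. dist (p s) (p t) < \<rho> / 2" by (rule tendstoD) (use \<rho> in simp)
    moreover have "\<forall>\<^sub>F s in at t within {0..1}. \<forall>\<^sub>F z in nhds (p s). \<Phi> s z = \<Phi> t z"
      using \<Phi> t by (auto simp: continuation_along_def)
    ultimately have "\<forall>\<^sub>F s in at t within {0..1}. dist (p s) (p t) < \<rho> / 2 \<and> (\<forall>\<^sub>F z in nhds (p s). \<Phi> s z = \<Phi> t z)"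
      by (rule eventually_conj)
    then obtain \<delta> where "0 < \<delta>" "\<And>s. s \<in> {0..1} \<Longrightarrow> s \<noteq> t \<Longrightarrow> \<bar>s - t\<bar> < \<delta> \<Longrightarrow>
        dist (p s) (p t) < \<rho> / 2 \<and> (\<forall>\<^sub>F z in nhds (p s). \<Phi> s z = \<Phi> t z)"
      by (auto simp: eventually_at dist_real_def)
    then have "dist (p s) (p t) < \<rho> / 2 \<and> (\<forall>\<^sub>F z in nhds (p s). \<Phi> s z = \<Phi> t z)"
      if "s \<in> {0..1}" "\<bar>s - t\<bar> < \<delta>" for s
      using that \<rho>(1) by (cases "s = t") auto
    then show ?thesis using \<rho> \<open>0 < \<delta>\<close>
      by (intro exI[of _ "\<rho> / 2"] exI[of _ \<delta>]) simp
  qed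
  then have "\<forall>t\<in>{0..1}. \<exists>\<rho> \<delta>. 0 < \<rho> \<and> 0 < \<delta> \<and> \<Phi> t holomorphic_on ball (p t) (2 * \<rho>) \<and>
      (\<forall>s\<in>{0..1}. \<bar>s - t\<bar> < \<delta> \<longrightarrow> dist (p s) (p t) < \<rho> \<and> (\<forall>\<^sub>F z in nhds (p s). \<Phi> s z = \<Phi> t z))"
    by blast
  then obtain \<rho> \<delta> where \<rho>\<delta>: "\<forall>t\<in>{0..1}. 0 < \<rho> t \<and> 0 < \<delta> t \<and> \<Phi> t holomorphic_on ball (p t) (2 * \<rho> t) \<and>
      (\<forall>s\<in>{0..1}. \<bar>s - t\<bar> < \<delta> t \<longrightarrow> dist (p s) (p t) < \<rho> t \<and> (\<forall>\<^sub>F z in nhds (p s). \<Phi> s z = \<Phi> t z))"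
    unfolding bchoice_iff by blast
  have \<rho>: "\<And>t. t \<in> {0..1} \<Longrightarrow> 0 < \<rho> t" and \<delta>: "\<And>t. t \<in> {0..1} \<Longrightarrow> 0 < \<delta> t"
    and hol: "\<And>t. t \<in> {0..1} \<Longrightarrow> \<Phi> t holomorphic_on ball (p t) (2 * \<rho> t)"
    and near: "\<And>t s. t \<in> {0..1} \<Longrightarrow> s \<in> {0..1} \<Longrightarrow> \<bar>s - t\<bar> < \<delta> t \<Longrightarrow>
      dist (p s) (p t) < \<rho> t \<and> (\<forall>\<^sub>F z in nhds (p s). \<Phi> s z = \<Phi> t z)"
    using \<rho>\<delta> by blast+
  have "{0..1} \<subseteq> (\<Union>t\<in>{0..1}. ball t (\<delta> t))" using \<delta> by force
  then obtain C where C: "C \<subseteq> {0..1}" "finite C" "{0..1} \<subseteq> (\<Union>t\<in>C. ball t (\<delta> t))"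
    by (rule compactE_image[OF compact_Icc, rotated]) auto
  have "\<forall>s\<in>{0..1}. \<exists>t\<in>C. \<bar>s - t\<bar> < \<delta> t" using C(3) by (force simp: dist_real_def)
  then obtain i where i: "\<And>s. s \<in> {0..1} \<Longrightarrow> i s \<in> C \<and> \<bar>s - i s\<bar> < \<delta> (i s)" by metis
  have "C \<noteq> {}" using i[of 0] by auto
  define r where "r = Min (\<rho> ` C)"
  have r: "0 < r" "\<And>t. t \<in> C \<Longrightarrow> r \<le> \<rho> t"
    using C \<open>C \<noteq> {}\<close> \<rho> by (auto simp: r_def)
  \<comment> \<open>The germ at s is represented by the function at the centre of a covering
    interval that contains s.\<close>
  define \<Psi> where "\<Psi> s = \<Phi> (i s)" for s
  have sub: "ball (p s) r \<subseteq> ball (p t) (2 * \<rho> t)" if "t \<in> C" "s \<in> {0..1}" "\<bar>s - t\<bar> < \<delta> t" for s t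
  proof
    fix z assume "z \<in> ball (p s) r"
    then show "z \<in> ball (p t) (2 * \<rho> t)"
      using near[of t s] that C r(2)[of t] dist_triangle[of "p t" z "p s"] by (auto simp: dist_commute)
  qed
  show thesis
  proof (rule that[OF r(1), of \<Psi>])
    fix t :: real assume t: "t \<in> {0..1}"
    show "\<Psi> t holomorphic_on ball (p t) r"
      unfolding \<Psi>_def by (rule holomorphic_on_subset[OF hol sub]) (use i[OF t] t C in auto)
    have "\<forall>\<^sub>F s in at t within {0..1}. \<bar>s - i t\<bar> < \<delta> (i t)"
      by (rule order_tendstoD[of _ "\<bar>t - i t\<bar>"]) (use i[OF t] in \<open>auto intro!: tendsto_intros\<close>)
    moreover have "\<forall>\<^sub>F s in at t within {0..1}. s \<in> {0..1}" by (simp add: eventually_at_filter)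
    ultimately show "\<forall>\<^sub>F s in at t within {0..1}. \<forall>z\<in>ball (p s) r. \<Psi> s z = \<Psi> t z"
    proof eventually_elim
      case (elim s)
      have C': "i s \<in> {0..1}" "i t \<in> {0..1}" using i[OF t] i[OF elim(2)] C by auto
      have "\<forall>\<^sub>F z in nhds (p s). \<Phi> s z = \<Phi> (i s) z" "\<forall>\<^sub>F z in nhds (p s). \<Phi> s z = \<Phi> (i t) z"
        using near[OF C'(1) elim(2)] near[OF C'(2) elim(2) elim(1)] i[OF elim(2)] by auto
      then have "\<forall>\<^sub>F z in nhds (p s). \<Phi> (i s) z = \<Phi> (i t) z" by eventually_elim simp
      moreover have "\<Phi> (i s) holomorphic_on ball (p s) r" "\<Phi> (i t) holomorphic_on ball (p s) r"
        by (rule holomorphic_on_subset[OF hol sub], use i[OF t] i[OF elim(2)] elim C' in auto)+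
      ultimately show ?case
        using holomorphic_eq_on_ball[of "\<Phi> (i s)" "p s" r "\<Phi> (i t)" "p s"] r(1) by (auto simp: \<Psi>_def)
    qed
  next
    have 0: "i 0 \<in> {0..1}" "\<bar>0 - i 0\<bar> < \<delta> (i 0)" and 1: "i 1 \<in> {0..1}" "\<bar>1 - i 1\<bar> < \<delta> (i 1)"
      using i[of 0] i[of 1] C by auto
    have "\<forall>\<^sub>F z in nhds (p 0). \<Phi> 0 z = f z" using \<Phi> by (simp add: continuation_along_def pathstart_def)
    moreover have "\<forall>\<^sub>F z in nhds (p 0). \<Phi> 0 z = \<Phi> (i 0) z" using near[of "i 0" 0] 0 by auto
    ultimately show "\<forall>\<^sub>F z in nhds (pathstart p). \<Psi> 0 z = f z"
      unfolding pathstart_def \<Psi>_def by eventually_elim simp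
    have "\<forall>\<^sub>F z in nhds (p 1). \<Phi> 1 z = \<Phi> (i 1) z" using near[of "i 1" 1] 1 by auto
    then show "\<Psi> 1 (pathfinish p) = \<Phi> 1 (pathfinish p)"
      unfolding pathfinish_def \<Psi>_def by (auto dest: eventually_nhds_x_imp_x)
  qed
qed

text \<open>A family of germs with common radius r serves every path that stays within r of p, with
  the same function g at the end. Hence continuation along segments is holomorphic in the end
  point.\<close>

lemma continuation_along_perturb:
  assumes p: "path p" and "continuable_along p f"
  obtains r g where "0 < r" "g holomorphic_on ball (pathfinish p) r"
    and "\<forall>q. path q \<and> pathstart q = pathstart p \<and> (\<forall>t\<in>{0..1}. dist (q t) (p t) < r) \<longrightarrow>
      (\<exists>\<Psi>. continuation_along q f \<Psi> \<and> \<Psi> 1 = g)"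
proof -
  obtain \<Phi> where \<Phi>: "continuation_along p f \<Phi>" using assms by (auto simp: continuable_along_def)
  obtain \<Psi> r where r: "0 < r" and hol: "\<And>t. t \<in> {0..1} \<Longrightarrow> \<Psi> t holomorphic_on ball (p t) r"
    and start: "\<forall>\<^sub>F z in nhds (pathstart p). \<Psi> 0 z = f z" and "\<Psi> 1 (pathfinish p) = \<Phi> 1 (pathfinish p)"
    and agree: "\<And>t. t \<in> {0..1} \<Longrightarrow> \<forall>\<^sub>F s in at t within {0..1}. \<forall>z\<in>ball (p s) r. \<Psi> s z = \<Psi> t z"
    by (rule continuation_uniform[OF p \<Phi>], rule that)
  show thesis
  proof (rule that[OF r, of "\<Psi> 1"])
    show "\<Psi> 1 holomorphic_on ball (pathfinish p) r" using hol[of 1] by (simp add: pathfinish_def)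
    show "\<forall>q. path q \<and> pathstart q = pathstart p \<and> (\<forall>t\<in>{0..1}. dist (q t) (p t) < r) \<longrightarrow>
      (\<exists>\<Phi>. continuation_along q f \<Phi> \<and> \<Phi> 1 = \<Psi> 1)"
    proof (intro allI impI, elim conjE)
    fix q assume q: "path q" "pathstart q = pathstart p" and "\<forall>t\<in>{0..1}. dist (q t) (p t) < r"
    then have q3: "dist (q t) (p t) < r" if "t \<in> {0..1}" for t using that by blast
    have "continuation_along q f \<Psi>"
      unfolding continuation_along_def
    proof (intro conjI ballI)
      show "\<forall>\<^sub>F z in nhds (pathstart q). \<Psi> 0 z = f z" using start q by simp
      fix t :: real assume t: "t \<in> {0..1}"
      have "q t \<in> ball (p t) r" using q3[OF t] by (simp add: dist_commute)
      then show "\<Psi> t analytic_on {q t}"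
        using analytic_on_singleton[OF hol[OF t] open_ball] by blast
      have "\<forall>\<^sub>F s in at t within {0..1}. s \<in> {0..1}" by (simp add: eventually_at_filter)
      with agree[OF t] show "\<forall>\<^sub>F s in at t within {0..1}. \<forall>\<^sub>F z in nhds (q s). \<Psi> s z = \<Psi> t z"
      proof eventually_elim
        case (elim s)
        have "q s \<in> ball (p s) r" using q3[OF elim(2)] by (simp add: dist_commute)
        then show ?case using elim(1) by (auto intro!: eventually_nhds_in_open[THEN eventually_mono, of "ball (p s) r"])
      qed
    qed
    then show "\<exists>\<Phi>. continuation_along q f \<Phi> \<and> \<Phi> 1 = \<Psi> 1" by blast
    qed
  qed
qed

lemma continued_value_linepath_holomorphic:
  assumes "continuable_along (linepath a x) f"
  obtains r where "0 < r" "\<And>y. y \<in> ball x r \<Longrightarrow> continuable_along (linepath a y) f"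
    and "(\<lambda>y. continued_value (linepath a y) f) holomorphic_on ball x r"
proof -
  obtain r g where r: "0 < r" "g holomorphic_on ball x r"
    and g: "\<forall>q. path q \<and> pathstart q = a \<and> (\<forall>t\<in>{0..1}. dist (q t) (linepath a x t) < r) \<longrightarrow>
      (\<exists>\<Psi>. continuation_along q f \<Psi> \<and> \<Psi> 1 = g)"
    by (rule continuation_along_perturb[OF path_linepath assms, unfolded pathfinish_linepath pathstart_linepath], rule that)
  have cont: "\<exists>\<Psi>. continuation_along (linepath a y) f \<Psi> \<and> \<Psi> 1 = g" if "y \<in> ball x r" for y
  proof (rule g[rule_format], intro conjI ballI)
    fix t :: real assume t: "t \<in> {0..1}"
    have "dist (linepath a y t) (linepath a x t) = \<bar>t\<bar> * dist y x"
      by (simp add: linepath_def dist_norm flip: scaleR_diff_right)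
    also have "\<dots> \<le> 1 * dist y x" by (rule mult_right_mono) (use t in auto)
    finally show "dist (linepath a y t) (linepath a x t) < r" using that by (simp add: dist_commute)
  qed auto
  show thesis
  proof (rule that[OF r(1)])
    show "continuable_along (linepath a y) f" if "y \<in> ball x r" for y
      using cont[OF that] by (auto simp: continuable_along_def)
    have "continued_value (linepath a y) f = g y" if "y \<in> ball x r" for y
      using cont[OF that] continued_value_eq[OF path_linepath] by fastforce
    then show "(\<lambda>y. continued_value (linepath a y) f) holomorphic_on ball x r"
      by (intro holomorphic_transform[OF r(2)]) simp
  qed
qed

lemma continued_value_linepath_start:
  assumes "f analytic_on {a}"
  shows "continuable_along (linepath a a) f" "\<forall>\<^sub>F y in nhds a. continued_value (linepath a y) f = f y"
proof -
  obtain r where r: "0 < r" "f holomorphic_on ball a r"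
    using eventually_nhds_holomorphic_ball[OF assms] .
  have cont: "continuation_along (linepath a y) f (\<lambda>_. f)" if "y \<in> ball a r" for y
  proof -
    have "closed_segment a y \<subseteq> ball a r"
      by (rule closed_segment_subset) (use that r in auto)
    then have "linepath a y t \<in> ball a r" if "t \<in> {0..1}" for t
      using linepath_in_path[OF that] by blast
    then have "f analytic_on {linepath a y t}" if "t \<in> {0..1}" for t
      using analytic_on_singleton[OF r(2) open_ball] that by blast
    then show ?thesis by (simp add: continuation_along_def)
  qed
  show "continuable_along (linepath a a) f" using cont[of a] r by (auto simp: continuable_along_def)
  have "continued_value (linepath a y) f = f y" if "y \<in> ball a r" for y
    using continued_value_eq[OF path_linepath cont[OF that]] by simp
  then show "\<forall>\<^sub>F y in nhds a. continued_value (linepath a y) f = f y"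
    using eventually_nhds_in_open[of "ball a r" a] r by (auto elim!: eventually_mono)
qed

lemma continuation_pullback:
  assumes q: "path q" "path_image q \<subseteq> X" and X: "open X" "\<pi> holomorphic_on X"
    and "continuation_along (\<pi> \<circ> q) f \<Phi>"
  shows "continuation_along q (f \<circ> \<pi>) (\<lambda>t. \<Phi> t \<circ> \<pi>)"
proof -
  have qX: "q t \<in> X" if "t \<in> {0..1}" for t using q that by (auto simp: path_image_def)
  have pull: "\<forall>\<^sub>F z in nhds (q t). P (\<pi> z)" if "t \<in> {0..1}" "\<forall>\<^sub>F z in nhds (\<pi> (q t)). P z" for t P
  proof -
    have "isCont \<pi> (q t)"
      using holomorphic_on_imp_continuous_on[OF X(2)] X(1) qX[OF that(1)] continuous_on_eq_continuous_at by blast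
    then have "(\<pi> \<longlongrightarrow> \<pi> (q t)) (nhds (q t))"
      by (simp add: isCont_def tendsto_at_iff_tendsto_nhds)
    then show ?thesis by (rule eventually_compose_filterlim[OF that(2)])
  qed
  show ?thesis
    unfolding continuation_along_def
  proof (intro conjI ballI)
    show "\<forall>\<^sub>F z in nhds (pathstart q). (\<Phi> 0 \<circ> \<pi>) z = (f \<circ> \<pi>) z"
      using pull[of 0 "\<lambda>z. \<Phi> 0 z = f z"] assms(5) by (simp add: continuation_along_def pathstart_def)
    fix t :: real assume t: "t \<in> {0..1}"
    have "\<pi> analytic_on {q t}" by (rule analytic_on_singleton[OF X(2,1) qX[OF t]])
    moreover have "\<Phi> t analytic_on {\<pi> (q t)}" using assms(5) t by (simp add: continuation_along_def)
    ultimately show "\<Phi> t \<circ> \<pi> analytic_on {q t}" by (intro analytic_on_compose) auto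
    have "\<forall>\<^sub>F s in at t within {0..1}. \<forall>\<^sub>F z in nhds (\<pi> (q s)). \<Phi> s z = \<Phi> t z"
      using assms(5) t by (simp add: continuation_along_def)
    moreover have "\<forall>\<^sub>F s in at t within {0..1}. s \<in> {0..1}" by (simp add: eventually_at_filter)
    ultimately show "\<forall>\<^sub>F s in at t within {0..1}. \<forall>\<^sub>F z in nhds (q s). (\<Phi> s \<circ> \<pi>) z = (\<Phi> t \<circ> \<pi>) z"
      by eventually_elim (use pull in simp)
  qed
qed

text \<open>The germs are those of \<open>A\<close> composed with the local inverses of \<open>\<pi>\<close>.\<close>

lemma continuation_push:
  assumes X: "open X" "\<pi> holomorphic_on X" "\<And>x. x \<in> X \<Longrightarrow> deriv \<pi> x \<noteq> 0" and A: "A holomorphic_on X"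
    and q: "path q" "path_image q \<subseteq> X" and f: "\<forall>\<^sub>F s in nhds (pathstart q). f (\<pi> s) = A s"
  obtains \<Phi> where "continuation_along (\<pi> \<circ> q) f \<Phi>" "\<Phi> 1 (\<pi> (pathfinish q)) = A (pathfinish q)"
proof -
  have qX: "q t \<in> X" if "t \<in> {0..1}" for t using q that by (auto simp: path_image_def)
  have "\<exists>r. 0 < r \<and> ball x r \<subseteq> X \<and> inj_on \<pi> (ball x r)" if "x \<in> X" for x
    using has_complex_derivative_locally_injective[OF X(2) that X(1) X(3)[OF that]] by metis
  then obtain r where r: "\<And>x. x \<in> X \<Longrightarrow> 0 < r x" "\<And>x. x \<in> X \<Longrightarrow> ball x (r x) \<subseteq> X"
      "\<And>x. x \<in> X \<Longrightarrow> inj_on \<pi> (ball x (r x))"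
    by metis
  have img: "open (\<pi> ` N)" if "open N" "N \<subseteq> ball x (r x)" "x \<in> X" for N x
    by (rule open_mapping_thm3[OF holomorphic_on_subset[OF X(2)] that(1)])
      (use that r inj_on_subset in \<open>blast+\<close>)
  define g where "g x = inv_into (ball x (r x)) \<pi>" for x
  have g: "g x (\<pi> y) = y" if "x \<in> X" "y \<in> ball x (r x)" for x y
    using inv_into_f_f[OF r(3)] that by (simp add: g_def)
  have push: "\<forall>\<^sub>F z in nhds (\<pi> x). \<exists>y\<in>N. z = \<pi> y" if "open N" "x \<in> N" "x \<in> X" for N x
  proof -
    have "\<forall>\<^sub>F z in nhds (\<pi> x). z \<in> \<pi> ` (N \<inter> ball x (r x))"
      by (rule eventually_nhds_in_open[OF img]) (use that r in auto)
    then show ?thesis by eventually_elim auto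
  qed
  define \<Phi> where "\<Phi> t = A \<circ> g (q t)" for t
  have "continuation_along (\<pi> \<circ> q) f \<Phi>"
    unfolding continuation_along_def
  proof (intro conjI ballI)
    have q0: "q 0 \<in> X" using qX[of 0] by simp
    obtain V where V: "open V" "q 0 \<in> V" "\<And>s. s \<in> V \<Longrightarrow> f (\<pi> s) = A s"
      using f by (auto simp: eventually_nhds pathstart_def)
    have "\<forall>\<^sub>F z in nhds (\<pi> (q 0)). \<exists>y \<in> V \<inter> ball (q 0) (r (q 0)). z = \<pi> y"
      by (rule push) (use V q0 r in auto)
    then have "\<forall>\<^sub>F z in nhds (\<pi> (q 0)). \<Phi> 0 z = f z"
      by eventually_elim (use g q0 V in \<open>auto simp: \<Phi>_def\<close>)
    then show "\<forall>\<^sub>F z in nhds (pathstart (\<pi> \<circ> q)). \<Phi> 0 z = f z" by (simp add: pathstart_def)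
    fix t :: real assume t: "t \<in> {0..1}"
    define x where "x = q t"
    have x: "x \<in> X" using qX[OF t] by (simp add: x_def)
    obtain h where h: "h holomorphic_on \<pi> ` ball x (r x)" "\<And>z. z \<in> ball x (r x) \<Longrightarrow> h (\<pi> z) = z"
      using holomorphic_has_inverse[OF holomorphic_on_subset[OF X(2) r(2)[OF x]] open_ball r(3)[OF x]] by metis
    have "(A \<circ> h) holomorphic_on \<pi> ` ball x (r x)"
      by (rule holomorphic_on_compose_gen[OF h(1) A]) (use h(2) r(2)[OF x] in auto)
    then have "\<Phi> t holomorphic_on \<pi> ` ball x (r x)"
      by (rule holomorphic_transform) (use h(2) g[OF x] in \<open>auto simp: \<Phi>_def x_def\<close>)
    moreover have "open (\<pi> ` ball x (r x))" by (rule img) (use x in auto)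
    moreover have "\<pi> x \<in> \<pi> ` ball x (r x)" using r(1)[OF x] by auto
    ultimately show "\<Phi> t analytic_on {(\<pi> \<circ> q) t}"
      unfolding o_def x_def[symmetric] by (rule analytic_on_singleton)
    have "(q \<longlongrightarrow> q t) (at t within {0..1})" using q t unfolding path_def continuous_on_def by blast
    then have "\<forall>\<^sub>F s in at t within {0..1}. dist (q s) x < r x"
      unfolding x_def by (rule tendstoD) (use r(1)[OF x] in \<open>simp add: x_def\<close>)
    moreover have "\<forall>\<^sub>F s in at t within {0..1}. s \<in> {0..1}" by (simp add: eventually_at_filter)
    ultimately show "\<forall>\<^sub>F s in at t within {0..1}. \<forall>\<^sub>F z in nhds ((\<pi> \<circ> q) s). \<Phi> s z = \<Phi> t z"
    proof eventually_elim
      case (elim s)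
      have "\<forall>\<^sub>F z in nhds (\<pi> (q s)). \<exists>y \<in> ball x (r x) \<inter> ball (q s) (r (q s)). z = \<pi> y"
        by (rule push) (use elim qX r in \<open>auto simp: dist_commute\<close>)
      then show ?case
        unfolding o_def by eventually_elim (use g x qX elim in \<open>auto simp: \<Phi>_def x_def\<close>)
    qed
  qed
  moreover have "\<Phi> 1 (\<pi> (q 1)) = A (q 1)" using g[OF qX[of 1] , of "q 1"] r(1)[OF qX[of 1]] by (simp add: \<Phi>_def)
  ultimately show thesis using that by (simp add: pathfinish_def)
qed

lemma continued_value_push:
  assumes "open X" "\<pi> holomorphic_on X" "\<And>x. x \<in> X \<Longrightarrow> deriv \<pi> x \<noteq> 0" "A holomorphic_on X"
    and "path q" "path_image q \<subseteq> X" "\<forall>\<^sub>F s in nhds (pathstart q). f (\<pi> s) = A s"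
  shows "continuable_along (\<pi> \<circ> q) f" "continued_value (\<pi> \<circ> q) f = A (pathfinish q)"
proof -
  obtain \<Phi> where \<Phi>: "continuation_along (\<pi> \<circ> q) f \<Phi>" "\<Phi> 1 (\<pi> (pathfinish q)) = A (pathfinish q)"
    by (rule continuation_push[OF assms])
  then show "continuable_along (\<pi> \<circ> q) f" by (auto simp: continuable_along_def)
  have "path (\<pi> \<circ> q)"
    by (rule path_continuous_image) (use assms in \<open>auto intro: holomorphic_on_imp_continuous_on holomorphic_on_subset\<close>)
  from continued_value_eq[OF this \<Phi>(1)] \<Phi>(2)
  show "continued_value (\<pi> \<circ> q) f = A (pathfinish q)" by (simp add: pathfinish_def)
qed

subsection \<open>The principal star\<close>

text \<open>Holomorphy is local in the end point, so the segments from one base point already give a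
  single function on all of X.\<close>

lemma develop_on_convex:
  assumes X: "open X" and s0: "s0 \<in> X" and g: "g analytic_on {s0}"
    and cont: "\<And>s. s \<in> X \<Longrightarrow> continuable_along (linepath s0 s) g"
  shows "(\<lambda>s. continued_value (linepath s0 s) g) holomorphic_on X"
    and "\<forall>\<^sub>F s in nhds s0. continued_value (linepath s0 s) g = g s"
proof -
  have "(\<lambda>s. continued_value (linepath s0 s) g) field_differentiable at s" if s: "s \<in> X" for s
  proof -
    obtain r where "0 < r" "(\<lambda>s. continued_value (linepath s0 s) g) holomorphic_on ball s r"
      using continued_value_linepath_holomorphic[OF cont[OF s]] by blast
    then show ?thesis using holomorphic_on_imp_differentiable_at[of _ "ball s r" s] by simp
  qed
  then show "(\<lambda>s. continued_value (linepath s0 s) g) holomorphic_on X"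
    by (auto simp: holomorphic_on_def field_differentiable_at_within)
  show "\<forall>\<^sub>F s in nhds s0. continued_value (linepath s0 s) g = g s"
    by (rule continued_value_linepath_start(2)[OF g])
qed

lemma continuation_along_segment_initial:
  assumes "continuable_along (linepath a z) f" "0 \<le> t" "t \<le> 1"
  shows "continuable_along (linepath a (linepath a z t)) f"
proof -
  obtain \<Phi> where \<Phi>: "continuation_along (linepath a z) f \<Phi>" using assms(1) by (auto simp: continuable_along_def)
  have eq: "linepath a (linepath a z t) s = linepath a z (t * s)" for s
    by (simp add: linepath_def scaleR_conv_of_real algebra_simps)
  have ts: "t * s \<in> {0..1}" if "s \<in> {0..1}" for s using that assms by (auto intro: mult_le_one)
  have "continuation_along (linepath a (linepath a z t)) f (\<lambda>s. \<Phi> (t * s))"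
    unfolding continuation_along_def
  proof (intro conjI ballI)
    show "\<forall>\<^sub>F z' in nhds (pathstart (linepath a (linepath a z t))). \<Phi> (t * 0) z' = f z'"
      using \<Phi> by (simp add: continuation_along_def)
    fix s :: real assume s: "s \<in> {0..1}"
    show "\<Phi> (t * s) analytic_on {linepath a (linepath a z t) s}"
      using \<Phi> ts[OF s] unfolding eq by (simp add: continuation_along_def)
    have ev: "\<forall>\<^sub>F s' in at (t * s) within {0..1}. \<forall>\<^sub>F w in nhds (linepath a z s'). \<Phi> s' w = \<Phi> (t * s) w"
      using \<Phi> ts[OF s] by (simp add: continuation_along_def)
    then obtain V where V: "open V" "t * s \<in> V" "\<And>s'. s' \<in> V \<Longrightarrow> s' \<in> {0..1} \<Longrightarrow> s' \<noteq> t * s \<Longrightarrow>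
        \<forall>\<^sub>F w in nhds (linepath a z s'). \<Phi> s' w = \<Phi> (t * s) w"
      by (auto simp: eventually_at_topological)
    have "((\<lambda>s'. t * s') \<longlongrightarrow> t * s) (at s within {0..1})" by (intro tendsto_intros)
    then have "\<forall>\<^sub>F s' in at s within {0..1}. t * s' \<in> V" by (rule topological_tendstoD[OF _ V(1,2)])
    moreover have "\<forall>\<^sub>F s' in at s within {0..1}. s' \<in> {0..1}" by (simp add: eventually_at_filter)
    ultimately show "\<forall>\<^sub>F s' in at s within {0..1}. \<forall>\<^sub>F w in nhds (linepath a (linepath a z t) s').
        \<Phi> (t * s') w = \<Phi> (t * s) w"
    proof eventually_elim
      case (elim s')
      then show ?case unfolding eq using V(3)[of "t * s'"] ts[of s'] by (cases "t * s' = t * s") auto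
    qed
  qed
  then show ?thesis by (auto simp: continuable_along_def)
qed

lemma open_principal_star: "open (principal_star F)"
  unfolding open_contains_ball
proof
  fix z assume "z \<in> principal_star F"
  then have "continuable_along (linepath 0 z) (eval_fps F)" by (simp add: principal_star_def)
  then obtain r where "0 < r" "\<And>y. y \<in> ball z r \<Longrightarrow> continuable_along (linepath 0 y) (eval_fps F)"
    using continued_value_linepath_holomorphic by blast
  then show "\<exists>e>0. ball z e \<subseteq> principal_star F" by (auto simp: principal_star_def)
qed

lemma holomorphic_principal_branch: "principal_branch F holomorphic_on principal_star F"
proof -
  have "principal_branch F field_differentiable at s" if s: "s \<in> principal_star F" for s
  proof -
    obtain r where "0 < r" "(\<lambda>s. continued_value (linepath 0 s) (eval_fps F)) holomorphic_on ball s r"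
      using continued_value_linepath_holomorphic s unfolding principal_star_def by blast
    then show ?thesis using holomorphic_on_imp_differentiable_at[of _ "ball s r" s]
      by (simp add: principal_branch_def[abs_def])
  qed
  then show ?thesis by (auto simp: holomorphic_on_def field_differentiable_at_within)
qed

lemma principal_star_scale:
  assumes "z \<in> principal_star F" "0 \<le> t" "t \<le> 1"
  shows "of_real t * z \<in> principal_star F"
proof -
  have "linepath 0 z t = of_real t * z" by (simp add: linepath_def scaleR_conv_of_real)
  then show ?thesis using continuation_along_segment_initial[of 0 z _ t] assms by (simp add: principal_star_def)
qed

lemma singularity_not_in_star: "\<alpha> \<in> singularities F \<Longrightarrow> \<alpha> \<notin> principal_star F"
proof
  assume \<alpha>: "\<alpha> \<in> singularities F" "\<alpha> \<in> principal_star F"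
  then obtain r where r: "0 < r" "ball \<alpha> r \<subseteq> principal_star F"
    using open_principal_star open_contains_ball by blast
  have "principal_branch F holomorphic_on ball \<alpha> r"
    by (rule holomorphic_on_subset[OF holomorphic_principal_branch r(2)])
  then show False using \<alpha>(1) r(1) by (force simp: singularities_def)
qed

lemma closed_singularities: "closed (singularities F)"
  unfolding closed_sequential_limits
proof (intro allI impI, elim conjE)
  fix x l assume x: "\<forall>n. x n \<in> singularities F" and l: "x \<longlonglongrightarrow> l"
  show "l \<in> singularities F"
    unfolding singularities_def
  proof (intro CollectI allI impI)
    fix r :: real assume r: "0 < r"
    then have "\<forall>\<^sub>F n in sequentially. dist (x n) l < r / 2" by (intro tendstoD[OF l]) simp
    then obtain n where n: "dist (x n) l < r / 2" unfolding eventually_sequentially by blast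
    have sub: "ball (x n) (r / 2) \<subseteq> ball l r"
      by (rule ball_subset_ball_iff[THEN iffD2]) (use n r in auto)
    obtain b where b: "b \<in> principal_star F \<inter> ball (x n) (r / 2)"
      "\<not> (\<exists>f. f holomorphic_on ball (x n) (r / 2) \<and> (\<forall>\<^sub>F z in nhds b. f z = principal_branch F z))"
      using x[rule_format, of n, unfolded singularities_def mem_Collect_eq, rule_format, of "r / 2"] r by auto
    show "\<exists>b\<in>principal_star F \<inter> ball l r. \<not> (\<exists>f. f holomorphic_on ball l r \<and> (\<forall>\<^sub>F z in nhds b. f z = principal_branch F z))"
    proof (rule bexI[of _ b])
      show "b \<in> principal_star F \<inter> ball l r" using b(1) sub by auto
      show "\<not> (\<exists>f. f holomorphic_on ball l r \<and> (\<forall>\<^sub>F z in nhds b. f z = principal_branch F z))"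
        using b(2) holomorphic_on_subset[OF _ sub] by blast
    qed
  qed
qed

text \<open>A second singularity \<alpha>' would be the centre of a disc inside the punctured disc
  about \<alpha>. There every germ over a star point continues along all segments, hence to a
  function on the whole disc, and \<alpha>' would be regular.\<close>

lemma isolated_at_imp_no_other:
  assumes "isolated_at F \<alpha>"
  obtains r where "0 < r" "\<And>\<alpha>'. \<alpha>' \<in> ball \<alpha> r \<Longrightarrow> \<alpha>' \<in> singularities F \<Longrightarrow> \<alpha>' = \<alpha>"
proof -
  obtain r where r: "0 < r" and cont: "\<And>b p. b \<in> principal_star F \<Longrightarrow> b \<in> ball \<alpha> r - {\<alpha>} \<Longrightarrow> path p \<Longrightarrow>
      pathstart p = b \<Longrightarrow> path_image p \<subseteq> ball \<alpha> r - {\<alpha>} \<Longrightarrow> continuable_along p (principal_branch F)"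
    using assms unfolding isolated_at_def by blast
  show thesis
  proof (rule that[OF r], rule ccontr)
    fix \<alpha>' assume \<alpha>': "\<alpha>' \<in> ball \<alpha> r" "\<alpha>' \<in> singularities F" "\<alpha>' \<noteq> \<alpha>"
    have "open (ball \<alpha> r - {\<alpha>})" by (rule open_delete) simp
    then obtain \<rho> where \<rho>: "0 < \<rho>" "ball \<alpha>' \<rho> \<subseteq> ball \<alpha> r - {\<alpha>}"
      using \<alpha>' by (meson DiffI open_contains_ball singletonD)
    obtain b where b: "b \<in> principal_star F \<inter> ball \<alpha>' \<rho>"
      "\<not> (\<exists>f. f holomorphic_on ball \<alpha>' \<rho> \<and> (\<forall>\<^sub>F z in nhds b. f z = principal_branch F z))"
      using \<alpha>'(2) \<rho>(1) unfolding singularities_def by blast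
    have bs: "b \<in> principal_star F" "b \<in> ball \<alpha>' \<rho>" using b by auto
    have an: "principal_branch F analytic_on {b}"
      by (rule analytic_on_singleton[OF holomorphic_principal_branch open_principal_star bs(1)])
    have "continuable_along (linepath b s) (principal_branch F)" if "s \<in> ball \<alpha>' \<rho>" for s
    proof (rule cont[OF bs(1)])
      have "closed_segment b s \<subseteq> ball \<alpha>' \<rho>" by (rule closed_segment_subset[OF bs(2) that]) simp
      then show "path_image (linepath b s) \<subseteq> ball \<alpha> r - {\<alpha>}" using \<rho>(2) by auto
    qed (use bs \<rho> in auto)
    from develop_on_convex[OF open_ball bs(2) an this] b(2) show False by blast
  qed
qed

lemma analytic_eval_fps_0:
  assumes "fps_conv_radius F > 0"
  shows "eval_fps F analytic_on {0}"
proof (rule analytic_on_singleton)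
  show "eval_fps F holomorphic_on eball 0 (fps_conv_radius F)" by (intro holomorphic_intros) auto
qed (use assms in \<open>auto simp: zero_ereal_def in_eball_iff\<close>)

lemma zero_in_principal_star: "fps_conv_radius F > 0 \<Longrightarrow> 0 \<in> principal_star F"
  using continued_value_linepath_start(1)[OF analytic_eval_fps_0] by (simp add: principal_star_def)

lemma principal_branch_near_0:
  "fps_conv_radius F > 0 \<Longrightarrow> \<forall>\<^sub>F z in nhds 0. principal_branch F z = eval_fps F z"
  using continued_value_linepath_start(2)[OF analytic_eval_fps_0] by (simp add: principal_branch_def[abs_def])

text \<open>The first point w of the ray that leaves the star is singular: otherwise the branch at a
  slightly earlier point extends to a disc about w, and switching to this extension continues the
  germ as far as w.\<close>

lemma first_singularity:
  assumes R: "fps_conv_radius F > 0" and u: "u \<notin> principal_star F"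
  obtains t where "0 < t" "t \<le> 1" "of_real t * u \<in> singularities F"
proof -
  note 0 = zero_in_principal_star[OF R] and near0 = principal_branch_near_0[OF R]
  define T where "T = {t. 0 \<le> t \<and> t \<le> 1 \<and> of_real t * u \<notin> principal_star F}"
  have "1 \<in> T" using u by (simp add: T_def)
  have "closed T"
  proof -
    have "closed ((\<lambda>t. of_real t * u) -` (- principal_star F))"
      by (intro continuous_closed_vimage closed_Compl open_principal_star continuous_intros)
    moreover have "T = {0..1} \<inter> ((\<lambda>t. of_real t * u) -` (- principal_star F))" by (auto simp: T_def)
    ultimately show ?thesis by auto
  qed
  have "bdd_below T" by (auto simp: T_def bdd_below_def)
  define t where "t = Inf T"
  have tT: "t \<in> T" unfolding t_def by (rule closed_contains_Inf) (use \<open>1 \<in> T\<close> \<open>bdd_below T\<close> \<open>closed T\<close> in auto)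
  have t: "0 < t" "t \<le> 1" "of_real t * u \<notin> principal_star F"
    using tT 0 by (cases "t = 0", auto simp: T_def)+
  have below: "of_real s * u \<in> principal_star F" if "0 \<le> s" "s < t" for s
    using cInf_lower[of s T] that \<open>bdd_below T\<close> t by (force simp: T_def t_def)
  define w where "w = of_real t * u"
  have "w \<noteq> 0" using t 0 by (auto simp: w_def)
  have "w \<in> singularities F"
  proof (rule ccontr)
    assume "w \<notin> singularities F"
    then obtain r where r: "0 < r" "\<And>b. b \<in> principal_star F \<inter> ball w r \<Longrightarrow>
        \<exists>f. f holomorphic_on ball w r \<and> (\<forall>\<^sub>F z in nhds b. f z = principal_branch F z)"
      unfolding singularities_def by blast
    \<comment> \<open>The rest of the segment, from s w to w, lies within r/2 of w; the maximum with
      1/2 keeps s positive.\<close>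
    define s where "s = max (1 / 2) (1 - r / (2 * norm w))"
    have s: "0 < s" "s < 1" using r(1) \<open>w \<noteq> 0\<close> by (auto simp: s_def)
    have close: "of_real x * w \<in> ball w r" if "s \<le> x" "x \<le> 1" for x
    proof -
      have "w - of_real x * w = of_real (1 - x) * w" by (simp add: left_diff_distrib)
      then have "dist w (of_real x * w) = (1 - x) * norm w"
        using that by (simp add: dist_norm norm_mult del: of_real_diff)
      also have "\<dots> \<le> (r / (2 * norm w)) * norm w"
        by (rule mult_right_mono) (use that in \<open>auto simp: s_def\<close>)
      also have "\<dots> < r" using r(1) \<open>w \<noteq> 0\<close> by simp
      finally show ?thesis by simp
    qed
    have star: "of_real x * w \<in> principal_star F" if "0 \<le> x" "x < 1" for x
      using below[of "x * t"] that t by (simp add: w_def mult.assoc)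
    obtain f where f: "f holomorphic_on ball w r" "\<forall>\<^sub>F z in nhds (of_real s * w). f z = principal_branch F z"
      using r(2)[of "of_real s * w"] close[of s] star[of s] s by auto
    obtain V where V: "open V" "of_real s * w \<in> V" "\<And>z. z \<in> V \<Longrightarrow> f z = principal_branch F z"
      using f(2) by (auto simp: eventually_nhds)
    define \<Phi> where "\<Phi> x = (if x < s then principal_branch F else f)" for x :: real
    have lp: "linepath 0 w x = of_real x * w" for x by (simp add: linepath_def scaleR_conv_of_real)
    have "continuation_along (linepath 0 w) (eval_fps F) \<Phi>"
      unfolding continuation_along_def
    proof (intro conjI ballI)
      show "\<forall>\<^sub>F z in nhds (pathstart (linepath 0 w)). \<Phi> 0 z = eval_fps F z"
        using near0 s by (simp add: \<Phi>_def)
      fix x :: real assume x: "x \<in> {0..1}"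
      show "\<Phi> x analytic_on {linepath 0 w x}"
      proof (cases "x < s")
        case True
        then show ?thesis
          using analytic_on_singleton[OF holomorphic_principal_branch open_principal_star star[of x]] x s
          unfolding lp by (simp add: \<Phi>_def)
      next
        case False
        then show ?thesis
          using analytic_on_singleton[OF f(1) open_ball close[of x]] x unfolding lp by (simp add: \<Phi>_def)
      qed
      show "\<forall>\<^sub>F y in at x within {0..1}. \<forall>\<^sub>F z in nhds (linepath 0 w y). \<Phi> y z = \<Phi> x z"
      proof (cases x s rule: linorder_cases)
        case less
        have "\<forall>\<^sub>F y in at x within {0..1}. y < s" by (rule order_tendstoD(2)[OF tendsto_ident_at less])
        then show ?thesis by eventually_elim (use less in \<open>simp add: \<Phi>_def\<close>)
      next
        case greater
        have "\<forall>\<^sub>F y in at x within {0..1}. s < y" by (rule order_tendstoD(1)[OF tendsto_ident_at greater])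
        then show ?thesis by eventually_elim (use greater in \<open>simp add: \<Phi>_def\<close>)
      next
        case equal
        have "((\<lambda>y. of_real y * w) \<longlongrightarrow> of_real s * w) (at x within {0..1})"
          unfolding equal by (intro tendsto_intros)
        then have "\<forall>\<^sub>F y in at x within {0..1}. of_real y * w \<in> V"
          by (rule topological_tendstoD[OF _ V(1,2)])
        then show ?thesis
        proof eventually_elim
          case (elim y)
          have "\<forall>\<^sub>F z in nhds (of_real y * w). z \<in> V" by (rule eventually_nhds_in_open[OF V(1) elim])
          then show ?case unfolding lp by eventually_elim (use V(3) in \<open>simp add: \<Phi>_def\<close>)
        qed
      qed
    qed
    then have "w \<in> principal_star F" by (auto simp: principal_star_def continuable_along_def)
    then show False using t(3) by (simp add: w_def)
  qed
  then show thesis using that t by (simp add: w_def)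
qed

subsection \<open>Branches at a singularity\<close>

lemma less_ln_iff: "0 < y \<Longrightarrow> x < ln y \<longleftrightarrow> exp x < (y::real)"
  using exp_less_cancel_iff[of x "ln y"] by simp

text \<open>The principal branch next to \<alpha>, read from the side \<sigma> of the ray and
  continued to a logarithmic half plane. It is meant for regular \<alpha> as well: the last clause
  makes \<open>jump A\<close> vanish there, so the contour argument can treat all points
  alike.\<close>

definition side_branch :: "complex fps \<Rightarrow> real \<Rightarrow> complex \<Rightarrow> real \<Rightarrow> (complex \<Rightarrow> complex) \<Rightarrow> bool" where
  "side_branch F \<sigma> \<alpha> c A \<longleftrightarrow> integrable_branch c A \<and>
     (\<forall>s. Re s < c \<longrightarrow> 0 < \<sigma> * Im s \<longrightarrow> \<sigma> * Im s < pi \<longrightarrow>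
        \<alpha> * (1 + exp s) \<in> principal_star F \<and> principal_branch F (\<alpha> * (1 + exp s)) = A s) \<and>
     (\<alpha> \<notin> singularities F \<longrightarrow> (\<forall>s. Re s < c \<longrightarrow> A (s + 2 * of_real pi * \<i>) = A s))"

lemma integrable_branch_mono:
  assumes "integrable_branch c A" "c' \<le> c" shows "integrable_branch c' A"
  unfolding integrable_branch_def
proof (intro conjI allI impI)
  show "A holomorphic_on {s. Re s < c'}"
    by (rule holomorphic_on_subset[OF integrable_branch_holo[OF assms(1)]]) (use assms(2) in auto)
  fix M e :: real assume "0 < e"
  then obtain R where "\<And>s. Re s < R \<Longrightarrow> \<bar>Im s\<bar> \<le> M \<Longrightarrow> norm (exp s * A s) \<le> e"
    using integrable_branch_decay[OF assms(1)] by blast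
  then show "\<exists>R. \<forall>s. Re s < R \<longrightarrow> Re s < c' \<longrightarrow> \<bar>Im s\<bar> \<le> M \<longrightarrow> norm (exp s * A s) \<le> e" by blast
qed

lemma side_branch_mono: "side_branch F \<sigma> \<alpha> c A \<Longrightarrow> c' \<le> c \<Longrightarrow> side_branch F \<sigma> \<alpha> c' A"
  unfolding side_branch_def using integrable_branch_mono by fastforce

lemma sign_Im_exp:
  assumes "\<sigma> = 1 \<or> \<sigma> = (-1::real)" "0 < \<sigma> * Im s" "\<sigma> * Im s < pi"
  shows "0 < \<sigma> * Im (exp s)"
proof -
  have "0 < sin (\<sigma> * Im s)" by (rule sin_gt_zero[OF assms(2,3)])
  moreover have "sin (\<sigma> * Im s) = \<sigma> * sin (Im s)" using assms(1) by auto
  ultimately have "0 < exp (Re s) * (\<sigma> * sin (Im s))" by simp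
  then show ?thesis by (simp add: Im_exp mult.left_commute)
qed

lemma halfplane_quotient:
  assumes "\<sigma> = 1 \<or> \<sigma> = (-1::real)"
  shows "convex {u. 0 < \<sigma> * Im (u / \<alpha>)}" "open {u. 0 < \<sigma> * Im (u / \<alpha>)}"
proof -
  have "linear (\<lambda>u. u / \<alpha>)" by (rule bounded_linear.linear[OF bounded_linear_divide])
  moreover have "convex {z. 0 < \<sigma> * Im z}"
    using assms convex_halfspace_Im_gt[of 0] convex_halfspace_Im_lt[of 0] by auto
  ultimately have "convex ((\<lambda>u. u / \<alpha>) -` {z. 0 < \<sigma> * Im z})" by (rule convex_linear_vimage)
  then show "convex {u. 0 < \<sigma> * Im (u / \<alpha>)}" by (simp add: vimage_def)
  have "continuous_on UNIV (\<lambda>u. \<sigma> * Im (u / \<alpha>))"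
    by (cases "\<alpha> = 0") (auto intro!: continuous_intros)
  then show "open {u. 0 < \<sigma> * Im (u / \<alpha>)}" by (intro open_Collect_less continuous_on_const)
qed

locale isolated_germ =
  fixes F :: "complex fps"
  assumes radius: "fps_conv_radius F > 0"
    and isolated: "\<And>\<alpha>. \<alpha> \<in> singularities F \<Longrightarrow> isolated_at F \<alpha> \<and> integrable_at F \<alpha>"
begin

text \<open>The set of singularities is closed, so an accumulation point would be a singularity that
  is not isolated.\<close>

lemma finite_singularities: "finite (singularities F \<inter> cball 0 M)"
proof (rule ccontr)
  assume "infinite (singularities F \<inter> cball 0 M)"
  then obtain x where x: "x islimpt (singularities F \<inter> cball 0 M)"
    using Heine_Borel_imp_Bolzano_Weierstrass[OF compact_cball] by (metis inf_le2)
  then have lim: "x islimpt singularities F" by (rule islimpt_subset) simp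
  then have "x \<in> singularities F" using closed_singularities closed_limpt by blast
  then obtain r where r: "0 < r" "\<And>y. y \<in> ball x r \<Longrightarrow> y \<in> singularities F \<Longrightarrow> y = x"
    using isolated_at_imp_no_other isolated by blast
  then show False using lim unfolding islimpt_approachable by (metis dist_commute mem_ball)
qed

lemma zero_not_singularity: "0 \<notin> singularities F"
  using zero_in_principal_star[OF radius] singularity_not_in_star by blast

text \<open>A point outside of the star has a singularity on its segment, with the same argument and
  no larger modulus. Only finitely many singularities have modulus at most e^M, and \<eta> is the
  least nonzero angle between them and the ray; the cap at 1 keeps the principal logarithm
  unambiguous.\<close>

lemma ray_sector:
  obtains \<eta> where "0 < \<eta>" "\<eta> \<le> 1"
    "\<And>x. Re x < M \<Longrightarrow> Im x \<noteq> \<theta> \<Longrightarrow> \<bar>Im x - \<theta>\<bar> < \<eta> \<Longrightarrow> exp x \<in> principal_star F"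
proof -
  \<comment> \<open>Deviation of the argument of v from \<theta>, taken modulo 2 pi by the principal
    logarithm.\<close>
  define angle where "angle v = \<bar>Im (Ln (v * exp (- \<i> * of_real \<theta>)))\<bar>" for v
  define V where "V = {v \<in> singularities F \<inter> cball 0 (exp M). angle v \<noteq> 0}"
  have "finite V" unfolding V_def by (rule finite_subset[OF _ finite_singularities[of "exp M"]]) auto
  define \<eta> where "\<eta> = Min (insert 1 (angle ` V))"
  have \<eta>: "0 < \<eta>" "\<eta> \<le> 1" "\<And>v. v \<in> V \<Longrightarrow> \<eta> \<le> angle v"
    using \<open>finite V\<close> by (auto simp: \<eta>_def Min_gr_iff V_def angle_def)
  show thesis
  proof (rule that[OF \<eta>(1,2)], rule ccontr)
    fix x assume x: "Re x < M" "Im x \<noteq> \<theta>" "\<bar>Im x - \<theta>\<bar> < \<eta>" "exp x \<notin> principal_star F"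
    obtain t where t: "0 < t" "t \<le> 1" "of_real t * exp x \<in> singularities F"
      by (rule first_singularity[OF radius x(4)])
    define v where "v = of_real t * exp x"
    have "v * exp (- \<i> * of_real \<theta>) = exp (of_real (ln t) + x - \<i> * of_real \<theta>)"
      using t(1) by (simp add: v_def exp_add exp_diff exp_minus exp_of_real divide_inverse)
    moreover have "Ln (exp (of_real (ln t) + x - \<i> * of_real \<theta>)) = of_real (ln t) + x - \<i> * of_real \<theta>"
      by (rule Ln_exp) (use x(3) \<eta>(2) pi_gt3 in auto)
    ultimately have angle: "angle v = \<bar>Im x - \<theta>\<bar>" by (simp add: angle_def)
    have "norm v \<le> 1 * exp (Re x)" using t(1,2) by (simp add: v_def norm_mult mult_right_mono)
    also have "\<dots> \<le> exp M" using x(1) by simp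
    finally have "v \<in> V" using t(3) x(2) angle by (simp add: V_def v_def)
    then show False using \<eta>(3)[of v] angle x(3) by simp
  qed
qed

text \<open>Off the ray the sector suffices; on the ray the point is safe until the next larger
  modulus of a singularity, and finiteness keeps this at a positive distance from m.\<close>

lemma ray_clear:
  assumes clear: "\<And>a. a \<le> m \<Longrightarrow> exp (Complex a \<theta>) \<notin> singularities F"
  obtains \<eta> where "0 < \<eta>" "\<And>x. Re x < m + \<eta> \<Longrightarrow> \<bar>Im x - \<theta>\<bar> < \<eta> \<Longrightarrow> exp x \<in> principal_star F"
proof -
  obtain \<eta>1 where \<eta>1: "0 < \<eta>1" "\<eta>1 \<le> 1"
    "\<And>x. Re x < m + 1 \<Longrightarrow> Im x \<noteq> \<theta> \<Longrightarrow> \<bar>Im x - \<theta>\<bar> < \<eta>1 \<Longrightarrow> exp x \<in> principal_star F"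
    using ray_sector[of "m + 1" \<theta>] by blast
  define V where "V = {v \<in> singularities F \<inter> cball 0 (exp (m + 1)). m < ln (norm v)}"
  have "finite V" unfolding V_def by (rule finite_subset[OF _ finite_singularities[of "exp (m + 1)"]]) auto
  define \<eta> where "\<eta> = Min (insert \<eta>1 ((\<lambda>v. ln (norm v) - m) ` V))"
  have \<eta>: "0 < \<eta>" "\<eta> \<le> \<eta>1" "\<And>v. v \<in> V \<Longrightarrow> \<eta> \<le> ln (norm v) - m"
    using \<open>finite V\<close> \<eta>1 by (auto simp: \<eta>_def Min_gr_iff V_def)
  show thesis
  proof (rule that[OF \<eta>(1)], rule ccontr)
    fix x assume x: "Re x < m + \<eta>" "\<bar>Im x - \<theta>\<bar> < \<eta>" "exp x \<notin> principal_star F"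
    then have Im: "Im x = \<theta>" using \<eta>1(3)[of x] \<eta>(2) \<eta>1(2) by force
    obtain t where t: "0 < t" "t \<le> 1" "of_real t * exp x \<in> singularities F"
      by (rule first_singularity[OF radius x(3)])
    have "of_real t * exp x = exp (of_real (ln t) + x)" using t(1) by (simp add: exp_add exp_of_real)
    also have "of_real (ln t) + x = Complex (ln t + Re x) \<theta>" using Im by (simp add: complex_eq_iff)
    finally have v: "of_real t * exp x = exp (Complex (ln t + Re x) \<theta>)" .
    then have "m < ln t + Re x" using clear t(3) by (metis not_less)
    moreover have "ln t \<le> 0" using t by simp
    ultimately have "exp (Complex (ln t + Re x) \<theta>) \<in> V"
      using t(3) x(1) \<eta>(2) \<eta>1(2) unfolding V_def v by simp
    then have "\<eta> \<le> (ln t + Re x) - m" using \<eta>(3) by fastforce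
    then show False using x(1) \<open>ln t \<le> 0\<close> by linarith
  qed
qed

text \<open>In the coordinate ln u a small disc about \<alpha> lies in a narrow sector about its
  ray, and Im \<zeta> \<noteq> 0 keeps the point off the ray itself.\<close>

lemma half_disc_in_star:
  assumes "\<alpha> \<noteq> 0"
  obtains r where "0 < r" "r \<le> 1 / 2" "\<And>\<zeta>. norm \<zeta> < r \<Longrightarrow> Im \<zeta> \<noteq> 0 \<Longrightarrow> \<alpha> * (1 + \<zeta>) \<in> principal_star F"
proof -
  define x0 where "x0 = Ln \<alpha>"
  obtain \<eta> where \<eta>: "0 < \<eta>" "\<eta> \<le> 1"
    "\<And>x. Re x < Re x0 + 2 \<Longrightarrow> Im x \<noteq> Im x0 \<Longrightarrow> \<bar>Im x - Im x0\<bar> < \<eta> \<Longrightarrow> exp x \<in> principal_star F"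
    using ray_sector[of "Re x0 + 2" "Im x0"] by blast
  show thesis
  proof (rule that[of "\<eta> / 2"])
    fix \<zeta> :: complex assume \<zeta>: "norm \<zeta> < \<eta> / 2" "Im \<zeta> \<noteq> 0"
    have n1: "norm \<zeta> < 1 / 2" using \<zeta>(1) \<eta> by simp
    have nz: "1 + \<zeta> \<noteq> 0" using \<zeta>(2) by (auto simp: complex_eq_iff)
    have nL: "norm (Ln (1 + \<zeta>)) \<le> 2 * norm \<zeta>" by (rule norm_Ln_le[OF n1])
    have "Im (Ln (1 + \<zeta>)) \<noteq> 0" using Im_Ln_eq_0[OF nz] \<zeta>(2) by simp
    then have "exp (x0 + Ln (1 + \<zeta>)) \<in> principal_star F"
      using abs_Re_le_cmod[of "Ln (1 + \<zeta>)"] abs_Im_le_cmod[of "Ln (1 + \<zeta>)"] nL \<zeta>(1) \<eta>(2)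
      by (intro \<eta>(3)) auto
    then show "\<alpha> * (1 + \<zeta>) \<in> principal_star F" using assms nz by (simp add: x0_def exp_add)
  qed (use \<eta> in auto)
qed

text \<open>Regularity extends each germ near \<alpha>, but the two sides may need different
  extensions when \<alpha> lies behind another singularity. One half disc is convex and inside the
  star, so on it a single extension agrees with the principal branch throughout.\<close>

lemma regular_side:
  assumes \<alpha>: "\<alpha> \<noteq> 0" "\<alpha> \<notin> singularities F" and \<sigma>: "\<sigma> = 1 \<or> \<sigma> = (-1::real)"
  obtains r f where "0 < r" "f holomorphic_on ball \<alpha> r"
    "\<And>u. u \<in> ball \<alpha> r \<Longrightarrow> 0 < \<sigma> * Im (u / \<alpha>) \<Longrightarrow> u \<in> principal_star F \<and> principal_branch F u = f u"
proof -
  obtain r0 where r0: "0 < r0" "r0 \<le> 1 / 2"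
      "\<And>\<zeta>. norm \<zeta> < r0 \<Longrightarrow> Im \<zeta> \<noteq> 0 \<Longrightarrow> \<alpha> * (1 + \<zeta>) \<in> principal_star F"
    using half_disc_in_star[OF \<alpha>(1)] by blast
  obtain r1 where r1: "0 < r1" "\<And>b. b \<in> principal_star F \<inter> ball \<alpha> r1 \<Longrightarrow>
      \<exists>f. f holomorphic_on ball \<alpha> r1 \<and> (\<forall>\<^sub>F z in nhds b. f z = principal_branch F z)"
    using \<alpha>(2) unfolding singularities_def by blast
  define r where "r = min r1 (r0 * norm \<alpha>)"
  have r: "0 < r" using r0 r1 \<alpha> by (simp add: r_def)
  define H where "H = ball \<alpha> r \<inter> {u. 0 < \<sigma> * Im (u / \<alpha>)}"
  have H: "open H" "convex H" unfolding H_def using halfplane_quotient[OF \<sigma>] by (auto intro: convex_Int open_Int)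
  have Hstar: "u \<in> principal_star F" if "u \<in> H" for u
  proof -
    have "norm (u / \<alpha> - 1) = norm (u - \<alpha>) / norm \<alpha>"
      using \<alpha>(1) by (simp add: norm_divide[symmetric] diff_divide_distrib)
    also have "\<dots> < r0" using that \<alpha>(1) by (simp add: H_def r_def dist_norm norm_minus_commute divide_simps)
    finally have "\<alpha> * (1 + (u / \<alpha> - 1)) \<in> principal_star F"
      by (rule r0(3)) (use that in \<open>auto simp: H_def\<close>)
    then show ?thesis using \<alpha>(1) by simp
  qed
  \<comment> \<open>A point of the half disc, perpendicular to the ray at \<alpha> and at half the
    radius.\<close>
  define b where "b = \<alpha> * (1 + of_real (r / (2 * norm \<alpha>)) * \<i> * of_real \<sigma>)"
  have bH: "b \<in> H"
  proof -
    have "\<alpha> - b = - (\<alpha> * (of_real (r / (2 * norm \<alpha>)) * \<i> * of_real \<sigma>))" by (simp add: b_def algebra_simps)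
    then have "dist \<alpha> b = norm \<alpha> * (r / (2 * norm \<alpha>))"
      using \<sigma> r by (auto simp: dist_norm norm_mult norm_divide simp del: of_real_divide)
    moreover have "b / \<alpha> = 1 + of_real (r / (2 * norm \<alpha>)) * \<i> * of_real \<sigma>" using \<alpha>(1) by (simp add: b_def)
    ultimately show ?thesis using \<alpha>(1) r \<sigma> by (auto simp: H_def simp del: of_real_divide)
  qed
  obtain f where f: "f holomorphic_on ball \<alpha> r1" "\<forall>\<^sub>F z in nhds b. f z = principal_branch F z"
    using r1(2)[of b] bH Hstar by (auto simp: H_def r_def)
  obtain V where V: "open V" "b \<in> V" "\<And>z. z \<in> V \<Longrightarrow> f z = principal_branch F z"
    using f(2) by (auto simp: eventually_nhds)
  have HB: "H \<subseteq> ball \<alpha> r1" by (auto simp: H_def r_def)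
  have "f u = principal_branch F u" if "u \<in> H" for u
    by (rule analytic_continuation_open[of "V \<inter> H" H f "principal_branch F" u])
      (use V H bH that Hstar HB in \<open>auto intro: convex_connected holomorphic_on_subset[OF f(1)]
        holomorphic_on_subset[OF holomorphic_principal_branch]\<close>)
  then show thesis
    using Hstar r by (intro that[of r f]) (auto intro: holomorphic_on_subset[OF f(1)] simp: H_def r_def)
qed

lemma side_branch_exists_regular:
  assumes \<alpha>: "\<alpha> \<noteq> 0" "\<alpha> \<notin> singularities F" and \<sigma>: "\<sigma> = 1 \<or> \<sigma> = (-1::real)"
  obtains c A where "side_branch F \<sigma> \<alpha> c A"
proof -
  obtain r f where r: "0 < r" "f holomorphic_on ball \<alpha> r"
    "\<And>u. u \<in> ball \<alpha> r \<Longrightarrow> 0 < \<sigma> * Im (u / \<alpha>) \<Longrightarrow> u \<in> principal_star F \<and> principal_branch F u = f u"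
    using regular_side[OF assms] by blast
  define c where "c = ln (r / (2 * norm \<alpha>))"
  define A where "A s = f (\<alpha> * (1 + exp s))" for s
  have in_ball: "\<alpha> * (1 + exp s) \<in> cball \<alpha> (r / 2)" if "Re s < c" for s
  proof -
    have "exp (Re s) < r / (2 * norm \<alpha>)" using that r(1) \<alpha>(1) unfolding c_def by (subst (asm) less_ln_iff) auto
    then have "norm \<alpha> * exp (Re s) \<le> r / 2" using \<alpha>(1) by (simp add: field_simps)
    moreover have "\<alpha> - \<alpha> * (1 + exp s) = - (\<alpha> * exp s)" by (simp add: algebra_simps)
    ultimately show ?thesis by (simp add: dist_norm norm_mult)
  qed
  have cb: "cball \<alpha> (r / 2) \<subseteq> ball \<alpha> r" using r(1) by auto
  have "compact (f ` cball \<alpha> (r / 2))"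
    by (intro compact_continuous_image holomorphic_on_imp_continuous_on holomorphic_on_subset[OF r(2) cb] compact_cball)
  then obtain K where K: "0 < K" "\<And>u. u \<in> cball \<alpha> (r / 2) \<Longrightarrow> norm (f u) \<le> K"
    by (metis bounded_pos compact_imp_bounded imageI)
  have "(f \<circ> (\<lambda>s. \<alpha> * (1 + exp s))) holomorphic_on {s. Re s < c}"
    by (rule holomorphic_on_compose_gen[OF _ r(2)]) (use in_ball cb in \<open>auto intro!: holomorphic_intros\<close>)
  then have "integrable_branch c A"
    unfolding integrable_branch_def
  proof (intro conjI allI impI)
    fix M e :: real assume e: "0 < e"
    show "\<exists>R. \<forall>s. Re s < R \<longrightarrow> Re s < c \<longrightarrow> \<bar>Im s\<bar> \<le> M \<longrightarrow> norm (exp s * A s) \<le> e"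
    proof (intro exI[of _ "ln (e / K)"] allI impI)
      fix s assume s: "Re s < ln (e / K)" "Re s < c"
      have "exp (Re s) < e / K" using s(1) e K by (subst (asm) less_ln_iff) auto
      then have "exp (Re s) * norm (A s) \<le> (e / K) * K"
        unfolding A_def by (intro mult_mono K in_ball s) (use e K in auto)
      then show "norm (exp s * A s) \<le> e" using K by (simp add: norm_mult)
    qed
  qed (simp add: o_def A_def[abs_def])
  moreover have "\<alpha> * (1 + exp s) \<in> principal_star F \<and> principal_branch F (\<alpha> * (1 + exp s)) = A s"
    if s: "Re s < c" "0 < \<sigma> * Im s" "\<sigma> * Im s < pi" for s
    unfolding A_def by (rule r(3)) (use in_ball[OF s(1)] cb sign_Im_exp[OF \<sigma> s(2,3)] \<alpha>(1) in auto)
  ultimately have "side_branch F \<sigma> \<alpha> c A"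
    unfolding side_branch_def by (auto simp: A_def)
  then show thesis by (rule that)
qed

text \<open>The branch pulled back to the half plane continues along all segments, because their
  images avoid \<alpha>; so it develops into one function A, equal to the pullback on the strip over
  the half disc. Turning through a bounded angle becomes bounded Im s, which turns the Stolz limit
  into the decay condition.\<close>

lemma side_branch_exists_singular:
  assumes \<alpha>: "\<alpha> \<in> singularities F" and \<sigma>: "\<sigma> = 1 \<or> \<sigma> = (-1::real)"
  obtains c A where "side_branch F \<sigma> \<alpha> c A"
proof -
  have \<alpha>0: "\<alpha> \<noteq> 0" using zero_not_singularity \<alpha> by auto
  obtain r0 where r0: "0 < r0" "r0 \<le> 1 / 2"
      "\<And>\<zeta>. norm \<zeta> < r0 \<Longrightarrow> Im \<zeta> \<noteq> 0 \<Longrightarrow> \<alpha> * (1 + \<zeta>) \<in> principal_star F"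
    using half_disc_in_star[OF \<alpha>0] by blast
  obtain r1 where r1: "0 < r1" and cont: "\<And>b p. b \<in> principal_star F \<Longrightarrow> b \<in> ball \<alpha> r1 - {\<alpha>} \<Longrightarrow> path p \<Longrightarrow>
      pathstart p = b \<Longrightarrow> path_image p \<subseteq> ball \<alpha> r1 - {\<alpha>} \<Longrightarrow> continuable_along p (principal_branch F)"
    using isolated[OF \<alpha>] unfolding isolated_at_def by blast
  define c where "c = ln (min r0 (r1 / norm \<alpha>))"
  define \<pi> where "\<pi> s = \<alpha> * (1 + exp s)" for s
  define X where "X = {s. Re s < c}"
  have X: "open X" "convex X" unfolding X_def by (simp_all add: open_halfspace_Re_lt convex_halfspace_Re_lt)
  have Xr: "norm (exp s) < r0" "\<pi> s \<in> ball \<alpha> r1 - {\<alpha>}" if "s \<in> X" for s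
  proof -
    have "exp (Re s) < min r0 (r1 / norm \<alpha>)"
      using that r0(1) r1 \<alpha>0 unfolding X_def c_def by (simp add: less_ln_iff)
    then show "norm (exp s) < r0" and "\<pi> s \<in> ball \<alpha> r1 - {\<alpha>}"
      using \<alpha>0 by (auto simp: \<pi>_def dist_norm norm_mult algebra_simps field_simps)
  qed
  have \<pi>: "\<pi> holomorphic_on X" unfolding \<pi>_def by (intro holomorphic_intros)
  have d\<pi>: "deriv \<pi> s \<noteq> 0" for s
  proof -
    have "(\<pi> has_field_derivative \<alpha> * exp s) (at s)" unfolding \<pi>_def by (auto intro!: derivative_eq_intros)
    then show ?thesis using \<alpha>0 by (simp add: DERIV_imp_deriv)
  qed
  define strip where "strip = X \<inter> {s. 0 < \<sigma> * Im s} \<inter> {s. \<sigma> * Im s < pi}"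
  have strip: "open strip" "convex strip"
  proof -
    have "open {s. 0 < \<sigma> * Im s}" "open {s. \<sigma> * Im s < pi}" "convex {s. 0 < \<sigma> * Im s}" "convex {s. \<sigma> * Im s < pi}"
      using \<sigma> convex_halfspace_Im_gt[of 0] convex_halfspace_Im_lt[of 0] convex_halfspace_Im_lt[of pi]
        convex_halfspace_Im_gt[of "-pi"] open_halfspace_Im_gt[of 0] open_halfspace_Im_lt[of 0] open_halfspace_Im_lt[of pi]
        open_halfspace_Im_gt[of "-pi"]
      by (auto simp: minus_less_iff)
    then show "open strip" "convex strip" unfolding strip_def using X by (auto intro: convex_Int open_Int)
  qed
  have \<pi>strip: "\<pi> s \<in> principal_star F" if "s \<in> strip" for s
    unfolding \<pi>_def by (rule r0(3)) (use that Xr sign_Im_exp[OF \<sigma>, of s] in \<open>auto simp: strip_def\<close>)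
  define s0 where "s0 = Complex (c - 1) (\<sigma> * pi / 2)"
  have s0: "s0 \<in> strip" "s0 \<in> X" using \<sigma> by (auto simp: s0_def strip_def X_def)
  define g where "g = principal_branch F \<circ> \<pi>"
  have gstrip: "g holomorphic_on strip"
    unfolding g_def by (rule holomorphic_on_compose_gen[OF _ holomorphic_principal_branch])
      (use \<pi>strip in \<open>auto intro: holomorphic_on_subset[OF \<pi>] simp: strip_def\<close>)
  have gan: "g analytic_on {s0}" by (rule analytic_on_singleton[OF gstrip strip(1) s0(1)])
  have cg: "continuable_along (linepath s0 s) g" if s: "s \<in> X" for s
  proof -
    have seg: "path_image (linepath s0 s) \<subseteq> X" using closed_segment_subset[OF s0(2) s X(2)] by simp
    have "path (\<pi> \<circ> linepath s0 s)"
      by (rule path_continuous_image) (use seg in \<open>auto intro: holomorphic_on_imp_continuous_on holomorphic_on_subset[OF \<pi>]\<close>)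
    then have "continuable_along (\<pi> \<circ> linepath s0 s) (principal_branch F)"
      by (intro cont[of "\<pi> s0"]) (use \<pi>strip s0 Xr seg in \<open>auto simp: pathstart_def path_image_compose linepath_0'\<close>)
    then show ?thesis
      using continuation_pullback[OF path_linepath seg X(1) \<pi>] by (auto simp: continuable_along_def g_def)
  qed
  define A where "A s = continued_value (linepath s0 s) g" for s
  have A: "A holomorphic_on X" "\<forall>\<^sub>F s in nhds s0. A s = g s"
    unfolding A_def by (rule develop_on_convex[OF X(1) s0(2) gan cg]; assumption)+
  obtain V where V: "open V" "s0 \<in> V" "\<And>s. s \<in> V \<Longrightarrow> A s = g s"
    using A(2) by (auto simp: eventually_nhds)
  have Ag: "A s = g s" if "s \<in> strip" for s
    by (rule analytic_continuation_open[of "V \<inter> strip" strip A g s])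
      (use V strip s0 that gstrip in \<open>auto intro: convex_connected holomorphic_on_subset[OF A(1)] simp: strip_def\<close>)
  have "integrable_branch c A"
    unfolding integrable_branch_def
  proof (intro conjI allI impI)
    fix M e :: real assume e: "0 < e"
    define B where "B = \<bar>M\<bar> + pi"
    have "uniform_limit {-B..B} (\<lambda>b \<theta>. (pathfinish (arc_about \<alpha> b \<theta>) - \<alpha>) *
             continued_value (arc_about \<alpha> b \<theta>) (principal_branch F)) (\<lambda>_. 0) (at \<alpha> within principal_star F)"
      using isolated[OF \<alpha>] unfolding integrable_at_def by blast
    then have "\<forall>\<^sub>F b in at \<alpha> within principal_star F. \<forall>\<theta>\<in>{-B..B}. dist ((pathfinish (arc_about \<alpha> b \<theta>) - \<alpha>) *
             continued_value (arc_about \<alpha> b \<theta>) (principal_branch F)) 0 < e * norm \<alpha>"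
      by (rule uniform_limitD) (use e \<alpha>0 in simp)
    then obtain d where d: "0 < d" "\<And>b \<theta>. b \<in> principal_star F \<Longrightarrow> b \<noteq> \<alpha> \<Longrightarrow> dist b \<alpha> < d \<Longrightarrow> \<theta> \<in> {-B..B} \<Longrightarrow>
        norm ((pathfinish (arc_about \<alpha> b \<theta>) - \<alpha>) * continued_value (arc_about \<alpha> b \<theta>) (principal_branch F)) < e * norm \<alpha>"
      unfolding eventually_at dist_0_norm dist_norm[of _ 0] by (auto simp: dist_norm)
    show "\<exists>R. \<forall>s. Re s < R \<longrightarrow> Re s < c \<longrightarrow> \<bar>Im s\<bar> \<le> M \<longrightarrow> norm (exp s * A s) \<le> e"
    proof (intro exI[of _ "ln (d / norm \<alpha>)"] allI impI)
      fix s assume s: "Re s < ln (d / norm \<alpha>)" "Re s < c" "\<bar>Im s\<bar> \<le> M"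
      \<comment> \<open>A point over the same circle as s whose image lies in the star; the arc
        through the angle \<theta> leads from it to s.\<close>
      define sb where "sb = Complex (Re s) (\<sigma> * pi / 2)"
      define \<theta> where "\<theta> = Im s - \<sigma> * pi / 2"
      have sb: "sb \<in> strip" "sb \<in> X" and sX: "s \<in> X" using \<sigma> s(2) by (auto simp: sb_def strip_def X_def)
      have nb: "norm (exp s) * norm \<alpha> < d" "norm (exp sb) * norm \<alpha> < d"
        using s(1) d(1) \<alpha>0 by (auto simp: less_ln_iff field_simps sb_def)
      have lin: "sb + \<i> * of_real (\<theta> * t) = linepath sb s t" for t
        by (simp add: linepath_def complex_eq_iff sb_def \<theta>_def algebra_simps)
      have arc: "arc_about \<alpha> (\<pi> sb) \<theta> = \<pi> \<circ> linepath sb s"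
        unfolding arc_about_def \<pi>_def fun_eq_iff o_def lin[symmetric] exp_add by (simp add: algebra_simps)
      have ev: "\<forall>\<^sub>F s' in nhds (pathstart (linepath sb s)). principal_branch F (\<pi> s') = A s'"
      proof -
        have "\<forall>\<^sub>F s' in nhds sb. s' \<in> strip" by (rule eventually_nhds_in_open[OF strip(1) sb(1)])
        then show ?thesis unfolding pathstart_linepath by eventually_elim (use Ag in \<open>simp add: g_def\<close>)
      qed
      have val: "continued_value (arc_about \<alpha> (\<pi> sb) \<theta>) (principal_branch F) = A s"
        using continued_value_push(2)[OF X(1) \<pi> d\<pi> A(1) path_linepath _ ev] closed_segment_subset[OF sb(2) sX X(2)]
        unfolding arc by simp
      have fin: "pathfinish (arc_about \<alpha> (\<pi> sb) \<theta>) - \<alpha> = \<alpha> * exp s"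
        unfolding arc by (simp add: pathfinish_def \<pi>_def linepath_def algebra_simps)
      have "\<theta> \<in> {-B..B}" using s(3) \<sigma> pi_gt_zero unfolding \<theta>_def B_def atLeastAtMost_iff by (elim disjE; simp only:; linarith)
      then have "norm (\<alpha> * exp s * A s) < e * norm \<alpha>"
        using d(2)[of "\<pi> sb" \<theta>] \<pi>strip[OF sb(1)] Xr(2)[OF sb(2)] nb(2) unfolding val fin
        by (auto simp: \<pi>_def dist_norm norm_mult algebra_simps)
      then show "norm (exp s * A s) \<le> e" using \<alpha>0 by (simp add: norm_mult mult.assoc mult.commute[of "norm \<alpha>"])
    qed
  qed (use A(1) in \<open>simp add: X_def\<close>)
  then have "side_branch F \<sigma> \<alpha> c A"
    unfolding side_branch_def using \<alpha> Ag \<pi>strip by (auto simp: strip_def X_def g_def \<pi>_def)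
  then show thesis by (rule that)
qed

lemma side_branch_exists:
  assumes "\<alpha> \<noteq> 0" "\<sigma> = 1 \<or> \<sigma> = (-1::real)"
  obtains c A where "side_branch F \<sigma> \<alpha> c A"
  using side_branch_exists_regular[OF assms(1) _ assms(2)] side_branch_exists_singular[OF _ assms(2)] by blast

end

subsection \<open>The Hadamard product as a contour integral\<close>

text \<open>Contours are built from finitely many segments, so that statements about their integrals
  follow from the case of one segment by induction.\<close>

inductive polygonal :: "(real \<Rightarrow> complex) \<Rightarrow> bool" where
  polygonal_linepath: "polygonal (linepath a b)"
| polygonal_join: "polygonal p \<Longrightarrow> polygonal q \<Longrightarrow> pathfinish p = pathstart q \<Longrightarrow> polygonal (p +++ q)"

lemma polygonal_valid_path: "polygonal p \<Longrightarrow> valid_path p"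
  by (induction rule: polygonal.induct) (auto intro: valid_path_join)

lemma polygonal_path: "polygonal p \<Longrightarrow> path p"
  by (simp add: polygonal_valid_path valid_path_imp_path)

lemma polygonal_reversepath: "polygonal p \<Longrightarrow> polygonal (reversepath p)"
proof (induction rule: polygonal.induct)
  case (polygonal_join p q)
  then show ?case by (simp add: reversepath_joinpaths polygonal.polygonal_join)
qed (auto intro: polygonal.intros)

lemma polygonal_integrable:
  "polygonal p \<Longrightarrow> continuous_on (path_image p) f \<Longrightarrow> f contour_integrable_on p"
proof (induction rule: polygonal.induct)
  case (polygonal_join p q)
  then show ?case
    by (auto simp: path_image_join intro!: contour_integrable_joinI polygonal_valid_path
        intro: continuous_on_subset[OF _ Un_upper1] continuous_on_subset[OF _ Un_upper2])
qed (auto intro: contour_integrable_continuous_linepath)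

lemma polygonal_integral_join:
  assumes "polygonal p" "polygonal q" "pathfinish p = pathstart q" "continuous_on (path_image (p +++ q)) f"
  shows "contour_integral (p +++ q) f = contour_integral p f + contour_integral q f"
proof -
  have "continuous_on (path_image p) f" "continuous_on (path_image q) f"
    using assms(3,4) by (auto simp: path_image_join elim: continuous_on_subset)
  then show ?thesis
    using assms by (intro contour_integral_join polygonal_integrable polygonal_valid_path)
qed

lemma polygonal_integral_holomorphic:
  assumes "polygonal p" and U: "open U"
    and "continuous_on (U \<times> path_image p) (\<lambda>(w, s). k w s)"
    and "\<And>s. s \<in> path_image p \<Longrightarrow> (\<lambda>w. k w s) holomorphic_on U"
  shows "(\<lambda>w. contour_integral p (k w)) holomorphic_on U"
  using assms(1,3,4)
proof (induction rule: polygonal.induct)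
  case (polygonal_linepath a b)
  then show ?case using contour_integral_linepath_holomorphic_on[OF U] by simp
next
  case (polygonal_join p q)
  have img: "path_image (p +++ q) = path_image p \<union> path_image q"
    using polygonal_join.hyps by (simp add: path_image_join)
  have "(\<lambda>w. contour_integral p (k w)) holomorphic_on U" "(\<lambda>w. contour_integral q (k w)) holomorphic_on U"
    using polygonal_join.prems unfolding img by (auto intro!: polygonal_join.IH elim: continuous_on_subset)
  then have "(\<lambda>w. contour_integral p (k w) + contour_integral q (k w)) holomorphic_on U"
    by (rule holomorphic_on_add)
  then show ?case
  proof (rule holomorphic_transform)
    fix w assume w: "w \<in> U"
    have "continuous_on (path_image (p +++ q)) ((\<lambda>x. k (fst x) (snd x)) \<circ> (\<lambda>s. (w, s)))"
      by (intro continuous_on_compose continuous_intros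
          continuous_on_subset[OF polygonal_join.prems(1)[unfolded case_prod_unfold]]) (use w in auto)
    then have "continuous_on (path_image (p +++ q)) (k w)" by (simp add: o_def)
    then show "contour_integral p (k w) + contour_integral q (k w) = contour_integral (p +++ q) (k w)"
      using polygonal_join.hyps by (simp add: polygonal_integral_join)
  qed
qed

lemma polygonal_integral_uniform_limit:
  assumes "polygonal p" and "\<And>n::nat. continuous_on (path_image p) (f n)"
    and "uniform_limit (path_image p) f l sequentially"
  shows "(\<lambda>n. contour_integral p (f n)) \<longlonglongrightarrow> contour_integral p l"
  using assms
proof (induction rule: polygonal.induct)
  case (polygonal_linepath a b)
  show ?case
    by (rule contour_integral_uniform_limit(2)[where B = "norm (b - a)"])
      (use polygonal_linepath in \<open>auto intro!: always_eventually contour_integrable_continuous_linepath\<close>)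
next
  case (polygonal_join p q)
  have img: "path_image (p +++ q) = path_image p \<union> path_image q"
    using polygonal_join.hyps by (simp add: path_image_join)
  have "(\<lambda>n. contour_integral p (f n)) \<longlonglongrightarrow> contour_integral p l" "(\<lambda>n. contour_integral q (f n)) \<longlonglongrightarrow> contour_integral q l"
    using polygonal_join.prems unfolding img by (auto intro!: polygonal_join.IH intro: continuous_on_subset[OF _ Un_upper1]
        continuous_on_subset[OF _ Un_upper2] elim: uniform_limit_on_subset)
  then have lim: "(\<lambda>n. contour_integral p (f n) + contour_integral q (f n)) \<longlonglongrightarrow> contour_integral p l + contour_integral q l"
    by (rule tendsto_add)
  have "continuous_on (path_image (p +++ q)) l"
    by (rule uniform_limit_theorem[OF _ polygonal_join.prems(2)]) (use polygonal_join.prems(1) in auto)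
  then show ?case
    using lim polygonal_join.hyps polygonal_join.prems(1) by (simp add: polygonal_integral_join)
qed

lemma polygonal_integral_primitive:
  assumes "polygonal p" "path_image p \<subseteq> X" "\<And>x. x \<in> X \<Longrightarrow> (N has_field_derivative f x) (at x within X)"
  shows "contour_integral p f = N (pathfinish p) - N (pathstart p)"
  using contour_integral_primitive[OF assms(3) polygonal_valid_path[OF assms(1)] assms(2)]
  by (simp add: contour_integral_unique)

section \<open>Taylor coefficients and the Hadamard product as integrals\<close>

lemma eval_fps_split_constant:
  fixes F :: "complex fps"
  assumes "norm z < fps_conv_radius F"
  shows "eval_fps F z = fps_nth F 0 + z * eval_fps (fps_shift 1 F) z"
proof -
  have "F = fps_const (fps_nth F 0) + fps_X * fps_shift 1 F"
    by (rule fps_ext) simp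
  then have "eval_fps F z = eval_fps (fps_const (fps_nth F 0) + fps_X * fps_shift 1 F) z" by simp
  also have "\<dots> = eval_fps (fps_const (fps_nth F 0)) z + eval_fps (fps_X * fps_shift 1 F) z"
    by (rule eval_fps_add) (use assms in \<open>auto intro!: less_le_trans[OF _ fps_conv_radius_mult]\<close>)
  also have "eval_fps (fps_X * fps_shift 1 F) z = eval_fps fps_X z * eval_fps (fps_shift 1 F) z"
    by (rule eval_fps_mult) (use assms in auto)
  finally show ?thesis by simp
qed

text \<open>Cauchy's coefficient formula in the coordinate ln z, without winding numbers. Split h =
  a + z h1. In degree 0 the term a x contributes 2 pi i a, while h1 has a primitive on the
  star-shaped X. In higher degree the constant term has a 2 pi i periodic primitive, and the shifted
  series takes over.\<close>

lemma fps_coefficient_integral: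
  assumes X: "open X" "starlike X" "0 \<in> X" and p: "polygonal p" "exp ` path_image p \<subseteq> X"
    and closed: "pathfinish p = pathstart p + 2 * of_real pi * \<i>"
  shows "h holomorphic_on X \<Longrightarrow> fps_conv_radius F > 0 \<Longrightarrow> (\<forall>\<^sub>F z in nhds 0. h z = eval_fps F z) \<Longrightarrow>
    contour_integral p (\<lambda>x. h (exp x) * exp (- of_nat n * x)) = 2 * of_real pi * \<i> * fps_nth F n"
proof (induction n arbitrary: h F)
  have exp_periodic: "exp (of_int m * (x + 2 * of_real pi * \<i>)) = exp (of_int m * x)" for m x
  proof -
    have "exp (of_int m * (2 * of_real pi * \<i>)) = (1::complex)"
      by (subst exp_eq_1) (auto intro: exI[of _ m])
    then show ?thesis by (simp add: distrib_left exp_add)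
  qed
  have split: "\<exists>h1. h1 holomorphic_on X \<and> (\<forall>\<^sub>F z in nhds 0. h1 z = eval_fps (fps_shift 1 F) z) \<and>
      (\<forall>z\<in>X - {0}. h z = fps_nth F 0 + z * h1 z)"
    if h: "h holomorphic_on X" and F: "fps_conv_radius F > 0" and ev: "\<forall>\<^sub>F z in nhds 0. h z = eval_fps F z" for h F
  proof -
    \<comment> \<open>The singularity at 0 is removable: near 0 this is the shifted series,
      elsewhere a quotient of holomorphic functions.\<close>
    define h1 where "h1 z = (if z = 0 then fps_nth F 1 else (h z - fps_nth F 0) / z)" for z
    have Fe: "\<forall>\<^sub>F z in nhds (0::complex). z \<in> eball 0 (fps_conv_radius F)"
      by (rule eventually_nhds_in_open) (use F in \<open>auto simp: in_eball_iff zero_ereal_def\<close>)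
    have ev1: "\<forall>\<^sub>F z in nhds 0. h1 z = eval_fps (fps_shift 1 F) z"
      using ev Fe
    proof eventually_elim
      case (elim z)
      show ?case
      proof (cases "z = 0")
        case False
        then show ?thesis using elim eval_fps_split_constant[of z F] by (simp add: h1_def in_eball_iff)
      qed (simp add: h1_def eval_fps_at_0)
    qed
    then obtain V where V: "open V" "0 \<in> V" "\<And>z. z \<in> V \<Longrightarrow> h1 z = eval_fps (fps_shift 1 F) z"
      by (auto simp: eventually_nhds)
    have "eval_fps (fps_shift 1 F) holomorphic_on V \<inter> eball 0 (fps_conv_radius F)"
      by (intro holomorphic_intros) auto
    then have "h1 holomorphic_on V \<inter> eball 0 (fps_conv_radius F)"
      by (rule holomorphic_transform) (use V in auto)
    moreover have "(\<lambda>z. (h z - fps_nth F 0) / z) holomorphic_on X - {0}"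
      by (intro holomorphic_intros holomorphic_on_subset[OF h]) auto
    then have "h1 holomorphic_on X - {0}"
      by (rule holomorphic_transform) (auto simp: h1_def)
    ultimately have "h1 holomorphic_on (V \<inter> eball 0 (fps_conv_radius F)) \<union> (X - {0})"
      by (rule holomorphic_on_Un) (use V X in \<open>auto intro: open_delete\<close>)
    then have "h1 holomorphic_on X"
      by (rule holomorphic_on_subset) (use V F in \<open>auto simp: in_eball_iff zero_ereal_def\<close>)
    moreover have "\<forall>z\<in>X - {0}. h z = fps_nth F 0 + z * h1 z" by (simp add: h1_def)
    ultimately show ?thesis using ev1 by blast
  qed
  have cont: "continuous_on (path_image p) (\<lambda>x. h (exp x) * exp (c * x))" if "h holomorphic_on X" for h c
    by (intro continuous_intros continuous_on_compose2[OF holomorphic_on_imp_continuous_on[OF that]]) (use p in auto)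
  note vp = polygonal_valid_path[OF p(1)]
  {
    case 0
    obtain h1 where h1: "h1 holomorphic_on X" "\<forall>z\<in>X - {0}. h z = fps_nth F 0 + z * h1 z"
      using split[OF 0] by blast
    have "\<exists>H. \<forall>z\<in>X. (H has_field_derivative h1 z) (at z)"
      by (rule holomorphic_starlike_primitive[OF holomorphic_on_imp_continuous_on[OF h1(1)] X(2,1) finite.emptyI])
        (use holomorphic_on_imp_differentiable_at[OF h1(1) X(1)] in auto)
    then obtain H where H: "\<And>z. z \<in> X \<Longrightarrow> (H has_field_derivative h1 z) (at z)" by blast
    have "contour_integral p (\<lambda>x. h (exp x) * exp (- of_nat 0 * x)) = contour_integral p (\<lambda>x. fps_nth F 0 + exp x * h1 (exp x))"
      by (rule contour_integral_eq) (use h1(2) p(2) in auto)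
    also have "\<dots> = (fps_nth F 0 * pathfinish p + H (exp (pathfinish p))) - (fps_nth F 0 * pathstart p + H (exp (pathstart p)))"
    proof (rule polygonal_integral_primitive[OF p(1), where X = "path_image p"])
      fix x assume "x \<in> path_image p"
      then have "((\<lambda>x. H (exp x)) has_field_derivative h1 (exp x) * exp x) (at x)"
        using p(2) by (intro DERIV_chain2[OF H] DERIV_exp) auto
      then have "((\<lambda>x. fps_nth F 0 * x + H (exp x)) has_field_derivative fps_nth F 0 * 1 + h1 (exp x) * exp x) (at x)"
        by (intro DERIV_add DERIV_cmult DERIV_ident)
      then show "((\<lambda>x. fps_nth F 0 * x + H (exp x)) has_field_derivative fps_nth F 0 + exp x * h1 (exp x)) (at x within path_image p)"
        by (simp add: mult.commute has_field_derivative_at_within)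
    qed simp
    also have "\<dots> = 2 * of_real pi * \<i> * fps_nth F 0"
      unfolding closed by (simp add: exp_add algebra_simps)
    finally show ?case .
  next
    case (Suc n)
    obtain h1 where h1: "h1 holomorphic_on X" "\<forall>\<^sub>F z in nhds 0. h1 z = eval_fps (fps_shift 1 F) z"
        "\<forall>z\<in>X - {0}. h z = fps_nth F 0 + z * h1 z"
      using split[OF Suc.prems] by blast
    define a where "a = fps_nth F 0"
    define P where "P x = - (a / of_nat (Suc n)) * exp (- of_nat (Suc n) * x)" for x :: complex
    have split_exp: "exp (- of_nat (Suc n) * x) = exp (- x) * exp (- of_nat n * x)" for x :: complex
      by (simp add: algebra_simps flip: exp_add)
    have "contour_integral p (\<lambda>x. h (exp x) * exp (- of_nat (Suc n) * x))
        = contour_integral p (\<lambda>x. a * exp (- of_nat (Suc n) * x) + h1 (exp x) * exp (- of_nat n * x))"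
    proof (rule contour_integral_eq)
      fix x assume "x \<in> path_image p"
      then have "h (exp x) = a + exp x * h1 (exp x)" using h1(3) p(2) unfolding a_def by auto
      then show "h (exp x) * exp (- of_nat (Suc n) * x) = a * exp (- of_nat (Suc n) * x) + h1 (exp x) * exp (- of_nat n * x)"
        unfolding split_exp by (simp add: distrib_right exp_minus field_simps)
    qed
    also have "\<dots> = contour_integral p (\<lambda>x. a * exp (- of_nat (Suc n) * x)) + contour_integral p (\<lambda>x. h1 (exp x) * exp (- of_nat n * x))"
      by (intro contour_integral_add polygonal_integrable[OF p(1)] cont h1(1) continuous_intros)
    also have "contour_integral p (\<lambda>x. h1 (exp x) * exp (- of_nat n * x)) = 2 * of_real pi * \<i> * fps_nth (fps_shift 1 F) n"
      using Suc.prems(2) h1 by (intro Suc.IH) auto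
    also have "contour_integral p (\<lambda>x. a * exp (- of_nat (Suc n) * x)) = P (pathfinish p) - P (pathstart p)"
    proof (rule polygonal_integral_primitive[OF p(1) order_refl])
      fix x
      have "(P has_field_derivative - (a / of_nat (Suc n)) * (exp (- of_nat (Suc n) * x) * (- of_nat (Suc n)))) (at x)"
        unfolding P_def by (rule derivative_eq_intros refl | simp)+
      moreover have "- (a / of_nat (Suc n)) * (exp (- of_nat (Suc n) * x) * (- of_nat (Suc n))) = a * exp (- of_nat (Suc n) * x)"
        by (simp del: of_nat_Suc)
      ultimately show "(P has_field_derivative a * exp (- of_nat (Suc n) * x)) (at x within path_image p)"
        by (metis has_field_derivative_at_within)
    qed
    also have "P (pathfinish p) = P (pathstart p)"
      unfolding P_def closed using exp_periodic[of "- int (Suc n)" "pathstart p"] by (simp del: of_nat_Suc)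
    finally show ?case by simp
  }
qed

definition hadamard_kernel :: "complex fps \<Rightarrow> complex fps \<Rightarrow> complex \<Rightarrow> complex \<Rightarrow> complex" where
  "hadamard_kernel F G z x = principal_branch F (exp x) * principal_branch G (z / exp x)"

definition hadamard_region :: "complex fps \<Rightarrow> complex fps \<Rightarrow> complex \<Rightarrow> complex set" where
  "hadamard_region F G z = {x. exp x \<in> principal_star F \<and> z / exp x \<in> principal_star G}"

lemma starlike_principal_star: "fps_conv_radius F > 0 \<Longrightarrow> starlike (principal_star F)"
  unfolding starlike_def
proof (rule bexI[OF _ zero_in_principal_star], intro ballI subsetI)
  fix z w assume "z \<in> principal_star F" "w \<in> closed_segment 0 z"
  then show "w \<in> principal_star F"
    using principal_star_scale[of z F] by (auto simp: closed_segment_def scaleR_conv_of_real)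
qed

text \<open>For a fixed contour the integral is holomorphic on the set Z of all z admissible for it.
  Z contains the segment from 0 to z0 because the star of G is star-shaped, and near 0 the expansion
  of G under the integral produces the series of the Hadamard product. So the integral continues the
  germ along that segment and is the principal branch at its end.\<close>

lemma hadamard_integral:
  assumes F: "fps_conv_radius F > 0" and G: "fps_conv_radius G > 0"
    and p: "polygonal p" "path_image p \<subseteq> hadamard_region F G z0"
    and closed: "pathfinish p = pathstart p + 2 * of_real pi * \<i>"
  shows "z0 \<in> principal_star (hadamard F G)"
    and "principal_branch (hadamard F G) z0 = contour_integral p (hadamard_kernel F G z0) / (2 * of_real pi * \<i>)"
proof -
  define Z where "Z = {z. \<forall>x\<in>path_image p. z / exp x \<in> principal_star G}"
  have comp: "compact (path_image p)" by (rule compact_path_image[OF polygonal_path[OF p(1)]])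
  have "compact ((\<lambda>x. exp (- x)) ` path_image p)"
    by (intro compact_continuous_image comp continuous_intros)
  then have "bounded ((\<lambda>x. exp (- x)) ` path_image p)" by (rule compact_imp_bounded)
  then obtain M where M: "0 < M" "\<And>x. x \<in> path_image p \<Longrightarrow> norm (exp (- x)) \<le> M"
    unfolding bounded_pos by blast
  have quot: "norm (z / exp x) \<le> norm z * M" if "x \<in> path_image p" for z x
    using M(2)[OF that] mult_left_mono[of "norm (exp (- x))" M "norm z"] by (simp add: exp_minus divide_inverse norm_mult)
  have "open Z"
    unfolding open_dist
  proof
    fix z assume z: "z \<in> Z"
    have "compact ((\<lambda>x. z / exp x) ` path_image p)" by (intro compact_continuous_image comp continuous_intros) auto
    moreover have "(\<lambda>x. z / exp x) ` path_image p \<subseteq> principal_star G" using z by (auto simp: Z_def)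
    ultimately obtain e where e: "0 < e" "(\<Union>y\<in>(\<lambda>x. z / exp x) ` path_image p. ball y e) \<subseteq> principal_star G"
      using compact_subset_open_imp_ball_epsilon_subset[OF _ open_principal_star] by metis
    show "\<exists>d>0. \<forall>y. dist y z < d \<longrightarrow> y \<in> Z"
    proof (intro exI[of _ "e / M"] conjI allI impI)
      fix y assume y: "dist y z < e / M"
      have "y / exp x \<in> principal_star G" if x: "x \<in> path_image p" for x
      proof -
        have "dist (z / exp x) (y / exp x) = norm ((z - y) / exp x)" by (simp add: dist_norm diff_divide_distrib)
        also have "\<dots> \<le> norm (z - y) * M" by (rule quot[OF x])
        also have "\<dots> < e" using y M(1) by (simp add: dist_norm norm_minus_commute field_simps)
        finally have "y / exp x \<in> ball (z / exp x) e" by simp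
        then have "y / exp x \<in> (\<Union>y\<in>(\<lambda>x. z / exp x) ` path_image p. ball y e)" using x by blast
        then show ?thesis by (rule subsetD[OF e(2)])
      qed
      then show "y \<in> Z" by (simp add: Z_def)
    qed (use e M in simp)
  qed
  have ZK: "of_real t * z0 \<in> Z" if "0 \<le> t" "t \<le> 1" for t
    unfolding Z_def
  proof (intro CollectI ballI)
    fix x assume "x \<in> path_image p"
    then have "z0 / exp x \<in> principal_star G" using p(2) by (auto simp: hadamard_region_def)
    from principal_star_scale[OF this that] show "of_real t * z0 / exp x \<in> principal_star G" by simp
  qed
  have expp: "exp ` path_image p \<subseteq> principal_star F" using p(2) by (auto simp: hadamard_region_def)
  note contF = holomorphic_on_imp_continuous_on[OF holomorphic_principal_branch[of F]]
  note contG = holomorphic_on_imp_continuous_on[OF holomorphic_principal_branch[of G]]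
  define h where "h z = contour_integral p (hadamard_kernel F G z) / (2 * of_real pi * \<i>)" for z
  have "(\<lambda>z. contour_integral p (hadamard_kernel F G z)) holomorphic_on Z"
  proof (rule polygonal_integral_holomorphic[OF p(1) \<open>open Z\<close>])
    show "continuous_on (Z \<times> path_image p) (\<lambda>(z, x). hadamard_kernel F G z x)"
      unfolding hadamard_kernel_def case_prod_unfold
      by (intro continuous_intros continuous_on_compose2[OF contF] continuous_on_compose2[OF contG])
        (use expp in \<open>auto simp: Z_def\<close>)
    fix x assume x: "x \<in> path_image p"
    have "(principal_branch G \<circ> (\<lambda>z. z / exp x)) holomorphic_on Z"
      by (rule holomorphic_on_compose_gen[OF _ holomorphic_principal_branch])
        (use x in \<open>auto simp: Z_def intro!: holomorphic_intros\<close>)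
    then show "(\<lambda>z. hadamard_kernel F G z x) holomorphic_on Z"
      unfolding hadamard_kernel_def o_def by (intro holomorphic_intros)
  qed
  then have h: "h holomorphic_on Z" unfolding h_def by (intro holomorphic_intros) auto
  have near0: "\<forall>\<^sub>F z in nhds 0. h z = eval_fps (hadamard F G) z"
  proof -
    obtain V where V: "open V" "0 \<in> V" "\<And>z. z \<in> V \<Longrightarrow> principal_branch G z = eval_fps G z"
      using principal_branch_near_0[OF G] by (auto simp: eventually_nhds)
    have "open (V \<inter> eball 0 (fps_conv_radius G))" "0 \<in> V \<inter> eball 0 (fps_conv_radius G)"
      using V G by (auto simp: in_eball_iff zero_ereal_def)
    then obtain r where r: "0 < r" "cball 0 r \<subseteq> V \<inter> eball 0 (fps_conv_radius G)"
      using open_contains_cball by blast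
    have "ereal r < fps_conv_radius G" using r(2) r(1) subsetD[OF r(2), of "of_real r"] by (auto simp: in_eball_iff)
    then have sum: "summable (\<lambda>n. norm (fps_nth G n * of_real r ^ n))"
      using r(1) by (intro norm_summable_fps) auto
    \<comment> \<open>For |z| < r/M all quotients z / exp x lie in the closed disc of radius r, on
      which the series of G converges uniformly.\<close>
    have "h z = eval_fps (hadamard F G) z" if z: "norm z < r / M" for z
    proof -
      have small: "norm (z / exp x) \<le> r" if "x \<in> path_image p" for x
        using quot[OF that, of z] z M(1) by (simp add: field_simps)
      define f where "f n x = (\<Sum>i<n. principal_branch F (exp x) * (fps_nth G i * (z / exp x) ^ i))" for n x
      have "continuous_on (path_image p) (\<lambda>x. principal_branch F (exp x))"
        by (intro continuous_on_compose2[OF contF] continuous_intros) (use expp in auto)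
      then have "compact ((\<lambda>x. principal_branch F (exp x)) ` path_image p)" by (rule compact_continuous_image[OF _ comp])
      then obtain L where L: "0 < L" "\<And>x. x \<in> path_image p \<Longrightarrow> norm (principal_branch F (exp x)) \<le> L"
        by (metis bounded_pos compact_imp_bounded imageI)
      have val: "(\<lambda>i. principal_branch F (exp x) * (fps_nth G i * (z / exp x) ^ i)) sums hadamard_kernel F G z x"
        if x: "x \<in> path_image p" for x
      proof -
        have "z / exp x \<in> cball 0 r" using small[OF x] by simp
        then have w: "z / exp x \<in> V" "norm (z / exp x) < fps_conv_radius G" using r(2) by (auto simp: in_eball_iff)
        then have "(\<lambda>i. fps_nth G i * (z / exp x) ^ i) sums eval_fps G (z / exp x)" by (intro sums_eval_fps)
        then show ?thesis unfolding hadamard_kernel_def V(3)[OF w(1)] by (rule sums_mult)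
      qed
      have "uniform_limit (path_image p) f (\<lambda>x. \<Sum>i. principal_branch F (exp x) * (fps_nth G i * (z / exp x) ^ i)) sequentially"
        unfolding f_def
      proof (rule Weierstrass_m_test)
        fix n x assume x: "x \<in> path_image p"
        have "norm (z / exp x) ^ n \<le> r ^ n" by (rule power_mono[OF small[OF x]]) simp
        then show "norm (principal_branch F (exp x) * (fps_nth G n * (z / exp x) ^ n)) \<le> L * norm (fps_nth G n * of_real r ^ n)"
          unfolding norm_mult norm_power using L(2)[OF x] L(1) r(1) by (intro mult_mono) auto
      qed (use sum in \<open>rule summable_mult\<close>)
      then have "uniform_limit (path_image p) f (hadamard_kernel F G z) sequentially"
        by (rule uniform_limit_cong'[THEN iffD1, rotated -1]) (use val in \<open>auto simp: sums_iff\<close>)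
      moreover have cont_term: "continuous_on (path_image p) (\<lambda>x. principal_branch F (exp x) * (c * (z / exp x) ^ i))" for c i
        by (intro continuous_intros continuous_on_compose2[OF contF]) (use expp in auto)
      ultimately have lim: "(\<lambda>n. contour_integral p (f n)) \<longlonglongrightarrow> contour_integral p (hadamard_kernel F G z)"
        unfolding f_def by (intro polygonal_integral_uniform_limit[OF p(1)] continuous_on_sum)
      have "contour_integral p (f n) = (\<Sum>i<n. 2 * of_real pi * \<i> * (fps_nth F i * fps_nth G i * z ^ i))" for n
      proof -
        have "contour_integral p (f n) = (\<Sum>i<n. contour_integral p (\<lambda>x. principal_branch F (exp x) * (fps_nth G i * (z / exp x) ^ i)))"
          unfolding f_def by (intro contour_integral_sum polygonal_integrable[OF p(1)] cont_term) auto
        also have "\<dots> = (\<Sum>i<n. 2 * of_real pi * \<i> * (fps_nth F i * fps_nth G i * z ^ i))"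
        proof (rule sum.cong[OF refl])
          fix i
          have E: "exp (- of_nat i * x) = inverse (exp x) ^ i" for x :: complex
            by (simp add: exp_minus exp_of_nat_mult power_inverse)
          have eq: "(\<lambda>x. principal_branch F (exp x) * (fps_nth G i * (z / exp x) ^ i))
              = (\<lambda>x. (fps_nth G i * z ^ i) * (principal_branch F (exp x) * exp (- of_nat i * x)))"
            unfolding E by (simp add: fun_eq_iff divide_inverse power_mult_distrib)
          have "contour_integral p (\<lambda>x. (fps_nth G i * z ^ i) * (principal_branch F (exp x) * exp (- of_nat i * x)))
              = (fps_nth G i * z ^ i) * contour_integral p (\<lambda>x. principal_branch F (exp x) * exp (- of_nat i * x))"
            by (rule contour_integral_lmul, rule polygonal_integrable[OF p(1)],
                intro continuous_intros continuous_on_compose2[OF contF]) (use expp in auto)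
          also have "contour_integral p (\<lambda>x. principal_branch F (exp x) * exp (- of_nat i * x)) = 2 * of_real pi * \<i> * fps_nth F i"
            by (rule fps_coefficient_integral[OF open_principal_star starlike_principal_star[OF F] zero_in_principal_star[OF F]
                  p(1) expp closed holomorphic_principal_branch F principal_branch_near_0[OF F]])
          finally show "contour_integral p (\<lambda>x. principal_branch F (exp x) * (fps_nth G i * (z / exp x) ^ i))
              = 2 * of_real pi * \<i> * (fps_nth F i * fps_nth G i * z ^ i)" unfolding eq by simp
        qed
        finally show ?thesis .
      qed
      with lim have "(\<lambda>i. 2 * of_real pi * \<i> * (fps_nth F i * fps_nth G i * z ^ i)) sums contour_integral p (hadamard_kernel F G z)"
        by (simp add: sums_def)
      from sums_divide[OF this, of "2 * of_real pi * \<i>"]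
      have "(\<lambda>i. fps_nth F i * fps_nth G i * z ^ i) sums h z"
        by (simp add: h_def)
      then show ?thesis by (simp add: eval_fps_def hadamard_def sums_iff)
    qed
    moreover have "\<forall>\<^sub>F z in nhds (0::complex). z \<in> ball 0 (r / M)"
      by (rule eventually_nhds_in_open) (use r M in auto)
    ultimately show ?thesis by (auto elim!: eventually_mono)
  qed
  have lp: "linepath 0 z0 t = of_real t * z0" for t by (simp add: linepath_def scaleR_conv_of_real)
  have cont: "continuation_along (linepath 0 z0) (eval_fps (hadamard F G)) (\<lambda>_. h)"
    unfolding continuation_along_def
  proof (intro conjI ballI)
    fix t :: real assume t: "t \<in> {0..1}"
    show "h analytic_on {linepath 0 z0 t}"
      unfolding lp by (rule analytic_on_singleton[OF h \<open>open Z\<close> ZK]) (use t in auto)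
  qed (use near0 in auto)
  then show "z0 \<in> principal_star (hadamard F G)" by (auto simp: principal_star_def continuable_along_def)
  show "principal_branch (hadamard F G) z0 = contour_integral p (hadamard_kernel F G z0) / (2 * of_real pi * \<i>)"
    unfolding principal_branch_def using continued_value_eq[OF path_linepath cont] by (simp add: h_def)
qed

subsection \<open>The contour near a direction\<close>

text \<open>One side \<sigma> is fixed throughout, and a branch is chosen at every nonzero point,
  singular or not.\<close>

locale hadamard_side =
  F: isolated_germ F + G: isolated_germ G for F G :: "complex fps" +
  fixes \<gamma> :: complex and \<sigma> :: real and A B :: "complex \<Rightarrow> complex \<Rightarrow> complex" and cA cB :: "complex \<Rightarrow> real"
  assumes \<gamma>: "\<gamma> \<noteq> 0" and \<sigma>: "\<sigma> = 1 \<or> \<sigma> = -1"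
    and A: "\<And>\<alpha>. \<alpha> \<noteq> 0 \<Longrightarrow> side_branch F \<sigma> \<alpha> (cA \<alpha>) (A \<alpha>)"
    and B: "\<And>\<beta>. \<beta> \<noteq> 0 \<Longrightarrow> side_branch G \<sigma> \<beta> (cB \<beta>) (B \<beta>)"
begin

definition target :: "complex \<Rightarrow> complex" where
  "target W = \<gamma> * (1 + exp W)"

definition side :: "complex \<Rightarrow> bool" where
  "side W \<longleftrightarrow> 0 < \<sigma> * Im W \<and> \<sigma> * Im W < pi"

definition conv_int :: "complex \<Rightarrow> complex \<Rightarrow> complex" where
  "conv_int \<alpha> W = integral {0..1} (conv_density (A \<alpha>) (B (\<gamma> / \<alpha>)) W)"

lemma target_periodic [simp]: "target (W + 2 * of_real pi * \<i>) = target W"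
  by (simp add: target_def)

lemma integral_of_extension_holomorphic:
  assumes f: "f holomorphic_on X" and g: "g holomorphic_on Y" and U: "open U"
    and "\<And>y. y \<in> closed_segment a b \<Longrightarrow> exp y \<in> X"
    and "\<And>W y. W \<in> U \<Longrightarrow> y \<in> closed_segment a b \<Longrightarrow> target W / exp y \<in> Y"
  shows "(\<lambda>W. contour_integral (linepath a b) (\<lambda>y. f (exp y) * g (target W / exp y))) holomorphic_on U"
proof (rule contour_integral_linepath_holomorphic_on[OF U])
  note cf = holomorphic_on_imp_continuous_on[OF f] and cg = holomorphic_on_imp_continuous_on[OF g]
  show "continuous_on (U \<times> closed_segment a b) (\<lambda>(W, y). f (exp y) * g (target W / exp y))"
    unfolding case_prod_unfold target_def
    by (intro continuous_intros continuous_on_compose2[OF cf] continuous_on_compose2[OF cg])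
      (use assms(4,5) in \<open>auto simp: target_def\<close>)
  fix y assume y: "y \<in> closed_segment a b"
  have "(g \<circ> (\<lambda>W. target W / exp y)) holomorphic_on U"
    by (rule holomorphic_on_compose_gen[OF _ g]) (use assms(5) y in \<open>auto simp: target_def intro!: holomorphic_intros\<close>)
  then show "(\<lambda>W. f (exp y) * g (target W / exp y)) holomorphic_on U"
    unfolding o_def by (intro holomorphic_intros)
qed

lemma extension_holomorphic:
  assumes f: "f holomorphic_on X" and g: "g holomorphic_on Y"
    and "\<And>y. y \<in> D \<Longrightarrow> exp y \<in> X" and "\<And>y. y \<in> D \<Longrightarrow> target W / exp y \<in> Y"
  shows "(\<lambda>y. f (exp y) * g (target W / exp y)) holomorphic_on D"
proof -
  have "(g \<circ> (\<lambda>y. target W / exp y)) holomorphic_on D" "(f \<circ> exp) holomorphic_on D"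
    by (rule holomorphic_on_compose_gen[OF _ g] holomorphic_on_compose_gen[OF _ f];
        use assms(3,4) in \<open>auto intro!: holomorphic_intros\<close>)+
  then show ?thesis unfolding o_def by (intro holomorphic_intros)
qed

end

text \<open>A direction \<theta> with a sector of half width \<eta> in which F is cut at most on the
  ray itself, and likewise G about the matching direction Im (Ln \<gamma>) - \<theta>. The contour
  comes along Re x = lo, and its detour reaches Re x = hi.\<close>

locale detour = hadamard_side +
  fixes \<theta> lo hi \<eta> :: real
  assumes lohi: "lo < hi" and \<eta>: "0 < \<eta>" "\<eta> \<le> 1"
    and F_sector: "\<And>x. Re x < hi + 1 \<Longrightarrow> Im x \<noteq> \<theta> \<Longrightarrow> \<bar>Im x - \<theta>\<bar> < \<eta> \<Longrightarrow> exp x \<in> principal_star F"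
    and G_sector: "\<And>y. Re y < Re (Ln \<gamma>) + 2 - lo \<Longrightarrow> Im y \<noteq> Im (Ln \<gamma>) - \<theta> \<Longrightarrow>
      \<bar>Im y - (Im (Ln \<gamma>) - \<theta>)\<bar> < \<eta> \<Longrightarrow> exp y \<in> principal_star G"
begin

text \<open>|e^W| < \<eta>/4 forces |Ln (1 + e^W)| < \<eta>/2, so that the moving cut stays inside
  of the sector.\<close>

definition "e0 = ln (\<eta> / 4)"

text \<open>The logarithm of z/\<gamma>: the cut of G(z/e^x) lies on the line Im x = \<theta> + Im
  (shift W), at height Im (shift W) over the cut of F.\<close>

definition shift :: "complex \<Rightarrow> complex" where
  "shift W = Ln (1 + exp W)"

lemma shift_bounds:
  assumes "Re W < e0"
  shows "norm (exp W) < \<eta> / 4" "norm (shift W) < \<eta> / 2" "1 + exp W \<noteq> 0" "exp (shift W) = 1 + exp W"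
proof -
  show e: "norm (exp W) < \<eta> / 4" using assms \<eta> by (simp add: e0_def less_ln_iff)
  then have "norm (exp W) < 1 / 2" using \<eta> by simp
  then have "norm (shift W) \<le> 2 * norm (exp W)" unfolding shift_def by (rule norm_Ln_le)
  then show "norm (shift W) < \<eta> / 2" using e by simp
  show nz: "1 + exp W \<noteq> 0"
  proof
    assume "1 + exp W = 0"
    then have "exp W = - 1" by (simp add: add_eq_0_iff)
    then have "norm (exp W) = 1" by simp
    then show False using e \<eta> by linarith
  qed
  show "exp (shift W) = 1 + exp W" using nz by (simp add: shift_def)
qed

lemma shift_side:
  assumes "Re W < e0" "side W"
  shows "0 < \<sigma> * Im (shift W)" "\<bar>Im (shift W)\<bar> < \<eta> / 2"
proof -
  have "0 < \<sigma> * Im (1 + exp W)"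
    using sign_Im_exp[OF \<sigma>, of W] assms(2) by (simp add: side_def)
  moreover have "norm (exp W) < 1 / 4" using shift_bounds(1)[OF assms(1)] \<eta> by simp
  then have Re: "0 < Re (1 + exp W)" using abs_Re_le_cmod[of "exp W"] unfolding plus_complex.sel one_complex.sel by linarith
  ultimately show "0 < \<sigma> * Im (shift W)"
    using \<sigma> Im_Ln_pos_lt[OF shift_bounds(3)[OF assms(1)]] Im_Ln_pos_le[OF shift_bounds(3)[OF assms(1)]]
      Re_Ln_pos_lt_imp[OF Re] pi_gt_zero unfolding shift_def by (auto simp: abs_less_iff not_le)
  show "\<bar>Im (shift W)\<bar> < \<eta> / 2" using abs_Im_le_cmod[of "shift W"] shift_bounds(2)[OF assms(1)] by linarith
qed

lemma target_quotient:
  assumes "Re W < e0"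
  shows "target W / exp x = exp (Ln \<gamma> + shift W - x)"
  using shift_bounds(4)[OF assms] \<gamma> by (simp add: target_def exp_add exp_diff)

text \<open>The strip between the cut of \<open>F(e\<^sup>x)\<close> on \<open>Im x = \<theta>\<close> and the cut of \<open>G(z/e\<^sup>x)\<close> above or below it.\<close>

definition rect :: "complex \<Rightarrow> complex set" where
  "rect W = {x. lo - 1 < Re x \<and> Re x < hi + 1 \<and> 0 < \<sigma> * (Im x - \<theta>) \<and> \<sigma> * (Im x - \<theta>) < \<sigma> * Im (shift W)}"

lemma rect_open_convex: "open (rect W)" "convex (rect W)"
proof -
  have h: "convex {x. 0 < \<sigma> * (Im x - \<theta>)}" "convex {x. \<sigma> * (Im x - \<theta>) < b}"
    "open {x. 0 < \<sigma> * (Im x - \<theta>)}" "open {x. \<sigma> * (Im x - \<theta>) < b}" for b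
  proof -
    have 1: "{x. 0 < \<sigma> * (Im x - \<theta>)} = (if \<sigma> = 1 then {x. Im x > \<theta>} else {x. Im x < \<theta>})"
      using \<sigma> by (auto simp: set_eq_iff)
    show "convex {x. 0 < \<sigma> * (Im x - \<theta>)}" "open {x. 0 < \<sigma> * (Im x - \<theta>)}"
      unfolding 1 by (simp_all add: convex_halfspace_Im_gt convex_halfspace_Im_lt open_halfspace_Im_gt open_halfspace_Im_lt)
    have 2: "{x. \<sigma> * (Im x - \<theta>) < b} = (if \<sigma> = 1 then {x. Im x < \<theta> + b} else {x. Im x > \<theta> - b})"
      using \<sigma> by (auto simp: set_eq_iff algebra_simps)
    show "convex {x. \<sigma> * (Im x - \<theta>) < b}" "open {x. \<sigma> * (Im x - \<theta>) < b}"
      unfolding 2 by (simp_all add: convex_halfspace_Im_gt convex_halfspace_Im_lt open_halfspace_Im_gt open_halfspace_Im_lt)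
  qed
  have eq: "rect W = {x. Re x > lo - 1} \<inter> {x. Re x < hi + 1} \<inter> {x. 0 < \<sigma> * (Im x - \<theta>)} \<inter> {x. \<sigma> * (Im x - \<theta>) < \<sigma> * Im (shift W)}"
    by (auto simp: rect_def)
  show "open (rect W)" unfolding eq by (intro open_Int h open_halfspace_Re_gt open_halfspace_Re_lt)
  show "convex (rect W)" unfolding eq by (intro convex_Int h convex_halfspace_Re_gt convex_halfspace_Re_lt)
qed

lemma rect_offset:
  assumes "Re W < e0" "side W" "x \<in> rect W"
  shows "Im x \<noteq> \<theta>" "\<bar>Im x - \<theta>\<bar> < \<eta>" "Im (Ln \<gamma> + shift W - x) \<noteq> Im (Ln \<gamma>) - \<theta>"
    "\<bar>Im (Ln \<gamma> + shift W - x) - (Im (Ln \<gamma>) - \<theta>)\<bar> < \<eta>"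
    "0 < \<sigma> * (Im (shift W) - (Im x - \<theta>))"
  using assms(3) shift_side[OF assms(1,2)] \<sigma> \<eta> by (auto simp: rect_def abs_if split: if_splits)

lemma rect_region:
  assumes "Re W < e0" "side W"
  shows "rect W \<subseteq> hadamard_region F G (target W)"
proof
  fix x assume x: "x \<in> rect W"
  note o = rect_offset[OF assms x]
  have "Re (shift W) \<le> 1" using abs_Re_le_cmod[of "shift W"] shift_bounds(2)[OF assms(1)] \<eta> by linarith
  then have "Re (Ln \<gamma> + shift W - x) < Re (Ln \<gamma>) + 2 - lo" using x by (simp add: rect_def)
  then have "exp (Ln \<gamma> + shift W - x) \<in> principal_star G" by (rule G_sector[OF _ o(3,4)])
  moreover have "exp x \<in> principal_star F" by (rule F_sector[OF _ o(1,2)]) (use x in \<open>simp add: rect_def\<close>)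
  ultimately show "x \<in> hadamard_region F G (target W)"
    by (simp add: hadamard_region_def target_quotient[OF assms(1)])
qed

text \<open>Makes limits along \<open>rect W\<close> at points of the line Im x = \<theta>
  unique.\<close>

lemma rect_limit_point:
  assumes "Re W < e0" "side W" "s \<in> {lo..hi}"
  shows "Complex s \<theta> islimpt rect W"
  unfolding islimpt_approachable
proof (intro allI impI)
  fix e :: real assume e: "0 < e"
  define \<psi> where "\<psi> = Im (shift W)"
  have \<psi>: "0 < \<sigma> * \<psi>" "\<psi> \<noteq> 0" using shift_side[OF assms(1,2)] by (auto simp: \<psi>_def)
  define t where "t = min (1 / 2) (e / (2 * \<bar>\<psi>\<bar>))"
  have t: "0 < t" "t < 1" "t * \<bar>\<psi>\<bar> < e"
  proof -
    show "0 < t" "t < 1" using e \<psi> by (auto simp: t_def)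
    have "t * \<bar>\<psi>\<bar> \<le> e / (2 * \<bar>\<psi>\<bar>) * \<bar>\<psi>\<bar>" by (rule mult_right_mono) (auto simp: t_def)
    then show "t * \<bar>\<psi>\<bar> < e" using e \<psi>(2) by simp
  qed
  have "\<sigma> * (t * \<psi>) = t * (\<sigma> * \<psi>)" by simp
  moreover have "t * (\<sigma> * \<psi>) < 1 * (\<sigma> * \<psi>)" by (rule mult_strict_right_mono) (use t \<psi> in auto)
  moreover have "0 < t * (\<sigma> * \<psi>)" by (rule mult_pos_pos) (use t \<psi> in auto)
  ultimately have "0 < \<sigma> * (t * \<psi>)" "\<sigma> * (t * \<psi>) < \<sigma> * \<psi>" by linarith+
  then have "Complex s (\<theta> + t * \<psi>) \<in> rect W"
    using assms(3) by (simp add: rect_def \<psi>_def[symmetric])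
  moreover have "Complex s (\<theta> + t * \<psi>) \<noteq> Complex s \<theta>" using t \<psi> by simp
  moreover have "dist (Complex s (\<theta> + t * \<psi>)) (Complex s \<theta>) < e"
    using t by (simp add: dist_norm complex_diff cmod_def abs_mult)
  ultimately show "\<exists>x'\<in>rect W. x' \<noteq> Complex s \<theta> \<and> dist x' (Complex s \<theta>) < e" by blast
qed

section \<open>Boundary values on the line and local contributions\<close>

definition point :: "real \<Rightarrow> complex" where
  "point s = exp (Complex s \<theta>)"

lemma point_nonzero [simp]: "point s \<noteq> 0" "\<gamma> / point s \<noteq> 0"
  using \<gamma> by (simp_all add: point_def)

definition special :: "real \<Rightarrow> bool" where
  "special s \<longleftrightarrow> point s \<in> singularities F \<or> \<gamma> / point s \<in> singularities G"

definition prim :: "complex \<Rightarrow> (complex \<Rightarrow> complex) \<Rightarrow> bool" where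
  "prim W N \<longleftrightarrow> (\<forall>x\<in>rect W. (N has_field_derivative hadamard_kernel F G (target W) x) (at x))"

lemma isolated_special:
  obtains d where "0 < d" "\<And>t. t \<noteq> s \<Longrightarrow> \<bar>t - s\<bar> < d \<Longrightarrow> \<not> special t"
proof -
  have "open (- (singularities F - {point s}))" "open (- (singularities G - {\<gamma> / point s}))"
  proof -
    have "closed (H - {x})" if "closed H" "\<And>y. y \<in> H \<Longrightarrow> \<exists>r>0. \<forall>z\<in>ball y r. z \<in> H \<longrightarrow> z = y" for H and x :: complex
      unfolding closed_limpt
    proof (intro allI impI)
      fix y assume y: "y islimpt H - {x}"
      then have "y islimpt H" by (rule islimpt_subset) auto
      then have "y \<in> H" using that(1) closed_limpt by blast
      then show "y \<in> H - {x}"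
        using that(2)[of y] \<open>y islimpt H\<close> unfolding islimpt_approachable by (metis dist_commute mem_ball)
    qed
    moreover have "\<exists>r>0. \<forall>z\<in>ball y r. z \<in> singularities F \<longrightarrow> z = y" if "y \<in> singularities F" for y
      using isolated_at_imp_no_other F.isolated[OF that] by metis
    moreover have "\<exists>r>0. \<forall>z\<in>ball y r. z \<in> singularities G \<longrightarrow> z = y" if "y \<in> singularities G" for y
      using isolated_at_imp_no_other G.isolated[OF that] by metis
    ultimately have "closed (singularities F - {point s})" "closed (singularities G - {\<gamma> / point s})"
      using closed_singularities by blast+
    then show "open (- (singularities F - {point s}))" "open (- (singularities G - {\<gamma> / point s}))"
      by (simp_all only: open_Compl)
  qed
  note op = this
  have lim: "(point \<longlongrightarrow> point s) (at s)" "((\<lambda>t. \<gamma> / point t) \<longlongrightarrow> \<gamma> / point s) (at s)"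
    unfolding point_def Complex_eq by (auto intro!: tendsto_intros)
  have "\<forall>\<^sub>F t in at s. point t \<in> - (singularities F - {point s})"
    by (rule topological_tendstoD[OF lim(1) op(1)]) simp
  moreover have "\<forall>\<^sub>F t in at s. \<gamma> / point t \<in> - (singularities G - {\<gamma> / point s})"
    by (rule topological_tendstoD[OF lim(2) op(2)]) simp
  ultimately have "\<forall>\<^sub>F t in at s. \<not> special t"
    using eventually_neq_at_within[of s s UNIV]
  proof eventually_elim
    case (elim t)
    have "point t \<noteq> point s"
    proof
      assume "point t = point s"
      then have "norm (point t) = norm (point s)" by simp
      then show False using elim(3) by (simp add: point_def)
    qed
    then show ?case using elim \<gamma> by (auto simp: special_def)
  qed
  then show thesis using that by (auto simp: eventually_at dist_real_def)
qed

lemma finite_special: "finite {s \<in> {a..b}. special s}"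
proof (rule ccontr)
  assume "infinite {s \<in> {a..b}. special s}"
  then obtain s where "s islimpt {s \<in> {a..b}. special s}"
    using Heine_Borel_imp_Bolzano_Weierstrass[OF compact_Icc _ Collect_restrict, of a b special] by blast
  moreover obtain d where "0 < d" "\<And>t. t \<noteq> s \<Longrightarrow> \<bar>t - s\<bar> < d \<Longrightarrow> \<not> special t"
    using isolated_special by blast
  ultimately show False unfolding islimpt_approachable by (auto simp: dist_real_def)
qed

text \<open>The strip shrinks to the line Im x = \<theta> as z tends to \<gamma>, so no fixed point
  lies in it for all W. Boundary values of a primitive at fixed points of the line take the place of
  integrals between points of the strip.\<close>

definition bdry_limit :: "complex \<Rightarrow> (complex \<Rightarrow> complex) \<Rightarrow> real \<Rightarrow> complex \<Rightarrow> bool" where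
  "bdry_limit W N s l \<longleftrightarrow> (N \<longlongrightarrow> l) (at (Complex s \<theta>) within rect W)"

lemma bdry_limit_unique:
  assumes "Re W < e0" "side W" "s \<in> {lo..hi}" "bdry_limit W N s l" "bdry_limit W N s l'"
  shows "l = l'"
proof -
  have "\<not> trivial_limit (at (Complex s \<theta>) within rect W)"
    using rect_limit_point[OF assms(1,2,3)] by (simp add: trivial_limit_within)
  then show ?thesis using assms(4,5) unfolding bdry_limit_def by (rule tendsto_unique)
qed

text \<open>Strip and disc are convex, so on their intersection N differs by a constant from a
  primitive M that is continuous at the boundary point.\<close>

lemma bdry_limit_transfer:
  assumes N: "prim W N" and M: "\<And>y. y \<in> rect W \<inter> ball c d \<Longrightarrow> (M has_field_derivative hadamard_kernel F G (target W) y) (at y)"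
    and p: "p \<in> rect W \<inter> ball c d" and s: "Complex s \<theta> \<in> ball c d" "isCont M (Complex s \<theta>)"
  shows "bdry_limit W N s (M (Complex s \<theta>) + (N p - M p))"
proof -
  have eq: "N y = M y + (N p - M p)" if "y \<in> rect W \<inter> ball c d" for y
    using primitives_differ_constant[of "rect W \<inter> ball c d" y p N "hadamard_kernel F G (target W)" M] that p M N rect_open_convex
    by (auto simp: prim_def algebra_simps convex_connected convex_Int open_Int)
  have "((\<lambda>y. M y + (N p - M p)) \<longlongrightarrow> M (Complex s \<theta>) + (N p - M p)) (at (Complex s \<theta>) within rect W)"
    by (intro tendsto_intros) (use s(2) in \<open>auto simp: isCont_def intro: tendsto_within_subset\<close>)
  moreover have "\<forall>\<^sub>F y in at (Complex s \<theta>) within rect W. M y + (N p - M p) = N y"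
  proof -
    have "\<forall>\<^sub>F y in at (Complex s \<theta>) within rect W. y \<in> ball c d"
      using s(1) by (intro eventually_at_topological[THEN iffD2] exI[of _ "ball c d"]) auto
    moreover have "\<forall>\<^sub>F y in at (Complex s \<theta>) within rect W. y \<in> rect W" by (simp add: eventually_at_filter)
    ultimately show ?thesis by eventually_elim (use eq in auto)
  qed
  ultimately show ?thesis unfolding bdry_limit_def by (rule Lim_transform_eventually)
qed

lemma rect_meets_ball:
  assumes "Re W < e0" "side W" "x \<in> {lo..hi}" "0 < d"
  obtains p where "p \<in> rect W \<inter> ball (Complex x \<theta>) d"
  using rect_limit_point[OF assms(1,2,3)] assms(4) by (auto simp: islimpt_approachable dist_commute)

text \<open>
  \<open>V\<close> is the contribution of the part of the contour from \<open>s\<close> to \<open>t\<close> along the line \<open>Im x = \<theta>\<close>,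
  as a function on the logarithmic covering, with monodromy \<open>D\<close>.
\<close>

definition contribution :: "real \<Rightarrow> real \<Rightarrow> (complex \<Rightarrow> complex) \<Rightarrow> bool" where
  "contribution s t D \<longleftrightarrow> (\<exists>e V. e \<le> e0 \<and> V holomorphic_on {W. Re W < e} \<and>
     (\<forall>W. Re W < e \<longrightarrow> V (W + 2 * of_real pi * \<i>) = V W + D W) \<and>
     (\<forall>W N. Re W < e \<longrightarrow> side W \<longrightarrow> prim W N \<longrightarrow>
        (\<exists>ls lt. bdry_limit W N s ls \<and> bdry_limit W N t lt \<and> lt - ls = V W)))"

lemma contribution_trans:
  assumes "contribution s t D1" "contribution t u D2" "t \<in> {lo..hi}"
  shows "contribution s u (\<lambda>W. D1 W + D2 W)"
proof -
  obtain e1 V1 where 1: "e1 \<le> e0" "V1 holomorphic_on {W. Re W < e1}"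
     "\<And>W. Re W < e1 \<Longrightarrow> V1 (W + 2 * of_real pi * \<i>) = V1 W + D1 W"
     "\<And>W N. Re W < e1 \<Longrightarrow> side W \<Longrightarrow> prim W N \<Longrightarrow>
        (\<exists>ls lt. bdry_limit W N s ls \<and> bdry_limit W N t lt \<and> lt - ls = V1 W)"
    using assms(1) unfolding contribution_def by blast
  obtain e2 V2 where 2: "e2 \<le> e0" "V2 holomorphic_on {W. Re W < e2}"
     "\<And>W. Re W < e2 \<Longrightarrow> V2 (W + 2 * of_real pi * \<i>) = V2 W + D2 W"
     "\<And>W N. Re W < e2 \<Longrightarrow> side W \<Longrightarrow> prim W N \<Longrightarrow>
        (\<exists>ls lt. bdry_limit W N t ls \<and> bdry_limit W N u lt \<and> lt - ls = V2 W)"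
    using assms(2) unfolding contribution_def by blast
  show ?thesis
    unfolding contribution_def
  proof (intro exI[of _ "min e1 e2"] exI[of _ "\<lambda>W. V1 W + V2 W"] conjI allI impI)
    show "min e1 e2 \<le> e0" using 1 by simp
    show "(\<lambda>W. V1 W + V2 W) holomorphic_on {W. Re W < min e1 e2}"
      by (intro holomorphic_intros holomorphic_on_subset[OF 1(2)] holomorphic_on_subset[OF 2(2)]) auto
    fix W assume W: "Re W < min e1 e2"
    then show "V1 (W + 2 * of_real pi * \<i>) + V2 (W + 2 * of_real pi * \<i>) = V1 W + V2 W + (D1 W + D2 W)"
      using 1(3) 2(3) by simp
    fix N assume N: "side W" "prim W N"
    obtain ls lt where l1: "bdry_limit W N s ls" "bdry_limit W N t lt" "lt - ls = V1 W" using 1(4)[of W N] W N by auto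
    obtain lt' lu where l2: "bdry_limit W N t lt'" "bdry_limit W N u lu" "lu - lt' = V2 W" using 2(4)[of W N] W N by auto
    have "lt = lt'" by (rule bdry_limit_unique[OF _ N(1) assms(3) l1(2) l2(1)]) (use W 1 in auto)
    then have "lu - ls = V1 W + V2 W" unfolding l1(3)[symmetric] l2(3)[symmetric] by simp
    then show "\<exists>ls lt. bdry_limit W N s ls \<and> bdry_limit W N u lt \<and> lt - ls = V1 W + V2 W"
      using l1 l2 by (rule_tac exI[of _ ls], rule_tac exI[of _ lu]) auto
  qed
qed

text \<open>At a point that is not special both factors extend across their cuts, F(e^y) across the
  line Im y = \<theta> and G(z/e^y) across its moving cut. The bound ln (\<delta>/2) makes |shift W|
  < \<delta>, which keeps z/e^y close to \<open>\<gamma> / point x\<close>.\<close>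

lemma regular_extension:
  assumes x: "\<not> special x"
  obtains f g d \<delta> where "0 < d" "0 < \<delta>" "f holomorphic_on ball (point x) d" "g holomorphic_on ball (\<gamma> / point x) d"
    and "\<And>y. y \<in> ball (Complex x \<theta>) \<delta> \<Longrightarrow> exp y \<in> ball (point x) d"
    and "\<And>W y. Re W < min e0 (ln (\<delta> / 2)) \<Longrightarrow> y \<in> ball (Complex x \<theta>) \<delta> \<Longrightarrow> target W / exp y \<in> ball (\<gamma> / point x) d"
    and "\<And>y. y \<in> ball (Complex x \<theta>) \<delta> \<Longrightarrow> 0 < \<sigma> * (Im y - \<theta>) \<Longrightarrow>
           exp y \<in> principal_star F \<and> principal_branch F (exp y) = f (exp y)"
    and "\<And>W y. Re W < min e0 (ln (\<delta> / 2)) \<Longrightarrow> y \<in> ball (Complex x \<theta>) \<delta> \<Longrightarrow> 0 < \<sigma> * (Im (shift W) - (Im y - \<theta>)) \<Longrightarrow>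
           target W / exp y \<in> principal_star G \<and> principal_branch G (target W / exp y) = g (target W / exp y)"
proof -
  obtain r1 f where r1: "0 < r1" "f holomorphic_on ball (point x) r1"
    "\<And>u. u \<in> ball (point x) r1 \<Longrightarrow> 0 < \<sigma> * Im (u / point x) \<Longrightarrow> u \<in> principal_star F \<and> principal_branch F u = f u"
    using F.regular_side[OF point_nonzero(1) _ \<sigma>, of x] x unfolding special_def by blast
  obtain r2 g where r2: "0 < r2" "g holomorphic_on ball (\<gamma> / point x) r2"
    "\<And>u. u \<in> ball (\<gamma> / point x) r2 \<Longrightarrow> 0 < \<sigma> * Im (u / (\<gamma> / point x)) \<Longrightarrow> u \<in> principal_star G \<and> principal_branch G u = g u"
    using G.regular_side[OF point_nonzero(2) _ \<sigma>, of x] x unfolding special_def by blast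
  define d where "d = min r1 r2"
  have d: "0 < d" using r1 r2 by (simp add: d_def)
  have cont: "\<exists>\<delta>>0. \<forall>v. norm v < \<delta> \<longrightarrow> a * exp v \<in> ball a d" for a :: complex
  proof -
    have "((\<lambda>v. a * exp v) \<longlongrightarrow> a * exp 0) (nhds (0::complex))"
      by (intro tendsto_intros filterlim_ident)
    then have "\<forall>\<^sub>F v in nhds (0::complex). dist (a * exp v) (a * exp 0) < d" using d by (rule tendstoD)
    then show ?thesis by (auto simp: eventually_nhds_metric dist_commute)
  qed
  obtain \<delta>1 where \<delta>1: "0 < \<delta>1" "\<And>v. norm v < \<delta>1 \<Longrightarrow> point x * exp v \<in> ball (point x) d" using cont by blast
  obtain \<delta>2 where \<delta>2: "0 < \<delta>2" "\<And>v. norm v < \<delta>2 \<Longrightarrow> (\<gamma> / point x) * exp v \<in> ball (\<gamma> / point x) d" using cont by blast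
  define \<delta> where "\<delta> = min (min \<delta>1 (\<delta>2 / 2)) (1 / 2)"
  have \<delta>: "0 < \<delta>" "\<delta> \<le> \<delta>1" "2 * \<delta> \<le> \<delta>2" "\<delta> \<le> 1 / 2" using \<delta>1 \<delta>2 by (auto simp: \<delta>_def)
  have expy: "exp y = point x * exp (y - Complex x \<theta>)" for y by (simp add: point_def exp_diff)
  have quot: "target W / exp y = (\<gamma> / point x) * exp (shift W - (y - Complex x \<theta>))" if "Re W < e0" for W y
    using \<gamma> by (simp add: target_quotient[OF that] point_def exp_add exp_diff)
  have sh: "norm (shift W) < \<delta>" if "Re W < min e0 (ln (\<delta> / 2))" for W
  proof -
    have "norm (exp W) < 1 / 2" using shift_bounds(1)[of W] that \<eta> by simp
    then have "norm (shift W) \<le> 2 * norm (exp W)" unfolding shift_def by (rule norm_Ln_le)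
    moreover have "exp (Re W) < \<delta> / 2" using that \<delta>(1) less_ln_iff[of "\<delta> / 2" "Re W"] by simp
    ultimately show ?thesis by simp
  qed
  have small_y: "norm (y - Complex x \<theta>) < \<delta>" "\<bar>Im y - \<theta>\<bar> < \<delta>" if "y \<in> ball (Complex x \<theta>) \<delta>" for y
    using that abs_Im_le_cmod[of "y - Complex x \<theta>"] by (auto simp: dist_norm norm_minus_commute)
  have E: "exp y \<in> ball (point x) d" if "y \<in> ball (Complex x \<theta>) \<delta>" for y
    unfolding expy[of y] by (rule \<delta>1(2)) (use small_y(1)[OF that] \<delta>(2) in simp)
  have Q: "target W / exp y \<in> ball (\<gamma> / point x) d" if "Re W < min e0 (ln (\<delta> / 2))" "y \<in> ball (Complex x \<theta>) \<delta>" for W y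
    unfolding quot[OF that(1)[THEN min_less_iff_conj[THEN iffD1], THEN conjunct1]]
    by (rule \<delta>2(2)) (use small_y(1)[OF that(2)] sh[OF that(1)] \<delta>(3) norm_triangle_ineq4[of "shift W" "y - Complex x \<theta>"] in linarith)
  show thesis
  proof (rule that[OF d \<delta>(1)])
    show "f holomorphic_on ball (point x) d" by (rule holomorphic_on_subset[OF r1(2)]) (auto simp: d_def)
    show "g holomorphic_on ball (\<gamma> / point x) d" by (rule holomorphic_on_subset[OF r2(2)]) (auto simp: d_def)
    fix y assume y: "y \<in> ball (Complex x \<theta>) \<delta>"
    show "exp y \<in> ball (point x) d" by (rule E[OF y])
    show "exp y \<in> principal_star F \<and> principal_branch F (exp y) = f (exp y)" if "0 < \<sigma> * (Im y - \<theta>)"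
    proof (rule r1(3))
      show "exp y \<in> ball (point x) r1" using E[OF y] by (simp add: d_def)
      have "0 < \<sigma> * Im (exp (y - Complex x \<theta>))"
        by (rule sign_Im_exp[OF \<sigma>]) (use that small_y(2)[OF y] \<delta>(4) pi_gt3 \<sigma> in \<open>auto simp: abs_less_iff\<close>)
      then show "0 < \<sigma> * Im (exp y / point x)" by (simp add: expy[of y])
    qed
    fix W assume W: "Re W < min e0 (ln (\<delta> / 2))"
    show "target W / exp y \<in> ball (\<gamma> / point x) d" by (rule Q[OF W y])
    show "target W / exp y \<in> principal_star G \<and> principal_branch G (target W / exp y) = g (target W / exp y)"
      if "0 < \<sigma> * (Im (shift W) - (Im y - \<theta>))"
    proof (rule r2(3))
      show "target W / exp y \<in> ball (\<gamma> / point x) r2" using Q[OF W y] by (simp add: d_def)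
      have "\<bar>Im (shift W)\<bar> < \<delta>" using sh[OF W] abs_Im_le_cmod[of "shift W"] by linarith
      then have "0 < \<sigma> * Im (exp (shift W - (y - Complex x \<theta>)))"
        by (intro sign_Im_exp[OF \<sigma>]) (use that small_y(2)[OF y] \<delta>(4) pi_gt3 \<sigma> in \<open>auto simp: abs_less_iff\<close>)
      moreover have "target W / exp y / (\<gamma> / point x) = exp (shift W - (y - Complex x \<theta>))"
        using quot[of W y] W \<gamma> by (simp add: field_simps)
      ultimately show "0 < \<sigma> * Im (target W / exp y / (\<gamma> / point x))" by simp
    qed
  qed
qed

text \<open>With both factors extended the integral can be taken on the line itself. It depends on W
  only through z and so has no monodromy.\<close>

lemma contribution_regular:
  assumes x: "x \<in> {lo..hi}" "\<not> special x"
  obtains d where "0 < d" "\<And>s t. \<bar>s - x\<bar> < d \<Longrightarrow> \<bar>t - x\<bar> < d \<Longrightarrow> contribution s t (\<lambda>_. 0)"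
proof -
  obtain f g d \<delta> where d: "0 < d" "0 < \<delta>" "f holomorphic_on ball (point x) d" "g holomorphic_on ball (\<gamma> / point x) d"
    and E: "\<And>y. y \<in> ball (Complex x \<theta>) \<delta> \<Longrightarrow> exp y \<in> ball (point x) d"
    and Q: "\<And>W y. Re W < min e0 (ln (\<delta> / 2)) \<Longrightarrow> y \<in> ball (Complex x \<theta>) \<delta> \<Longrightarrow> target W / exp y \<in> ball (\<gamma> / point x) d"
    and PF: "\<And>y. y \<in> ball (Complex x \<theta>) \<delta> \<Longrightarrow> 0 < \<sigma> * (Im y - \<theta>) \<Longrightarrow>
           exp y \<in> principal_star F \<and> principal_branch F (exp y) = f (exp y)"
    and PG: "\<And>W y. Re W < min e0 (ln (\<delta> / 2)) \<Longrightarrow> y \<in> ball (Complex x \<theta>) \<delta> \<Longrightarrow> 0 < \<sigma> * (Im (shift W) - (Im y - \<theta>)) \<Longrightarrow>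
           target W / exp y \<in> principal_star G \<and> principal_branch G (target W / exp y) = g (target W / exp y)"
    by (rule regular_extension[OF x(2)], rule that)
  define e where "e = min e0 (ln (\<delta> / 2))"
  define D where "D = ball (Complex x \<theta>) \<delta>"
  define k where "k W y = f (exp y) * g (target W / exp y)" for W y
  show thesis
  proof (rule that[OF d(2)])
    fix s t assume st: "\<bar>s - x\<bar> < \<delta>" "\<bar>t - x\<bar> < \<delta>"
    then have stD: "Complex s \<theta> \<in> D" "Complex t \<theta> \<in> D"
      by (auto simp: D_def dist_norm complex_diff cmod_def)
    have segD: "closed_segment (Complex s \<theta>) (Complex t \<theta>) \<subseteq> D"
      by (rule closed_segment_subset[OF stD]) (simp add: D_def)
    show "contribution s t (\<lambda>_. 0)"
      unfolding contribution_def
    proof (intro exI[of _ e] exI[of _ "\<lambda>W. contour_integral (linepath (Complex s \<theta>) (Complex t \<theta>)) (k W)"] conjI allI impI)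
      show "e \<le> e0" by (simp add: e_def)
      show "(\<lambda>W. contour_integral (linepath (Complex s \<theta>) (Complex t \<theta>)) (k W)) holomorphic_on {W. Re W < e}"
        unfolding k_def
        by (rule integral_of_extension_holomorphic[OF d(3,4) open_halfspace_Re_lt])
          (use E Q segD in \<open>auto simp: D_def e_def simp del: mem_ball\<close>)
      fix W assume W: "Re W < e"
      show "contour_integral (linepath (Complex s \<theta>) (Complex t \<theta>)) (k (W + 2 * of_real pi * \<i>)) =
          contour_integral (linepath (Complex s \<theta>) (Complex t \<theta>)) (k W) + 0"
        using target_periodic[of W] unfolding k_def by simp
      fix N assume sN: "side W" "prim W N"
      have hk: "k W holomorphic_on D"
        unfolding k_def by (rule extension_holomorphic[OF d(3,4)]) (use E Q W in \<open>auto simp: D_def e_def simp del: mem_ball\<close>)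
      obtain M where M0: "\<And>y. y \<in> D \<Longrightarrow> (M has_field_derivative k W y) (at y within D)"
        using holomorphic_convex_primitive'[OF _ _ hk] unfolding D_def by blast
      have M: "(M has_field_derivative k W y) (at y)" if "y \<in> D" for y
        using M0[OF that] at_within_open[OF that] by (simp add: D_def)
      have W0: "Re W < e0" using W by (simp add: e_def)
      have MK: "(M has_field_derivative hadamard_kernel F G (target W) y) (at y)" if "y \<in> rect W \<inter> ball (Complex x \<theta>) \<delta>" for y
      proof -
        have "hadamard_kernel F G (target W) y = k W y"
          using that PF[of y] PG[of W y] rect_offset(5)[OF W0 sN(1), of y] W
          by (auto simp: hadamard_kernel_def k_def rect_def e_def)
        then show ?thesis using M[of y] that by (simp add: D_def)
      qed
      obtain p where p: "p \<in> rect W \<inter> ball (Complex x \<theta>) \<delta>"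
        by (rule rect_meets_ball[OF W0 sN(1) x(1) d(2)])
      have lim: "bdry_limit W N q (M (Complex q \<theta>) + (N p - M p))" if "Complex q \<theta> \<in> D" for q
        by (rule bdry_limit_transfer[OF sN(2) MK p])
          (use that M[OF that] in \<open>auto simp: D_def intro: DERIV_isCont\<close>)
      have "M (Complex t \<theta>) - M (Complex s \<theta>) = contour_integral (linepath (Complex s \<theta>) (Complex t \<theta>)) (k W)"
        using contour_integral_linepath_primitive(1)[OF M0 segD] by simp
      then show "\<exists>ls lt. bdry_limit W N s ls \<and> bdry_limit W N t lt \<and>
          lt - ls = contour_integral (linepath (Complex s \<theta>) (Complex t \<theta>)) (k W)"
        using lim[OF stD(1)] lim[OF stD(2)] by (metis add_diff_cancel_right)
    qed
  qed
qed

text \<open>In the coordinate Sl, with e^y = \<alpha>(1 + exp (Sl y)), the integrand near x is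
  \<open>kern A' B' W\<close>. Points of the line left of x have Im (Sl y) = \<sigma> pi, points
  right of x have Im (Sl y) = 0, and Im W is strictly between: passing x means passing between the
  two branch points, which is \<open>pinch\<close>. Two points right of x are on the same side of
  both branch points; they are joined in the outer strip, where the kernel is periodic in W.\<close>

lemma contribution_special:
  assumes x: "x \<in> {lo..hi}"
  obtains d where "0 < d"
    "\<And>s t. x - d < s \<Longrightarrow> s < x \<Longrightarrow> x < t \<Longrightarrow> t < x + d \<Longrightarrow> contribution s t (\<lambda>W. of_real \<sigma> * (- conv_int (point x) W))"
    "\<And>s t. x < s \<Longrightarrow> s < x + d \<Longrightarrow> x < t \<Longrightarrow> t < x + d \<Longrightarrow> contribution s t (\<lambda>_. 0)"
proof -
  define \<alpha> where "\<alpha> = point x"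
  define \<beta> where "\<beta> = \<gamma> / \<alpha>"
  have \<alpha>0: "\<alpha> \<noteq> 0" "\<beta> \<noteq> 0" using \<gamma> by (simp_all add: \<alpha>_def \<beta>_def)
  define c where "c = min (min (cA \<alpha>) (cB \<beta>)) (ln (1 / 2))"
  define A' where "A' = A \<alpha>"
  define B' where "B' = B \<beta>"
  have sA: "side_branch F \<sigma> \<alpha> c A'" and sB: "side_branch G \<sigma> \<beta> c B'"
    using side_branch_mono[OF A[OF \<alpha>0(1)]] side_branch_mono[OF B[OF \<alpha>0(2)]] by (auto simp: A'_def B'_def c_def)
  have iA: "integrable_branch c A'" and iB: "integrable_branch c B'"
    using sA sB by (auto simp: side_branch_def)
  have hA: "A' holomorphic_on {s. Re s < c}" and hB: "B' holomorphic_on {s. Re s < c}"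
    using iA iB by (auto dest: integrable_branch_holo)
  have "c \<le> ln (1 / 2)" by (simp add: c_def)
  then have "exp c \<le> exp (ln (1 / 2))" by (simp only: exp_le_cancel_iff)
  then interpret scale c by unfold_locales simp
  define x\<theta> where "x\<theta> = Complex x \<theta>"
  define \<zeta> where "\<zeta> y = exp (y - x\<theta>) - 1" for y
  \<comment> \<open>The rotation by -\<sigma> i takes the half plane of the strip to the right half
    plane, so the cut of Ln points away from the strip and both halves of the line remain in its
    domain; the second term undoes the rotation.\<close>
  define Sl where "Sl y = Ln (- (of_real \<sigma> * \<i>) * \<zeta> y) + of_real \<sigma> * \<i> * of_real (pi / 2)" for y
  have "(\<zeta> \<longlongrightarrow> \<zeta> x\<theta>) (nhds x\<theta>)" unfolding \<zeta>_def by (intro tendsto_intros filterlim_ident)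
  then have "\<forall>\<^sub>F y in nhds x\<theta>. dist (\<zeta> y) (\<zeta> x\<theta>) < exp (c - 2)" by (rule tendstoD) simp
  then obtain d0 where d0: "0 < d0" "\<And>y. dist y x\<theta> < d0 \<Longrightarrow> norm (\<zeta> y) < exp (c - 2)"
    by (auto simp: eventually_nhds_metric \<zeta>_def)
  define d where "d = min d0 (1 / 2)"
  have d: "0 < d" "d \<le> 1 / 2" using d0 by (auto simp: d_def)
  define D where "D = ball x\<theta> d"
  have zsmall: "norm (\<zeta> y) < exp (c - 2)" if "y \<in> D" for y
    using d0(2)[of y] that by (simp add: D_def d_def dist_commute)
  have zexp: "exp y = \<alpha> * (1 + \<zeta> y)" for y
    by (simp add: \<alpha>_def point_def \<zeta>_def x\<theta>_def exp_diff)
  have cut: "- (of_real \<sigma> * \<i>) * \<zeta> y \<notin> \<real>\<^sub>\<le>\<^sub>0" if "Re (\<zeta> y) \<noteq> 0 \<or> 0 < \<sigma> * Im (\<zeta> y)" for y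
    using that \<sigma> by (auto simp: complex_nonpos_Reals_iff)
  have exp_rot: "exp (of_real \<sigma> * \<i> * of_real (pi / 2)) = of_real \<sigma> * \<i>"
    using \<sigma> by (auto simp: exp_eq_polar cis_conv_exp[symmetric] exp_minus cis.code complex_eq_iff)
  have expSl: "exp (Sl y) = \<zeta> y" if "\<zeta> y \<noteq> 0" for y
  proof -
    have "- (of_real \<sigma> * \<i>) * \<zeta> y \<noteq> 0" using that \<sigma> by auto
    then have "exp (Sl y) = - (of_real \<sigma> * \<i>) * \<zeta> y * (of_real \<sigma> * \<i>)"
      unfolding Sl_def exp_add exp_rot by simp
    also have "\<dots> = \<zeta> y" using \<sigma> by (auto simp: complex_eq_iff)
    finally show ?thesis .
  qed
  have ReSl: "Re (Sl y) < c - 2" if "y \<in> D" "\<zeta> y \<noteq> 0" for y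
  proof -
    have "exp (Re (Sl y)) < exp (c - 2)" using zsmall[OF that(1)] expSl[OF that(2)] norm_exp_eq_Re[of "Sl y"] by simp
    then show ?thesis by simp
  qed
  have dSl: "(Sl has_field_derivative (1 + \<zeta> y) / \<zeta> y) (at y)" if "Re (\<zeta> y) \<noteq> 0 \<or> 0 < \<sigma> * Im (\<zeta> y)" for y
  proof -
    have nz: "\<zeta> y \<noteq> 0" using that by auto
    have "(\<zeta> has_field_derivative 1 + \<zeta> y) (at y)" unfolding \<zeta>_def by (auto intro!: derivative_eq_intros)
    then have "((\<lambda>y. - (of_real \<sigma> * \<i>) * \<zeta> y) has_field_derivative - (of_real \<sigma> * \<i>) * (1 + \<zeta> y)) (at y)"
      by (rule DERIV_cmult)
    from has_field_derivative_Ln[OF cut[OF that]]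
    have "((\<lambda>y. Ln (- (of_real \<sigma> * \<i>) * \<zeta> y)) has_field_derivative
        inverse (- (of_real \<sigma> * \<i>) * \<zeta> y) * (- (of_real \<sigma> * \<i>) * (1 + \<zeta> y))) (at y)"
      by (rule DERIV_chain2) fact
    then have "(Sl has_field_derivative inverse (- (of_real \<sigma> * \<i>) * \<zeta> y) * (- (of_real \<sigma> * \<i>) * (1 + \<zeta> y)) + 0) (at y)"
      unfolding Sl_def by (intro DERIV_add DERIV_const)
    moreover have "inverse (- (of_real \<sigma> * \<i>) * \<zeta> y) * (- (of_real \<sigma> * \<i>) * (1 + \<zeta> y)) + 0 = (1 + \<zeta> y) / \<zeta> y"
      using nz \<sigma> by (auto simp: field_simps)
    ultimately show ?thesis by simp
  qed
  define r where "r s = exp (s - x) - 1" for s :: real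
  have zreal: "\<zeta> (Complex s \<theta>) = of_real (r s)" for s
  proof -
    have "Complex s \<theta> - x\<theta> = of_real (s - x)" by (simp add: x\<theta>_def complex_eq_iff)
    then show ?thesis by (simp add: \<zeta>_def r_def exp_of_real[of "s - x"]) (simp flip: exp_of_real)
  qed
  have Sl_left: "Sl (Complex s \<theta>) = of_real (ln (- r s)) + of_real \<sigma> * \<i> * of_real pi" "r s < 0" if "s < x" for s
  proof -
    show r: "r s < 0" using that by (simp add: r_def)
    have "Ln (- (of_real \<sigma> * \<i>) * of_real (r s)) = of_real (ln (- r s)) + of_real \<sigma> * \<i> * of_real (pi / 2)"
    proof (rule Ln_unique)
      show "exp (of_real (ln (- r s)) + of_real \<sigma> * \<i> * of_real (pi / 2)) = - (of_real \<sigma> * \<i>) * of_real (r s)"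
        unfolding exp_add exp_rot using r by (simp add: exp_of_real)
    qed (use \<sigma> pi_gt3 in auto)
    then show "Sl (Complex s \<theta>) = of_real (ln (- r s)) + of_real \<sigma> * \<i> * of_real pi"
      unfolding Sl_def zreal by simp
  qed
  have Sl_right: "Sl (Complex s \<theta>) = of_real (ln (r s))" "0 < r s" if "x < s" for s
  proof -
    show r: "0 < r s" using that by (simp add: r_def)
    have "Ln (- (of_real \<sigma> * \<i>) * of_real (r s)) = of_real (ln (r s)) - of_real \<sigma> * \<i> * of_real (pi / 2)"
    proof (rule Ln_unique)
      have "inverse (of_real \<sigma> * \<i>) = - (of_real \<sigma> * \<i>)" using \<sigma> by auto
      then show "exp (of_real (ln (r s)) - of_real \<sigma> * \<i> * of_real (pi / 2)) = - (of_real \<sigma> * \<i>) * of_real (r s)"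
        unfolding exp_diff exp_rot using r by (simp add: exp_of_real divide_inverse)
    qed (use \<sigma> pi_gt3 in auto)
    then show "Sl (Complex s \<theta>) = of_real (ln (r s))"
      unfolding Sl_def zreal by simp
  qed
  have inD: "Complex s \<theta> \<in> D" if "x - d < s" "s < x + d" for s
    using that by (auto simp: D_def x\<theta>_def dist_norm complex_diff cmod_def)
  have rne: "r s \<noteq> 0" if "s \<noteq> x" for s using that by (simp add: r_def)
  have Sl_real: "Re (Sl (Complex s \<theta>)) < c - 2" "isCont Sl (Complex s \<theta>)" if "x - d < s" "s < x + d" "s \<noteq> x" for s
    using ReSl[OF inD[OF that(1,2)]] dSl[of "Complex s \<theta>"] rne[OF that(3)] by (auto simp: zreal intro: DERIV_isCont)
  \<comment> \<open>A primitive on the strip is Ns composed with Sl up to a constant, so its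
    boundary values are values of Ns.\<close>
  have main: "\<exists>C. \<forall>s. x - d < s \<longrightarrow> s < x + d \<longrightarrow> s \<noteq> x \<longrightarrow> bdry_limit W N s (Ns (Sl (Complex s \<theta>)) + C)"
    if W: "Re W < e0" "Re W < c - 3" "side W" and N: "prim W N"
      and Ns: "\<And>s. s \<in> S W \<Longrightarrow> (Ns has_field_derivative kern A' B' W s) (at s)" for W N Ns
  proof -
    define Q where "Q = rect W \<inter> D"
    have Qo: "open Q" "convex Q" unfolding Q_def D_def using rect_open_convex by (auto intro: convex_Int open_Int)
    have Imz: "0 < \<sigma> * Im (\<zeta> y)" if "y \<in> Q" for y
    proof -
      have "0 < \<sigma> * Im (exp (y - x\<theta>))"
        by (rule sign_Im_exp[OF \<sigma>])
          (use that rect_offset[OF W(1,3), of y] \<eta> \<sigma> pi_gt3 in \<open>auto simp: Q_def rect_def x\<theta>_def abs_less_iff\<close>)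
      then show ?thesis by (simp add: \<zeta>_def)
    qed
    have sideSl: "side (Sl y)" if "y \<in> Q" for y
    proof -
      have "0 < Re (- (of_real \<sigma> * \<i>) * \<zeta> y)" using Imz[OF that] by simp
      then have "\<bar>Im (Ln (- (of_real \<sigma> * \<i>) * \<zeta> y))\<bar> < pi / 2" by (rule Re_Ln_pos_lt_imp)
      then show ?thesis using \<sigma> unfolding side_def Sl_def by (auto simp: abs_less_iff)
    qed
    have znz: "\<zeta> y \<noteq> 0" if "y \<in> Q" for y using Imz[OF that] by auto
    have ReQ: "Re (Sl y) < c - 2" if "y \<in> Q" for y using ReSl znz that by (auto simp: Q_def)
    have expW: "1 + exp W \<noteq> 0" by (rule shift_bounds(3)[OF W(1)])
    have slit: "Sl y \<in> S W" if y: "y \<in> Q" for y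
    proof -
      \<comment> \<open>On the slit \<zeta> y = l e^W with l \<ge> 1, so e^y divided by \<alpha>(1 +
        e^W) is (1 + l e^W)/(1 + e^W), and the sign of its imaginary part puts y on or beyond the
        cut of G.\<close>
      have "\<not> Re W \<le> Re (Sl y)" if eq: "Im (Sl y) = Im W"
      proof
        assume le: "Re W \<le> Re (Sl y)"
        define l where "l = exp (Re (Sl y) - Re W)"
        have l: "1 \<le> l" using le by (simp add: l_def)
        have "Sl y - W = of_real (Re (Sl y) - Re W)" using eq by (simp add: complex_eq_iff)
        then have "\<zeta> y / exp W = of_real l" using expSl[OF znz[OF y]] by (metis exp_diff exp_of_real l_def)
        then have z: "\<zeta> y = of_real l * exp W" by (simp add: field_simps)
        define w where "w = exp W"
        have w: "0 < \<sigma> * Im w" unfolding w_def by (rule sign_Im_exp[OF \<sigma>]) (use W(3) in \<open>auto simp: side_def\<close>)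
        have "exp (y - x\<theta> - shift W) = (1 + of_real l * w) / (1 + w)"
          using shift_bounds(4)[OF W(1)] z by (simp add: exp_diff \<zeta>_def w_def diff_eq_eq add.commute)
        also have "\<dots> = (1 + of_real l * w) * (1 + cnj w) / of_real ((norm (1 + w))\<^sup>2)"
          using expW by (subst complex_div_cnj) (simp add: w_def)
        finally have "\<sigma> * Im (exp (y - x\<theta> - shift W)) = \<sigma> * Im ((1 + of_real l * w) * (1 + cnj w)) / (norm (1 + w))\<^sup>2"
          by (simp add: Im_divide_of_real)
        also have "\<sigma> * Im ((1 + of_real l * w) * (1 + cnj w)) = (l - 1) * (\<sigma> * Im w)" by (simp add: algebra_simps)
        finally have "0 \<le> \<sigma> * Im (exp (y - x\<theta> - shift W))" using l w by simp
        moreover have "0 < \<sigma> * Im (exp (- (y - x\<theta> - shift W)))"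
          by (rule sign_Im_exp[OF \<sigma>])
            (use y rect_offset[OF W(1,3), of y] shift_side[OF W(1,3)] \<eta> \<sigma> pi_gt3 in \<open>auto simp: Q_def rect_def x\<theta>_def abs_less_iff\<close>)
        ultimately show False
          using \<sigma> by (auto simp: Im_exp mult_less_0_iff zero_le_mult_iff zero_less_mult_iff sin_diff algebra_simps)
      qed
      then show ?thesis using ReQ[OF y] sideSl[OF y] W(3) \<sigma> by (auto simp: slit_strip_def side_def abs_less_iff)
    qed
    have Slh: "Sl holomorphic_on Q"
      unfolding holomorphic_on_def
      using dSl Imz by (meson field_differentiable_at_within field_differentiable_def)
    have PFA: "principal_branch F (exp y) = A' (Sl y)" if "y \<in> Q" for y
    proof -
      have "principal_branch F (\<alpha> * (1 + exp (Sl y))) = A' (Sl y)"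
        using sA ReQ[OF that] sideSl[OF that] unfolding side_branch_def side_def by auto
      then show ?thesis by (simp add: expSl[OF znz[OF that]] zexp[of y])
    qed
    have part: "partner W (Sl y) = W + Ln (1 - \<zeta> y * exp (- W)) - Ln (1 + \<zeta> y)" if "\<zeta> y \<noteq> 0" for y
      using expSl[OF that] by (simp add: partner_def exp_diff exp_minus divide_inverse)
    have RePart: "Re (partner W (Sl y)) < c" if "y \<in> Q" for y
      by (rule Re_partner[OF slit_not_nonpos[OF slit[OF that]] ReQ[OF that]]) (use W in simp)
    have PGB1: "principal_branch G (target W / exp y) = B' (partner W (Sl y))" if y: "y \<in> Q" "side (partner W (Sl y))" for y
    proof -
      have "exp (partner W (Sl y)) = (exp W - \<zeta> y) / (1 + \<zeta> y)"
        using exp_partner[OF slit_not_nonpos[OF slit[OF y(1)]] ReQ[OF y(1)]] expSl[OF znz[OF y(1)]] by simp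
      moreover have "1 + \<zeta> y \<noteq> 0" by (simp add: \<zeta>_def)
      ultimately have "1 + exp (partner W (Sl y)) = (1 + exp W) / (1 + \<zeta> y)"
        by (simp add: divide_simps) (simp add: algebra_simps)
      then have "\<beta> * (1 + exp (partner W (Sl y))) = target W / exp y"
        unfolding zexp[of y] target_def \<beta>_def by simp
      then show ?thesis using sB RePart[OF y(1)] y(2) by (auto simp: side_branch_def side_def)
    qed
    have ph: "(\<lambda>y. partner W (Sl y)) holomorphic_on Q"
    proof -
      have "1 + exp (Sl y) \<notin> \<real>\<^sub>\<le>\<^sub>0" "1 - exp (Sl y - W) \<notin> \<real>\<^sub>\<le>\<^sub>0" if "y \<in> Q" for y
        using one_plus_exp(4)[OF ReQ[OF that]] slit_not_nonpos[OF slit[OF that]] by auto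
      then show ?thesis unfolding partner_def by (intro holomorphic_intros Slh) auto
    qed
    have "(B' \<circ> (\<lambda>y. partner W (Sl y))) holomorphic_on Q"
      by (rule holomorphic_on_compose_gen[OF ph hB]) (use RePart in auto)
    then have H1: "(\<lambda>y. B' (partner W (Sl y))) holomorphic_on Q" by (simp add: o_def)
    have "(principal_branch G \<circ> (\<lambda>y. target W / exp y)) holomorphic_on Q"
      by (rule holomorphic_on_compose_gen[OF _ holomorphic_principal_branch])
        (use rect_region[OF W(1,3)] in \<open>auto intro!: holomorphic_intros simp: Q_def hadamard_region_def\<close>)
    then have H2: "(\<lambda>y. principal_branch G (target W / exp y)) holomorphic_on Q" by (simp add: o_def)
    \<comment> \<open>The branch B' is tied to G only where the partner lies in the open side strip.
      The partner tends to W as y tends to the base point, so such y exist; the identity theorem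
      then carries the equality to all of the connected set Q.\<close>
    have "\<exists>y\<in>Q. side (partner W (Sl y))"
    proof -
      have "((\<lambda>y. W + Ln (1 - \<zeta> y * exp (- W)) - Ln (1 + \<zeta> y)) \<longlongrightarrow> W + Ln (1 - \<zeta> x\<theta> * exp (- W)) - Ln (1 + \<zeta> x\<theta>)) (at x\<theta> within rect W)"
        unfolding \<zeta>_def by (intro tendsto_intros) (auto simp: complex_nonpos_Reals_iff)
      then have lim: "((\<lambda>y. W + Ln (1 - \<zeta> y * exp (- W)) - Ln (1 + \<zeta> y)) \<longlongrightarrow> W) (at x\<theta> within rect W)"
        by (simp add: \<zeta>_def)
      have "open {s. side s}"
        unfolding side_def using \<sigma> by (intro open_Collect_conj open_Collect_less continuous_intros)
      then have "\<forall>\<^sub>F y in at x\<theta> within rect W. W + Ln (1 - \<zeta> y * exp (- W)) - Ln (1 + \<zeta> y) \<in> {s. side s}"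
        by (rule topological_tendstoD[OF lim]) (use W(3) in simp)
      moreover have "\<forall>\<^sub>F y in at x\<theta> within rect W. y \<in> D"
        by (intro eventually_at_topological[THEN iffD2] exI[of _ D]) (use d in \<open>auto simp: D_def\<close>)
      moreover have "\<forall>\<^sub>F y in at x\<theta> within rect W. y \<in> rect W" by (simp add: eventually_at_filter)
      ultimately have "\<forall>\<^sub>F y in at x\<theta> within rect W. y \<in> Q \<and> side (partner W (Sl y))"
      proof eventually_elim
        case (elim y)
        then have "y \<in> Q" by (simp add: Q_def)
        then show ?case using elim part[OF znz] by simp
      qed
      moreover have "\<not> trivial_limit (at x\<theta> within rect W)"
        using rect_limit_point[OF W(1,3) x] by (simp add: trivial_limit_within x\<theta>_def)
      ultimately show ?thesis using eventually_happens' by blast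
    qed
    then obtain y0 where y0: "y0 \<in> Q" "side (partner W (Sl y0))" by blast
    define Q' where "Q' = {y \<in> Q. side (partner W (Sl y))}"
    have "open Q'"
    proof -
      have "open (Q \<inter> (\<lambda>y. partner W (Sl y)) -` {s. side s})"
        by (rule continuous_open_preimage[OF holomorphic_on_imp_continuous_on[OF ph] Qo(1)])
          (use \<sigma> in \<open>unfold side_def, intro open_Collect_conj open_Collect_less continuous_intros\<close>)
      moreover have "Q' = Q \<inter> (\<lambda>y. partner W (Sl y)) -` {s. side s}" by (auto simp: Q'_def)
      ultimately show ?thesis by simp
    qed
    have PGB: "principal_branch G (target W / exp y) = B' (partner W (Sl y))" if "y \<in> Q" for y
      by (rule analytic_continuation_open[OF \<open>open Q'\<close> Qo(1) _ convex_connected[OF Qo(2)] _ H2 H1 _ that])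
        (use y0 PGB1 in \<open>auto simp: Q'_def\<close>)
    have der: "((\<lambda>y. Ns (Sl y)) has_field_derivative hadamard_kernel F G (target W) y) (at y)" if "y \<in> rect W \<inter> ball x\<theta> d" for y
    proof -
      have y: "y \<in> Q" using that by (simp add: Q_def D_def)
      have "((\<lambda>y. Ns (Sl y)) has_field_derivative kern A' B' W (Sl y) * ((1 + \<zeta> y) / \<zeta> y)) (at y)"
        by (rule DERIV_chain2[OF Ns[OF slit[OF y]] dSl]) (use Imz[OF y] in simp)
      moreover have "1 + \<zeta> y \<noteq> 0" by (simp add: \<zeta>_def)
      then have "kern A' B' W (Sl y) * ((1 + \<zeta> y) / \<zeta> y) = hadamard_kernel F G (target W) y"
        using znz[OF y] by (simp add: kern_def hadamard_kernel_def PFA[OF y] PGB[OF y] expSl[OF znz[OF y]])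
      ultimately show ?thesis by simp
    qed
    obtain p where p: "p \<in> rect W \<inter> ball x\<theta> d"
      unfolding x\<theta>_def by (rule rect_meets_ball[OF W(1,3) x d(1)])
    show ?thesis
    proof (intro exI[of _ "N p - Ns (Sl p)"] allI impI)
      fix s assume s: "x - d < s" "s < x + d" "s \<noteq> x"
      have "Im (Sl (Complex s \<theta>)) = 0 \<or> Im (Sl (Complex s \<theta>)) = \<sigma> * pi"
        using s(3) Sl_left(1)[of s] Sl_right(1)[of s] by (cases "s < x") auto
      then have "Sl (Complex s \<theta>) \<in> S W"
        using Sl_real(1)[OF s] W(3) \<sigma> by (auto simp: slit_strip_def side_def)
      then have "isCont Ns (Sl (Complex s \<theta>))" using Ns DERIV_isCont by blast
      then have cont: "isCont (\<lambda>y. Ns (Sl y)) (Complex s \<theta>)"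
        by (rule isCont_o2[OF Sl_real(2)[OF s]])
      show "bdry_limit W N s (Ns (Sl (Complex s \<theta>)) + (N p - Ns (Sl p)))"
        by (rule bdry_limit_transfer[OF N der p inD[OF s(1,2), unfolded D_def] cont])
    qed
  qed
  show thesis
  proof (rule that[OF d(1)])
    fix s t assume st: "x - d < s" "s < x" "x < t" "t < x + d"
    define s' where "s' = Sl (Complex s \<theta>)"
    define t' where "t' = Sl (Complex t \<theta>)"
    define e where "e = min (min e0 (c - 3)) (min (Re s') (Re t'))"
    have R: "Re s' < c - 2" "Re t' < c - 2" using Sl_real(1)[of s] Sl_real(1)[of t] st by (auto simp: s'_def t'_def)
    have Im: "Im s' = \<sigma> * pi" "Im t' = 0" using Sl_left(1)[OF st(2)] Sl_right(1)[OF st(3)] by (auto simp: s'_def t'_def)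
    \<comment> \<open>\<open>pinch\<close> runs from the upper to the lower gap. For \<sigma> = -1
      the left point s' is in the lower gap, hence the exchanged end points and the sign.\<close>
    define V where "V W = (if \<sigma> = 1 then pinch A' B' s' t' W else - pinch A' B' t' s' W)" for W
    show "contribution s t (\<lambda>W. of_real \<sigma> * (- conv_int (point x) W))"
      unfolding contribution_def
    proof (intro exI[of _ e] exI[of _ V] conjI allI impI)
      show "e \<le> e0" by (simp add: e_def)
      have "pinch A' B' s' t' holomorphic_on {W. Re W < e}" "pinch A' B' t' s' holomorphic_on {W. Re W < e}"
        by (rule pinch_holomorphic[OF hA hB]; use R in \<open>simp add: e_def\<close>)+
      then show "V holomorphic_on {W. Re W < e}"
        unfolding V_def[abs_def] by (cases "\<sigma> = 1") (auto intro!: holomorphic_intros)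
      fix W assume W: "Re W < e"
      have W': "Re W < c - 3" "Re W < Re s'" "Re W < Re t'" "Re W < e0" using W by (auto simp: e_def)
      have ci: "conv_int (point x) W = pinch A' B' s' t' W - pinch A' B' s' t' (W + 2 * of_real pi * \<i>)"
        "conv_int (point x) W = pinch A' B' t' s' W - pinch A' B' t' s' (W + 2 * of_real pi * \<i>)"
        unfolding conv_int_def A'_def[symmetric] B'_def[symmetric] \<alpha>_def[symmetric] \<beta>_def[symmetric]
        by (rule integral_unique[OF pinch_turn[OF iA iB W'(1,2) R(1) W'(3) R(2)]]
            integral_unique[OF pinch_turn[OF iA iB W'(1,3) R(2) W'(2) R(1)]])+
      show "V (W + 2 * of_real pi * \<i>) = V W + of_real \<sigma> * (- conv_int (point x) W)"
      proof (cases "\<sigma> = 1")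
        case True
        then show ?thesis using ci(1) by (simp add: V_def)
      next
        case False
        then have "\<sigma> = -1" using \<sigma> by simp
        then show ?thesis using ci(2) by (simp add: V_def)
      qed
      fix N assume N: "side W" "prim W N"
      have sW: "0 < \<sigma> * Im W" "\<sigma> * Im W < pi" using N(1) by (simp_all add: side_def)
      obtain Ns where Ns: "\<And>s. s \<in> S W \<Longrightarrow> (Ns has_field_derivative kern A' B' W s) (at s)"
        using kern_primitive[OF hA hB, of W] W' by auto
      obtain C where C: "\<And>s. x - d < s \<Longrightarrow> s < x + d \<Longrightarrow> s \<noteq> x \<Longrightarrow> bdry_limit W N s (Ns (Sl (Complex s \<theta>)) + C)"
        using main[OF W'(4,1) N Ns] by blast
      have "Ns t' - Ns s' = V W"
      proof (cases "\<sigma> = 1")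
        case True
        then have "s' \<in> upper_gap W" "t' \<in> lower_gap W"
          using R Im sW by (auto simp: upper_gap_def lower_gap_def)
        then show ?thesis using pinch_eq_primitive[OF Ns W'(1) _ W'(2) _ W'(3)] True by (simp add: V_def)
      next
        case False
        then have "\<sigma> = -1" using \<sigma> by simp
        then have "t' \<in> upper_gap W" "s' \<in> lower_gap W"
          using R Im sW by (auto simp: upper_gap_def lower_gap_def)
        then show ?thesis using pinch_eq_primitive[OF Ns W'(1) _ W'(3) _ W'(2)] False by (simp add: V_def)
      qed
      then show "\<exists>ls lt. bdry_limit W N s ls \<and> bdry_limit W N t lt \<and> lt - ls = V W"
        using C[of s] C[of t] st by (intro exI[of _ "Ns s' + C"] exI[of _ "Ns t' + C"]) (auto simp: s'_def t'_def)
    qed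
  next
    fix s t assume st: "x < s" "s < x + d" "x < t" "t < x + d"
    define s' where "s' = Sl (Complex s \<theta>)"
    define t' where "t' = Sl (Complex t \<theta>)"
    define e where "e = min (min e0 (c - 3)) (min (Re s') (Re t'))"
    have st': "x - d < s" "x - d < t" "s \<noteq> x" "t \<noteq> x" using st d by auto
    have R: "Re s' < c - 2" "Re t' < c - 2" using Sl_real(1)[of s] Sl_real(1)[of t] st st' by (auto simp: s'_def t'_def)
    have Im: "Im s' = 0" "Im t' = 0" using Sl_right(1)[OF st(1)] Sl_right(1)[OF st(3)] by (auto simp: s'_def t'_def)
    \<comment> \<open>Points right of x are in the lower gap for \<sigma> = 1 and in the upper gap
      for \<sigma> = -1; in the lower gap the outer kernel agrees with \<open>kern\<close> only
      after turning B'.\<close>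
    define B2 where "B2 = (if \<sigma> = 1 then turn B' else B')"
    have hB2: "B2 holomorphic_on {s. Re s < c}"
      using hB holomorphic_on_Re_lt_shift[OF hB] by (auto simp: B2_def turn_def[abs_def])
    define V where "V W = contour_integral (linepath s' t') (outer_kern A' B2 W)" for W
    show "contribution s t (\<lambda>_. 0)"
      unfolding contribution_def
    proof (intro exI[of _ e] exI[of _ V] conjI allI impI)
      show "e \<le> e0" by (simp add: e_def)
      have seg: "closed_segment s' t' \<subseteq> R W" if "Re W < e" for W
        by (rule closed_segment_subset[OF _ _ convex_R]) (use R that in \<open>auto simp: outer_strip_def e_def\<close>)
      have "(\<lambda>W. contour_integral (linepath 0 1) (\<lambda>t. outer_kern A' B2 W (s' + t * (t' - s')) * (t' - s'))) holomorphic_on {W. Re W < e}"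
        by (rule holomorphic_on_integral_outer_kern[OF hA hB2 open_halfspace_Re_lt holomorphic_on_const holomorphic_on_const])
          (use seg affine_in_segment in blast)
      then show "V holomorphic_on {W. Re W < e}"
        unfolding V_def[abs_def] by (subst contour_integral_linepath_unit)
      fix W assume W: "Re W < e"
      have W': "Re W < c - 3" "Re W < Re s'" "Re W < Re t'" "Re W < e0" using W by (auto simp: e_def)
      have "outer_kern A' B2 (W + 2 * of_real pi * \<i>) = outer_kern A' B2 W" by (simp add: outer_kern_def fun_eq_iff)
      then show "V (W + 2 * of_real pi * \<i>) = V W + 0" by (simp add: V_def)
      fix N assume N: "side W" "prim W N"
      have sW: "0 < \<sigma> * Im W" "\<sigma> * Im W < pi" using N(1) by (simp_all add: side_def)
      obtain Ns where Ns: "\<And>s. s \<in> S W \<Longrightarrow> (Ns has_field_derivative kern A' B' W s) (at s)"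
        using kern_primitive[OF hA hB, of W] W' by auto
      obtain C where C: "\<And>s. x - d < s \<Longrightarrow> s < x + d \<Longrightarrow> s \<noteq> x \<Longrightarrow> bdry_limit W N s (Ns (Sl (Complex s \<theta>)) + C)"
        using main[OF W'(4,1) N Ns] by blast
      have gap: "closed_segment s' t' \<subseteq> S W \<and> (\<forall>u\<in>closed_segment s' t'. outer_kern A' B2 W u = kern A' B' W u)"
      proof (cases "\<sigma> = 1")
        case True
        then have "s' \<in> lower_gap W" "t' \<in> lower_gap W" using R Im sW by (auto simp: lower_gap_def)
        then have "closed_segment s' t' \<subseteq> lower_gap W" by (rule closed_segment_subset) (rule lower_gap_props)
        then show ?thesis using lower_gap_props(3)[of W] seg[OF W] outer_kern_lower[of _ W A' B'] True by (auto simp: B2_def)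
      next
        case False
        then have "\<sigma> = -1" using \<sigma> by simp
        then have "s' \<in> upper_gap W" "t' \<in> upper_gap W" using R Im sW by (auto simp: upper_gap_def)
        then have "closed_segment s' t' \<subseteq> upper_gap W" by (rule closed_segment_subset) (rule upper_gap_props)
        then show ?thesis using upper_gap_props(3)[of W] seg[OF W] outer_kern_upper[of _ W A' B'] False by (auto simp: B2_def)
      qed
      have "V W = contour_integral (linepath s' t') (kern A' B' W)"
        unfolding V_def by (rule contour_integral_eq) (use gap in auto)
      also have "\<dots> = Ns t' - Ns s'"
        by (rule contour_integral_linepath_primitive(1)[of "S W"]) (use gap Ns in \<open>auto intro: has_field_derivative_at_within\<close>)
      finally have "Ns t' - Ns s' = V W" by simp
      then show "\<exists>ls lt. bdry_limit W N s ls \<and> bdry_limit W N t lt \<and> lt - ls = V W"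
        using C[of s] C[of t] st st' by (intro exI[of _ "Ns s' + C"] exI[of _ "Ns t' + C"]) (auto simp: s'_def t'_def)
    qed
  qed
qed

end

text \<open>Additivity over an interval by Bolzano's bisection principle, with local data available
  only between points outside of S. A junction that falls on S is moved slightly to the right by e,
  which is why a crossing at x also has to handle two points right of x. Half-open intervals count
  each point of S once, and a \<notin> S restores the closed interval at the end.\<close>

lemma Bolzano_junctions:
  fixes C :: "real \<Rightarrow> real \<Rightarrow> ('w \<Rightarrow> complex) \<Rightarrow> bool" and S :: "real set" and D :: "real \<Rightarrow> 'w \<Rightarrow> complex"
  assumes ab: "a \<le> b" "a \<notin> S" "b \<notin> S"
    and trans: "\<And>s t u D1 D2. C s t D1 \<Longrightarrow> C t u D2 \<Longrightarrow> t \<in> {a..b} \<Longrightarrow> C s u (\<lambda>W. D1 W + D2 W)"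
    and isolated: "\<And>x. x \<in> {a..b} \<Longrightarrow> \<exists>d>0. \<forall>t. t \<noteq> x \<longrightarrow> \<bar>t - x\<bar> < d \<longrightarrow> t \<notin> S"
    and regular: "\<And>x. x \<in> {a..b} \<Longrightarrow> x \<notin> S \<Longrightarrow> \<exists>d>0. \<forall>s t. \<bar>s - x\<bar> < d \<longrightarrow> \<bar>t - x\<bar> < d \<longrightarrow> C s t (\<lambda>_. 0)"
    and crossing: "\<And>x. x \<in> {a..b} \<Longrightarrow> x \<in> S \<Longrightarrow> \<exists>d>0.
      (\<forall>s t. x - d < s \<longrightarrow> s < x \<longrightarrow> x < t \<longrightarrow> t < x + d \<longrightarrow> C s t (D x)) \<and>
      (\<forall>s t. x < s \<longrightarrow> s < x + d \<longrightarrow> x < t \<longrightarrow> t < x + d \<longrightarrow> C s t (\<lambda>_. 0))"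
  shows "C a b (\<lambda>W. \<Sum>x\<in>S \<inter> {a..b}. D x W)" "finite (S \<inter> {a..b})"
proof -
  show fin: "finite (S \<inter> {a..b})"
  proof (rule ccontr)
    assume "infinite (S \<inter> {a..b})"
    then obtain x where x: "x \<in> {a..b}" "x islimpt S \<inter> {a..b}"
      using Heine_Borel_imp_Bolzano_Weierstrass[OF compact_Icc, of "S \<inter> {a..b}" a b] by auto
    obtain d where "0 < d" "\<forall>t. t \<noteq> x \<longrightarrow> \<bar>t - x\<bar> < d \<longrightarrow> t \<notin> S" using isolated[OF x(1)] by blast
    then show False using x(2) unfolding islimpt_approachable by (auto simp: dist_real_def)
  qed
  have "\<forall>x\<in>{a..b} \<inter> S. \<exists>d. 0 < d \<and> x + d \<le> b \<and>
      (\<forall>s t. x - d < s \<longrightarrow> s < x \<longrightarrow> x < t \<longrightarrow> t < x + d \<longrightarrow> C s t (D x)) \<and>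
      (\<forall>s t. x < s \<longrightarrow> s < x + d \<longrightarrow> x < t \<longrightarrow> t < x + d \<longrightarrow> C s t (\<lambda>_. 0))"
  proof
    fix x assume "x \<in> {a..b} \<inter> S"
    then have x: "x \<in> {a..b}" "x \<in> S" by auto
    obtain d where d: "0 < d" "\<And>s t. x - d < s \<Longrightarrow> s < x \<Longrightarrow> x < t \<Longrightarrow> t < x + d \<Longrightarrow> C s t (D x)"
      "\<And>s t. x < s \<Longrightarrow> s < x + d \<Longrightarrow> x < t \<Longrightarrow> t < x + d \<Longrightarrow> C s t (\<lambda>_. 0)"
      using crossing[OF x] by blast
    have "x < b" using x ab(3) by (cases "x = b") auto
    then show "\<exists>d. 0 < d \<and> x + d \<le> b \<and>
      (\<forall>s t. x - d < s \<longrightarrow> s < x \<longrightarrow> x < t \<longrightarrow> t < x + d \<longrightarrow> C s t (D x)) \<and>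
      (\<forall>s t. x < s \<longrightarrow> s < x + d \<longrightarrow> x < t \<longrightarrow> t < x + d \<longrightarrow> C s t (\<lambda>_. 0))"
      using d by (intro exI[of _ "min d (b - x)"]) auto
  qed
  from bchoice[OF this] obtain d where d: "\<And>x. x \<in> {a..b} \<Longrightarrow> x \<in> S \<Longrightarrow> 0 < d x" "\<And>x. x \<in> {a..b} \<Longrightarrow> x \<in> S \<Longrightarrow> x + d x \<le> b"
    and cross: "\<And>x s t. x \<in> {a..b} \<Longrightarrow> x \<in> S \<Longrightarrow> x - d x < s \<Longrightarrow> s < x \<Longrightarrow> x < t \<Longrightarrow> t < x + d x \<Longrightarrow> C s t (D x)"
    and right: "\<And>x s t. x \<in> {a..b} \<Longrightarrow> x \<in> S \<Longrightarrow> x < s \<Longrightarrow> s < x + d x \<Longrightarrow> x < t \<Longrightarrow> t < x + d x \<Longrightarrow> C s t (\<lambda>_. 0)"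
    by blast
  define e where "e x = (if x \<in> S then x + d x / 2 else x)" for x
  have e_mem: "e x \<in> {a..b}" if "x \<in> {a..b}" for x
    using d[OF that] that by (auto simp: e_def)
  have "a \<le> a \<longrightarrow> b \<le> b \<longrightarrow> C (e a) (e b) (\<lambda>W. \<Sum>x\<in>S \<inter> {a<..b}. D x W)"
  proof (induction rule: Bolzano[OF ab(1), where P = "\<lambda>s t. a \<le> s \<longrightarrow> t \<le> b \<longrightarrow> C (e s) (e t) (\<lambda>W. \<Sum>x\<in>S \<inter> {s<..t}. D x W)"])
    case (1 s t u)
    show ?case
    proof (intro impI)
      assume r: "a \<le> s" "u \<le> b"
      have "C (e s) (e u) (\<lambda>W. (\<Sum>x\<in>S \<inter> {s<..t}. D x W) + (\<Sum>x\<in>S \<inter> {t<..u}. D x W))"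
        using 1 r e_mem[of t] by (intro trans[of _ "e t"]) auto
      moreover have "(\<Sum>x\<in>S \<inter> {s<..u}. D x W) = (\<Sum>x\<in>S \<inter> {s<..t}. D x W) + (\<Sum>x\<in>S \<inter> {t<..u}. D x W)" for W
      proof -
        have "S \<inter> {s<..u} = (S \<inter> {s<..t}) \<union> (S \<inter> {t<..u})" using 1(3,4) by auto
        moreover have "finite (S \<inter> {s<..t})" "finite (S \<inter> {t<..u})"
          using 1(3,4) r by (auto intro!: finite_subset[OF _ fin])
        ultimately show ?thesis by (subst sum.union_disjoint[symmetric]) auto
      qed
      ultimately show "C (e s) (e u) (\<lambda>W. \<Sum>x\<in>S \<inter> {s<..u}. D x W)" by simp
    qed
  next
    case (2 x)
    then have x: "x \<in> {a..b}" by simp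
    obtain \<delta> where \<delta>: "0 < \<delta>" "\<And>t. t \<noteq> x \<Longrightarrow> \<bar>t - x\<bar> < \<delta> \<Longrightarrow> t \<notin> S" using isolated[OF x] by blast
    show ?case
    proof (cases "x \<in> S")
      case False
      obtain r where r: "0 < r" "\<And>s t. \<bar>s - x\<bar> < r \<Longrightarrow> \<bar>t - x\<bar> < r \<Longrightarrow> C s t (\<lambda>_. 0)"
        using regular[OF x False] by blast
      show ?thesis
      proof (intro exI[of _ "min r \<delta>"] conjI allI impI)
        fix s t assume st: "s \<le> x \<and> x \<le> t \<and> t - s < min r \<delta>"
        have nS: "y \<notin> S" if "s \<le> y" "y \<le> t" for y
          using that st False \<delta>(2)[of y] by (cases "y = x") (auto simp: abs_less_iff)
        then have "S \<inter> {s<..t} = {}" "e s = s" "e t = t" using st by (auto simp: e_def)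
        then show "C (e s) (e t) (\<lambda>W. \<Sum>x\<in>S \<inter> {s<..t}. D x W)" using r(2)[of s t] st by simp
      qed (use r \<delta> in simp)
    next
      case True
      show ?thesis
      proof (intro exI[of _ "min (d x) \<delta>"] conjI allI impI)
        fix s t assume st: "s \<le> x \<and> x \<le> t \<and> t - s < min (d x) \<delta>"
        have nS: "y \<notin> S" if "s \<le> y" "y \<le> t" "y \<noteq> x" for y
          using that st \<delta>(2)[of y] by (auto simp: abs_less_iff)
        have et: "x < e t" "e t < x + d x"
          using st nS[of t] True d(1)[OF x True] by (cases "t = x"; simp add: e_def)+
        show "C (e s) (e t) (\<lambda>W. \<Sum>x\<in>S \<inter> {s<..t}. D x W)"
        proof (cases "s = x")
          case sx: True
          then have "S \<inter> {s<..t} = {}" "x < e s" "e s < x + d x" using nS True d(1)[OF x True] by (auto simp: e_def)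
          then show ?thesis using right[OF x True _ _ et] by simp
        next
          case False
          have "y = x" if "y \<in> S" "s < y" "y \<le> t" for y using nS[OF less_imp_le] that by blast
          then have "S \<inter> {s<..t} \<subseteq> {x}" by auto
          moreover have "s < x" "s \<notin> S" using nS[of s] False st by auto
          ultimately have "S \<inter> {s<..t} = {x}" "e s = s" using st True by (auto simp: e_def)
          moreover have "C s (e t) (D x)"
            by (rule cross[OF x True _ _ et]) (use st \<open>s < x\<close> in auto)
          ultimately show ?thesis by simp
        qed
      qed (use d(1)[OF x True] \<delta> in simp)
    qed
  qed
  moreover have "S \<inter> {a<..b} = S \<inter> {a..b}" using ab(2) by (auto simp: less_le)
  ultimately show "C a b (\<lambda>W. \<Sum>x\<in>S \<inter> {a..b}. D x W)" using ab by (simp add: e_def)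
qed

context hadamard_side
begin

text \<open>At a regular point the side branch is 2 pi i periodic, so one of the two jumps, and with
  it the density, vanishes.\<close>

lemma conv_int_not_pair:
  assumes \<alpha>: "\<alpha> \<noteq> 0" "\<alpha> \<notin> singularities F \<or> \<gamma> / \<alpha> \<notin> singularities G"
  obtains e where "\<And>W. Re W < e \<Longrightarrow> conv_int \<alpha> W = 0"
proof -
  have \<beta>0: "\<gamma> / \<alpha> \<noteq> 0" using \<alpha>(1) \<gamma> by simp
  define c where "c = min (min (cA \<alpha>) (cB (\<gamma> / \<alpha>))) (ln (1 / 2))"
  have sA: "side_branch F \<sigma> \<alpha> c (A \<alpha>)" and sB: "side_branch G \<sigma> (\<gamma> / \<alpha>) c (B (\<gamma> / \<alpha>))"
    using side_branch_mono[OF A[OF \<alpha>(1)]] side_branch_mono[OF B[OF \<beta>0]] by (auto simp: c_def)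
  have "c \<le> ln (1 / 2)" by (simp add: c_def)
  then have "exp c \<le> exp (ln (1 / 2))" by (simp only: exp_le_cancel_iff)
  then interpret scale c by unfold_locales simp
  show thesis
  proof (rule that[of "c - 2"])
    fix W assume W: "Re W < c - 2"
    have zero: "conv_density (A \<alpha>) (B (\<gamma> / \<alpha>)) W t = 0" if t: "t \<in> {0<..<1}" for t
    proof -
      define s where "s = W + of_real (ln t)"
      have "ln t < 0" "Re s = Re W + ln t" using t by (auto simp: s_def)
      then have s: "Re s < Re W" "Re s < c - 2" using W by linarith+
      have "jump (A \<alpha>) s = 0 \<or> jump (B (\<gamma> / \<alpha>)) (partner W s) = 0"
        using \<alpha>(2)
      proof
        assume "\<alpha> \<notin> singularities F"
        then show ?thesis using sA s W by (simp add: jump_def side_branch_def)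
      next
        assume "\<gamma> / \<alpha> \<notin> singularities G"
        moreover have "Re (partner W s) < c" by (rule Re_partner[OF inner_not_nonpos[OF s(1)] s(2) W])
        ultimately show ?thesis using sB by (simp add: jump_def side_branch_def)
      qed
      then show ?thesis by (auto simp: conv_density_def s_def)
    qed
    have "integral {0..1} (conv_density (A \<alpha>) (B (\<gamma> / \<alpha>)) W) = integral {0..1} (\<lambda>_::real. 0)"
      by (rule integral_spike[of "{0, 1 :: real}"]) (use zero in \<open>auto simp: less_le\<close>)
    then show "conv_int \<alpha> W = 0" by (simp add: conv_int_def)
  qed
qed

end

context detour
begin

lemma contribution_cong:
  assumes "contribution s t D" "\<And>W. Re W < e1 \<Longrightarrow> D W = D' W"
  shows "contribution s t D'"
proof -
  obtain e V where V: "e \<le> e0" "V holomorphic_on {W. Re W < e}"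
     "\<And>W. Re W < e \<Longrightarrow> V (W + 2 * of_real pi * \<i>) = V W + D W"
     "\<And>W N. Re W < e \<Longrightarrow> side W \<Longrightarrow> prim W N \<Longrightarrow>
        (\<exists>ls lt. bdry_limit W N s ls \<and> bdry_limit W N t lt \<and> lt - ls = V W)"
    using assms(1) unfolding contribution_def by blast
  show ?thesis
    unfolding contribution_def
  proof (intro exI[of _ "min e e1"] exI[of _ V] conjI allI impI)
    show "V holomorphic_on {W. Re W < min e e1}" by (rule holomorphic_on_subset[OF V(2)]) auto
  qed (use V assms(2) in auto)
qed

definition pair :: "real \<Rightarrow> bool" where
  "pair x \<longleftrightarrow> point x \<in> singularities F \<and> \<gamma> / point x \<in> singularities G"

lemma contribution_line:
  assumes "\<not> special lo" "\<not> special hi"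
  shows "contribution lo hi (\<lambda>W. \<Sum>x\<in>{x \<in> {lo..hi}. pair x}. of_real \<sigma> * (- conv_int (point x) W))"
    and "finite {x \<in> {lo..hi}. pair x}"
proof -
  define D where "D x W = (if pair x then of_real \<sigma> * (- conv_int (point x) W) else 0)" for x W
  have cross: "\<exists>d>0. (\<forall>s t. x - d < s \<longrightarrow> s < x \<longrightarrow> x < t \<longrightarrow> t < x + d \<longrightarrow> contribution s t (D x)) \<and>
      (\<forall>s t. x < s \<longrightarrow> s < x + d \<longrightarrow> x < t \<longrightarrow> t < x + d \<longrightarrow> contribution s t (\<lambda>_. 0))" if x: "x \<in> {lo..hi}" for x
  proof -
    obtain e where e: "\<And>W. Re W < e \<Longrightarrow> \<not> pair x \<Longrightarrow> conv_int (point x) W = 0"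
      using conv_int_not_pair[of "point x"] unfolding pair_def by (metis point_nonzero(1))
    have eq: "of_real \<sigma> * (- conv_int (point x) W) = D x W" if "Re W < e" for W
      using e[OF that] by (simp add: D_def)
    obtain d where d: "0 < d"
      "\<And>s t. x - d < s \<Longrightarrow> s < x \<Longrightarrow> x < t \<Longrightarrow> t < x + d \<Longrightarrow> contribution s t (\<lambda>W. of_real \<sigma> * (- conv_int (point x) W))"
      "\<And>s t. x < s \<Longrightarrow> s < x + d \<Longrightarrow> x < t \<Longrightarrow> t < x + d \<Longrightarrow> contribution s t (\<lambda>_. 0)"
      using contribution_special[OF x] by blast
    show ?thesis
    proof (intro exI[of _ d] conjI allI impI)
      fix s t assume "x - d < s" "s < x" "x < t" "t < x + d"
      from d(2)[OF this] show "contribution s t (D x)" using eq by (rule contribution_cong)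
    qed (use d in auto)
  qed
  have iso: "\<exists>d>0. \<forall>t. t \<noteq> x \<longrightarrow> \<bar>t - x\<bar> < d \<longrightarrow> t \<notin> Collect special" for x
    using isolated_special[of x] unfolding mem_Collect_eq by metis
  have reg: "\<exists>d>0. \<forall>s t. \<bar>s - x\<bar> < d \<longrightarrow> \<bar>t - x\<bar> < d \<longrightarrow> contribution s t (\<lambda>_. 0)"
    if "x \<in> {lo..hi}" "x \<notin> Collect special" for x
    using contribution_regular[OF that(1)] that(2) unfolding mem_Collect_eq by metis
  have "contribution lo hi (\<lambda>W. \<Sum>x\<in>Collect special \<inter> {lo..hi}. D x W)"
  proof (rule Bolzano_junctions(1)[of lo hi "Collect special" contribution D])
    fix s t u D1 D2 assume "contribution s t D1" "contribution t u D2" "t \<in> {lo..hi}"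
    then show "contribution s u (\<lambda>W. D1 W + D2 W)" by (rule contribution_trans)
  next
    fix x assume "x \<in> {lo..hi}"
    show "\<exists>d>0. \<forall>t. t \<noteq> x \<longrightarrow> \<bar>t - x\<bar> < d \<longrightarrow> t \<notin> Collect special" by (rule iso)
  next
    fix x assume "x \<in> {lo..hi}" "x \<notin> Collect special"
    then show "\<exists>d>0. \<forall>s t. \<bar>s - x\<bar> < d \<longrightarrow> \<bar>t - x\<bar> < d \<longrightarrow> contribution s t (\<lambda>_. 0)" by (rule reg)
  next
    fix x assume "x \<in> {lo..hi}"
    then show "\<exists>d>0. (\<forall>s t. x - d < s \<longrightarrow> s < x \<longrightarrow> x < t \<longrightarrow> t < x + d \<longrightarrow> contribution s t (D x)) \<and>
      (\<forall>s t. x < s \<longrightarrow> s < x + d \<longrightarrow> x < t \<longrightarrow> t < x + d \<longrightarrow> contribution s t (\<lambda>_. 0))" by (rule cross)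
  qed (use lohi assms in simp_all)
  moreover have "finite (Collect special \<inter> {lo..hi})"
    using finite_special[of lo hi] by (simp add: Int_def conj_commute)
  ultimately have S: "contribution lo hi (\<lambda>W. \<Sum>x\<in>Collect special \<inter> {lo..hi}. D x W)" "finite (Collect special \<inter> {lo..hi})" by auto
  have sub: "{x \<in> {lo..hi}. pair x} \<subseteq> Collect special \<inter> {lo..hi}" by (auto simp: pair_def special_def)
  show "finite {x \<in> {lo..hi}. pair x}" by (rule finite_subset[OF sub S(2)])
  have "(\<Sum>x\<in>Collect special \<inter> {lo..hi}. D x W) = (\<Sum>x\<in>{x \<in> {lo..hi}. pair x}. of_real \<sigma> * (- conv_int (point x) W))" for W
    by (rule sum.mono_neutral_cong_right[OF S(2) sub]) (auto simp: D_def)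
  then show "contribution lo hi (\<lambda>W. \<Sum>x\<in>{x \<in> {lo..hi}. pair x}. of_real \<sigma> * (- conv_int (point x) W))"
    using S(1) by simp
qed

end

subsection \<open>The closed contour\<close>

lemma holomorphic_hadamard_kernel: "hadamard_kernel F G z holomorphic_on hadamard_region F G z"
proof -
  have "(principal_branch F \<circ> exp) holomorphic_on hadamard_region F G z"
    "(principal_branch G \<circ> (\<lambda>x. z / exp x)) holomorphic_on hadamard_region F G z"
    by (rule holomorphic_on_compose_gen[OF _ holomorphic_principal_branch];
        auto simp: hadamard_region_def intro!: holomorphic_intros)+
  then show ?thesis unfolding hadamard_kernel_def o_def by (intro holomorphic_intros)
qed

context hadamard_side
begin

text \<open>
  The contour is assembled from pieces. The integral over the piece from \<open>a\<close> to \<open>b\<close> extends from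
  one side of the cut to the logarithmic covering, with monodromy \<open>D\<close>.
\<close>

definition chain :: "complex \<Rightarrow> complex \<Rightarrow> (complex \<Rightarrow> complex) \<Rightarrow> bool" where
  "chain a b D \<longleftrightarrow> (\<exists>e V. V holomorphic_on {W. Re W < e} \<and>
     (\<forall>W. Re W < e \<longrightarrow> V (W + 2 * of_real pi * \<i>) = V W + D W) \<and>
     (\<forall>W. Re W < e \<longrightarrow> side W \<longrightarrow>
       (\<exists>p. polygonal p \<and> path_image p \<subseteq> hadamard_region F G (target W) \<and> pathstart p = a \<and> pathfinish p = b \<and>
            contour_integral p (hadamard_kernel F G (target W)) = V W)))"

lemma chain_trans:
  assumes "chain a b D1" "chain b c D2"
  shows "chain a c (\<lambda>W. D1 W + D2 W)"
proof -
  obtain e1 V1 where 1: "V1 holomorphic_on {W. Re W < e1}"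
     "\<And>W. Re W < e1 \<Longrightarrow> V1 (W + 2 * of_real pi * \<i>) = V1 W + D1 W"
     "\<And>W. Re W < e1 \<Longrightarrow> side W \<Longrightarrow>
       (\<exists>p. polygonal p \<and> path_image p \<subseteq> hadamard_region F G (target W) \<and> pathstart p = a \<and> pathfinish p = b \<and>
            contour_integral p (hadamard_kernel F G (target W)) = V1 W)"
    using assms(1) unfolding chain_def by blast
  obtain e2 V2 where 2: "V2 holomorphic_on {W. Re W < e2}"
     "\<And>W. Re W < e2 \<Longrightarrow> V2 (W + 2 * of_real pi * \<i>) = V2 W + D2 W"
     "\<And>W. Re W < e2 \<Longrightarrow> side W \<Longrightarrow>
       (\<exists>p. polygonal p \<and> path_image p \<subseteq> hadamard_region F G (target W) \<and> pathstart p = b \<and> pathfinish p = c \<and>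
            contour_integral p (hadamard_kernel F G (target W)) = V2 W)"
    using assms(2) unfolding chain_def by blast
  show ?thesis
    unfolding chain_def
  proof (intro exI[of _ "min e1 e2"] exI[of _ "\<lambda>W. V1 W + V2 W"] conjI allI impI)
    show "(\<lambda>W. V1 W + V2 W) holomorphic_on {W. Re W < min e1 e2}"
      by (intro holomorphic_intros holomorphic_on_subset[OF 1(1)] holomorphic_on_subset[OF 2(1)]) auto
    fix W assume W: "Re W < min e1 e2"
    then show "V1 (W + 2 * of_real pi * \<i>) + V2 (W + 2 * of_real pi * \<i>) = V1 W + V2 W + (D1 W + D2 W)"
      using 1(2) 2(2) by simp
    assume side: "side W"
    obtain p where p: "polygonal p" "path_image p \<subseteq> hadamard_region F G (target W)" "pathstart p = a" "pathfinish p = b"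
      "contour_integral p (hadamard_kernel F G (target W)) = V1 W" using 1(3)[of W] W side by auto
    obtain q where q: "polygonal q" "path_image q \<subseteq> hadamard_region F G (target W)" "pathstart q = b" "pathfinish q = c"
      "contour_integral q (hadamard_kernel F G (target W)) = V2 W" using 2(3)[of W] W side by auto
    have img: "path_image (p +++ q) \<subseteq> hadamard_region F G (target W)" using p q by (simp add: path_image_join)
    have "contour_integral (p +++ q) (hadamard_kernel F G (target W)) = V1 W + V2 W"
      using p q by (subst polygonal_integral_join)
        (auto intro: continuous_on_subset[OF holomorphic_on_imp_continuous_on[OF holomorphic_hadamard_kernel] img])
    then show "\<exists>p. polygonal p \<and> path_image p \<subseteq> hadamard_region F G (target W) \<and> pathstart p = a \<and> pathfinish p = c \<and>
            contour_integral p (hadamard_kernel F G (target W)) = V1 W + V2 W"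
      using p q img by (intro exI[of _ "p +++ q"]) (auto intro: polygonal_join)
  qed
qed

lemma chain_reverse:
  assumes "chain a b D"
  shows "chain b a (\<lambda>W. - D W)"
proof -
  obtain e V where V: "V holomorphic_on {W. Re W < e}"
     "\<And>W. Re W < e \<Longrightarrow> V (W + 2 * of_real pi * \<i>) = V W + D W"
     "\<And>W. Re W < e \<Longrightarrow> side W \<Longrightarrow>
       (\<exists>p. polygonal p \<and> path_image p \<subseteq> hadamard_region F G (target W) \<and> pathstart p = a \<and> pathfinish p = b \<and>
            contour_integral p (hadamard_kernel F G (target W)) = V W)"
    using assms unfolding chain_def by blast
  show ?thesis
    unfolding chain_def
  proof (intro exI[of _ e] exI[of _ "\<lambda>W. - V W"] conjI allI impI)
    show "(\<lambda>W. - V W) holomorphic_on {W. Re W < e}" by (intro holomorphic_intros V(1))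
    fix W assume W: "Re W < e"
    then show "- V (W + 2 * of_real pi * \<i>) = - V W + - D W" using V(2) by simp
    assume "side W"
    then obtain p where p: "polygonal p" "path_image p \<subseteq> hadamard_region F G (target W)" "pathstart p = a" "pathfinish p = b"
      "contour_integral p (hadamard_kernel F G (target W)) = V W" using V(3)[OF W] by blast
    then show "\<exists>p. polygonal p \<and> path_image p \<subseteq> hadamard_region F G (target W) \<and> pathstart p = b \<and> pathfinish p = a \<and>
            contour_integral p (hadamard_kernel F G (target W)) = - V W"
      by (intro exI[of _ "reversepath p"]) (auto intro: polygonal_reversepath simp: contour_integral_reversepath polygonal_valid_path)
  qed
qed

text \<open>A fixed segment that stays in the region for all small W gives an integral depending on
  z alone, hence no monodromy.\<close>

lemma chain_linepath:
  assumes "\<And>W x. Re W < e \<Longrightarrow> x \<in> closed_segment a b \<Longrightarrow> x \<in> hadamard_region F G (target W)"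
  shows "chain a b (\<lambda>_. 0)"
  unfolding chain_def
proof (intro exI[of _ e] exI[of _ "\<lambda>W. contour_integral (linepath a b) (hadamard_kernel F G (target W))"] conjI allI impI)
  have "closed_segment a b \<noteq> {}" by simp
  have F: "exp y \<in> principal_star F" if "y \<in> closed_segment a b" for y
    using assms[of "of_real (e - 1)" y] that by (simp add: hadamard_region_def)
  have G: "target W / exp y \<in> principal_star G" if "Re W < e" "y \<in> closed_segment a b" for W y
    using assms[OF that] by (simp add: hadamard_region_def)
  show "(\<lambda>W. contour_integral (linepath a b) (hadamard_kernel F G (target W))) holomorphic_on {W. Re W < e}"
    unfolding hadamard_kernel_def[abs_def]
    by (rule integral_of_extension_holomorphic[OF holomorphic_principal_branch holomorphic_principal_branch open_halfspace_Re_lt])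
      (use F G in auto)
qed (use assms in \<open>auto intro!: exI[of _ "linepath a b"] polygonal_linepath\<close>)

end

section \<open>Passing one direction\<close>

context detour
begin

text \<open>Near the lower end e^x lies in the star of F in every direction, so only G has to be
  extended across its cut; k is the extended integrand.\<close>

lemma lower_end_extension:
  assumes "\<not> special lo" and F_small: "\<And>x. Re x < lo + 1 \<Longrightarrow> exp x \<in> principal_star F"
  obtains \<delta> e k where "0 < \<delta>" "e \<le> e0"
    and "\<And>W. Re W < e \<Longrightarrow> k W holomorphic_on ball (Complex lo \<theta>) \<delta>"
    and "\<And>a b. a \<in> ball (Complex lo \<theta>) \<delta> \<Longrightarrow> b \<in> ball (Complex lo \<theta>) \<delta> \<Longrightarrow>
      (\<lambda>W. contour_integral (linepath a b) (k W)) holomorphic_on {W. Re W < e}"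
    and "\<And>W. k (W + 2 * of_real pi * \<i>) = k W"
    and "\<And>W y. Re W < e \<Longrightarrow> y \<in> ball (Complex lo \<theta>) \<delta> \<Longrightarrow> 0 < \<sigma> * (Im (shift W) - (Im y - \<theta>)) \<Longrightarrow>
      y \<in> hadamard_region F G (target W) \<and> hadamard_kernel F G (target W) y = k W y"
proof -
  obtain f g d \<delta>0 where d: "0 < d" "0 < \<delta>0" "f holomorphic_on ball (point lo) d" "g holomorphic_on ball (\<gamma> / point lo) d"
    and Q: "\<And>W y. Re W < min e0 (ln (\<delta>0 / 2)) \<Longrightarrow> y \<in> ball (Complex lo \<theta>) \<delta>0 \<Longrightarrow> target W / exp y \<in> ball (\<gamma> / point lo) d"
    and PG: "\<And>W y. Re W < min e0 (ln (\<delta>0 / 2)) \<Longrightarrow> y \<in> ball (Complex lo \<theta>) \<delta>0 \<Longrightarrow> 0 < \<sigma> * (Im (shift W) - (Im y - \<theta>)) \<Longrightarrow>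
           target W / exp y \<in> principal_star G \<and> principal_branch G (target W / exp y) = g (target W / exp y)"
    using regular_extension[OF assms(1)] by metis
  define \<delta> where "\<delta> = min \<delta>0 1"
  have ball: "y \<in> ball (Complex lo \<theta>) \<delta>0" "exp y \<in> principal_star F" if "y \<in> ball (Complex lo \<theta>) \<delta>" for y
  proof -
    show "y \<in> ball (Complex lo \<theta>) \<delta>0" using that by (simp add: \<delta>_def)
    have "\<bar>Re (y - Complex lo \<theta>)\<bar> < 1"
      using abs_Re_le_cmod[of "y - Complex lo \<theta>"] that by (auto simp: \<delta>_def dist_norm norm_minus_commute)
    then show "exp y \<in> principal_star F" by (intro F_small) simp
  qed
  show thesis
  proof (rule that[of \<delta> "min e0 (ln (\<delta>0 / 2))" "\<lambda>W y. principal_branch F (exp y) * g (target W / exp y)"])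
    show "(\<lambda>y. principal_branch F (exp y) * g (target W / exp y)) holomorphic_on ball (Complex lo \<theta>) \<delta>"
      if "Re W < min e0 (ln (\<delta>0 / 2))" for W
      by (rule extension_holomorphic[OF holomorphic_principal_branch d(4)]) (use ball Q that in blast)+
    show "(\<lambda>W. contour_integral (linepath a b) (\<lambda>y. principal_branch F (exp y) * g (target W / exp y))) holomorphic_on
        {W. Re W < min e0 (ln (\<delta>0 / 2))}"
      if "a \<in> ball (Complex lo \<theta>) \<delta>" "b \<in> ball (Complex lo \<theta>) \<delta>" for a b
      by (rule integral_of_extension_holomorphic[OF holomorphic_principal_branch d(4) open_halfspace_Re_lt])
        (use ball Q closed_segment_subset[OF that convex_ball] in blast)+
    fix W y assume W: "Re W < min e0 (ln (\<delta>0 / 2))" "y \<in> ball (Complex lo \<theta>) \<delta>" "0 < \<sigma> * (Im (shift W) - (Im y - \<theta>))"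
    show "y \<in> hadamard_region F G (target W) \<and> hadamard_kernel F G (target W) y = principal_branch F (exp y) * g (target W / exp y)"
      using PG[OF W(1) ball(1)[OF W(2)] W(3)] ball(2)[OF W(2)] by (simp add: hadamard_region_def hadamard_kernel_def)
  qed (use d(2) in \<open>auto simp: \<delta>_def\<close>)
qed

text \<open>Dual to the lower end: z/e^x is small enough to lie in the star of G, and only F has to
  be extended across its cut.\<close>

lemma upper_end_extension:
  assumes "\<not> special hi" and G_small: "\<And>y. Re y < Re (Ln \<gamma>) - hi + 1 \<Longrightarrow> exp y \<in> principal_star G"
  obtains \<delta> e k where "0 < \<delta>" "e \<le> e0"
    and "\<And>W. Re W < e \<Longrightarrow> k W holomorphic_on ball (Complex hi \<theta>) \<delta>"
    and "\<And>a b. a \<in> ball (Complex hi \<theta>) \<delta> \<Longrightarrow> b \<in> ball (Complex hi \<theta>) \<delta> \<Longrightarrow>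
      (\<lambda>W. contour_integral (linepath a b) (k W)) holomorphic_on {W. Re W < e}"
    and "\<And>W. k (W + 2 * of_real pi * \<i>) = k W"
    and "\<And>W y. Re W < e \<Longrightarrow> y \<in> ball (Complex hi \<theta>) \<delta> \<Longrightarrow> 0 < \<sigma> * (Im y - \<theta>) \<Longrightarrow>
      y \<in> hadamard_region F G (target W) \<and> hadamard_kernel F G (target W) y = k W y"
proof -
  obtain f g d \<delta>0 where d: "0 < d" "0 < \<delta>0" "f holomorphic_on ball (point hi) d" "g holomorphic_on ball (\<gamma> / point hi) d"
    and E: "\<And>y. y \<in> ball (Complex hi \<theta>) \<delta>0 \<Longrightarrow> exp y \<in> ball (point hi) d"
    and PF: "\<And>y. y \<in> ball (Complex hi \<theta>) \<delta>0 \<Longrightarrow> 0 < \<sigma> * (Im y - \<theta>) \<Longrightarrow>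
           exp y \<in> principal_star F \<and> principal_branch F (exp y) = f (exp y)"
    using regular_extension[OF assms(1)] by metis
  define \<delta> where "\<delta> = min \<delta>0 (1 / 2)"
  have ball: "y \<in> ball (Complex hi \<theta>) \<delta>0" if "y \<in> ball (Complex hi \<theta>) \<delta>" for y
    using that by (simp add: \<delta>_def)
  have Q: "target W / exp y \<in> principal_star G" if W: "Re W < e0" "y \<in> ball (Complex hi \<theta>) \<delta>" for W y
  proof -
    have "\<bar>Re (y - Complex hi \<theta>)\<bar> < 1 / 2"
      using abs_Re_le_cmod[of "y - Complex hi \<theta>"] that by (auto simp: \<delta>_def dist_norm norm_minus_commute)
    then have "\<bar>Re y - hi\<bar> < 1 / 2" by simp
    moreover have "Re (shift W) < 1 / 2"
      using abs_Re_le_cmod[of "shift W"] shift_bounds(2)[OF W(1)] \<eta>(2) by linarith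
    ultimately have "Re (Ln \<gamma> + shift W - y) < Re (Ln \<gamma>) - hi + 1"
      unfolding minus_complex.sel plus_complex.sel by linarith
    then show ?thesis unfolding target_quotient[OF W(1)] by (rule G_small)
  qed
  show thesis
  proof (rule that[of \<delta> e0 "\<lambda>W y. f (exp y) * principal_branch G (target W / exp y)"])
    show "(\<lambda>y. f (exp y) * principal_branch G (target W / exp y)) holomorphic_on ball (Complex hi \<theta>) \<delta>"
      if "Re W < e0" for W
      by (rule extension_holomorphic[OF d(3) holomorphic_principal_branch]) (use ball E Q that in blast)+
    show "(\<lambda>W. contour_integral (linepath a b) (\<lambda>y. f (exp y) * principal_branch G (target W / exp y))) holomorphic_on
        {W. Re W < e0}"
      if "a \<in> ball (Complex hi \<theta>) \<delta>" "b \<in> ball (Complex hi \<theta>) \<delta>" for a b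
      by (rule integral_of_extension_holomorphic[OF d(3) holomorphic_principal_branch open_halfspace_Re_lt])
        (use ball E Q closed_segment_subset[OF that convex_ball] in blast)+
    fix W y assume W: "Re W < e0" "y \<in> ball (Complex hi \<theta>) \<delta>" "0 < \<sigma> * (Im y - \<theta>)"
    show "y \<in> hadamard_region F G (target W) \<and> hadamard_kernel F G (target W) y = f (exp y) * principal_branch G (target W / exp y)"
      using PF[OF ball[OF W(2)] W(3)] Q[OF W(1,2)] by (simp add: hadamard_region_def hadamard_kernel_def)
  qed (use d(2) in \<open>auto simp: \<delta>_def\<close>)
qed

text \<open>On one side of the direction the segment keeps distance at least m from the height
  \<theta>, while for small W the cut of G is closer than m to that height.\<close>

lemma chain_side:
  assumes F_small: "\<And>x. Re x < lo + 1 \<Longrightarrow> exp x \<in> principal_star F"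
    and st: "0 < \<tau> * (s - \<theta>)" "\<bar>s - \<theta>\<bar> < \<eta> / 2" "0 < \<tau> * (t - \<theta>)" "\<bar>t - \<theta>\<bar> < \<eta> / 2" and \<tau>: "\<tau> = 1 \<or> \<tau> = -1"
  shows "chain (Complex lo s) (Complex lo t) (\<lambda>_. 0)"
proof -
  define m where "m = min \<bar>s - \<theta>\<bar> \<bar>t - \<theta>\<bar>"
  have m: "0 < m" using st by (auto simp: m_def)
  show ?thesis
  proof (rule chain_linepath[of "min e0 (ln (m / 2))"])
    fix W x assume W: "Re W < min e0 (ln (m / 2))" and "x \<in> closed_segment (Complex lo s) (Complex lo t)"
    then have x: "Re x = lo" "Im x \<in> closed_segment s t" by (simp_all add: closed_segment_same_Re)
    have off: "m \<le> \<bar>Im x - \<theta>\<bar>" "\<bar>Im x - \<theta>\<bar> < \<eta> / 2"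
      using x(2) st \<tau> by (auto simp: m_def closed_segment_eq_real_ivl abs_if split: if_splits)
    have W0: "Re W < e0" using W by simp
    have "norm (exp W) < 1 / 2" using shift_bounds(1)[OF W0] \<eta> by simp
    then have "norm (shift W) \<le> 2 * norm (exp W)" unfolding shift_def by (rule norm_Ln_le)
    moreover have "exp (Re W) < m / 2" using W m less_ln_iff[of "m / 2" "Re W"] by simp
    ultimately have sm: "norm (shift W) < m" by simp
    have b: "\<bar>Im (shift W)\<bar> < m" "\<bar>Im (shift W)\<bar> < \<eta> / 2" "\<bar>Re (shift W)\<bar> < 1"
      using abs_Im_le_cmod[of "shift W"] abs_Re_le_cmod[of "shift W"] sm shift_bounds(2)[OF W0] \<eta> by linarith+
    have "target W / exp x \<in> principal_star G"
      unfolding target_quotient[OF W0]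
    proof (rule G_sector)
      show "Re (Ln \<gamma> + shift W - x) < Re (Ln \<gamma>) + 2 - lo"
        using b x(1) unfolding minus_complex.sel plus_complex.sel by linarith
      have eq: "Im (Ln \<gamma> + shift W - x) - (Im (Ln \<gamma>) - \<theta>) = Im (shift W) - (Im x - \<theta>)" by simp
      show "\<bar>Im (Ln \<gamma> + shift W - x) - (Im (Ln \<gamma>) - \<theta>)\<bar> < \<eta>" unfolding eq using b off by linarith
      have "Im (shift W) - (Im x - \<theta>) \<noteq> 0" using b off by linarith
      then show "Im (Ln \<gamma> + shift W - x) \<noteq> Im (Ln \<gamma>) - \<theta>" using eq by linarith
    qed
    moreover have "exp x \<in> principal_star F" by (rule F_small) (simp add: x(1))
    ultimately show "x \<in> hadamard_region F G (target W)" by (simp add: hadamard_region_def)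
  qed
qed

text \<open>In the coordinate x the cut of F extends to the right and that of G(z/e^x) to the left.
  The route crosses the height \<theta> at Re x = lo, where F has no cut, follows the strip between
  the cuts, leaves it at Re x = hi, where G has no cut, and returns beyond both. Only the passage
  along the strip carries monodromy.\<close>

lemma chain_crossing:
  assumes ends: "\<not> special lo" "\<not> special hi"
    and F_small: "\<And>x. Re x < lo + 1 \<Longrightarrow> exp x \<in> principal_star F"
    and G_small: "\<And>y. Re y < Re (Ln \<gamma>) - hi + 1 \<Longrightarrow> exp y \<in> principal_star G"
  obtains \<kappa> where "0 < \<kappa>" "\<kappa> < \<eta> / 2"
    "chain (Complex lo (\<theta> - \<sigma> * \<kappa>)) (Complex lo (\<theta> + \<sigma> * \<kappa>))
       (\<lambda>W. \<Sum>x\<in>{x \<in> {lo..hi}. pair x}. of_real \<sigma> * (- conv_int (point x) W))"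
proof -
  define D where "D W = (\<Sum>x\<in>{x \<in> {lo..hi}. pair x}. of_real \<sigma> * (- conv_int (point x) W))" for W
  obtain \<delta>1 e1 k1 where k1: "0 < \<delta>1" "e1 \<le> e0"
      "\<And>W. Re W < e1 \<Longrightarrow> k1 W holomorphic_on ball (Complex lo \<theta>) \<delta>1"
      "\<And>a b. a \<in> ball (Complex lo \<theta>) \<delta>1 \<Longrightarrow> b \<in> ball (Complex lo \<theta>) \<delta>1 \<Longrightarrow>
        (\<lambda>W. contour_integral (linepath a b) (k1 W)) holomorphic_on {W. Re W < e1}"
      "\<And>W. k1 (W + 2 * of_real pi * \<i>) = k1 W"
    and k1eq: "\<And>W y. Re W < e1 \<Longrightarrow> y \<in> ball (Complex lo \<theta>) \<delta>1 \<Longrightarrow> 0 < \<sigma> * (Im (shift W) - (Im y - \<theta>)) \<Longrightarrow>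
      y \<in> hadamard_region F G (target W) \<and> hadamard_kernel F G (target W) y = k1 W y"
    by (rule lower_end_extension[OF ends(1) F_small], assumption, rule that)
  obtain \<delta>3 e3 k3 where k3: "0 < \<delta>3" "e3 \<le> e0"
      "\<And>W. Re W < e3 \<Longrightarrow> k3 W holomorphic_on ball (Complex hi \<theta>) \<delta>3"
      "\<And>a b. a \<in> ball (Complex hi \<theta>) \<delta>3 \<Longrightarrow> b \<in> ball (Complex hi \<theta>) \<delta>3 \<Longrightarrow>
        (\<lambda>W. contour_integral (linepath a b) (k3 W)) holomorphic_on {W. Re W < e3}"
      "\<And>W. k3 (W + 2 * of_real pi * \<i>) = k3 W"
    and k3eq: "\<And>W y. Re W < e3 \<Longrightarrow> y \<in> ball (Complex hi \<theta>) \<delta>3 \<Longrightarrow> 0 < \<sigma> * (Im y - \<theta>) \<Longrightarrow>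
      y \<in> hadamard_region F G (target W) \<and> hadamard_kernel F G (target W) y = k3 W y"
    by (rule upper_end_extension[OF ends(2) G_small], assumption, rule that)
  have "contribution lo hi D" unfolding D_def[abs_def] by (rule contribution_line[OF ends])
  then obtain e2 V where V: "e2 \<le> e0" "V holomorphic_on {W. Re W < e2}"
     "\<And>W. Re W < e2 \<Longrightarrow> V (W + 2 * of_real pi * \<i>) = V W + D W"
     "\<And>W N. Re W < e2 \<Longrightarrow> side W \<Longrightarrow> prim W N \<Longrightarrow>
        (\<exists>ls lt. bdry_limit W N lo ls \<and> bdry_limit W N hi lt \<and> lt - ls = V W)"
    unfolding contribution_def by blast
  \<comment> \<open>Small enough for both end discs and the sector; W is then restricted so that the
    moving cut stays within \<kappa> of the height \<theta>.\<close>
  define \<kappa> where "\<kappa> = min (min \<delta>1 \<delta>3) (\<eta> / 2) / 2"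
  have \<kappa>: "0 < \<kappa>" "\<kappa> < \<delta>1" "\<kappa> < \<delta>3" "\<kappa> < \<eta> / 2" using k1(1) k3(1) \<eta> by (auto simp: \<kappa>_def)
  define e where "e = min (min e1 e2) (min e3 (ln (\<kappa> / 2)))"
  define a0 where "a0 = Complex lo (\<theta> - \<sigma> * \<kappa>)"
  define a1 where "a1 = Complex lo \<theta>"
  define b1 where "b1 = Complex hi \<theta>"
  define b0 where "b0 = Complex hi (\<theta> + \<sigma> * \<kappa>)"
  define c0 where "c0 = Complex lo (\<theta> + \<sigma> * \<kappa>)"
  have dist: "dist (Complex r s) (Complex r t) = \<bar>s - t\<bar>" for r s t by (simp add: dist_norm complex_diff cmod_def)
  have a01: "a0 \<in> ball a1 \<delta>1" "a1 \<in> ball a1 \<delta>1" "b0 \<in> ball b1 \<delta>3" "b1 \<in> ball b1 \<delta>3"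
    using \<kappa> \<sigma> by (auto simp: a0_def a1_def b0_def b1_def dist)
  define P1 where "P1 W = contour_integral (linepath a0 a1) (k1 W)" for W
  define P3 where "P3 W = contour_integral (linepath b1 b0) (k3 W)" for W
  define P4 where "P4 W = contour_integral (linepath b0 c0) (hadamard_kernel F G (target W))" for W
  have shift_small: "\<bar>Im (shift W)\<bar> < \<kappa>" "\<bar>Re (shift W)\<bar> < 1" "Re W < e0" if "Re W < e" for W
  proof -
    show W0: "Re W < e0" using that V(1) by (simp add: e_def)
    have "norm (exp W) < 1 / 2" using shift_bounds(1)[OF W0] \<eta> by simp
    then have "norm (shift W) \<le> 2 * norm (exp W)" unfolding shift_def by (rule norm_Ln_le)
    moreover have "exp (Re W) < \<kappa> / 2" using that \<kappa>(1) less_ln_iff[of "\<kappa> / 2" "Re W"] by (simp add: e_def)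
    ultimately have "norm (shift W) < \<kappa>" by simp
    then show "\<bar>Im (shift W)\<bar> < \<kappa>" "\<bar>Re (shift W)\<bar> < 1"
      using abs_Im_le_cmod[of "shift W"] abs_Re_le_cmod[of "shift W"] \<kappa> \<eta> by linarith+
  qed
  have seg4: "x \<in> hadamard_region F G (target W)" if W: "Re W < e" and x: "x \<in> closed_segment b0 c0" for W x
  proof -
    have x': "Im x - \<theta> = \<sigma> * \<kappa>" "lo \<le> Re x" "Re x \<le> hi"
      using x lohi by (auto simp: b0_def c0_def closed_segment_same_Im closed_segment_eq_real_ivl)
    have sk: "\<bar>\<sigma> * \<kappa>\<bar> = \<kappa>" using \<sigma> \<kappa> by auto
    have "target W / exp x \<in> principal_star G"
      unfolding target_quotient[OF shift_small(3)[OF W]]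
    proof (rule G_sector)
      show "Re (Ln \<gamma> + shift W - x) < Re (Ln \<gamma>) + 2 - lo"
        using shift_small(2)[OF W] x'(2) unfolding minus_complex.sel plus_complex.sel by linarith
      have eq: "Im (Ln \<gamma> + shift W - x) - (Im (Ln \<gamma>) - \<theta>) = Im (shift W) - \<sigma> * \<kappa>" using x'(1) by simp
      show "\<bar>Im (Ln \<gamma> + shift W - x) - (Im (Ln \<gamma>) - \<theta>)\<bar> < \<eta>"
        unfolding eq using shift_small(1)[OF W] sk \<kappa>(4) by linarith
      have "Im (shift W) - \<sigma> * \<kappa> \<noteq> 0" using shift_small(1)[OF W] sk by linarith
      then show "Im (Ln \<gamma> + shift W - x) \<noteq> Im (Ln \<gamma>) - \<theta>" using eq by linarith
    qed
    moreover have "exp x \<in> principal_star F"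
      by (rule F_sector) (use x' sk \<kappa> in linarith)+
    ultimately show ?thesis by (simp add: hadamard_region_def)
  qed
  have "chain a0 c0 D"
    unfolding chain_def
  proof (intro exI[of _ e] exI[of _ "\<lambda>W. P1 W + V W + P3 W + P4 W"] conjI allI impI)
    have "P1 holomorphic_on {W. Re W < e}" "P3 holomorphic_on {W. Re W < e}"
      unfolding P1_def[abs_def] P3_def[abs_def]
      using k1(4)[of a0 a1] k3(4)[of b1 b0] a01 by (auto simp: a1_def b1_def e_def elim!: holomorphic_on_subset)
    moreover have "P4 holomorphic_on {W. Re W < e}"
      unfolding P4_def[abs_def] hadamard_kernel_def[abs_def]
      by (rule integral_of_extension_holomorphic[OF holomorphic_principal_branch holomorphic_principal_branch open_halfspace_Re_lt])
        (use seg4[of "of_real (e - 1)"] seg4 in \<open>auto simp: hadamard_region_def\<close>)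
    ultimately show "(\<lambda>W. P1 W + V W + P3 W + P4 W) holomorphic_on {W. Re W < e}"
      by (intro holomorphic_intros holomorphic_on_subset[OF V(2)]) (auto simp: e_def)
    fix W assume W: "Re W < e"
    have W': "Re W < e1" "Re W < e2" "Re W < e3" "Re W < e0" using W V(1) by (auto simp: e_def)
    show "P1 (W + 2 * of_real pi * \<i>) + V (W + 2 * of_real pi * \<i>) + P3 (W + 2 * of_real pi * \<i>) + P4 (W + 2 * of_real pi * \<i>) =
        P1 W + V W + P3 W + P4 W + D W"
      using V(3)[OF W'(2)] target_periodic[of W] by (simp add: P1_def P3_def P4_def k1(5) k3(5))
    assume side: "side W"
    define \<psi> where "\<psi> = Im (shift W)"
    have \<psi>: "0 < \<sigma> * \<psi>" "\<bar>\<psi>\<bar> < \<kappa>" using shift_side(1)[OF W'(4) side] shift_small(1)[OF W] by (auto simp: \<psi>_def)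
    \<comment> \<open>The actual contour enters and leaves the strip at mid-height, at points moving
      with W. The primitives trade them for the fixed points a1 and b1 of the line, between which
      P1, V and P3 are defined.\<close>
    define a where "a = Complex lo (\<theta> + \<psi> / 2)"
    define b where "b = Complex hi (\<theta> + \<psi> / 2)"
    have ab: "a \<in> ball a1 \<delta>1" "b \<in> ball b1 \<delta>3" "a \<in> rect W" "b \<in> rect W"
      using \<psi> \<kappa> lohi by (auto simp: a_def b_def a1_def b1_def dist rect_def \<psi>_def[symmetric] mult.commute[of \<psi>])
    have seg1: "closed_segment a0 a \<subseteq> {y \<in> ball a1 \<delta>1. 0 < \<sigma> * (Im (shift W) - (Im y - \<theta>))}"
    proof
      fix y assume y: "y \<in> closed_segment a0 a"
      then have "Im y \<in> closed_segment (\<theta> - \<sigma> * \<kappa>) (\<theta> + \<psi> / 2)" by (simp add: a0_def a_def closed_segment_same_Re)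
      then have "0 < \<sigma> * (\<psi> - (Im y - \<theta>))"
        using \<sigma> \<psi> \<kappa>(1) by (auto simp: closed_segment_eq_real_ivl split: if_splits)
      moreover have "y \<in> ball a1 \<delta>1" using y closed_segment_subset[OF a01(1) ab(1) convex_ball] by blast
      ultimately show "y \<in> {y \<in> ball a1 \<delta>1. 0 < \<sigma> * (Im (shift W) - (Im y - \<theta>))}" by (simp add: \<psi>_def)
    qed
    have seg3: "closed_segment b b0 \<subseteq> {y \<in> ball b1 \<delta>3. 0 < \<sigma> * (Im y - \<theta>)}"
    proof
      fix y assume y: "y \<in> closed_segment b b0"
      then have "Im y \<in> closed_segment (\<theta> + \<psi> / 2) (\<theta> + \<sigma> * \<kappa>)" by (simp add: b0_def b_def closed_segment_same_Re)
      then have "0 < \<sigma> * (Im y - \<theta>)"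
        using \<sigma> \<psi> \<kappa>(1) by (auto simp: closed_segment_eq_real_ivl split: if_splits)
      moreover have "y \<in> ball b1 \<delta>3" using y closed_segment_subset[OF ab(2) a01(3) convex_ball] by blast
      ultimately show "y \<in> {y \<in> ball b1 \<delta>3. 0 < \<sigma> * (Im y - \<theta>)}" by simp
    qed
    have seg2: "closed_segment a b \<subseteq> rect W" by (rule closed_segment_subset[OF ab(3,4) rect_open_convex(2)])
    let ?R = "hadamard_region F G (target W)" and ?k = "hadamard_kernel F G (target W)"
    have R1: "closed_segment a0 a \<subseteq> ?R" "\<And>y. y \<in> closed_segment a0 a \<Longrightarrow> ?k y = k1 W y"
      using seg1 k1eq[OF W'(1)] unfolding a1_def by blast+
    have R3: "closed_segment b b0 \<subseteq> ?R" "\<And>y. y \<in> closed_segment b b0 \<Longrightarrow> ?k y = k3 W y"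
      using seg3 k3eq[OF W'(3)] unfolding b1_def by blast+
    have R2: "closed_segment a b \<subseteq> ?R" using seg2 rect_region[OF W'(4) side] by blast
    have R4: "closed_segment b0 c0 \<subseteq> ?R" using seg4[OF W] by blast
    obtain M1 where M1: "\<And>y. y \<in> ball a1 \<delta>1 \<Longrightarrow> (M1 has_field_derivative k1 W y) (at y within ball a1 \<delta>1)"
      using holomorphic_convex_primitive'[OF convex_ball open_ball] k1(3)[OF W'(1)] unfolding a1_def by blast
    obtain M3 where M3: "\<And>y. y \<in> ball b1 \<delta>3 \<Longrightarrow> (M3 has_field_derivative k3 W y) (at y within ball b1 \<delta>3)"
      using holomorphic_convex_primitive'[OF convex_ball open_ball] k3(3)[OF W'(3)] unfolding b1_def by blast
    have M: "\<And>y. y \<in> ball a1 \<delta>1 \<Longrightarrow> (M1 has_field_derivative k1 W y) (at y)" "\<And>y. y \<in> ball b1 \<delta>3 \<Longrightarrow> (M3 has_field_derivative k3 W y) (at y)"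
      using M1 M3 at_within_open[OF _ open_ball] by metis+
    obtain N where N: "\<And>y. y \<in> rect W \<Longrightarrow> (N has_field_derivative ?k y) (at y within rect W)"
      using holomorphic_convex_primitive'[OF rect_open_convex(2,1)
          holomorphic_on_subset[OF holomorphic_hadamard_kernel rect_region[OF W'(4) side]]] by blast
    have pN: "prim W N" unfolding prim_def using N at_within_open[OF _ rect_open_convex(1)] by metis
    obtain ls lt where l: "bdry_limit W N lo ls" "bdry_limit W N hi lt" "lt - ls = V W" using V(4)[OF W'(2) side pN] by blast
    have "bdry_limit W N lo (M1 a1 + (N a - M1 a))"
      unfolding a1_def
    proof (rule bdry_limit_transfer[OF pN])
      fix y assume y: "y \<in> rect W \<inter> ball (Complex lo \<theta>) \<delta>1"
      then have "?k y = k1 W y" using k1eq[OF W'(1)] rect_offset(5)[OF W'(4) side] by blast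
      then show "(M1 has_field_derivative ?k y) (at y)" using M(1)[of y] y unfolding a1_def by simp
    next
      show "isCont M1 (Complex lo \<theta>)" using M(1)[OF a01(2)] DERIV_isCont unfolding a1_def by blast
    qed (use ab k1(1) in \<open>auto simp: a1_def\<close>)
    then have ls: "ls = M1 a1 + (N a - M1 a)" using bdry_limit_unique[OF W'(4) side _ l(1)] lohi by simp
    have "bdry_limit W N hi (M3 b1 + (N b - M3 b))"
      unfolding b1_def
    proof (rule bdry_limit_transfer[OF pN])
      fix y assume y: "y \<in> rect W \<inter> ball (Complex hi \<theta>) \<delta>3"
      then have "?k y = k3 W y" using k3eq[OF W'(3)] by (auto simp: rect_def)
      then show "(M3 has_field_derivative ?k y) (at y)" using M(2)[of y] y unfolding b1_def by simp
    next
      show "isCont M3 (Complex hi \<theta>)" using M(2)[OF a01(4)] DERIV_isCont unfolding b1_def by blast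
    qed (use ab k3(1) in \<open>auto simp: b1_def\<close>)
    then have lt: "lt = M3 b1 + (N b - M3 b)" using bdry_limit_unique[OF W'(4) side _ l(2)] lohi by simp
    have I1: "contour_integral (linepath a0 a) ?k = M1 a - M1 a0"
    proof -
      have "contour_integral (linepath a0 a) ?k = contour_integral (linepath a0 a) (k1 W)"
        by (rule contour_integral_eq) (use R1 in auto)
      also have "\<dots> = M1 a - M1 a0"
        by (rule contour_integral_linepath_primitive(1)[OF M1]) (use seg1 in auto)
      finally show ?thesis .
    qed
    have I3: "contour_integral (linepath b b0) ?k = M3 b0 - M3 b"
    proof -
      have "contour_integral (linepath b b0) ?k = contour_integral (linepath b b0) (k3 W)"
        by (rule contour_integral_eq) (use R3 in auto)
      also have "\<dots> = M3 b0 - M3 b"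
        by (rule contour_integral_linepath_primitive(1)[OF M3]) (use seg3 in auto)
      finally show ?thesis .
    qed
    have I2: "contour_integral (linepath a b) ?k = N b - N a" by (rule contour_integral_linepath_primitive(1)[OF N seg2])
    have P13: "P1 W = M1 a1 - M1 a0" "P3 W = M3 b0 - M3 b1"
      unfolding P1_def P3_def
      by (rule contour_integral_linepath_primitive(1)[OF M1] contour_integral_linepath_primitive(1)[OF M3];
          use closed_segment_subset[OF a01(1,2) convex_ball] closed_segment_subset[OF a01(4,3) convex_ball] in auto)+
    define p where "p = linepath a0 a +++ (linepath a b +++ (linepath b b0 +++ linepath b0 c0))"
    have img: "path_image p \<subseteq> ?R"
      unfolding p_def using R1(1) R2 R3(1) R4 by (simp add: path_image_join)
    have cont: "continuous_on X ?k" if "X \<subseteq> ?R" for X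
      by (rule continuous_on_subset[OF holomorphic_on_imp_continuous_on[OF holomorphic_hadamard_kernel] that])
    have "contour_integral p ?k = (M1 a - M1 a0) + ((N b - N a) + ((M3 b0 - M3 b) + P4 W))"
      unfolding p_def I1[symmetric] I2[symmetric] I3[symmetric] P4_def
      by (subst polygonal_integral_join; (subst polygonal_integral_join)?; (subst polygonal_integral_join)?)
        (use R1(1) R2 R3(1) R4 in \<open>auto intro!: polygonal.intros cont simp: path_image_join\<close>)
    also have "\<dots> = P1 W + V W + P3 W + P4 W"
      unfolding l(3)[symmetric] ls lt P13 by simp
    finally show "\<exists>p. polygonal p \<and> path_image p \<subseteq> ?R \<and> pathstart p = a0 \<and> pathfinish p = c0 \<and>
        contour_integral p ?k = P1 W + V W + P3 W + P4 W"
      using img by (intro exI[of _ p]) (auto simp: p_def intro!: polygonal.intros)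
  qed
  then show thesis using that[OF \<kappa>(1,4)] unfolding D_def[abs_def] a0_def c0_def by blast
qed

end

section \<open>The full turn about the origin\<close>

context isolated_germ
begin

lemma disc_in_star:
  obtains m where "\<And>x. Re x < m \<Longrightarrow> exp x \<in> principal_star F"
proof -
  obtain r where r: "0 < r" "ball 0 r \<subseteq> principal_star F"
    using open_principal_star[of F] zero_in_principal_star[OF radius] open_contains_ball by blast
  show thesis
    by (rule that[of "ln r"]) (use r less_ln_iff[OF r(1)] in \<open>auto simp: subset_iff\<close>)
qed

lemma modulus_avoiding_singularities:
  assumes "a < b"
  obtains x where "a < x" "x < b" "\<And>v. v \<in> singularities F \<Longrightarrow> ln (norm v) \<noteq> x"
proof -
  define X where "X = (\<lambda>v. ln (norm v)) ` (singularities F \<inter> cball 0 (exp b))"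
  have "finite X" unfolding X_def by (intro finite_imageI finite_singularities)
  then have "\<not> {a<..<b} \<subseteq> X" using infinite_Ioo[OF assms] finite_subset by blast
  then obtain x where "x \<in> {a<..<b}" and X: "x \<notin> X" by blast
  then have x: "a < x" "x < b" by auto
  show thesis
  proof (rule that[OF x(1,2)])
    fix v assume v: "v \<in> singularities F"
    show "ln (norm v) \<noteq> x"
    proof
      assume eq: "ln (norm v) = x"
      have "v \<noteq> 0" using v zero_not_singularity by auto
      then have "norm v = exp x" using eq by auto
      then have "x \<in> X" unfolding X_def using x v eq by (intro image_eqI[of _ _ v]) auto
      then show False using X by simp
    qed
  qed
qed

end

text \<open>F has no cut for Re x < lo + 1, and G(\<gamma>/e^x) has none for Re x > hi - 1. The two
  generic moduli keep the end points of every detour from being special.\<close>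

locale hadamard_annulus = hadamard_side +
  fixes lo hi :: real
  assumes lo_hi: "lo < hi"
    and F_small: "\<And>x. Re x < lo + 1 \<Longrightarrow> exp x \<in> principal_star F"
    and G_small: "\<And>y. Re y < Re (Ln \<gamma>) - hi + 1 \<Longrightarrow> exp y \<in> principal_star G"
    and lo_generic: "\<And>v. v \<in> singularities G \<Longrightarrow> ln (norm v) \<noteq> Re (Ln \<gamma>) - lo"
    and hi_generic: "\<And>v. v \<in> singularities F \<Longrightarrow> ln (norm v) \<noteq> hi"
begin

text \<open>The heights at which the line Re x = lo meets a cut of G(\<gamma>/e^x): a singularity of
  G in the matching direction with modulus at most |\<gamma>| e^(-lo).\<close>

definition direction :: "real \<Rightarrow> bool" where
  "direction \<theta> \<longleftrightarrow> (\<exists>r \<le> Re (Ln \<gamma>) - lo. exp (Complex r (Im (Ln \<gamma>) - \<theta>)) \<in> singularities G)"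

definition on_ray :: "real \<Rightarrow> real set" where
  "on_ray \<theta> = {a. exp (Complex a \<theta>) \<in> singularities F \<and> \<gamma> / exp (Complex a \<theta>) \<in> singularities G}"

lemma quotient_exp: "\<gamma> / exp (Complex a \<theta>) = exp (Complex (Re (Ln \<gamma>) - a) (Im (Ln \<gamma>) - \<theta>))"
proof -
  have "\<gamma> / exp (Complex a \<theta>) = exp (Ln \<gamma> - Complex a \<theta>)" using \<gamma> by (simp add: exp_diff)
  also have "Ln \<gamma> - Complex a \<theta> = Complex (Re (Ln \<gamma>) - a) (Im (Ln \<gamma>) - \<theta>)" by (simp add: complex_eq_iff)
  finally show ?thesis .
qed

lemma on_ray_bounds:
  assumes "a \<in> on_ray \<theta>"
  shows "a \<in> {lo..hi}"
proof -
  have "\<not> a < lo"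
  proof
    assume "a < lo"
    then have "exp (Complex a \<theta>) \<in> principal_star F" by (intro F_small) simp
    then show False using assms singularity_not_in_star by (auto simp: on_ray_def)
  qed
  moreover have "\<not> hi < a"
  proof
    assume "hi < a"
    then have "\<gamma> / exp (Complex a \<theta>) \<in> principal_star G" unfolding quotient_exp by (intro G_small) simp
    then show False using assms singularity_not_in_star by (auto simp: on_ray_def)
  qed
  ultimately show ?thesis by simp
qed

lemma detour_exists:
  obtains \<eta> where "detour F G \<gamma> \<sigma> A B cA cB \<theta> lo hi \<eta>"
proof -
  obtain \<eta>1 where 1: "0 < \<eta>1" "\<eta>1 \<le> 1"
    "\<And>x. Re x < hi + 1 \<Longrightarrow> Im x \<noteq> \<theta> \<Longrightarrow> \<bar>Im x - \<theta>\<bar> < \<eta>1 \<Longrightarrow> exp x \<in> principal_star F"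
    using F.ray_sector[of "hi + 1" \<theta>] by blast
  obtain \<eta>2 where 2: "0 < \<eta>2" "\<eta>2 \<le> 1"
    "\<And>y. Re y < Re (Ln \<gamma>) + 2 - lo \<Longrightarrow> Im y \<noteq> Im (Ln \<gamma>) - \<theta> \<Longrightarrow> \<bar>Im y - (Im (Ln \<gamma>) - \<theta>)\<bar> < \<eta>2 \<Longrightarrow>
      exp y \<in> principal_star G"
    using G.ray_sector[of "Re (Ln \<gamma>) + 2 - lo" "Im (Ln \<gamma>) - \<theta>"] by blast
  show thesis
    by (rule that[of "min \<eta>1 \<eta>2"], unfold_locales) (use lo_hi 1 2 in auto)
qed

lemma direction_isolated: "\<exists>d>0. \<forall>t. t \<noteq> \<theta> \<longrightarrow> \<bar>t - \<theta>\<bar> < d \<longrightarrow> \<not> direction t"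
proof -
  obtain \<eta> where "detour F G \<gamma> \<sigma> A B cA cB \<theta> lo hi \<eta>" using detour_exists by blast
  then interpret d: detour F G \<gamma> \<sigma> A B cA cB \<theta> lo hi \<eta> .
  have "\<not> direction t" if t: "t \<noteq> \<theta>" "\<bar>t - \<theta>\<bar> < \<eta>" for t
  proof
    assume "direction t"
    then obtain r where r: "r \<le> Re (Ln \<gamma>) - lo" "exp (Complex r (Im (Ln \<gamma>) - t)) \<in> singularities G"
      by (auto simp: direction_def)
    have "exp (Complex r (Im (Ln \<gamma>) - t)) \<in> principal_star G"
      by (rule d.G_sector) (use r t in \<open>auto simp: abs_minus_commute\<close>)
    then show False using r(2) singularity_not_in_star by blast
  qed
  then show ?thesis using d.\<eta>(1) by blast
qed

lemma chain_regular_direction: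
  assumes "\<not> direction \<theta>"
  shows "\<exists>d>0. \<forall>s t. \<bar>s - \<theta>\<bar> < d \<longrightarrow> \<bar>t - \<theta>\<bar> < d \<longrightarrow> chain (Complex lo s) (Complex lo t) (\<lambda>_. 0)"
proof -
  obtain \<eta> where "detour F G \<gamma> \<sigma> A B cA cB \<theta> lo hi \<eta>" using detour_exists by blast
  then interpret d: detour F G \<gamma> \<sigma> A B cA cB \<theta> lo hi \<eta> .
  have "exp (Complex a (Im (Ln \<gamma>) - \<theta>)) \<notin> singularities G" if "a \<le> Re (Ln \<gamma>) - lo" for a
    using assms that by (auto simp: direction_def)
  then obtain \<delta> where \<delta>: "0 < \<delta>"
      "\<And>y. Re y < Re (Ln \<gamma>) - lo + \<delta> \<Longrightarrow> \<bar>Im y - (Im (Ln \<gamma>) - \<theta>)\<bar> < \<delta> \<Longrightarrow> exp y \<in> principal_star G"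
    using G.ray_clear by metis
  show ?thesis
  proof (intro exI[of _ "\<delta> / 2"] conjI allI impI)
    fix s t assume st: "\<bar>s - \<theta>\<bar> < \<delta> / 2" "\<bar>t - \<theta>\<bar> < \<delta> / 2"
    show "chain (Complex lo s) (Complex lo t) (\<lambda>_. 0)"
    proof (rule chain_linepath[of "min d.e0 (ln (\<delta> / 4))"])
      fix W x assume W: "Re W < min d.e0 (ln (\<delta> / 4))" and "x \<in> closed_segment (Complex lo s) (Complex lo t)"
      then have x: "Re x = lo" "Im x \<in> closed_segment s t" by (simp_all add: closed_segment_same_Re)
      have "s \<le> Im x \<and> Im x \<le> t \<or> t \<le> Im x \<and> Im x \<le> s"
        using x(2) by (auto simp: closed_segment_eq_real_ivl split: if_splits)
      then have off: "\<bar>Im x - \<theta>\<bar> < \<delta> / 2" using st by linarith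
      have W0: "Re W < d.e0" using W by simp
      have "norm (exp W) < 1 / 2" using d.shift_bounds(1)[OF W0] d.\<eta> by simp
      then have "norm (d.shift W) \<le> 2 * norm (exp W)" unfolding d.shift_def by (rule norm_Ln_le)
      moreover have "exp (Re W) < \<delta> / 4" using W \<delta>(1) less_ln_iff[of "\<delta> / 4" "Re W"] by simp
      ultimately have "norm (d.shift W) < \<delta> / 2" by simp
      then have b: "\<bar>Im (d.shift W)\<bar> < \<delta> / 2" "\<bar>Re (d.shift W)\<bar> < \<delta> / 2"
        using abs_Im_le_cmod[of "d.shift W"] abs_Re_le_cmod[of "d.shift W"] by linarith+
      have "target W / exp x \<in> principal_star G"
        unfolding d.target_quotient[OF W0]
        by (rule \<delta>(2)) (use b off x(1) in \<open>unfold minus_complex.sel plus_complex.sel, linarith+\<close>)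
      moreover have "exp x \<in> principal_star F" by (rule F_small) (simp add: x(1))
      ultimately show "x \<in> hadamard_region F G (target W)" by (simp add: hadamard_region_def)
    qed
  qed (use \<delta> in simp)
qed

lemma chain_at_direction:
  "\<exists>d>0. (\<forall>s t. \<theta> - d < s \<longrightarrow> s < \<theta> \<longrightarrow> \<theta> < t \<longrightarrow> t < \<theta> + d \<longrightarrow>
        chain (Complex lo s) (Complex lo t) (\<lambda>W. - (\<Sum>a\<in>on_ray \<theta>. conv_int (exp (Complex a \<theta>)) W))) \<and>
      (\<forall>s t. \<theta> < s \<longrightarrow> s < \<theta> + d \<longrightarrow> \<theta> < t \<longrightarrow> t < \<theta> + d \<longrightarrow> chain (Complex lo s) (Complex lo t) (\<lambda>_. 0))"
  "finite (on_ray \<theta>)"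
proof -
  obtain \<eta> where "detour F G \<gamma> \<sigma> A B cA cB \<theta> lo hi \<eta>" using detour_exists by blast
  then interpret d: detour F G \<gamma> \<sigma> A B cA cB \<theta> lo hi \<eta> .
  have "\<not> d.special lo"
  proof
    assume "d.special lo"
    moreover have "d.point lo \<in> principal_star F" unfolding d.point_def by (rule F_small) simp
    moreover have "ln (norm (\<gamma> / d.point lo)) = Re (Ln \<gamma>) - lo" by (simp add: d.point_def quotient_exp)
    ultimately show False using lo_generic singularity_not_in_star unfolding d.special_def by blast
  qed
  moreover have "\<not> d.special hi"
  proof
    assume "d.special hi"
    moreover have "\<gamma> / d.point hi \<in> principal_star G" unfolding d.point_def quotient_exp by (rule G_small) simp
    moreover have "ln (norm (d.point hi)) = hi" by (simp add: d.point_def)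
    ultimately show False using hi_generic singularity_not_in_star unfolding d.special_def by blast
  qed
  ultimately have ends: "\<not> d.special lo" "\<not> d.special hi" by auto
  have ray: "{x \<in> {lo..hi}. d.pair x} = on_ray \<theta>"
    using on_ray_bounds[of _ \<theta>] by (auto simp: d.pair_def d.point_def on_ray_def)
  show "finite (on_ray \<theta>)" using d.contribution_line(2)[OF ends] by (simp only: ray)
  obtain \<kappa> where \<kappa>: "0 < \<kappa>" "\<kappa> < \<eta> / 2" and
    ch: "chain (Complex lo (\<theta> - \<sigma> * \<kappa>)) (Complex lo (\<theta> + \<sigma> * \<kappa>)) (\<lambda>W. \<Sum>x\<in>on_ray \<theta>. of_real \<sigma> * (- conv_int (d.point x) W))"
    by (rule d.chain_crossing[OF ends F_small G_small, unfolded ray], assumption, assumption, rule that)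
  define D where "D W = - (\<Sum>a\<in>on_ray \<theta>. conv_int (exp (Complex a \<theta>)) W)" for W
  \<comment> \<open>For \<sigma> = -1 the crossing runs downwards; reversing it changes the sign
    once more, so the monodromy is the same for both sides.\<close>
  have mid: "chain (Complex lo (\<theta> - \<kappa>)) (Complex lo (\<theta> + \<kappa>)) D"
  proof (cases "\<sigma> = 1")
    case True
    then show ?thesis using ch by (simp add: d.point_def D_def[abs_def] sum_negf)
  next
    case False
    then have "\<sigma> = -1" using \<sigma> by simp
    then show ?thesis using chain_reverse[OF ch] by (simp add: d.point_def D_def[abs_def])
  qed
  note side = d.chain_side[OF F_small]
  show "\<exists>d>0. (\<forall>s t. \<theta> - d < s \<longrightarrow> s < \<theta> \<longrightarrow> \<theta> < t \<longrightarrow> t < \<theta> + d \<longrightarrow>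
        chain (Complex lo s) (Complex lo t) (\<lambda>W. - (\<Sum>a\<in>on_ray \<theta>. conv_int (exp (Complex a \<theta>)) W))) \<and>
      (\<forall>s t. \<theta> < s \<longrightarrow> s < \<theta> + d \<longrightarrow> \<theta> < t \<longrightarrow> t < \<theta> + d \<longrightarrow> chain (Complex lo s) (Complex lo t) (\<lambda>_. 0))"
    unfolding D_def[symmetric]
  proof (intro exI[of _ "\<eta> / 2"] conjI allI impI)
    fix s t assume "\<theta> - \<eta> / 2 < s" "s < \<theta>" "\<theta> < t" "t < \<theta> + \<eta> / 2"
    then have "chain (Complex lo s) (Complex lo (\<theta> - \<kappa>)) (\<lambda>_. 0)" "chain (Complex lo (\<theta> + \<kappa>)) (Complex lo t) (\<lambda>_. 0)"
      using \<kappa> by (auto intro: side[where \<tau> = "-1"] side[where \<tau> = 1])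
    from chain_trans[OF chain_trans[OF this(1) mid] this(2)] show "chain (Complex lo s) (Complex lo t) D" by simp
  next
    fix s t assume "\<theta> < s" "s < \<theta> + \<eta> / 2" "\<theta> < t" "t < \<theta> + \<eta> / 2"
    then show "chain (Complex lo s) (Complex lo t) (\<lambda>_. 0)" by (intro side[where \<tau> = 1]) auto
  qed (use d.\<eta> in simp)
qed

lemma direction_periodic: "direction (\<theta> + 2 * pi) \<longleftrightarrow> direction \<theta>"
proof -
  have "Complex r (Im (Ln \<gamma>) - (\<theta> + 2 * pi)) = Complex r (Im (Ln \<gamma>) - \<theta>) - 2 * of_real pi * \<i>" for r
    by (simp add: complex_eq_iff)
  then have "exp (Complex r (Im (Ln \<gamma>) - (\<theta> + 2 * pi))) = exp (Complex r (Im (Ln \<gamma>) - \<theta>))" for r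
    by (simp only: exp_diff exp_two_pi_i div_by_1)
  then show ?thesis by (simp add: direction_def)
qed

definition pairs :: "complex set" where
  "pairs = {\<alpha> \<in> singularities F. \<gamma> / \<alpha> \<in> singularities G}"

text \<open>Polar coordinates: each pair has one argument in a window of length 2 pi, and the
  position of \<gamma>/\<alpha> makes this argument a direction. Since \<theta>0 is no direction,
  the closed window counts nothing twice.\<close>

lemma sum_over_rays:
  assumes \<theta>0: "\<not> direction \<theta>0" and fin: "finite (Collect direction \<inter> {\<theta>0..\<theta>0 + 2 * pi})"
  shows "(\<Sum>\<theta>\<in>Collect direction \<inter> {\<theta>0..\<theta>0 + 2 * pi}. \<Sum>a\<in>on_ray \<theta>. f (exp (Complex a \<theta>))) = (\<Sum>\<alpha>\<in>pairs. f \<alpha> :: complex)"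
proof -
  define T where "T = Collect direction \<inter> {\<theta>0..\<theta>0 + 2 * pi}"
  have T: "\<theta>0 < \<theta>" "\<theta> < \<theta>0 + 2 * pi" if "\<theta> \<in> T" for \<theta>
    using that \<theta>0 direction_periodic[of \<theta>0] by (auto simp: T_def less_le)
  have "bij_betw (\<lambda>(\<theta>, a). exp (Complex a \<theta>)) (Sigma T on_ray) pairs"
    unfolding bij_betw_def
  proof (intro conjI equalityI subsetI)
    show "inj_on (\<lambda>(\<theta>, a). exp (Complex a \<theta>)) (Sigma T on_ray)"
    proof (rule inj_onI, clarify)
      fix \<theta> a \<theta>' a' assume th: "\<theta> \<in> T" "\<theta>' \<in> T" and eq: "exp (Complex a \<theta>) = exp (Complex a' \<theta>')"
      then obtain n :: int where n: "Complex a \<theta> = Complex a' \<theta>' + of_int (2 * n) * of_real pi * \<i>"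
        by (auto simp: exp_eq)
      then have a: "a = a'" "\<theta> = \<theta>' + 2 * of_int n * pi" by (auto simp: complex_eq_iff)
      have "\<bar>\<theta> - \<theta>'\<bar> < 2 * pi" using T[OF th(1)] T[OF th(2)] by (simp add: abs_less_iff)
      then have "\<bar>of_int n\<bar> * (2 * pi) < 1 * (2 * pi)" unfolding a(2) by (simp add: abs_mult mult_ac)
      then have "\<bar>of_int n :: real\<bar> < 1" by (rule mult_right_less_imp_less) simp
      then have "n = 0" by linarith
      then show "\<theta> = \<theta>' \<and> a = a'" using a by simp
    qed
  next
    fix \<alpha> assume "\<alpha> \<in> pairs"
    then have \<alpha>: "\<alpha> \<in> singularities F" "\<gamma> / \<alpha> \<in> singularities G" "\<alpha> \<noteq> 0"
      using F.zero_not_singularity by (auto simp: pairs_def)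
    define \<phi> where "\<phi> = Arg2pi (\<alpha> / exp (\<i> * of_real \<theta>0))"
    have "0 \<le> \<phi>" "\<phi> < 2 * pi" "\<alpha> / exp (\<i> * of_real \<theta>0) = of_real (norm \<alpha>) * exp (\<i> * of_real \<phi>)"
      using Arg2pi[of "\<alpha> / exp (\<i> * of_real \<theta>0)"] by (auto simp: \<phi>_def norm_divide is_Arg_def)
    note \<phi> = this
    have "\<alpha> = of_real (norm \<alpha>) * (exp (\<i> * of_real \<phi>) * exp (\<i> * of_real \<theta>0))"
      using \<phi>(3) by (simp add: field_simps)
    also have "\<dots> = exp (Complex (ln (norm \<alpha>)) (\<theta>0 + \<phi>))"
      using \<alpha>(3) by (simp add: Complex_eq exp_add exp_of_real distrib_left mult_ac)
    finally have \<alpha>eq: "exp (Complex (ln (norm \<alpha>)) (\<theta>0 + \<phi>)) = \<alpha>" ..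
    then have ray: "ln (norm \<alpha>) \<in> on_ray (\<theta>0 + \<phi>)" using \<alpha> by (simp add: on_ray_def)
    have "direction (\<theta>0 + \<phi>)"
      unfolding direction_def
      using on_ray_bounds[OF ray] \<alpha>(2) quotient_exp[of "ln (norm \<alpha>)" "\<theta>0 + \<phi>"] \<alpha>eq
      by (intro exI[of _ "Re (Ln \<gamma>) - ln (norm \<alpha>)"]) auto
    then have "(\<theta>0 + \<phi>, ln (norm \<alpha>)) \<in> Sigma T on_ray" using ray \<phi> by (simp add: T_def)
    then show "\<alpha> \<in> (\<lambda>(\<theta>, a). exp (Complex a \<theta>)) ` Sigma T on_ray"
      by (rule rev_image_eqI) (simp add: \<alpha>eq)
  qed (auto simp: on_ray_def pairs_def)
  then have "(\<Sum>x\<in>Sigma T on_ray. f ((\<lambda>(\<theta>, a). exp (Complex a \<theta>)) x)) = (\<Sum>\<alpha>\<in>pairs. f \<alpha>)"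
    by (rule sum.reindex_bij_betw)
  moreover have "(\<Sum>\<theta>\<in>T. \<Sum>a\<in>on_ray \<theta>. f (exp (Complex a \<theta>))) = (\<Sum>(\<theta>, a)\<in>Sigma T on_ray. f (exp (Complex a \<theta>)))"
    by (rule sum.Sigma) (use fin chain_at_direction(2) in \<open>auto simp: T_def\<close>)
  ultimately show ?thesis by (simp add: T_def case_prod_unfold)
qed

lemma closed_chain:
  obtains \<theta> where "chain (Complex lo \<theta>) (Complex lo (\<theta> + 2 * pi)) (\<lambda>W. - (\<Sum>\<alpha>\<in>pairs. conv_int \<alpha> W))"
proof -
  obtain d where d: "0 < d" "\<And>t. t \<noteq> 0 \<Longrightarrow> \<bar>t - 0\<bar> < d \<Longrightarrow> \<not> direction t"
    using direction_isolated[of 0] by blast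
  \<comment> \<open>Directions are isolated, so a small positive angle is none.\<close>
  define \<theta>0 where "\<theta>0 = d / 2"
  have \<theta>0: "\<not> direction \<theta>0" "\<not> direction (\<theta>0 + 2 * pi)" using d by (auto simp: \<theta>0_def direction_periodic)
  define D where "D \<theta> W = - (\<Sum>a\<in>on_ray \<theta>. conv_int (exp (Complex a \<theta>)) W)" for \<theta> W
  have B: "chain (Complex lo \<theta>0) (Complex lo (\<theta>0 + 2 * pi)) (\<lambda>W. \<Sum>\<theta>\<in>Collect direction \<inter> {\<theta>0..\<theta>0 + 2 * pi}. D \<theta> W) \<and>
      finite (Collect direction \<inter> {\<theta>0..\<theta>0 + 2 * pi})"
  proof (intro conjI Bolzano_junctions[of \<theta>0 "\<theta>0 + 2 * pi" "Collect direction" "\<lambda>s t. chain (Complex lo s) (Complex lo t)" D])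
    fix s t u D1 D2 assume "chain (Complex lo s) (Complex lo t) D1" "chain (Complex lo t) (Complex lo u) D2"
    then show "chain (Complex lo s) (Complex lo u) (\<lambda>W. D1 W + D2 W)" by (rule chain_trans)
  next
    fix s t u D1 D2 assume "chain (Complex lo s) (Complex lo t) D1" "chain (Complex lo t) (Complex lo u) D2"
    then show "chain (Complex lo s) (Complex lo u) (\<lambda>W. D1 W + D2 W)" by (rule chain_trans)
  next
    fix x assume "x \<notin> Collect direction"
    then show "\<exists>d>0. \<forall>s t. \<bar>s - x\<bar> < d \<longrightarrow> \<bar>t - x\<bar> < d \<longrightarrow> chain (Complex lo s) (Complex lo t) (\<lambda>_. 0)"
      by (intro chain_regular_direction) simp
  next
    fix x assume "x \<notin> Collect direction"
    then show "\<exists>d>0. \<forall>s t. \<bar>s - x\<bar> < d \<longrightarrow> \<bar>t - x\<bar> < d \<longrightarrow> chain (Complex lo s) (Complex lo t) (\<lambda>_. 0)"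
      by (intro chain_regular_direction) simp
  qed (use \<theta>0 direction_isolated chain_at_direction(1) in \<open>simp_all add: D_def[abs_def]\<close>)
  have "(\<Sum>\<theta>\<in>Collect direction \<inter> {\<theta>0..\<theta>0 + 2 * pi}. D \<theta> W) = - (\<Sum>\<alpha>\<in>pairs. conv_int \<alpha> W)" for W
    unfolding D_def sum_negf using sum_over_rays[OF \<theta>0(1), of "\<lambda>\<alpha>. conv_int \<alpha> W"] B by simp
  then show thesis by (intro that[of \<theta>0]) (use B in simp)
qed

end

context hadamard_side
begin

lemma hadamard_continuation:
  obtains e H where "H holomorphic_on {W. Re W < e}"
    and "\<And>W. Re W < e \<Longrightarrow> side W \<Longrightarrow>
      target W \<in> principal_star (hadamard F G) \<and> principal_branch (hadamard F G) (target W) = H W"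
    and "\<And>W. Re W < e \<Longrightarrow> H (W + 2 * of_real pi * \<i>) - H W =
      - (1 / (2 * of_real pi * \<i>)) * (\<Sum>\<alpha>\<in>{\<alpha> \<in> singularities F. \<gamma> / \<alpha> \<in> singularities G}. conv_int \<alpha> W)"
proof -
  obtain mF where mF: "\<And>x. Re x < mF \<Longrightarrow> exp x \<in> principal_star F" using F.disc_in_star by blast
  obtain mG where mG: "\<And>x. Re x < mG \<Longrightarrow> exp x \<in> principal_star G" using G.disc_in_star by blast
  obtain y where y: "Re (Ln \<gamma>) - mF + 1 < y" "\<And>v. v \<in> singularities G \<Longrightarrow> ln (norm v) \<noteq> y"
    using G.modulus_avoiding_singularities[of "Re (Ln \<gamma>) - mF + 1" "Re (Ln \<gamma>) - mF + 2"] by auto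
  \<comment> \<open>The choice of y gives lo + 1 < mF; the second entry in h gives the corresponding
    margin for G.\<close>
  define lo where "lo = Re (Ln \<gamma>) - y"
  define h where "h = max lo (Re (Ln \<gamma>) + 1 - mG)"
  obtain hi where hi: "h < hi" "\<And>v. v \<in> singularities F \<Longrightarrow> ln (norm v) \<noteq> hi"
    using F.modulus_avoiding_singularities[of h "h + 1"] by auto
  interpret a: hadamard_annulus F G \<gamma> \<sigma> A B cA cB lo hi
  proof unfold_locales
    show "lo < hi" using hi by (simp add: h_def)
    show "exp x \<in> principal_star F" if "Re x < lo + 1" for x by (rule mF) (use that y in \<open>simp add: lo_def\<close>)
    show "exp x \<in> principal_star G" if "Re x < Re (Ln \<gamma>) - hi + 1" for x by (rule mG) (use that hi in \<open>simp add: h_def\<close>)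
  qed (use y hi in \<open>auto simp: lo_def\<close>)
  obtain \<theta> where "chain (Complex lo \<theta>) (Complex lo (\<theta> + 2 * pi)) (\<lambda>W. - (\<Sum>\<alpha>\<in>a.pairs. conv_int \<alpha> W))"
    by (rule a.closed_chain)
  then obtain e V where V: "V holomorphic_on {W. Re W < e}"
     "\<And>W. Re W < e \<Longrightarrow> V (W + 2 * of_real pi * \<i>) = V W + - (\<Sum>\<alpha>\<in>a.pairs. conv_int \<alpha> W)"
     "\<And>W. Re W < e \<Longrightarrow> side W \<Longrightarrow>
       (\<exists>p. polygonal p \<and> path_image p \<subseteq> hadamard_region F G (target W) \<and> pathstart p = Complex lo \<theta> \<and>
            pathfinish p = Complex lo (\<theta> + 2 * pi) \<and> contour_integral p (hadamard_kernel F G (target W)) = V W)"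
    unfolding chain_def by blast
  show thesis
  proof (rule that[of "\<lambda>W. V W / (2 * of_real pi * \<i>)" e])
    show "(\<lambda>W. V W / (2 * of_real pi * \<i>)) holomorphic_on {W. Re W < e}" using V(1) by (intro holomorphic_intros) auto
    fix W assume W: "Re W < e"
    show "V (W + 2 * of_real pi * \<i>) / (2 * of_real pi * \<i>) - V W / (2 * of_real pi * \<i>) =
      - (1 / (2 * of_real pi * \<i>)) * (\<Sum>\<alpha>\<in>{\<alpha> \<in> singularities F. \<gamma> / \<alpha> \<in> singularities G}. conv_int \<alpha> W)"
      unfolding V(2)[OF W] a.pairs_def by (simp add: field_simps)
    assume "side W"
    then obtain p where p: "polygonal p" "path_image p \<subseteq> hadamard_region F G (target W)" "pathstart p = Complex lo \<theta>"
        "pathfinish p = Complex lo (\<theta> + 2 * pi)" "contour_integral p (hadamard_kernel F G (target W)) = V W"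
      using V(3)[OF W] by blast
    have "pathfinish p = pathstart p + 2 * of_real pi * \<i>" unfolding p by (simp add: complex_eq_iff)
    from hadamard_integral[OF F.radius G.radius p(1,2) this] p(5)
    show "target W \<in> principal_star (hadamard F G) \<and> principal_branch (hadamard F G) (target W) = V W / (2 * of_real pi * \<i>)"
      by simp
  qed
qed

end

subsection \<open>Monodromy on the logarithmic covering\<close>

text \<open>In the logarithmic coordinate an arc about \<alpha> is a vertical segment, so a loop
  adds 2 pi i.\<close>

lemma arc_about_lift: "arc_about \<alpha> (\<alpha> + d * exp S) \<theta> = (\<lambda>s. \<alpha> + d * exp s) \<circ> linepath S (S + \<i> * of_real \<theta>)"
  by (rule ext) (simp add: arc_about_def linepath_def scaleR_conv_of_real algebra_simps flip: exp_add)

locale lifted_branch =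
  fixes \<alpha> d :: complex and c :: real and f A :: "complex \<Rightarrow> complex"
  assumes d: "d \<noteq> 0" and A: "A holomorphic_on {s. Re s < c}"
begin

definition lift :: "complex \<Rightarrow> complex" where
  "lift s = \<alpha> + d * exp s"

text \<open>Equality is required near S and not only at S: continuation depends on germs, and the
  set obtained is open, as iteration demands.\<close>

definition sheet :: "complex set" where
  "sheet = {S. Re S < c \<and> (\<forall>\<^sub>F s in nhds S. f (lift s) = A s)}"

lemma eventually_sheet: "S \<in> sheet \<Longrightarrow> \<forall>\<^sub>F s in nhds S. s \<in> sheet"
proof -
  assume S: "S \<in> sheet"
  have "\<forall>\<^sub>F s in nhds S. \<forall>\<^sub>F s' in nhds s. f (lift s') = A s'"
    using S by (simp add: sheet_def eventually_eventually)
  moreover have "\<forall>\<^sub>F s in nhds S. s \<in> {s. Re s < c}"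
    by (rule eventually_nhds_in_open) (use S in \<open>auto simp: sheet_def open_halfspace_Re_lt\<close>)
  ultimately show ?thesis by eventually_elim (simp add: sheet_def)
qed

lemma continued_value_arc:
  assumes S: "Re S < c" and g: "B holomorphic_on {s. Re s < c}" "\<forall>\<^sub>F s in nhds S. g (lift s) = B s"
  shows "continued_value (arc_about \<alpha> (lift S) \<theta>) g = B (S + \<i> * of_real \<theta>)"
proof -
  have img: "path_image (linepath S (S + \<i> * of_real \<theta>)) \<subseteq> {s. Re s < c}"
    unfolding path_image_linepath by (rule closed_segment_subset[OF _ _ convex_halfspace_Re_lt]) (use S in auto)
  have "lift holomorphic_on {s. Re s < c}" unfolding lift_def by (intro holomorphic_intros)
  moreover have "deriv lift s \<noteq> 0" for s
  proof -
    have "(lift has_field_derivative d * exp s) (at s)" unfolding lift_def by (auto intro!: derivative_eq_intros)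
    then show ?thesis using d by (simp add: DERIV_imp_deriv)
  qed
  ultimately have "continued_value (lift \<circ> linepath S (S + \<i> * of_real \<theta>)) g = B (S + \<i> * of_real \<theta>)"
    using continued_value_push(2)[OF open_halfspace_Re_lt _ _ g(1) path_linepath img, of lift g] g(2) by simp
  moreover have "lift \<circ> linepath S (S + \<i> * of_real \<theta>) = arc_about \<alpha> (lift S) \<theta>"
    unfolding lift_def[abs_def] arc_about_lift ..
  ultimately show ?thesis by simp
qed

lemma holomorphic_turns: "(\<lambda>s. A (s + of_int k * (2 * of_real pi * \<i>))) holomorphic_on {s. Re s < c}"
proof -
  have "(A \<circ> (\<lambda>s. s + of_int k * (2 * of_real pi * \<i>))) holomorphic_on {s. Re s < c}"
    by (rule holomorphic_on_compose_gen[OF _ A]) (auto intro!: holomorphic_intros)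
  then show ?thesis by (simp add: o_def)
qed

text \<open>m = 1 and m = -1 cover both loop directions. S is arbitrary in the induction because the
  next continuation needs the previous iterate as a function near S.\<close>

lemma iterated_arc:
  assumes op: "\<And>g u. op g u = continued_value (arc_about \<alpha> u (of_int m * (2 * pi))) g"
  shows "S \<in> sheet \<Longrightarrow> (op ^^ n) f (lift S) = A (S + of_int (int n * m) * (2 * of_real pi * \<i>))"
proof (induction n arbitrary: S)
  case 0
  then show ?case by (auto simp: sheet_def dest: eventually_nhds_x_imp_x)
next
  case (Suc n)
  have "\<forall>\<^sub>F s in nhds S. (op ^^ n) f (lift s) = A (s + of_int (int n * m) * (2 * of_real pi * \<i>))"
    using eventually_sheet[OF Suc.prems] by eventually_elim (rule Suc.IH)
  have "Re S < c" using Suc.prems by (simp add: sheet_def)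
  have "(op ^^ Suc n) f (lift S) = continued_value (arc_about \<alpha> (lift S) (of_int m * (2 * pi))) ((op ^^ n) f)"
    by (simp only: funpow.simps o_apply op)
  also have "\<dots> = A (S + \<i> * of_real (of_int m * (2 * pi)) + of_int (int n * m) * (2 * of_real pi * \<i>))"
    by (rule continued_value_arc[OF \<open>Re S < c\<close> holomorphic_turns]) fact
  finally show ?case by (simp add: algebra_simps)
qed

lemma Sigma_pow_lift:
  assumes "S \<in> sheet"
  shows "Sigma_pow \<alpha> k f (lift S) = A (S + of_int k * (2 * of_real pi * \<i>))"
proof (cases "0 \<le> k")
  case True
  have "(Sigma_op \<alpha> ^^ nat k) f (lift S) = A (S + of_int (int (nat k) * 1) * (2 * of_real pi * \<i>))"
    by (rule iterated_arc[OF _ assms]) (simp add: Sigma_op_def)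
  then show ?thesis using True by (simp add: Sigma_pow_def)
next
  case False
  have "(Sigma_inv \<alpha> ^^ nat (- k)) f (lift S) = A (S + of_int (int (nat (- k)) * (-1)) * (2 * of_real pi * \<i>))"
    by (rule iterated_arc[OF _ assms]) (simp add: Sigma_inv_def)
  then show ?thesis using False by (simp add: Sigma_pow_def)
qed

lemma Delta_op_lift:
  assumes S: "S \<in> sheet"
  shows "Delta_op \<alpha> (Sigma_pow \<alpha> k f) (lift S) = jump A (S + of_int k * (2 * of_real pi * \<i>))"
proof -
  have "\<forall>\<^sub>F s in nhds S. Sigma_pow \<alpha> k f (lift s) = A (s + of_int k * (2 * of_real pi * \<i>))"
    using eventually_sheet[OF S] by eventually_elim (rule Sigma_pow_lift)
  from continued_value_arc[OF _ holomorphic_turns this, of "2 * pi"] S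
  have "Sigma_op \<alpha> (Sigma_pow \<alpha> k f) (lift S) = A (S + of_int k * (2 * of_real pi * \<i>) + 2 * of_real pi * \<i>)"
    by (simp add: Sigma_op_def sheet_def algebra_simps)
  then show ?thesis by (simp add: Delta_op_def jump_def Sigma_pow_lift[OF S])
qed

end

text \<open>The part of \<open>side_branch\<close> that is established for the Hadamard product,
  without decay.\<close>

definition half_branch :: "complex fps \<Rightarrow> real \<Rightarrow> complex \<Rightarrow> real \<Rightarrow> (complex \<Rightarrow> complex) \<Rightarrow> bool" where
  "half_branch P \<sigma> \<alpha> c A \<longleftrightarrow> A holomorphic_on {s. Re s < c} \<and>
     (\<forall>s. Re s < c \<longrightarrow> 0 < \<sigma> * Im s \<longrightarrow> \<sigma> * Im s < pi \<longrightarrow>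
        \<alpha> * (1 + exp s) \<in> principal_star P \<and> principal_branch P (\<alpha> * (1 + exp s)) = A s)"

lemma side_branch_half: "side_branch F \<sigma> \<alpha> c A \<Longrightarrow> half_branch F \<sigma> \<alpha> c A"
  by (auto simp: side_branch_def half_branch_def dest: integrable_branch_holo)

text \<open>Extends the identity from the open half disc to those points of the ray that belong to
  the star: both functions are holomorphic on a disc about S and agree near a point of the open
  strip inside it.\<close>

lemma half_branch_closed:
  assumes h: "half_branch P \<sigma> \<alpha> c A" and \<sigma>: "\<sigma> = 1 \<or> \<sigma> = (-1::real)"
    and S: "Re S < c" "0 \<le> \<sigma> * Im S" "\<sigma> * Im S \<le> pi" "\<alpha> * (1 + exp S) \<in> principal_star P"
  shows "\<forall>\<^sub>F s in nhds S. principal_branch P (\<alpha> * (1 + exp s)) = A s"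
proof -
  define X where "X = {s. Re s < c} \<inter> (\<lambda>s. \<alpha> * (1 + exp s)) -` principal_star P"
  have "open ((\<lambda>s. \<alpha> * (1 + exp s)) -` principal_star P)"
    by (rule open_vimage[OF open_principal_star]) (intro continuous_intros)
  then have "open X" unfolding X_def by (intro open_Int open_halfspace_Re_lt)
  moreover have "S \<in> X" using S by (simp add: X_def)
  ultimately obtain r where r: "0 < r" "ball S r \<subseteq> X" by (meson open_contains_ball)
  define T where "T = ball S r \<inter> {s. 0 < \<sigma> * Im s} \<inter> {s. \<sigma> * Im s < pi}"
  have T: "open T"
    unfolding T_def by (intro open_Int open_ball open_Collect_less continuous_intros)
  have PA: "principal_branch P (\<alpha> * (1 + exp s)) = A s" if "s \<in> T" for s
    using h that r by (auto simp: T_def X_def half_branch_def)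
  define \<delta> where "\<delta> = min (r / 2) (pi / 2)"
  \<comment> \<open>A short vertical step from S into the open strip, away from the nearer
    border.\<close>
  define s0 where "s0 = (if \<sigma> * Im S < pi / 2 then S + \<i> * of_real (\<sigma> * \<delta>) else S - \<i> * of_real (\<sigma> * (\<delta> / 2)))"
  have \<delta>: "0 < \<delta>" "\<delta> < r" "\<delta> \<le> pi / 2" using r pi_gt_zero by (auto simp: \<delta>_def)
  have "dist S s0 < r" using \<delta> \<sigma> by (auto simp: s0_def dist_norm norm_mult)
  moreover have "\<sigma> * Im s0 = (if \<sigma> * Im S < pi / 2 then \<sigma> * Im S + \<delta> else \<sigma> * Im S - \<delta> / 2)"
    using \<sigma> by (auto simp: s0_def algebra_simps)
  then have "0 < \<sigma> * Im s0" "\<sigma> * Im s0 < pi" using \<delta> S(2,3) by (auto split: if_splits)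
  ultimately have s0: "s0 \<in> T" by (simp add: T_def)
  have "(principal_branch P \<circ> (\<lambda>s. \<alpha> * (1 + exp s))) holomorphic_on ball S r"
    by (rule holomorphic_on_compose_gen[OF _ holomorphic_principal_branch]) (use r in \<open>auto simp: X_def intro!: holomorphic_intros\<close>)
  then have hol: "(\<lambda>s. principal_branch P (\<alpha> * (1 + exp s))) holomorphic_on ball S r" by (simp add: o_def)
  have Ah: "A holomorphic_on ball S r"
    by (rule holomorphic_on_subset[of _ "{s. Re s < c}"]) (use h r in \<open>auto simp: half_branch_def X_def\<close>)
  have ev: "\<forall>\<^sub>F s in nhds s0. principal_branch P (\<alpha> * (1 + exp s)) = A s"
    using eventually_nhds_in_open[OF T s0] by eventually_elim (rule PA)
  have "s0 \<in> ball S r" using s0 by (simp add: T_def)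
  then have eq: "principal_branch P (\<alpha> * (1 + exp s)) = A s" if "s \<in> ball S r" for s
    using holomorphic_eq_on_ball[OF hol Ah _ ev that] by blast
  have "\<forall>\<^sub>F s in nhds S. s \<in> ball S r" by (rule eventually_nhds_in_open) (use r in auto)
  then show ?thesis by eventually_elim (rule eq)
qed

lemma Delta_half_branch:
  assumes h: "half_branch P \<sigma> \<alpha> c A" and \<sigma>: "\<sigma> = 1 \<or> \<sigma> = (-1::real)" and \<alpha>: "\<alpha> \<noteq> 0"
    and S: "Re S < c" "0 \<le> \<sigma> * Im S" "\<sigma> * Im S \<le> pi" "\<alpha> * (1 + exp S) \<in> principal_star P"
  shows "Delta_op \<alpha> (Sigma_pow \<alpha> k (principal_branch P)) (\<alpha> * (1 + exp S)) = jump A (S + of_int k * (2 * of_real pi * \<i>))"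
proof -
  interpret lifted_branch \<alpha> \<alpha> c "principal_branch P" A
    by unfold_locales (use \<alpha> h in \<open>auto simp: half_branch_def\<close>)
  have lift: "lift s = \<alpha> * (1 + exp s)" for s by (simp add: lift_def algebra_simps)
  have "S \<in> sheet" using half_branch_closed[OF h \<sigma> S] S(1) by (simp add: sheet_def lift)
  then show ?thesis using Delta_op_lift by (simp add: lift)
qed

section \<open>Isolation of the singularities of the product, and linearity\<close>

lemma log_quotient:
  assumes "z \<noteq> \<gamma>" "\<gamma> \<noteq> (0::complex)"
  obtains W \<sigma> where "\<sigma> = 1 \<or> \<sigma> = (-1::real)" "z = \<gamma> * (1 + exp W)" "0 \<le> \<sigma> * Im W" "\<sigma> * Im W \<le> pi"
    "exp (Re W) = norm (z - \<gamma>) / norm \<gamma>"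
proof -
  define W where "W = Ln (z / \<gamma> - 1)"
  have nz: "z / \<gamma> - 1 \<noteq> 0" using assms by auto
  then have eW: "exp W = z / \<gamma> - 1" by (simp add: W_def)
  have eq: "z = \<gamma> * (1 + exp W)" using assms(2) by (simp add: eW)
  have "norm (z / \<gamma> - 1) = norm (z - \<gamma>) / norm \<gamma>"
    using assms(2) by (simp add: norm_divide[symmetric] diff_divide_distrib)
  then have norm: "exp (Re W) = norm (z - \<gamma>) / norm \<gamma>" using eW by (metis norm_exp_eq_Re)
  have "- pi < Im W" "Im W \<le> pi" unfolding W_def using mpi_less_Im_Ln[OF nz] Im_Ln_le_pi[OF nz] by auto
  then show thesis
    using that[of 1 W] that[of "-1" W] eq norm by (cases "0 \<le> Im W") auto
qed

text \<open>Every z \<noteq> \<gamma> is \<gamma>(1 + e^W) with W in one of two closed half strips,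
  so each side can be handled with its own branches.\<close>

lemma eventually_near:
  assumes "\<gamma> \<noteq> (0::complex)"
    and "\<And>\<sigma>. \<sigma> = 1 \<or> \<sigma> = (-1::real) \<Longrightarrow>
      \<exists>e. \<forall>W. Re W < e \<longrightarrow> 0 \<le> \<sigma> * Im W \<longrightarrow> \<sigma> * Im W \<le> pi \<longrightarrow> P (\<gamma> * (1 + exp W))"
  shows "\<forall>\<^sub>F z in at \<gamma>. P z"
proof -
  obtain e1 where e1: "\<forall>W. Re W < e1 \<longrightarrow> 0 \<le> 1 * Im W \<longrightarrow> 1 * Im W \<le> pi \<longrightarrow> P (\<gamma> * (1 + exp W))"
    using assms(2)[of 1] by blast
  obtain e2 where e2: "\<forall>W. Re W < e2 \<longrightarrow> 0 \<le> -1 * Im W \<longrightarrow> -1 * Im W \<le> pi \<longrightarrow> P (\<gamma> * (1 + exp W))"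
    using assms(2)[of "-1"] by blast
  define m where "m = min e1 e2"
  have "\<forall>\<^sub>F z in at \<gamma>. z \<in> ball \<gamma> (norm \<gamma> * exp m) - {\<gamma>}"
    by (rule eventually_at_in_open) (use assms(1) in auto)
  then show ?thesis
  proof eventually_elim
    case (elim z)
    then have "z \<noteq> \<gamma>" by simp
    then obtain W \<sigma> where W: "\<sigma> = 1 \<or> \<sigma> = (-1::real)" "z = \<gamma> * (1 + exp W)" "0 \<le> \<sigma> * Im W" "\<sigma> * Im W \<le> pi"
      "exp (Re W) = norm (z - \<gamma>) / norm \<gamma>"
      using log_quotient[OF _ assms(1)] by metis
    have "norm (z - \<gamma>) / norm \<gamma> < exp m"
      using elim assms(1) by (simp add: dist_norm norm_minus_commute field_simps)
    then have "exp (Re W) < exp m" by (simp only: W(5))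
    then have "Re W < m" by simp
    then show "P z" unfolding W(2) using W(1,3,4) e1 e2 by (auto simp: m_def)
  qed
qed

text \<open>exp covers the punctured plane: a path about \<gamma> lifts to the half plane, and A
  pushed down along the lift continues the branch. The side is determined by the initial point
  alone.\<close>

lemma half_branches_isolated:
  assumes \<gamma>: "\<gamma> \<noteq> 0" and h1: "half_branch P 1 \<gamma> c1 A1" and h2: "half_branch P (-1) \<gamma> c2 A2"
  shows "isolated_at P \<gamma>"
  unfolding isolated_at_def
proof (intro exI[of _ "norm \<gamma> * exp (min c1 c2)"] conjI ballI allI impI)
  define c where "c = min c1 c2"
  fix b p assume b: "b \<in> principal_star P \<inter> (ball \<gamma> (norm \<gamma> * exp (min c1 c2)) - {\<gamma>})"
    and p: "path p \<and> pathstart p = b \<and> path_image p \<subseteq> ball \<gamma> (norm \<gamma> * exp (min c1 c2)) - {\<gamma>}"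
  then have "b \<noteq> \<gamma>" by simp
  then obtain S \<sigma> where S: "\<sigma> = 1 \<or> \<sigma> = (-1::real)" "b = \<gamma> * (1 + exp S)" "0 \<le> \<sigma> * Im S" "\<sigma> * Im S \<le> pi"
    "exp (Re S) = norm (b - \<gamma>) / norm \<gamma>"
    using log_quotient[OF _ \<gamma>] by metis
  have small: "norm (z - \<gamma>) / norm \<gamma> < exp c" if "z \<in> ball \<gamma> (norm \<gamma> * exp c)" for z
    using that \<gamma> by (simp add: dist_norm norm_minus_commute field_simps)
  define A where "A = (if \<sigma> = 1 then A1 else A2)"
  define cs where "cs = (if \<sigma> = 1 then c1 else c2)"
  have h: "half_branch P \<sigma> \<gamma> cs A" using S(1) h1 h2 by (auto simp: A_def cs_def)
  have cs: "c \<le> cs" by (simp add: c_def cs_def)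
  have "exp (Re S) < exp c" unfolding S(5) by (rule small) (use b in \<open>simp add: c_def\<close>)
  then have ReS: "Re S < c" by simp
  have ev: "\<forall>\<^sub>F s in nhds S. principal_branch P (\<gamma> * (1 + exp s)) = A s"
    by (rule half_branch_closed[OF h S(1) _ S(3,4)]) (use ReS cs b S(2) in auto)
  have "path (\<lambda>t. p t / \<gamma> - 1)"
    using p \<gamma> unfolding path_def by (intro continuous_intros) auto
  moreover have "path_image (\<lambda>t. p t / \<gamma> - 1) \<subseteq> - {0}" using p \<gamma> by (auto simp: path_image_def)
  moreover have "exp S = pathstart (\<lambda>t. p t / \<gamma> - 1)" using p S(2) \<gamma> by (auto simp: pathstart_def)
  ultimately obtain q where q: "path q" "pathstart q = S" "\<And>t. t \<in> {0..1} \<Longrightarrow> exp (q t) = p t / \<gamma> - 1"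
    using covering_space_lift_path_strong[OF covering_space_exp_punctured_plane, of S] by (metis UNIV_I)
  have pq: "p t = \<gamma> * (1 + exp (q t))" if "t \<in> {0..1}" for t using q(3)[OF that] \<gamma> by simp
  have img: "path_image q \<subseteq> {s. Re s < cs}"
  proof -
    have "Re (q t) < cs" if t: "t \<in> {0..1}" for t
    proof -
      have "exp (Re (q t)) = norm (p t - \<gamma>) / norm \<gamma>"
        using q(3)[OF t] \<gamma> by (simp add: norm_divide[symmetric] diff_divide_distrib flip: norm_exp_eq_Re)
      also have "p t \<in> path_image p" using t by (simp add: path_image_def)
      then have "p t \<in> ball \<gamma> (norm \<gamma> * exp c)" using p unfolding c_def by blast
      then have "norm (p t - \<gamma>) / norm \<gamma> < exp c" by (rule small)
      finally show ?thesis using cs by simp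
    qed
    then show ?thesis by (auto simp: path_image_def)
  qed
  have "deriv (\<lambda>s. \<gamma> * (1 + exp s)) s \<noteq> 0" for s
  proof -
    have "((\<lambda>s. \<gamma> * (1 + exp s)) has_field_derivative \<gamma> * exp s) (at s)" by (auto intro!: derivative_eq_intros)
    then show ?thesis using \<gamma> by (simp add: DERIV_imp_deriv)
  qed
  moreover have "(\<lambda>s. \<gamma> * (1 + exp s)) holomorphic_on {s. Re s < cs}" by (intro holomorphic_intros)
  ultimately have "continuable_along ((\<lambda>s. \<gamma> * (1 + exp s)) \<circ> q) (principal_branch P)"
    using continued_value_push(1)[OF open_halfspace_Re_lt _ _ _ q(1) img, of "\<lambda>s. \<gamma> * (1 + exp s)" A "principal_branch P"] h ev q(2)
    by (simp add: half_branch_def)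
  moreover have "continuable_along ((\<lambda>s. \<gamma> * (1 + exp s)) \<circ> q) f = continuable_along p f" for f
  proof -
    have "continuation_along ((\<lambda>s. \<gamma> * (1 + exp s)) \<circ> q) f \<Phi> = continuation_along p f \<Phi>" for \<Phi>
    proof -
      have e: "((\<lambda>s. \<gamma> * (1 + exp s)) \<circ> q) t = p t" if "t \<in> {0..1}" for t using pq[OF that] by simp
      have "(\<forall>\<^sub>F s in at t within {0..1}. \<forall>\<^sub>F z in nhds (((\<lambda>s. \<gamma> * (1 + exp s)) \<circ> q) s). \<Phi> s z = \<Phi> t z) \<longleftrightarrow>
          (\<forall>\<^sub>F s in at t within {0..1}. \<forall>\<^sub>F z in nhds (p s). \<Phi> s z = \<Phi> t z)" for t
        unfolding eventually_at_filter by (rule eventually_cong[OF eventually_True]) (use e in auto)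
      then show ?thesis
        unfolding continuation_along_def pathstart_def by (simp add: e del: o_apply)
    qed
    then show ?thesis by (simp add: continuable_along_def)
  qed
  ultimately show "continuable_along p (principal_branch P)" by simp
qed (use \<gamma> in simp)

lemma principal_branch_unique:
  assumes X: "open X" "z \<in> X" "\<And>t. t \<in> {0..1} \<Longrightarrow> of_real t * z \<in> X" and h: "h holomorphic_on X"
    and near: "\<forall>\<^sub>F w in nhds 0. eval_fps P w = h w"
  shows "z \<in> principal_star P" "principal_branch P z = h z"
proof -
  have img: "path_image (linepath 0 z) \<subseteq> X"
    using X(3) by (auto simp: path_image_def linepath_def scaleR_conv_of_real)
  have id: "(\<lambda>w. w) holomorphic_on X" "deriv (\<lambda>w. w) x \<noteq> 0" for x :: complex by auto
  have "(\<lambda>w. w) \<circ> linepath 0 z = linepath 0 z" by (simp add: fun_eq_iff)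
  then show "z \<in> principal_star P" "principal_branch P z = h z"
    using continued_value_push[OF X(1) id(1) id(2) h path_linepath img, of "eval_fps P"] near
    by (auto simp: principal_star_def principal_branch_def)
qed

lemma principal_branch_linear:
  assumes F: "fps_conv_radius F > 0" and G: "fps_conv_radius G > 0"
    and z: "z \<in> principal_star F" "z \<in> principal_star G"
  shows "z \<in> principal_star (fps_const c * F + G)"
    "principal_branch (fps_const c * F + G) z = c * principal_branch F z + principal_branch G z"
proof -
  have "\<forall>\<^sub>F w in nhds 0. w \<in> eball 0 (min (fps_conv_radius F) (fps_conv_radius G))"
    by (rule eventually_nhds_in_open) (use F G in \<open>auto simp: in_eball_iff zero_ereal_def\<close>)
  then have near: "\<forall>\<^sub>F w in nhds 0. eval_fps (fps_const c * F + G) w = c * principal_branch F w + principal_branch G w"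
    using principal_branch_near_0[OF F] principal_branch_near_0[OF G]
  proof eventually_elim
    case (elim w)
    then have w: "norm w < fps_conv_radius F" "norm w < fps_conv_radius G" by (auto simp: in_eball_iff)
    have "norm w < fps_conv_radius (fps_const c * F)"
      using w(1) fps_conv_radius_mult[of "fps_const c" F] by (simp add: less_le_trans)
    then have "eval_fps (fps_const c * F + G) w = eval_fps (fps_const c * F) w + eval_fps G w"
      using w(2) by (rule eval_fps_add)
    also have "eval_fps (fps_const c * F) w = c * eval_fps F w"
      using w(1) by (subst eval_fps_mult) auto
    finally show ?case using elim by simp
  qed
  have "(\<lambda>w. c * principal_branch F w + principal_branch G w) holomorphic_on principal_star F \<inter> principal_star G"
    by (intro holomorphic_intros holomorphic_on_subset[OF holomorphic_principal_branch]) auto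
  from principal_branch_unique[OF open_Int[OF open_principal_star open_principal_star] _ _ this near]
  show "z \<in> principal_star (fps_const c * F + G)"
    "principal_branch (fps_const c * F + G) z = c * principal_branch F z + principal_branch G z"
    using z principal_star_scale by auto
qed

section \<open>The convolution integral over the segment from \<alpha> to z/\<beta>\<close>

context isolated_germ
begin

text \<open>Serves the points z on the ray itself. One star point just before \<alpha> brings with
  it all points between it and \<alpha>: a first singularity on the way would lie at or before that
  point, against membership in the star, or so close to \<alpha> that it equals \<alpha>.\<close>

lemma segment_before_singularity:
  assumes \<alpha>: "\<alpha> \<in> singularities F"
  obtains d where "0 < d" "d \<le> 1" "\<And>x y. 0 < x \<Longrightarrow> x \<le> y \<Longrightarrow> y < d \<Longrightarrow>
    \<alpha> * (1 - of_real y) \<in> principal_star F \<Longrightarrow> \<alpha> * (1 - of_real x) \<in> principal_star F"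
proof -
  have \<alpha>0: "\<alpha> \<noteq> 0" using \<alpha> zero_not_singularity by auto
  obtain r where r: "0 < r" "\<And>\<alpha>'. \<alpha>' \<in> ball \<alpha> r \<Longrightarrow> \<alpha>' \<in> singularities F \<Longrightarrow> \<alpha>' = \<alpha>"
    using isolated_at_imp_no_other[of F \<alpha>] isolated[OF \<alpha>] by blast
  define d where "d = min (r / norm \<alpha>) 1"
  show thesis
  proof (rule that[of d])
    show "0 < d" "d \<le> 1" using r(1) \<alpha>0 by (auto simp: d_def)
    fix x y assume xy: "0 < x" "x \<le> y" "y < d" and y: "\<alpha> * (1 - of_real y) \<in> principal_star F"
    have "y < r / norm \<alpha>" and d1: "y < 1" using xy(3) by (auto simp: d_def)
    then have d2: "y * norm \<alpha> < r" using \<alpha>0 by (simp add: pos_less_divide_eq)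
    show "\<alpha> * (1 - of_real x) \<in> principal_star F"
    proof (rule ccontr)
      assume "\<alpha> * (1 - of_real x) \<notin> principal_star F"
      then obtain s where s: "0 < s" "s \<le> 1" "of_real s * (\<alpha> * (1 - of_real x)) \<in> singularities F"
        using first_singularity[OF radius] by blast
      define w where "w = s * (1 - x)"
      have w0: "0 < w" unfolding w_def by (rule mult_pos_pos) (use s xy d1 in auto)
      have "s * (1 - x) \<le> 1 * (1 - x)" by (rule mult_right_mono) (use s xy d1 in auto)
      then have w1: "w \<le> 1 - x" by (simp add: w_def)
      have sing: "\<alpha> * of_real w \<in> singularities F" using s(3) by (simp add: w_def mult_ac)
      show False
      proof (cases "w \<le> 1 - y")
        case True
        have "of_real (w / (1 - y)) * (\<alpha> * (1 - of_real y)) \<in> principal_star F"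
          by (rule principal_star_scale[OF y]) (use w0 True d1 in auto)
        moreover have "1 - of_real y \<noteq> (0::complex)" using d1 by (simp add: complex_eq_iff)
        then have "of_real (w / (1 - y)) * (\<alpha> * (1 - of_real y)) = \<alpha> * of_real w" by simp
        ultimately have "\<alpha> * of_real w \<in> principal_star F" by (simp only:)
        then show False using sing singularity_not_in_star by blast
      next
        case False
        have "\<alpha> - \<alpha> * of_real w = \<alpha> * of_real (1 - w)" by (simp add: algebra_simps)
        then have "dist \<alpha> (\<alpha> * of_real w) = norm \<alpha> * (1 - w)" using w1 xy by (simp add: dist_norm norm_mult del: of_real_diff)
        also have "\<dots> \<le> norm \<alpha> * y" using False by (intro mult_left_mono) auto
        also have "\<dots> < r" using d2 by (simp add: mult.commute)
        finally have "\<alpha> * of_real w = \<alpha>" using r(2)[of "\<alpha> * of_real w"] sing by simp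
        then have "w = 1" using \<alpha>0 by simp
        then show False using w1 xy by simp
      qed
    qed
  qed
qed

end

lemma exp_turns: "exp (of_int k * (2 * of_real pi * \<i>)) = (1 :: complex)"
  by (subst exp_eq_1) (auto intro: exI[of _ k])

context hadamard_side
begin

text \<open>From \<open>pinch_turn\<close> only the convergence is extracted, so one auxiliary point
  with real part c - 5/2 can serve as both end points.\<close>

lemma conv_density_has_integral:
  assumes \<alpha>: "\<alpha> \<noteq> 0"
  obtains e where "\<And>W. Re W < e \<Longrightarrow> (conv_density (A \<alpha>) (B (\<gamma> / \<alpha>)) W has_integral conv_int \<alpha> W) {0..1}"
proof -
  have \<beta>0: "\<gamma> / \<alpha> \<noteq> 0" using \<alpha> \<gamma> by simp
  define c where "c = min (min (cA \<alpha>) (cB (\<gamma> / \<alpha>))) (ln (1 / 2))"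
  have "side_branch F \<sigma> \<alpha> c (A \<alpha>)" and "side_branch G \<sigma> (\<gamma> / \<alpha>) c (B (\<gamma> / \<alpha>))"
    using side_branch_mono[OF A[OF \<alpha>]] side_branch_mono[OF B[OF \<beta>0]] by (auto simp: c_def)
  then have i: "integrable_branch c (A \<alpha>)" "integrable_branch c (B (\<gamma> / \<alpha>))" by (auto simp: side_branch_def)
  have "c \<le> ln (1 / 2)" by (simp add: c_def)
  then have "exp c \<le> exp (ln (1 / 2))" by (simp only: exp_le_cancel_iff)
  then interpret scale c by unfold_locales simp
  have r: "Re (of_real (c - 5 / 2)) < c - 2" by simp
  show thesis
  proof (rule that[of "c - 3"])
    fix W assume W: "Re W < c - 3"
    then have r2: "Re W < Re (of_real (c - 5 / 2))" by simp
    from pinch_turn[OF i W r2 r r2 r]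
    show "(conv_density (A \<alpha>) (B (\<gamma> / \<alpha>)) W has_integral conv_int \<alpha> W) {0..1}"
      unfolding conv_int_def using integrable_integral has_integral_integrable by blast
  qed
qed

text \<open>For s = W + ln t the number 1 - e^(s - W) = 1 - t is positive, so T = W + ln (1 - t) -
  Ln (1 + t e^W). On the side strip the last logarithm has imaginary part of sign \<sigma>, which
  keeps \<sigma> Im T below pi; that \<sigma> Im T is positive follows from the sign of Im
  (e^T).\<close>

lemma partner_on_segment:
  assumes W: "norm (exp W) < 1 / 2" "0 \<le> \<sigma> * Im W" "\<sigma> * Im W \<le> pi" and t: "0 < t" "t < 1"
  defines "T \<equiv> partner W (W + of_real (ln t))"
  shows "exp T = exp W * of_real (1 - t) / (1 + of_real t * exp W)"
    and "side W \<Longrightarrow> side T" and "\<sigma> * Im W = pi \<Longrightarrow> Im T = Im W"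
proof -
  have expS: "exp (W + of_real (ln t)) = of_real t * exp W" using t by (simp add: exp_add exp_of_real)
  have eq: "1 - exp (W + of_real (ln t) - W) = of_real (1 - t)" using t by (simp add: exp_of_real)
  then have T: "T = W + of_real (ln (1 - t)) - Ln (1 + of_real t * exp W)"
    unfolding T_def partner_def expS eq using t by (simp add: Ln_of_real del: of_real_diff)
  have "t * norm (exp W) \<le> norm (exp W)" by (rule mult_left_le_one_le) (use t in auto)
  moreover have "norm (of_real t * exp W) = t * norm (exp W)" using t by (simp add: norm_mult)
  ultimately have "norm (of_real t * exp W) < 1" using W(1) by linarith
  then have Re: "0 < Re (1 + of_real t * exp W)"
    using abs_Re_le_cmod[of "of_real t * exp W"] unfolding plus_complex.sel one_complex.sel by linarith
  then have nz: "1 + of_real t * exp W \<noteq> 0" by (metis less_irrefl zero_complex.sel(1))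
  show expT: "exp T = exp W * of_real (1 - t) / (1 + of_real t * exp W)"
    unfolding T exp_diff exp_add using t nz by (simp add: exp_of_real)
  have ImT: "Im T = Im W - Im (Ln (1 + of_real t * exp W))" by (simp add: T)
  have q: "\<bar>Im (Ln (1 + of_real t * exp W))\<bar> < pi / 2" by (rule Re_Ln_pos_lt_imp[OF Re])
  show "side T" if "side W"
  proof -
    have w: "0 < \<sigma> * Im (exp W)" using sign_Im_exp[OF \<sigma>, of W] that by (simp add: side_def)
    have "\<sigma> * Im (1 + of_real t * exp W) = t * (\<sigma> * Im (exp W))" by simp
    also have "0 < \<dots>" using w t by simp
    finally have "0 < \<sigma> * Im (1 + of_real t * exp W)" .
    then have "0 < \<sigma> * Im (Ln (1 + of_real t * exp W))"
      using \<sigma> Im_Ln_pos_lt[OF nz] Im_Ln_pos_le[OF nz] q pi_gt_zero by (auto simp: abs_less_iff not_le)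
    moreover have "\<bar>\<sigma> * Im (Ln (1 + of_real t * exp W))\<bar> < pi / 2" using q \<sigma> by auto
    moreover have "\<sigma> * Im T = \<sigma> * Im W - \<sigma> * Im (Ln (1 + of_real t * exp W))" by (simp add: ImT right_diff_distrib)
    moreover have "0 < \<sigma> * Im W" "\<sigma> * Im W < pi" using that by (simp_all add: side_def)
    ultimately have up: "\<sigma> * Im T < pi" and low: "- (pi / 2) < \<sigma> * Im T" by linarith+
    have "Im (exp W / (1 + of_real t * exp W)) = Im (exp W) / (norm (1 + of_real t * exp W))\<^sup>2"
      unfolding Im_divide cmod_power2 by (simp add: algebra_simps)
    moreover have "exp T = of_real (1 - t) * (exp W / (1 + of_real t * exp W))" unfolding expT by simp
    then have "Im (exp T) = (1 - t) * Im (exp W / (1 + of_real t * exp W))"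
      by (simp only: times_complex.sel Re_complex_of_real Im_complex_of_real mult_zero_left add_0_right)
    ultimately have "\<sigma> * Im (exp T) = (1 - t) * (\<sigma> * Im (exp W) / (norm (1 + of_real t * exp W))\<^sup>2)"
      by (simp only: mult.left_commute times_divide_eq_right)
    also have "0 < \<dots>" by (rule mult_pos_pos[OF _ divide_pos_pos[OF w]]) (use t nz in auto)
    finally have pos: "0 < \<sigma> * Im (exp T)" .
    have "0 < \<sigma> * Im T"
    proof (rule ccontr)
      assume "\<not> 0 < \<sigma> * Im T"
      then have "0 \<le> sin (- (\<sigma> * Im T))" using low by (intro sin_ge_zero) auto
      moreover have "sin (\<sigma> * Im T) = \<sigma> * sin (Im T)" using \<sigma> by auto
      ultimately have "exp (Re T) * (\<sigma> * sin (Im T)) \<le> 0" by (simp add: mult_le_0_iff)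
      then show False using pos by (simp add: Im_exp mult.left_commute)
    qed
    then show ?thesis using up by (simp add: side_def)
  qed
  show "Im T = Im W" if "\<sigma> * Im W = pi"
  proof -
    have "Im W = \<sigma> * pi" using that \<sigma> by auto
    then have "sin (Im W) = 0" using \<sigma> by auto
    then have "Im (1 + of_real t * exp W) = 0" by (simp add: Im_exp)
    then have "1 + of_real t * exp W = of_real (Re (1 + of_real t * exp W))" by (simp add: complex_eq_iff)
    then have "Im (Ln (1 + of_real t * exp W)) = 0" using Re Ln_of_real[OF Re] by (metis Im_complex_of_real)
    then show ?thesis by (simp add: ImT)
  qed
qed

text \<open>On the segment u = \<alpha>(1 + e^S) and z/u = \<beta>(1 + e^T). The operators with
  exponent k evaluate the jumps at S + K and T + K, K = 2 pi i k, and the partner coordinate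
  respects this simultaneous shift, so the value is \<open>conv_int\<close> at W + K.\<close>

lemma pair_integral:
  assumes \<alpha>: "\<alpha> \<in> singularities F" and \<beta>: "\<beta> \<in> singularities G" and \<gamma>eq: "\<alpha> * \<beta> = \<gamma>"
  obtains e where "\<And>W. Re W < e \<Longrightarrow> 0 \<le> \<sigma> * Im W \<Longrightarrow> \<sigma> * Im W \<le> pi \<Longrightarrow> target W \<in> common_star F G \<gamma> \<Longrightarrow>
    (conv_integrand (Delta_op \<alpha> (Sigma_pow \<alpha> k (principal_branch F))) (Delta_op \<beta> (Sigma_pow \<beta> k (principal_branch G))) (target W)
      has_contour_integral conv_int \<alpha> (W + of_int k * (2 * of_real pi * \<i>))) (linepath \<alpha> (target W / \<beta>))"
proof -
  have nz: "\<alpha> \<noteq> 0" "\<beta> \<noteq> 0" using \<alpha> \<beta> F.zero_not_singularity G.zero_not_singularity by auto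
  have \<beta>eq: "\<gamma> / \<alpha> = \<beta>" using \<gamma>eq nz by auto
  define c where "c = min (min (cA \<alpha>) (cB \<beta>)) (ln (1 / 2))"
  have sA: "half_branch F \<sigma> \<alpha> c (A \<alpha>)" and sB: "half_branch G \<sigma> \<beta> c (B \<beta>)"
    using side_branch_mono[OF A[OF nz(1)]] side_branch_mono[OF B[OF nz(2)]] by (auto simp: c_def intro!: side_branch_half)
  have "c \<le> ln (1 / 2)" by (simp add: c_def)
  then have "exp c \<le> exp (ln (1 / 2))" by (simp only: exp_le_cancel_iff)
  then interpret scale c by unfold_locales simp
  obtain d1 where d1: "0 < d1" "d1 \<le> 1" "\<And>x y. 0 < x \<Longrightarrow> x \<le> y \<Longrightarrow> y < d1 \<Longrightarrow>
      \<alpha> * (1 - of_real y) \<in> principal_star F \<Longrightarrow> \<alpha> * (1 - of_real x) \<in> principal_star F"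
    by (rule F.segment_before_singularity[OF \<alpha>], rule that)
  obtain d2 where d2: "0 < d2" "d2 \<le> 1" "\<And>x y. 0 < x \<Longrightarrow> x \<le> y \<Longrightarrow> y < d2 \<Longrightarrow>
      \<beta> * (1 - of_real y) \<in> principal_star G \<Longrightarrow> \<beta> * (1 - of_real x) \<in> principal_star G"
    by (rule G.segment_before_singularity[OF \<beta>], rule that)
  obtain e1 where e1: "\<And>W. Re W < e1 \<Longrightarrow> (conv_density (A \<alpha>) (B \<beta>) W has_integral conv_int \<alpha> W) {0..1}"
    using conv_density_has_integral[OF nz(1)] unfolding \<beta>eq by blast
  define e where "e = min (min e1 (c - 3)) (min (ln d1) (ln d2))"
  define f where "f = Delta_op \<alpha> (Sigma_pow \<alpha> k (principal_branch F))"
  define g where "g = Delta_op \<beta> (Sigma_pow \<beta> k (principal_branch G))"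
  define K where "K = of_int k * (2 * of_real pi * \<i>)"
  have expK: "exp K = 1" unfolding K_def by (rule exp_turns)
  have ReK: "Re K = 0" by (simp add: K_def)
  have fA: "f (\<alpha> * (1 + exp S)) = jump (A \<alpha>) (S + K)"
    if "Re S < c" "0 \<le> \<sigma> * Im S" "\<sigma> * Im S \<le> pi" "\<alpha> * (1 + exp S) \<in> principal_star F" for S
    unfolding f_def K_def by (rule Delta_half_branch[OF sA \<sigma> nz(1) that])
  have gB: "g (\<beta> * (1 + exp S)) = jump (B \<beta>) (S + K)"
    if "Re S < c" "0 \<le> \<sigma> * Im S" "\<sigma> * Im S \<le> pi" "\<beta> * (1 + exp S) \<in> principal_star G" for S
    unfolding g_def K_def by (rule Delta_half_branch[OF sB \<sigma> nz(2) that])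
  show thesis
  proof (rule that[of e], unfold f_def[symmetric] g_def[symmetric] K_def[symmetric])
    fix W assume W: "Re W < e" "0 \<le> \<sigma> * Im W" "\<sigma> * Im W \<le> pi" and star: "target W \<in> common_star F G \<gamma>"
    have W': "Re W < e1" "Re W < c - 3" "Re W < c - 2" "exp (Re W) < d1" "exp (Re W) < d2"
      using W(1) d1(1) d2(1) less_ln_iff by (auto simp: e_def)
    have quot: "target W / \<beta> = \<alpha> * (1 + exp W)" "target W / \<alpha> = \<beta> * (1 + exp W)"
      unfolding target_def using nz by (simp_all add: \<gamma>eq[symmetric])
    have "(\<alpha>, \<beta>) \<in> sing_pairs F G \<gamma>" using \<alpha> \<beta> \<gamma>eq by (simp add: sing_pairs_def)
    then have stars: "\<alpha> * (1 + exp W) \<in> principal_star F" "\<beta> * (1 + exp W) \<in> principal_star G"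
      using star unfolding quot[symmetric] common_star_def by auto
    have polar: "exp W = of_real (exp (Re W)) * cis (Im W)" by (simp add: exp_eq_polar)
    \<comment> \<open>Otherwise z/\<beta> would lie on the ray behind \<alpha>, and the star would
      contain \<alpha>.\<close>
    have "\<sigma> * Im W \<noteq> 0"
    proof
      assume "\<sigma> * Im W = 0"
      then have "Im W = 0" using \<sigma> by auto
      then have ex: "exp W = of_real (exp (Re W))" using polar by simp
      have "of_real (1 / (1 + exp (Re W))) * (\<alpha> * (1 + exp W)) \<in> principal_star F"
        by (rule principal_star_scale[OF stars(1)]) (auto simp: divide_simps add_pos_pos)
      moreover have "1 + exp (Re W) \<noteq> 0" by (smt (verit) exp_gt_zero)
      then have "of_real (1 + exp (Re W)) \<noteq> (0::complex)" by (simp only: of_real_eq_0_iff not_False_eq_True)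
      then have "of_real (1 / (1 + exp (Re W))) * (\<alpha> * (1 + exp W)) = \<alpha>" unfolding ex by (simp add: divide_simps)
      ultimately show False using \<alpha> singularity_not_in_star by metis
    qed
    then have cases: "side W \<or> \<sigma> * Im W = pi" using W \<open>\<sigma> * Im W \<noteq> 0\<close> unfolding side_def by linarith
    have "exp (Re W) < exp (c - 3)" using W'(2) by simp
    also have "exp (c - 3) \<le> exp c" by simp
    finally have "exp (Re W) < 1 / 2" using exp_c by linarith
    then have small: "norm (exp W) < 1 / 2" by simp
    have dens: "conv_integrand f g (target W) (linepath \<alpha> (\<alpha> * (1 + exp W)) t) * (\<alpha> * (1 + exp W) - \<alpha>) =
        conv_density (A \<alpha>) (B \<beta>) (W + K) t" if t: "0 < t" "t < 1" for t
    proof -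
      define S where "S = W + of_real (ln t)"
      define T where "T = partner W S"
      have "ln t < 0" using t by simp
      have "Re S = Re W + ln t" by (simp add: S_def)
      then have S: "Re S < Re W" "Re S < c - 2" "Re S < c" "Im S = Im W" "exp S = of_real t * exp W"
        using \<open>ln t < 0\<close> W'(2) t by (linarith, linarith, linarith, simp_all add: S_def exp_add exp_of_real)
      note pT = partner_on_segment[OF small W(2,3) t, folded S_def, folded T_def]
      have ReT: "Re T < c" unfolding T_def by (rule Re_partner[OF inner_not_nonpos[OF S(1)] S(2) W'(3)])
      have stars': "\<alpha> * (1 + exp S) \<in> principal_star F \<and> \<beta> * (1 + exp T) \<in> principal_star G \<and> 0 \<le> \<sigma> * Im T \<and> \<sigma> * Im T \<le> pi"
        using cases
      proof
        assume "side W"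
        then have "side S" "side T" using pT(2) S(4) by (auto simp: side_def)
        then show ?thesis using sA sB S(3) ReT by (auto simp: half_branch_def side_def)
      next
        \<comment> \<open>Here z/\<gamma> is real and below 1. Both u and z/u run on rays just
          before \<alpha> and \<beta>, and stay between the known star points and the singularities
          because t x \<le> x and y \<le> x.\<close>
        assume pi: "\<sigma> * Im W = pi"
        define x where "x = exp (Re W)"
        have x: "0 < x" "x < d1" "x < d2" using W'(4,5) by (auto simp: x_def)
        have "Im W = \<sigma> * pi" using pi \<sigma> by auto
        then have "cis (Im W) = -1" using \<sigma> by (auto simp: complex_eq_iff)
        then have ex: "exp W = - of_real x" using polar by (simp add: x_def)
        have "x < 1" using x d1(2) by simp
        have tx: "0 < t * x" "t * x \<le> x" using t x by (auto simp: mult_le_cancel_right1)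
        have "\<alpha> * (1 - of_real (t * x)) \<in> principal_star F"
          by (rule d1(3)[OF tx x(2)]) (use stars(1) ex in simp)
        then have "\<alpha> * (1 + exp S) \<in> principal_star F" by (simp add: S(5) ex)
        moreover define y where "y = x * (1 - t) / (1 - t * x)"
        have "1 - t \<le> 1 - t * x" "0 < 1 - t * x" using tx \<open>x < 1\<close> t by (auto simp: mult_le_cancel_left1)
        then have "x * (1 - t) \<le> x * (1 - t * x)" using x by (intro mult_left_mono) auto
        then have y: "0 < y" "y \<le> x" using x t \<open>0 < 1 - t * x\<close> by (auto simp: y_def pos_divide_le_eq)
        have "\<beta> * (1 - of_real y) \<in> principal_star G"
          by (rule d2(3)[OF y x(3)]) (use stars(2) ex in simp)
        moreover have "exp T = - of_real y" unfolding pT(1) ex y_def by simp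
        ultimately show ?thesis using pT(3)[OF pi] pi pi_gt_zero by simp
      qed
      have nz1: "1 + of_real t * exp W \<noteq> 0"
      proof
        assume "1 + of_real t * exp W = 0"
        then have "of_real t * exp W = - 1" by (simp add: add_eq_0_iff)
        then have "norm (of_real t * exp W) = 1" by simp
        moreover have "norm (of_real t * exp W) = t * norm (exp W)" using t by (simp add: norm_mult)
        moreover have "t * norm (exp W) \<le> norm (exp W)" by (rule mult_left_le_one_le) (use t in auto)
        ultimately show False using small by linarith
      qed
      have lp: "linepath \<alpha> (\<alpha> * (1 + exp W)) t = \<alpha> * (1 + exp S)"
        by (simp add: linepath_def S(5) scaleR_conv_of_real algebra_simps)
      have "1 + exp T = (1 + exp W) / (1 + exp S)"
        unfolding pT(1) S(5) using nz1 by (simp add: divide_simps) (simp add: algebra_simps)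
      then have zu: "target W / (\<alpha> * (1 + exp S)) = \<beta> * (1 + exp T)"
        unfolding target_def using nz by (simp add: \<gamma>eq[symmetric])
      have diff: "\<alpha> * (1 + exp W) - \<alpha> = \<alpha> * exp W" by (simp add: algebra_simps)
      have cancel: "x / (\<alpha> * y) * (\<alpha> * w) = x * (w / y)" for x y w using nz(1) by (cases "y = 0") (auto simp: field_simps)
      have "f (\<alpha> * (1 + exp S)) = jump (A \<alpha>) (S + K)"
        by (rule fA) (use S W stars' in auto)
      moreover have "g (\<beta> * (1 + exp T)) = jump (B \<beta>) (T + K)"
        by (rule gB) (use ReT stars' in auto)
      ultimately have "conv_integrand f g (target W) (linepath \<alpha> (\<alpha> * (1 + exp W)) t) * (\<alpha> * (1 + exp W) - \<alpha>) =
          jump (A \<alpha>) (S + K) * jump (B \<beta>) (T + K) * (exp W / (1 + of_real t * exp W))"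
        unfolding conv_integrand_def lp zu diff cancel by (simp only: S(5))
      moreover have SK: "W + K + of_real (ln t) = S + K" by (simp add: S_def)
      moreover have TK: "partner (W + K) (S + K) = T + K"
        by (simp add: T_def partner_def exp_add expK)
      ultimately show ?thesis by (simp only: conv_density_def SK TK exp_add expK mult_1_right)
    qed
    have "(conv_density (A \<alpha>) (B \<beta>) (W + K) has_integral conv_int \<alpha> (W + K)) {0..1}"
      by (rule e1) (use W' ReK in simp)
    then have "((\<lambda>t. conv_integrand f g (target W) (linepath \<alpha> (\<alpha> * (1 + exp W)) t) * (\<alpha> * (1 + exp W) - \<alpha>))
        has_integral conv_int \<alpha> (W + K)) {0..1}"
      by (rule has_integral_spike_finite[rotated 2, where S = "{0, 1}"]) (use dens in auto)
    then show "(conv_integrand f g (target W) has_contour_integral conv_int \<alpha> (W + K)) (linepath \<alpha> (target W / \<beta>))"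
      unfolding has_contour_integral_linepath quot by simp
  qed
qed

lemma sing_pairs_eq: "sing_pairs F G \<gamma> = (\<lambda>\<alpha>. (\<alpha>, \<gamma> / \<alpha>)) ` {\<alpha> \<in> singularities F. \<gamma> / \<alpha> \<in> singularities G}"
  using F.zero_not_singularity by (fastforce simp: sing_pairs_def image_iff)

text \<open>\<gamma>/\<alpha> stays outside of a disc about 0 in which G is regular, so \<alpha> is
  bounded, and a bounded set contains finitely many singularities of F.\<close>

lemma finite_sing_pairs: "finite (sing_pairs F G \<gamma>)"
proof -
  obtain m where m: "\<And>x. Re x < m \<Longrightarrow> exp x \<in> principal_star G" using G.disc_in_star by blast
  have "norm \<alpha> \<le> norm \<gamma> * exp (- m)" if "\<alpha> \<in> singularities F" "\<gamma> / \<alpha> \<in> singularities G" for \<alpha>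
  proof -
    have nz: "\<alpha> \<noteq> 0" "\<gamma> / \<alpha> \<noteq> 0" using that F.zero_not_singularity \<gamma> by auto
    have "exp (Ln (\<gamma> / \<alpha>)) \<notin> principal_star G" using that(2) nz(2) singularity_not_in_star by simp
    then have "m \<le> Re (Ln (\<gamma> / \<alpha>))" using m by force
    then have "exp m \<le> norm (\<gamma> / \<alpha>)" using nz(2) by (simp add: ln_ge_iff)
    then show ?thesis using nz by (simp add: norm_divide exp_minus field_simps)
  qed
  then have "{\<alpha> \<in> singularities F. \<gamma> / \<alpha> \<in> singularities G} \<subseteq> singularities F \<inter> cball 0 (norm \<gamma> * exp (- m))" by auto
  then show ?thesis unfolding sing_pairs_eq by (intro finite_imageI finite_subset[OF _ F.finite_singularities])
qed

lemma hadamard_half_branch: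
  obtains e H where "half_branch (hadamard F G) \<sigma> \<gamma> e H"
    and "\<And>W. Re W < e \<Longrightarrow> jump H W = - (1 / (2 * of_real pi * \<i>)) * (\<Sum>(\<alpha>, \<beta>)\<in>sing_pairs F G \<gamma>. conv_int \<alpha> W)"
proof -
  obtain e H where H: "H holomorphic_on {W. Re W < e}"
    "\<And>W. Re W < e \<Longrightarrow> side W \<Longrightarrow>
      target W \<in> principal_star (hadamard F G) \<and> principal_branch (hadamard F G) (target W) = H W"
    "\<And>W. Re W < e \<Longrightarrow> H (W + 2 * of_real pi * \<i>) - H W =
      - (1 / (2 * of_real pi * \<i>)) * (\<Sum>\<alpha>\<in>{\<alpha> \<in> singularities F. \<gamma> / \<alpha> \<in> singularities G}. conv_int \<alpha> W)"
    by (rule hadamard_continuation, rule that)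
  show thesis
  proof (rule that[of e H])
    show "half_branch (hadamard F G) \<sigma> \<gamma> e H"
      using H(1,2) by (auto simp: half_branch_def side_def target_def)
    fix W assume W: "Re W < e"
    have "(\<Sum>(\<alpha>, \<beta>)\<in>sing_pairs F G \<gamma>. conv_int \<alpha> W) = (\<Sum>\<alpha>\<in>{\<alpha> \<in> singularities F. \<gamma> / \<alpha> \<in> singularities G}. conv_int \<alpha> W)"
      unfolding sing_pairs_eq by (subst sum.reindex) (auto simp: inj_on_def)
    then show "jump H W = - (1 / (2 * of_real pi * \<i>)) * (\<Sum>(\<alpha>, \<beta>)\<in>sing_pairs F G \<gamma>. conv_int \<alpha> W)"
      using H(3)[OF W] by (simp add: jump_def)
  qed
qed

lemma side_in_common_star:
  obtains e where "\<And>W. Re W < e \<Longrightarrow> side W \<Longrightarrow> target W \<in> common_star F G \<gamma>"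
proof -
  obtain e1 H where H: "half_branch (hadamard F G) \<sigma> \<gamma> e1 H" by (rule hadamard_half_branch, rule that)
  define E where "E p = min (cA (fst p)) (cB (snd p))" for p
  define e where "e = Min (insert e1 (E ` sing_pairs F G \<gamma>))"
  have e: "e \<le> e1" "\<And>p. p \<in> sing_pairs F G \<gamma> \<Longrightarrow> e \<le> E p"
    using finite_sing_pairs by (auto simp: e_def)
  show thesis
  proof (rule that[of e])
    fix W assume W: "Re W < e" "side W"
    have "target W / \<beta> \<in> principal_star F \<and> target W / \<alpha> \<in> principal_star G" if p: "(\<alpha>, \<beta>) \<in> sing_pairs F G \<gamma>" for \<alpha> \<beta>
    proof -
      have eq: "\<alpha> * \<beta> = \<gamma>" using p by (simp add: sing_pairs_def)
      then have nz: "\<alpha> \<noteq> 0" "\<beta> \<noteq> 0" using \<gamma> by auto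
      have "target W / \<beta> = \<alpha> * (1 + exp W)" "target W / \<alpha> = \<beta> * (1 + exp W)"
        unfolding target_def using nz by (simp_all add: eq[symmetric])
      moreover have "Re W < cA \<alpha>" "Re W < cB \<beta>" using e(2)[OF p] W(1) by (auto simp: E_def)
      ultimately show ?thesis using A[OF nz(1)] B[OF nz(2)] W(2) by (auto simp: side_branch_def side_def)
    qed
    moreover have "target W \<in> principal_star (hadamard F G)"
      using H W e(1) by (auto simp: half_branch_def side_def target_def)
    ultimately show "target W \<in> common_star F G \<gamma>" by (auto simp: common_star_def)
  qed
qed

text \<open>The jump formula for H is evaluated at W + K; finiteness of the set of pairs provides
  one bound on Re W for all of them.\<close>

lemma monodromy_formula:
  obtains e where "\<And>W. Re W < e \<Longrightarrow> 0 \<le> \<sigma> * Im W \<Longrightarrow> \<sigma> * Im W \<le> pi \<Longrightarrow> target W \<in> common_star F G \<gamma> \<Longrightarrow>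
    (\<forall>(\<alpha>, \<beta>) \<in> sing_pairs F G \<gamma>.
       conv_integrand (Delta_op \<alpha> (Sigma_pow \<alpha> k (principal_branch F)))
                      (Delta_op \<beta> (Sigma_pow \<beta> k (principal_branch G))) (target W)
         contour_integrable_on linepath \<alpha> (target W / \<beta>)) \<and>
    Delta_op \<gamma> (Sigma_pow \<gamma> k (principal_branch (hadamard F G))) (target W) =
      (\<Sum>(\<alpha>, \<beta>) \<in> sing_pairs F G \<gamma>.
         int_conv \<alpha> \<beta> (Delta_op \<alpha> (Sigma_pow \<alpha> k (principal_branch F)))
                      (Delta_op \<beta> (Sigma_pow \<beta> k (principal_branch G))) (target W))"
proof -
  define K where "K = of_int k * (2 * of_real pi * \<i>)"
  define I where "I \<alpha> \<beta> W = conv_integrand (Delta_op \<alpha> (Sigma_pow \<alpha> k (principal_branch F)))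
    (Delta_op \<beta> (Sigma_pow \<beta> k (principal_branch G))) (target W)" for \<alpha> \<beta> W
  have "\<forall>p\<in>sing_pairs F G \<gamma>. \<exists>e. \<forall>W. Re W < e \<longrightarrow> 0 \<le> \<sigma> * Im W \<longrightarrow> \<sigma> * Im W \<le> pi \<longrightarrow> target W \<in> common_star F G \<gamma> \<longrightarrow>
    (I (fst p) (snd p) W has_contour_integral conv_int (fst p) (W + K)) (linepath (fst p) (target W / snd p))"
  proof
    fix p assume "p \<in> sing_pairs F G \<gamma>"
    then have p: "fst p \<in> singularities F" "snd p \<in> singularities G" "fst p * snd p = \<gamma>" by (auto simp: sing_pairs_def)
    show "\<exists>e. \<forall>W. Re W < e \<longrightarrow> 0 \<le> \<sigma> * Im W \<longrightarrow> \<sigma> * Im W \<le> pi \<longrightarrow> target W \<in> common_star F G \<gamma> \<longrightarrow>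
      (I (fst p) (snd p) W has_contour_integral conv_int (fst p) (W + K)) (linepath (fst p) (target W / snd p))"
      unfolding I_def K_def by (rule pair_integral[OF p, of k]) blast
  qed
  from bchoice[OF this] obtain E where E0: "\<forall>p\<in>sing_pairs F G \<gamma>. \<forall>W. Re W < E p \<longrightarrow>
      0 \<le> \<sigma> * Im W \<longrightarrow> \<sigma> * Im W \<le> pi \<longrightarrow> target W \<in> common_star F G \<gamma> \<longrightarrow>
      (I (fst p) (snd p) W has_contour_integral conv_int (fst p) (W + K)) (linepath (fst p) (target W / snd p))"
    by (elim exE)
  have E: "(I \<alpha> \<beta> W has_contour_integral conv_int \<alpha> (W + K)) (linepath \<alpha> (target W / \<beta>))"
    if "(\<alpha>, \<beta>) \<in> sing_pairs F G \<gamma>" "Re W < E (\<alpha>, \<beta>)" "0 \<le> \<sigma> * Im W" "\<sigma> * Im W \<le> pi" "target W \<in> common_star F G \<gamma>"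
    for \<alpha> \<beta> W
    using bspec[OF E0 that(1)] that(2-5) by simp
  obtain e1 H where H: "half_branch (hadamard F G) \<sigma> \<gamma> e1 H"
    "\<And>W. Re W < e1 \<Longrightarrow> jump H W = - (1 / (2 * of_real pi * \<i>)) * (\<Sum>(\<alpha>, \<beta>)\<in>sing_pairs F G \<gamma>. conv_int \<alpha> W)"
    by (rule hadamard_half_branch, rule that)
  define e where "e = Min (insert e1 (E ` sing_pairs F G \<gamma>))"
  have e: "e \<le> e1" "\<And>p. p \<in> sing_pairs F G \<gamma> \<Longrightarrow> e \<le> E p"
    using finite_sing_pairs by (auto simp: e_def)
  show thesis
  proof (rule that[of e], unfold I_def[symmetric])
    fix W assume W: "Re W < e" "0 \<le> \<sigma> * Im W" "\<sigma> * Im W \<le> pi" "target W \<in> common_star F G \<gamma>"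
    have I: "(I \<alpha> \<beta> W has_contour_integral conv_int \<alpha> (W + K)) (linepath \<alpha> (target W / \<beta>))"
      if "(\<alpha>, \<beta>) \<in> sing_pairs F G \<gamma>" for \<alpha> \<beta>
      by (rule E[OF that _ W(2-4)]) (use e(2)[OF that] W(1) in simp)
    have "Delta_op \<gamma> (Sigma_pow \<gamma> k (principal_branch (hadamard F G))) (target W) = jump H (W + K)"
      unfolding target_def K_def
      by (rule Delta_half_branch[OF H(1) \<sigma> \<gamma> _ W(2,3)]) (use W e(1) in \<open>auto simp: common_star_def target_def\<close>)
    also have "\<dots> = - (1 / (2 * of_real pi * \<i>)) * (\<Sum>(\<alpha>, \<beta>)\<in>sing_pairs F G \<gamma>. conv_int \<alpha> (W + K))"
      by (rule H(2)) (use W(1) e(1) in \<open>simp add: K_def\<close>)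
    also have "\<dots> = (\<Sum>(\<alpha>, \<beta>) \<in> sing_pairs F G \<gamma>.
         int_conv \<alpha> \<beta> (Delta_op \<alpha> (Sigma_pow \<alpha> k (principal_branch F)))
                      (Delta_op \<beta> (Sigma_pow \<beta> k (principal_branch G))) (target W))"
      unfolding sum_distrib_left
      by (rule sum.cong[OF refl]) (auto simp: int_conv_def I_def[symmetric] contour_integral_unique[OF I])
    finally show "(\<forall>(\<alpha>, \<beta>) \<in> sing_pairs F G \<gamma>. I \<alpha> \<beta> W contour_integrable_on linepath \<alpha> (target W / \<beta>)) \<and>
      Delta_op \<gamma> (Sigma_pow \<gamma> k (principal_branch (hadamard F G))) (target W) =
      (\<Sum>(\<alpha>, \<beta>) \<in> sing_pairs F G \<gamma>.
         int_conv \<alpha> \<beta> (Delta_op \<alpha> (Sigma_pow \<alpha> k (principal_branch F)))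
                      (Delta_op \<beta> (Sigma_pow \<beta> k (principal_branch G))) (target W))"
      using I has_contour_integral_integrable by blast
  qed
qed

end

section \<open>Both sides of the cut together\<close>

lemma hadamard_side_exists:
  assumes "isolated_germ F" "isolated_germ G" "\<gamma> \<noteq> 0" "\<sigma> = 1 \<or> \<sigma> = (-1::real)"
  obtains A B cA cB where "hadamard_side F G \<gamma> \<sigma> A B cA cB"
proof -
  have "\<forall>\<alpha>. \<exists>c A. \<alpha> \<noteq> 0 \<longrightarrow> side_branch F \<sigma> \<alpha> c A" "\<forall>\<alpha>. \<exists>c A. \<alpha> \<noteq> 0 \<longrightarrow> side_branch G \<sigma> \<alpha> c A"
    using isolated_germ.side_branch_exists[OF assms(1) _ assms(4)] isolated_germ.side_branch_exists[OF assms(2) _ assms(4)]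
    by metis+
  then obtain cA A cB B where "\<And>\<alpha>. \<alpha> \<noteq> 0 \<Longrightarrow> side_branch F \<sigma> \<alpha> (cA \<alpha>) (A \<alpha>)" "\<And>\<beta>. \<beta> \<noteq> 0 \<Longrightarrow> side_branch G \<sigma> \<beta> (cB \<beta>) (B \<beta>)"
    by metis
  then have "hadamard_side F G \<gamma> \<sigma> A B cA cB"
    using assms by (simp add: hadamard_side_def hadamard_side_axioms_def)
  then show thesis by (rule that)
qed

lemma hadamard_side_common_star:
  assumes F: "isolated_germ F" and G: "isolated_germ G" and \<gamma>: "\<gamma> \<noteq> 0"
  shows "\<forall>\<^sub>F z in at \<gamma>. z / \<gamma> \<notin> \<real> \<longrightarrow> z \<in> common_star F G \<gamma>"
proof (rule eventually_near[OF \<gamma>])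
  fix \<sigma> :: real assume \<sigma>: "\<sigma> = 1 \<or> \<sigma> = -1"
  obtain A B cA cB where "hadamard_side F G \<gamma> \<sigma> A B cA cB" by (rule hadamard_side_exists[OF F G \<gamma> \<sigma>])
  then interpret hadamard_side F G \<gamma> \<sigma> A B cA cB .
  obtain e where e: "\<And>W. Re W < e \<Longrightarrow> side W \<Longrightarrow> target W \<in> common_star F G \<gamma>" by (rule side_in_common_star, rule that)
  show "\<exists>e. \<forall>W. Re W < e \<longrightarrow> 0 \<le> \<sigma> * Im W \<longrightarrow> \<sigma> * Im W \<le> pi \<longrightarrow>
      (\<gamma> * (1 + exp W) / \<gamma> \<notin> \<real> \<longrightarrow> \<gamma> * (1 + exp W) \<in> common_star F G \<gamma>)"
  proof (intro exI[of _ e] allI impI)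
    fix W assume W: "Re W < e" "0 \<le> \<sigma> * Im W" "\<sigma> * Im W \<le> pi" and nr: "\<gamma> * (1 + exp W) / \<gamma> \<notin> \<real>"
    have sin: "sin (Im W) \<noteq> 0"
    proof
      assume "sin (Im W) = 0"
      then have "1 + exp W \<in> \<real>" by (simp add: complex_is_Real_iff Im_exp)
      then show False using nr \<gamma> by simp
    qed
    have "\<sigma> * Im W \<noteq> pi"
    proof
      assume "\<sigma> * Im W = pi"
      then have "Im W = \<sigma> * pi" using \<sigma> by auto
      then show False using sin \<sigma> by auto
    qed
    moreover have "\<sigma> * Im W \<noteq> 0" using sin \<sigma> by auto
    ultimately have "side W" using W unfolding side_def by linarith
    then show "\<gamma> * (1 + exp W) \<in> common_star F G \<gamma>" using e[OF W(1)] by (simp add: target_def)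
  qed
qed

lemma hadamard_isolated:
  assumes F: "isolated_germ F" and G: "isolated_germ G" and \<gamma>: "\<gamma> \<noteq> 0"
  shows "isolated_at (hadamard F G) \<gamma>"
proof -
  have "\<exists>e H. half_branch (hadamard F G) \<sigma> \<gamma> e H" if \<sigma>: "\<sigma> = 1 \<or> \<sigma> = -1" for \<sigma> :: real
  proof -
    obtain A B cA cB where "hadamard_side F G \<gamma> \<sigma> A B cA cB" by (rule hadamard_side_exists[OF F G \<gamma> \<sigma>])
    then interpret hadamard_side F G \<gamma> \<sigma> A B cA cB .
    show ?thesis by (rule hadamard_half_branch) blast
  qed
  then show ?thesis using half_branches_isolated[OF \<gamma>] by metis
qed

lemma hadamard_monodromy:
  assumes F: "isolated_germ F" and G: "isolated_germ G" and \<gamma>: "\<gamma> \<noteq> 0"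
  shows "\<forall>\<^sub>F z in at \<gamma>. z \<in> common_star F G \<gamma> \<longrightarrow>
    (\<forall>(\<alpha>, \<beta>) \<in> sing_pairs F G \<gamma>.
       conv_integrand (Delta_op \<alpha> (Sigma_pow \<alpha> k (principal_branch F)))
                      (Delta_op \<beta> (Sigma_pow \<beta> k (principal_branch G))) z
         contour_integrable_on linepath \<alpha> (z / \<beta>)) \<and>
    Delta_op \<gamma> (Sigma_pow \<gamma> k (principal_branch (hadamard F G))) z =
      (\<Sum>(\<alpha>, \<beta>) \<in> sing_pairs F G \<gamma>.
         int_conv \<alpha> \<beta> (Delta_op \<alpha> (Sigma_pow \<alpha> k (principal_branch F)))
                      (Delta_op \<beta> (Sigma_pow \<beta> k (principal_branch G))) z)"
  (is "\<forall>\<^sub>F z in at \<gamma>. z \<in> _ \<longrightarrow> ?Q z")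
proof (rule eventually_near[OF \<gamma>])
  fix \<sigma> :: real assume \<sigma>: "\<sigma> = 1 \<or> \<sigma> = -1"
  obtain A B cA cB where "hadamard_side F G \<gamma> \<sigma> A B cA cB" by (rule hadamard_side_exists[OF F G \<gamma> \<sigma>])
  then interpret hadamard_side F G \<gamma> \<sigma> A B cA cB .
  obtain e where e: "\<And>W. Re W < e \<Longrightarrow> 0 \<le> \<sigma> * Im W \<Longrightarrow> \<sigma> * Im W \<le> pi \<Longrightarrow> target W \<in> common_star F G \<gamma> \<Longrightarrow> ?Q (target W)"
    by (rule monodromy_formula[of k], rule that)
  show "\<exists>e. \<forall>W. Re W < e \<longrightarrow> 0 \<le> \<sigma> * Im W \<longrightarrow> \<sigma> * Im W \<le> pi \<longrightarrow>
      (\<gamma> * (1 + exp W) \<in> common_star F G \<gamma> \<longrightarrow> ?Q (\<gamma> * (1 + exp W)))"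
  proof (intro exI[of _ e], intro allI, intro impI)
    fix W assume "Re W < e" "0 \<le> \<sigma> * Im W" "\<sigma> * Im W \<le> pi" "\<gamma> * (1 + exp W) \<in> common_star F G \<gamma>"
    then show "?Q (\<gamma> * (1 + exp W))" by (rule e[unfolded target_def])
  qed
qed

text \<open>Near 0 the branch is pulled back by exp and thus 2 pi i periodic. This treats \<alpha> =
  0 in the linearity statement, where \<alpha>(1 + e^s) is no coordinate.\<close>

lemma Delta_op_zero:
  assumes star: "\<And>x. Re x < m \<Longrightarrow> exp x \<in> principal_star P" and S: "Re S < m"
  shows "Delta_op 0 (Sigma_pow 0 k (principal_branch P)) (exp S) = 0"
proof -
  have "(principal_branch P \<circ> exp) holomorphic_on {s. Re s < m}"
    by (rule holomorphic_on_compose_gen[OF _ holomorphic_principal_branch]) (use star in \<open>auto intro: holomorphic_intros\<close>)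
  then interpret lifted_branch 0 1 m "principal_branch P" "\<lambda>s. principal_branch P (exp s)"
    by unfold_locales (auto simp: o_def)
  have "S \<in> sheet" using S by (simp add: sheet_def lift_def)
  from Delta_op_lift[OF this] show ?thesis by (simp add: lift_def jump_def exp_add)
qed

lemma Delta_linear:
  assumes F: "isolated_germ F" and G: "isolated_germ G"
  shows "\<forall>\<^sub>F z in at \<alpha>. z \<in> principal_star F \<inter> principal_star G \<longrightarrow>
    Delta_op \<alpha> (Sigma_pow \<alpha> k (principal_branch (fps_const c * F + G))) z =
      c * Delta_op \<alpha> (Sigma_pow \<alpha> k (principal_branch F)) z + Delta_op \<alpha> (Sigma_pow \<alpha> k (principal_branch G)) z"
    (is "\<forall>\<^sub>F z in at \<alpha>. z \<in> _ \<longrightarrow> ?P z")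
proof -
  interpret F: isolated_germ F by fact
  interpret G: isolated_germ G by fact
  note lin = principal_branch_linear[OF F.radius G.radius]
  show ?thesis
  proof (cases "\<alpha> = 0")
    case True
    obtain m1 where m1: "\<And>x. Re x < m1 \<Longrightarrow> exp x \<in> principal_star F" using F.disc_in_star by blast
    obtain m2 where m2: "\<And>x. Re x < m2 \<Longrightarrow> exp x \<in> principal_star G" using G.disc_in_star by blast
    define m where "m = min m1 m2"
    have "\<forall>\<^sub>F z in at 0. z \<in> ball 0 (exp m) - {0 :: complex}" by (rule eventually_at_in_open) auto
    then have "\<forall>\<^sub>F z in at 0. z \<in> principal_star F \<inter> principal_star G \<longrightarrow>
      Delta_op 0 (Sigma_pow 0 k (principal_branch (fps_const c * F + G))) z =
        c * Delta_op 0 (Sigma_pow 0 k (principal_branch F)) z + Delta_op 0 (Sigma_pow 0 k (principal_branch G)) z"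
    proof eventually_elim
      case (elim z)
      then have z: "z \<noteq> 0" "norm z < exp m" by auto
      then have S: "Re (Ln z) < m" "exp (Ln z) = z" by (auto simp flip: exp_less_cancel_iff[of _ m])
      have "Delta_op 0 (Sigma_pow 0 k (principal_branch Q)) (exp (Ln z)) = 0" if "Q \<in> {F, G, fps_const c * F + G}" for Q
        by (rule Delta_op_zero[OF _ S(1)]) (use that m1 m2 lin(1) in \<open>auto simp: m_def\<close>)
      then show ?case unfolding S(2) by simp
    qed
    then show ?thesis using True by simp
  next
    case \<alpha>: False
    show ?thesis
    proof (rule eventually_near[OF \<alpha>])
      fix \<sigma> :: real assume \<sigma>: "\<sigma> = 1 \<or> \<sigma> = -1"
      obtain c1 A where A: "side_branch F \<sigma> \<alpha> c1 A" using F.side_branch_exists[OF \<alpha> \<sigma>] by blast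
      obtain c2 B where B: "side_branch G \<sigma> \<alpha> c2 B" using G.side_branch_exists[OF \<alpha> \<sigma>] by blast
      define e where "e = min c1 c2"
      have hA: "half_branch F \<sigma> \<alpha> e A" and hB: "half_branch G \<sigma> \<alpha> e B"
        using side_branch_mono[OF A, of e] side_branch_mono[OF B, of e] by (auto simp: e_def intro!: side_branch_half)
      have hP: "half_branch (fps_const c * F + G) \<sigma> \<alpha> e (\<lambda>s. c * A s + B s)"
        using hA hB lin unfolding half_branch_def by (auto intro!: holomorphic_intros)
      show "\<exists>e. \<forall>W. Re W < e \<longrightarrow> 0 \<le> \<sigma> * Im W \<longrightarrow> \<sigma> * Im W \<le> pi \<longrightarrow>
        (\<alpha> * (1 + exp W) \<in> principal_star F \<inter> principal_star G \<longrightarrow> ?P (\<alpha> * (1 + exp W)))"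
      proof (intro exI[of _ e], intro allI, intro impI)
        fix W assume W: "Re W < e" "0 \<le> \<sigma> * Im W" "\<sigma> * Im W \<le> pi"
          and star: "\<alpha> * (1 + exp W) \<in> principal_star F \<inter> principal_star G"
        note D = Delta_half_branch[OF _ \<sigma> \<alpha> W]
        show "?P (\<alpha> * (1 + exp W))"
          unfolding D[OF hA IntD1[OF star]] D[OF hB IntD2[OF star]] D[OF hP lin(1)[OF IntD1[OF star] IntD2[OF star]]] jump_def
          by (simp add: algebra_simps)
      qed
    qed
  qed
qed

text \<open>The formula in the first conjunct is multiplicativity, the second conjunct is linearity;
  together they are the morphism property. Integrability and finiteness are asserted because
  integrals and sums have default values otherwise, and the clause on z/\<gamma> \<notin> \<real>
  shows that the formula holds on both sides of the ray near \<gamma>.\<close>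

theorem proposition1p2:
  fixes F G :: "complex fps"
  assumes "fps_conv_radius F > 0" and "fps_conv_radius G > 0"
    and "\<forall>\<alpha>\<in>singularities F. isolated_at F \<alpha> \<and> integrable_at F \<alpha>"
    and "\<forall>\<beta>\<in>singularities G. isolated_at G \<beta> \<and> integrable_at G \<beta>"
  shows
    "(\<forall>\<gamma> \<in> (\<lambda>(\<alpha>, \<beta>). \<alpha> * \<beta>) ` (singularities F \<times> singularities G).
        isolated_at (hadamard F G) \<gamma> \<and>
        finite (sing_pairs F G \<gamma>) \<and>
        (\<forall>\<^sub>F z in at \<gamma>. z / \<gamma> \<notin> \<real> \<longrightarrow> z \<in> common_star F G \<gamma>) \<and>
        (\<forall>k::int. \<forall>\<^sub>F z in at \<gamma>. z \<in> common_star F G \<gamma> \<longrightarrow>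
           (\<forall>(\<alpha>, \<beta>) \<in> sing_pairs F G \<gamma>.
              conv_integrand (Delta_op \<alpha> (Sigma_pow \<alpha> k (principal_branch F)))
                             (Delta_op \<beta> (Sigma_pow \<beta> k (principal_branch G))) z
                contour_integrable_on linepath \<alpha> (z / \<beta>)) \<and>
           Delta_op \<gamma> (Sigma_pow \<gamma> k (principal_branch (hadamard F G))) z =
             (\<Sum>(\<alpha>, \<beta>) \<in> sing_pairs F G \<gamma>.
                int_conv \<alpha> \<beta> (Delta_op \<alpha> (Sigma_pow \<alpha> k (principal_branch F)))
                             (Delta_op \<beta> (Sigma_pow \<beta> k (principal_branch G))) z))) \<and>
     (\<forall>\<alpha> c. \<forall>k::int. \<forall>\<^sub>F z in at \<alpha>. z \<in> principal_star F \<inter> principal_star G \<longrightarrow>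
        z \<in> principal_star (fps_const c * F + G) \<and>
        Delta_op \<alpha> (Sigma_pow \<alpha> k (principal_branch (fps_const c * F + G))) z =
          c * Delta_op \<alpha> (Sigma_pow \<alpha> k (principal_branch F)) z +
          Delta_op \<alpha> (Sigma_pow \<alpha> k (principal_branch G)) z)"
proof (intro conjI ballI allI)
  have F: "isolated_germ F" and G: "isolated_germ G"
    using assms by (auto simp: isolated_germ_def)
  {
    fix \<gamma> assume "\<gamma> \<in> (\<lambda>(\<alpha>, \<beta>). \<alpha> * \<beta>) ` (singularities F \<times> singularities G)"
    then have \<gamma>: "\<gamma> \<noteq> 0" using isolated_germ.zero_not_singularity[OF F] isolated_germ.zero_not_singularity[OF G] by auto
    show "isolated_at (hadamard F G) \<gamma>" by (rule hadamard_isolated[OF F G \<gamma>])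
    show "finite (sing_pairs F G \<gamma>)"
    proof -
      obtain A B cA cB where "hadamard_side F G \<gamma> 1 A B cA cB" by (rule hadamard_side_exists[OF F G \<gamma>]) auto
      then show ?thesis by (rule hadamard_side.finite_sing_pairs)
    qed
    show "\<forall>\<^sub>F z in at \<gamma>. z / \<gamma> \<notin> \<real> \<longrightarrow> z \<in> common_star F G \<gamma>" by (rule hadamard_side_common_star[OF F G \<gamma>])
    show "\<forall>\<^sub>F z in at \<gamma>. z \<in> common_star F G \<gamma> \<longrightarrow>
           (\<forall>(\<alpha>, \<beta>) \<in> sing_pairs F G \<gamma>.
              conv_integrand (Delta_op \<alpha> (Sigma_pow \<alpha> k (principal_branch F)))
                             (Delta_op \<beta> (Sigma_pow \<beta> k (principal_branch G))) z
                contour_integrable_on linepath \<alpha> (z / \<beta>)) \<and>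
           Delta_op \<gamma> (Sigma_pow \<gamma> k (principal_branch (hadamard F G))) z =
             (\<Sum>(\<alpha>, \<beta>) \<in> sing_pairs F G \<gamma>.
                int_conv \<alpha> \<beta> (Delta_op \<alpha> (Sigma_pow \<alpha> k (principal_branch F)))
                             (Delta_op \<beta> (Sigma_pow \<beta> k (principal_branch G))) z)" for k
      by (rule hadamard_monodromy[OF F G \<gamma>])
  }
  show "\<forall>\<^sub>F z in at \<alpha>. z \<in> principal_star F \<inter> principal_star G \<longrightarrow>
        z \<in> principal_star (fps_const c * F + G) \<and>
        Delta_op \<alpha> (Sigma_pow \<alpha> k (principal_branch (fps_const c * F + G))) z =
          c * Delta_op \<alpha> (Sigma_pow \<alpha> k (principal_branch F)) z +
          Delta_op \<alpha> (Sigma_pow \<alpha> k (principal_branch G)) z" for \<alpha> c and k :: int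
    using Delta_linear[OF F G, of \<alpha> k c] by eventually_elim (use principal_branch_linear(1)[OF assms(1,2)] in auto)
qed

end
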